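(* Let $G=(V,E)$ be a directed unweighted graph with $n$ vertices, a source $s$ and a sink $t$, and let $\lambda$ be the value of an $(s,t)$-max-flow in $G$. Then there exist an $(s,t)$-max-flow $f$ of $G$ and a data structure of size $O(\lambda n)$ such that, upon the failure of any set $F\subseteq E$ of at most two edges, the data structure can implicitly report an $(s,t)$-max-flow $f'$ of $G-F$ in $O(n)$ time; that is, it can identify all edges $e$ of $G-F$ for which $f'(e)\neq f(e)$ in $O(n)$ time. Moreover, when $|F|=1$, the data structure can determine for any edge $e$ of $G-F$ whether $f'(e)$ is $0$ or $1$ in $O(1)$ time.
   Context: Graphs are directed multigraphs with unit edge capacities; flows are $(s,t)$-flows respecting these capacities, and $G-F$ denotes the graph obtained by deleting the edges of $F$. *)

theory Defs
  imports Complex_Main "HOL-Library.FuncSet" "Graph_Theory.Digraph"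
begin

section \<open>Flows in directed multigraphs with unit capacities\<close>

definition st_flow :: "('a, 'b) pre_digraph \<Rightarrow> 'a \<Rightarrow> 'a \<Rightarrow> ('b \<Rightarrow> real) \<Rightarrow> bool" where
  "st_flow G s t f \<longleftrightarrow>
     (\<forall>e \<in> arcs G. 0 \<le> f e \<and> f e \<le> 1) \<and>
     (\<forall>v \<in> verts G - {s, t}. (\<Sum>e \<in> in_arcs G v. f e) = (\<Sum>e \<in> out_arcs G v. f e))"

definition flow_value :: "('a, 'b) pre_digraph \<Rightarrow> 'a \<Rightarrow> ('b \<Rightarrow> real) \<Rightarrow> real" where
  "flow_value G s f = (\<Sum>e \<in> out_arcs G s. f e) - (\<Sum>e \<in> in_arcs G s. f e)"

definition st_max_flow :: "('a, 'b) pre_digraph \<Rightarrow> 'a \<Rightarrow> 'a \<Rightarrow> ('b \<Rightarrow> real) \<Rightarrow> bool" where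
  "st_max_flow G s t f \<longleftrightarrow>
     st_flow G s t f \<and> (\<forall>g. st_flow G s t g \<longrightarrow> flow_value G s g \<le> flow_value G s f)"

definition max_flow_value :: "('a, 'b) pre_digraph \<Rightarrow> 'a \<Rightarrow> 'a \<Rightarrow> real" where
  "max_flow_value G s t = (SUP f \<in> {f. st_flow G s t f}. flow_value G s f)"

definition del_arcs :: "('a, 'b) pre_digraph \<Rightarrow> 'b set \<Rightarrow> ('a, 'b) pre_digraph" where
  "del_arcs G F = G\<lparr>arcs := arcs G - F\<rparr>"


section \<open>A word RAM\<close>

text \<open>
  Programs act on registers, on a random access memory and on a write-only output. All values
  are \<open>w\<close>-bit words; arithmetic is modulo \<open>2 ^ w\<close>. Register names occur literally in a program,
  so a program has only a constant number of registers; input-dependent addresses are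
  available for the memory only.
\<close>

datatype bop = Add | Sub | Mul | Div | Mod | And | Or | Xor | Shl | Shr

datatype test = Less nat nat | Eq nat nat

datatype com =
    Skip
  | Const nat nat
  | Op bop nat nat nat
  | Load nat nat
  | Store nat nat
  | Emit nat
  | Seq com com
  | Cond test com com
  | While test com

record state =
  regs :: "nat \<Rightarrow> nat"
  mem :: "nat \<Rightarrow> nat"
  out :: "nat list"

fun bop_val :: "nat \<Rightarrow> bop \<Rightarrow> nat \<Rightarrow> nat \<Rightarrow> nat" where
  "bop_val w Add a b = (a + b) mod 2 ^ w"
| "bop_val w Sub a b = nat ((int a - int b) mod 2 ^ w)"
| "bop_val w Mul a b = (a * b) mod 2 ^ w"
| "bop_val w Div a b = a div b"
| "bop_val w Mod a b = a mod b"
| "bop_val w And a b = and a b"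
| "bop_val w Or a b = or a b"
| "bop_val w Xor a b = xor a b"
| "bop_val w Shl a b = (a * 2 ^ b) mod 2 ^ w"
| "bop_val w Shr a b = a div 2 ^ b"

fun test_val :: "test \<Rightarrow> state \<Rightarrow> bool" where
  "test_val (Less i j) \<sigma> \<longleftrightarrow> regs \<sigma> i < regs \<sigma> j"
| "test_val (Eq i j) \<sigma> \<longleftrightarrow> regs \<sigma> i = regs \<sigma> j"

text \<open>\<open>exec w c \<sigma> k \<tau>\<close>: with word length \<open>w\<close>, command \<open>c\<close> started in state \<open>\<sigma>\<close> halts in
  state \<open>\<tau>\<close> after \<open>k\<close> steps. Every elementary instruction and every test takes one step.\<close>

inductive exec :: "nat \<Rightarrow> com \<Rightarrow> state \<Rightarrow> nat \<Rightarrow> state \<Rightarrow> bool" for w :: nat where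
  Skip: "exec w Skip \<sigma> 1 \<sigma>"
| Const: "exec w (Const i a) \<sigma> 1 (\<sigma>\<lparr>regs := (regs \<sigma>)(i := a mod 2 ^ w)\<rparr>)"
| Op: "exec w (Op b i j k) \<sigma> 1 (\<sigma>\<lparr>regs := (regs \<sigma>)(i := bop_val w b (regs \<sigma> j) (regs \<sigma> k))\<rparr>)"
| Load: "exec w (Load i j) \<sigma> 1 (\<sigma>\<lparr>regs := (regs \<sigma>)(i := mem \<sigma> (regs \<sigma> j))\<rparr>)"
| Store: "exec w (Store i j) \<sigma> 1 (\<sigma>\<lparr>mem := (mem \<sigma>)(regs \<sigma> i := regs \<sigma> j)\<rparr>)"
| Emit: "exec w (Emit i) \<sigma> 1 (\<sigma>\<lparr>out := out \<sigma> @ [regs \<sigma> i]\<rparr>)"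
| Seq: "exec w c1 \<sigma> k1 \<sigma>1 \<Longrightarrow> exec w c2 \<sigma>1 k2 \<tau> \<Longrightarrow> exec w (Seq c1 c2) \<sigma> (k1 + k2) \<tau>"
| CondT: "test_val b \<sigma> \<Longrightarrow> exec w c1 \<sigma> k \<tau> \<Longrightarrow> exec w (Cond b c1 c2) \<sigma> (1 + k) \<tau>"
| CondF: "\<not> test_val b \<sigma> \<Longrightarrow> exec w c2 \<sigma> k \<tau> \<Longrightarrow> exec w (Cond b c1 c2) \<sigma> (1 + k) \<tau>"
| WhileF: "\<not> test_val b \<sigma> \<Longrightarrow> exec w (While b c) \<sigma> 1 \<sigma>"
| WhileT: "test_val b \<sigma> \<Longrightarrow> exec w c \<sigma> k1 \<sigma>1 \<Longrightarrow> exec w (While b c) \<sigma>1 k2 \<tau> \<Longrightarrow>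
    exec w (While b c) \<sigma> (1 + k1 + k2) \<tau>"

definition pad :: "nat list \<Rightarrow> nat \<Rightarrow> nat" where
  "pad xs i = (if i < length xs then xs ! i else 0)"

text \<open>A query starts with the data structure \<open>D\<close> in the first \<open>length D\<close> memory cells and the
  query \<open>xs\<close> in the first registers; everything else is zero.\<close>

definition start :: "nat list \<Rightarrow> nat list \<Rightarrow> state" where
  "start D xs = \<lparr>regs = pad xs, mem = pad D, out = []\<rparr>"

text \<open>
  Words have \<open>\<Theta>(log (n + m))\<close> bits, so that a constant number of them can name a vertex or an
  edge. The bound on the word length is what makes the number of words a meaningful
  measure of size.
\<close>

definition word_length :: "nat \<Rightarrow> ('a, 'b) pre_digraph \<Rightarrow> nat" where
  "word_length c G = c * nat \<lceil>log 2 (real (card (verts G) + card (arcs G)))\<rceil>"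

end

theory Submission
  imports Defs
begin

text \<open>
  Fix a maximum flow \<open>A\<close> as a set of arcs, decomposed into \<open>k\<close> arc-disjoint simple paths \<open>pl 0, \<dots>, pl (k - 1)\<close>.

  One failure \<open>x\<close> on a path: if the tail of \<open>x\<close> still reaches its head in the residual graph, both lie in one strongly
  connected component, and the flow is rerouted along the in-tree and the out-tree of the component up to the first
  common vertex; otherwise the path of \<open>x\<close> is dropped. In all cases the set of changed arcs is a union of ancestor
  segments of forests, so membership is an interval test on preorder numbers, stored in a perfect hash table.

  Two failures: for each path, a block of \<open>O(n)\<close> arcs preserves the residual reachability that matters. If both failures
  lie on one path, this is reachability from the source in the residual graph of \<open>A\<close> without that path, under two faults.
  If they lie on different paths, it is reachability in the residual graph of \<open>A\<close> from the prefixes of the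
  path, and to its suffixes, under one fault. Minimal preservers of both kinds have constant
  in-degree. The query drops the paths that were hit and augments at most twice inside the union of their blocks. A
  cut that is closed in the blocks after the last augmentation lifts to a minimum cut of the whole graph.
\<close>

section \<open>Walks\<close>

text \<open>The size bound allows one block of \<open>O(n)\<close> arcs per path, so nothing may
  depend on a pair of paths. When the failures hit two paths, however, the flow left after dropping
  both depends on the pair, and so does its residual graph. The cut found by the last search is
  therefore compared with the residual graph of \<open>A\<close>, which is the same for all queries.
  Putting the two paths back leaves at most one residual arc of \<open>A\<close> that crosses the
  cut inside the blocks; this arc plays the role of the fault that the preservers must tolerate.
  Prefixes and suffixes appear because a path that enters the cut at most once has, around a failed
  arc leaving the cut, its prefix inside or its suffix outside. The two preservers are then used to
  regrow the cut in the full residual graph from that side.\<close>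

fun walk :: "('a \<Rightarrow> 'v) \<Rightarrow> ('a \<Rightarrow> 'v) \<Rightarrow> 'v \<Rightarrow> 'a list \<Rightarrow> 'v \<Rightarrow> bool" where
  "walk src dst p [] q \<longleftrightarrow> p = q"
| "walk src dst p (y # ys) q \<longleftrightarrow> src y = p \<and> walk src dst (dst y) ys q"

definition reach :: "('a \<Rightarrow> 'v) \<Rightarrow> ('a \<Rightarrow> 'v) \<Rightarrow> 'a set \<Rightarrow> 'v set \<Rightarrow> 'v set" where
  "reach src dst B S = {q. \<exists>p\<in>S. \<exists>ys. walk src dst p ys q \<and> set ys \<subseteq> B}"

lemma walk_append: "walk src dst p (xs @ ys) q \<longleftrightarrow> (\<exists>r. walk src dst p xs r \<and> walk src dst r ys q)"
  by (induction xs arbitrary: p) auto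

lemma walk_rev: "walk dst src q (rev ys) p \<longleftrightarrow> walk src dst p ys q"
  by (induction ys arbitrary: p) (auto simp: walk_append)

lemma walk_last: "walk src dst p ys q \<Longrightarrow> ys \<noteq> [] \<Longrightarrow> dst (last ys) = q"
  by (induction ys arbitrary: p) (auto split: if_splits)

lemma walk_cong:
  "(\<And>y. y \<in> set ys \<Longrightarrow> src y = src' y \<and> dst y = dst' y) \<Longrightarrow> walk src dst p ys q \<longleftrightarrow> walk src' dst' p ys q"
  by (induction ys arbitrary: p) auto

lemma walk_crossing:
  assumes "walk src dst p ys q" "p \<in> X" "q \<notin> X"
  shows "\<exists>y\<in>set ys. src y \<in> X \<and> dst y \<notin> X"
  using assms by (induction ys arbitrary: p) auto

text \<open>Loops are removed from the front: once the rest is simple, a later visit of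
  \<open>p\<close> splits it, and the walk restarts there.\<close>

lemma walk_simple:
  assumes "walk src dst p ys q"
  shows "\<exists>zs. walk src dst p zs q \<and> set zs \<subseteq> set ys \<and> distinct (p # map dst zs)"
  using assms
proof (induction "length ys" arbitrary: ys p rule: less_induct)
  case less
  show ?case
  proof (cases ys)
    case Nil
    then show ?thesis using less.prems by (intro exI[of _ "[]"]) auto
  next
    case (Cons y ys')
    have "walk src dst (dst y) ys' q" "src y = p" using less.prems Cons by auto
    then obtain zs where zs: "walk src dst (dst y) zs q" "set zs \<subseteq> set ys'" "distinct (dst y # map dst zs)"
      using less.hyps[of ys' "dst y"] Cons by auto
    show ?thesis
    proof (cases "p \<in> set (dst y # map dst zs)")
      case False
      then show ?thesis using zs Cons \<open>src y = p\<close> by (intro exI[of _ "y # zs"]) auto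
    next
      case True
      then have "p \<in> dst ` set (y # zs)" by simp
      then obtain z where z: "z \<in> set (y # zs)" "p = dst z" by blast
      then obtain us vs where uv: "y # zs = us @ z # vs" by (meson split_list)
      have "walk src dst p (us @ z # vs) q" using zs(1) \<open>src y = p\<close> unfolding uv[symmetric] by simp
      then have "walk src dst p vs q" using z by (auto simp: walk_append)
      moreover have "distinct (map dst (us @ z # vs))" using zs(3) unfolding uv[symmetric] by simp
      then have "distinct (p # map dst vs)" using z by auto
      moreover have "set vs \<subseteq> set ys" using zs(2) Cons arg_cong[OF uv, of set] by auto
      ultimately show ?thesis by blast
    qed
  qed
qed

lemma simple_walk_length:
  assumes "walk src dst p ys q" "distinct (p # map dst ys)" "p < n" "\<And>y. y \<in> set ys \<Longrightarrow> dst y < (n::nat)"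
  shows "length ys < n"
proof -
  have "card (set (p # map dst ys)) = Suc (length ys)" using assms(2) distinct_card by fastforce
  moreover have "set (p # map dst ys) \<subseteq> {..<n}" using assms(3,4) by auto
  then have "card (set (p # map dst ys)) \<le> n" using card_mono[of "{..<n}"] by fastforce
  ultimately show ?thesis by simp
qed

lemma reach_superset: "S \<subseteq> reach src dst B S"
proof
  fix x assume "x \<in> S"
  then show "x \<in> reach src dst B S" unfolding reach_def by (intro CollectI bexI[of _ x] exI[of _ "[]"]) auto
qed

lemma reach_mono: "B \<subseteq> B' \<Longrightarrow> S \<subseteq> S' \<Longrightarrow> reach src dst B S \<subseteq> reach src dst B' S'"
  unfolding reach_def by blast

lemma reach_walk: "p \<in> reach src dst B S \<Longrightarrow> walk src dst p ys q \<Longrightarrow> set ys \<subseteq> B \<Longrightarrow> q \<in> reach src dst B S"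
  unfolding reach_def by simp (metis Un_least set_append walk_append)

lemma reach_step: "src y \<in> reach src dst B S \<Longrightarrow> y \<in> B \<Longrightarrow> dst y \<in> reach src dst B S"
  by (rule reach_walk[of "src y" _ _ _ _ "[y]"]) auto

lemma reach_least:
  assumes "S \<subseteq> X" "\<And>y. y \<in> B \<Longrightarrow> src y \<in> X \<Longrightarrow> dst y \<in> X"
  shows "reach src dst B S \<subseteq> X"
proof
  fix q assume "q \<in> reach src dst B S"
  then obtain p ys where "p \<in> S" "walk src dst p ys q" "set ys \<subseteq> B" unfolding reach_def by blast
  then show "q \<in> X" using walk_crossing[of src dst p ys q X] assms by blast
qed

lemma reach_subset_verts: "S \<subseteq> V \<Longrightarrow> (\<And>y. y \<in> B \<Longrightarrow> dst y \<in> V) \<Longrightarrow> reach src dst B S \<subseteq> V"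
  by (rule reach_least) auto

section \<open>Sparse fault-tolerant reachability preservers\<close>

text \<open>
  A subgraph that is minimal among those preserving reachability for a family of queries
  (source set, fault set) has the property that each of its arcs \<open>y\<close> is critical: for some query
  every walk to the head of \<open>y\<close> uses \<open>y\<close>. Splicing the walks of several
  critical arcs with a common head bounds their number.
\<close>

definition preserves :: "('a \<Rightarrow> 'v) \<Rightarrow> ('a \<Rightarrow> 'v) \<Rightarrow> 'a set \<Rightarrow> ('v set \<times> 'a set) set \<Rightarrow> 'a set \<Rightarrow> bool" where
  "preserves src dst B Q H \<longleftrightarrow> (\<forall>(S, F)\<in>Q. reach src dst (B - F) S \<subseteq> reach src dst (H - F) S)"

text \<open>The walk \<open>P\<close> enters the head of \<open>y\<close> only by its last arc.
  Hence the walk of another critical arc with the same head cannot contain \<open>y\<close>, which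
  is what makes splicing safe.\<close>

definition critical ::
    "('a \<Rightarrow> 'v) \<Rightarrow> ('a \<Rightarrow> 'v) \<Rightarrow> 'a set \<Rightarrow> 'a \<Rightarrow> 'v set \<Rightarrow> 'a set \<Rightarrow> 'a list \<Rightarrow> bool" where
  "critical src dst H y S F P \<longleftrightarrow>
     (\<exists>p\<in>S. walk src dst p P (dst y)) \<and> set P \<subseteq> H - F \<and> (\<exists>us. P = us @ [y] \<and> dst y \<notin> dst ` set us) \<and>
     dst y \<notin> reach src dst (H - F - {y}) S"

text \<open>In a preserver with the fewest arcs, deleting \<open>y\<close> loses a vertex for some
  query. What is still reached without \<open>y\<close> is closed under all other surviving arcs, so
  \<open>y\<close> itself leads out of it; a walk to its tail followed by \<open>y\<close> is the
  witness.\<close>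

lemma minimal_preserver:
  assumes "finite B"
  obtains H where "H \<subseteq> B" "preserves src dst B Q H"
    "\<And>y. y \<in> H \<Longrightarrow> \<exists>S F P. (S, F) \<in> Q \<and> critical src dst H y S F P"
proof -
  let ?P = "\<lambda>H. H \<subseteq> B \<and> preserves src dst B Q H"
  have "?P B" by (auto simp: preserves_def)
  then obtain H where H: "?P H" and min: "\<And>H'. ?P H' \<Longrightarrow> card H \<le> card H'"
    using ex_has_least_nat[of ?P B card] by blast
  have finH: "finite H" using H assms finite_subset by blast
  have "\<exists>S F P. (S, F) \<in> Q \<and> critical src dst H y S F P" if y: "y \<in> H" for y
  proof -
    have "card (H - {y}) < card H" using y finH by (meson card_Diff1_less)
    then have "\<not> preserves src dst B Q (H - {y})" using min[of "H - {y}"] H by auto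
    then obtain S F where Q: "(S, F) \<in> Q" and nsub: "\<not> reach src dst (B - F) S \<subseteq> reach src dst (H - {y} - F) S"
      unfolding preserves_def by blast
    have sub: "reach src dst (B - F) S \<subseteq> reach src dst (H - F) S" using H Q unfolding preserves_def by blast
    have eq: "H - {y} - F = H - F - {y}" by blast
    let ?R = "reach src dst (H - F - {y}) S"
    have nr: "dst y \<notin> ?R"
    proof
      assume a: "dst y \<in> ?R"
      have "reach src dst (H - F) S \<subseteq> ?R"
      proof (rule reach_least[OF reach_superset])
        fix z assume "z \<in> H - F" "src z \<in> ?R"
        then show "dst z \<in> ?R" using a reach_step[of src z dst "H - F - {y}" S] by (cases "z = y") auto
      qed
      then show False using sub nsub eq by auto
    qed
    have "\<not> reach src dst (H - F) S \<subseteq> ?R" using sub nsub eq by auto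
    then obtain z where z: "z \<in> H - F" "src z \<in> ?R" "dst z \<notin> ?R"
      using reach_least[OF reach_superset[of S src dst "H - F - {y}"], of "H - F" src dst] by blast
    have zy: "z = y" using z reach_step[of src z dst "H - F - {y}" S] by blast
    obtain p ys where p: "p \<in> S" "walk src dst p ys (src y)" "set ys \<subseteq> H - F - {y}"
      using z(2) zy unfolding reach_def by blast
    have "dst x \<noteq> dst y" if "x \<in> set ys" for x
    proof
      assume "dst x = dst y"
      obtain us vs where "ys = us @ x # vs" using \<open>x \<in> set ys\<close> by (meson split_list)
      then have "walk src dst p (us @ [x]) (dst y)" "set (us @ [x]) \<subseteq> H - F - {y}"
        using p \<open>dst x = dst y\<close> by (auto simp: walk_append)
      then show False using nr p(1) unfolding reach_def by blast
    qed
    then have "critical src dst H y S F (ys @ [y])"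
      unfolding critical_def using nr p z zy by (fastforce simp: walk_append intro!: bexI[of _ p])
    then show ?thesis using Q by blast
  qed
  then show thesis using that H by blast
qed

lemma critical_other:
  assumes "critical src dst H y' S' F' P'" "y \<noteq> y'" "dst y = dst y'"
  shows "y \<notin> set P'"
proof
  assume y: "y \<in> set P'"
  obtain us where "P' = us @ [y']" "dst y' \<notin> dst ` set us" using assms(1) unfolding critical_def by blast
  then show False using y assms(2,3) by (metis Un_iff empty_iff image_eqI list.set(1) set_ConsD set_append)
qed

text \<open>\<open>P'\<close> misses \<open>y\<close> and starts in a smaller source set; if it
  missed \<open>F\<close> too, it would reach the common head in the query of \<open>y\<close>
  without using \<open>y\<close>.\<close>

lemma critical_hit:
  assumes "critical src dst H y S F P" "critical src dst H y' S' F' P'" "y \<noteq> y'" "dst y = dst y'" "S' \<subseteq> S"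
  shows "\<exists>k<length P'. P' ! k \<in> F"
proof (rule ccontr)
  assume "\<not> ?thesis"
  then have "set P' \<inter> F = {}" by (auto simp: in_set_conv_nth)
  moreover have "y \<notin> set P'" using critical_other[OF assms(2)] assms(3,4) by blast
  ultimately have "set P' \<subseteq> H - F - {y}" using assms(2) unfolding critical_def by blast
  then have "dst y \<in> reach src dst (H - F - {y}) S"
    using assms(2,4,5) unfolding critical_def reach_def by auto
  then show False using assms(1) unfolding critical_def by blast
qed

text \<open>Follow \<open>P\<close> up to the common arc and \<open>P'\<close> from there on. This
  walk avoids \<open>y\<close>, and its first part avoids \<open>F\<close>, so the part taken from
  \<open>P'\<close> must meet \<open>F\<close>.\<close>

lemma critical_splice:
  assumes "critical src dst H y S F P" "critical src dst H y' S' F' P'" "y \<noteq> y'" "dst y = dst y'"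
    "k < length P'" "P' ! k \<in> set P"
  shows "\<exists>l. k < l \<and> l < length P' \<and> P' ! l \<in> F"
proof (rule ccontr)
  assume "\<not> ?thesis"
  then have d: "set (drop (Suc k) P') \<inter> F = {}" by (auto simp: in_set_conv_nth)
  let ?z = "P' ! k"
  obtain us vs where uv: "P = us @ ?z # vs" using assms(6) by (meson split_list)
  obtain p where p: "p \<in> S" "walk src dst p P (dst y)" using assms(1) unfolding critical_def by blast
  obtain p' where p': "walk src dst p' P' (dst y)" using assms(2,4) unfolding critical_def by auto
  have P': "P' = take k P' @ ?z # drop (Suc k) P'" using assms(5) by (simp add: id_take_nth_drop)
  have "walk src dst (dst ?z) (drop (Suc k) P') (dst y)" using p' by (subst (asm) P') (auto simp: walk_append)
  then have w: "walk src dst p (us @ ?z # drop (Suc k) P') (dst y)" using p(2) by (subst (asm) uv) (auto simp: walk_append)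
  have nP': "y \<notin> set P'" using critical_other[OF assms(2)] assms(3,4) by blast
  have ny: "y \<noteq> ?z" using nP' assms(5) nth_mem by metis
  obtain qs where qs: "P = qs @ [y]" "dst y \<notin> dst ` set qs" using assms(1) unfolding critical_def by blast
  \<comment> \<open>\<open>y\<close> occurs on \<open>P\<close> only at the very end, hence not
    before the common arc.\<close>
  have nus: "y \<notin> set us"
  proof -
    have "us = take (length us) qs"
      using qs(1) uv by (metis append_eq_conv_conj append_eq_append_conv2 append_Cons butlast_snoc butlast_append list.distinct(1))
    then have "set us \<subseteq> set qs" by (metis set_take_subset)
    then show ?thesis using qs(2) by blast
  qed
  have "set (us @ ?z # drop (Suc k) P') \<subseteq> H - F - {y}"
    using d nP' nus ny assms(1,2) uv unfolding critical_def
    by (auto dest: in_set_dropD)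
  then show False using assms(1) p(1) w unfolding critical_def reach_def by blast
qed

lemma ex_sorted_sublist:
  assumes "finite X" "k \<le> card X"
  shows "\<exists>xs. distinct xs \<and> set xs \<subseteq> X \<and> length xs = k \<and> sorted (map (f :: 'a \<Rightarrow> nat) xs)"
proof -
  obtain ys where ys: "distinct ys" "set ys = X" using assms(1) finite_distinct_list by blast
  let ?zs = "sort_key f ys"
  have "length ?zs = card X" using ys distinct_card by fastforce
  then show ?thesis using ys assms(2) set_take_subset[of k ?zs]
    by (intro exI[of _ "take k ?zs"]) (auto simp: take_map[symmetric] sorted_wrt_take)
qed

lemma card_two_memb: "card F \<le> 2 \<Longrightarrow> finite F \<Longrightarrow> a \<in> F \<Longrightarrow> b \<in> F \<Longrightarrow> c \<in> F \<Longrightarrow> a \<noteq> b \<Longrightarrow> c = a \<or> c = b"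
proof (rule ccontr)
  assume a: "card F \<le> 2" "finite F" "a \<in> F" "b \<in> F" "c \<in> F" "a \<noteq> b" "\<not> (c = a \<or> c = b)"
  then have "card {a, b, c} \<le> card F" by (intro card_mono) auto
  then show False using a by auto
qed

text \<open>Suppose that five critical arcs share a head, and let \<open>el e e'\<close> be the last
  fault of \<open>e'\<close> on the walk of \<open>e\<close>. Sort four of them by how late these
  faults come on the walk of the fifth, \<open>e0\<close>. The fault of a later arc found there is
  missing on the walks of the earlier ones, so all of these are hit by the same second fault.
  Splicing at it finally forces three different faults on \<open>e 1\<close>.\<close>

theorem two_fault_preserver:
  assumes "finite B"
  obtains H where "H \<subseteq> B" "\<And>v. card {y \<in> H. dst y = v} \<le> 4"
    "\<And>F. finite F \<Longrightarrow> card F \<le> 2 \<Longrightarrow> reach src dst (B - F) {s} \<subseteq> reach src dst (H - F) {s}"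
proof -
  let ?Q = "{({s}, F) | F. finite F \<and> card F \<le> 2}"
  obtain H where H: "H \<subseteq> B" "preserves src dst B ?Q H"
    and "\<And>y. y \<in> H \<Longrightarrow> \<exists>S F P. (S, F) \<in> ?Q \<and> critical src dst H y S F P"
    by (rule minimal_preserver[OF assms, of src dst ?Q]) blast
  then have "\<forall>y. \<exists>F P. y \<in> H \<longrightarrow> finite F \<and> card F \<le> 2 \<and> critical src dst H y {s} F P" by blast
  then obtain F P where FP: "\<And>y. y \<in> H \<Longrightarrow> finite (F y) \<and> card (F y) \<le> 2 \<and> critical src dst H y {s} (F y) (P y)"
    by metis
  have "card {y \<in> H. dst y = v} \<le> 4" for v
  proof (rule ccontr)
    let ?X = "{y \<in> H. dst y = v}"
    assume "\<not> card ?X \<le> 4"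
    have finX: "finite ?X" using H(1) assms finite_subset by fastforce
    \<comment> \<open>Splicing at an arc shared with \<open>P e'\<close> yields a fault of
      \<open>e'\<close> strictly later, so every shared arc lies before this last position.\<close>
    define lp where "lp e e' = (GREATEST k. k < length (P e) \<and> P e ! k \<in> F e')" for e e'
    have lp: "lp e e' < length (P e)" "P e ! lp e e' \<in> F e'"
      and lp_max: "\<And>k. k < length (P e) \<Longrightarrow> P e ! k \<in> set (P e') \<Longrightarrow> k < lp e e'"
      if e: "e \<in> ?X" "e' \<in> ?X" "e \<noteq> e'" for e e'
    proof -
      let ?R = "\<lambda>k. k < length (P e) \<and> P e ! k \<in> F e'"
      have c: "critical src dst H e' {s} (F e') (P e')" "critical src dst H e {s} (F e) (P e)" using FP e by auto
      obtain k0 where k0: "?R k0" using critical_hit[OF c] e by auto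
      have "?R (Greatest ?R)" using GreatestI_nat[of ?R k0 "length (P e)"] k0 by auto
      then show "lp e e' < length (P e)" "P e ! lp e e' \<in> F e'" unfolding lp_def by auto
      fix k assume k: "k < length (P e)" "P e ! k \<in> set (P e')"
      obtain l where l: "k < l" "?R l" using critical_splice[OF c _ _ k] e by auto
      have "l \<le> Greatest ?R" using Greatest_le_nat[of ?R l "length (P e)"] l by auto
      then show "k < lp e e'" using l unfolding lp_def by simp
    qed
    define el where "el e e' = P e ! lp e e'" for e e'
    have el: "el e e' \<in> set (P e)" "el e e' \<in> F e'" if "e \<in> ?X" "e' \<in> ?X" "e \<noteq> e'" for e e'
      using lp[OF that] unfolding el_def by auto
    have far: "el e e'' \<notin> set (P e')"
      if "e \<in> ?X" "e' \<in> ?X" "e'' \<in> ?X" "e \<noteq> e'" "e \<noteq> e''" "lp e e' \<le> lp e e''" for e e' e''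
      using lp_max[of e e' "lp e e''"] lp[of e e''] that unfolding el_def by fastforce
    have "?X \<noteq> {}" using \<open>\<not> card ?X \<le> 4\<close> by (metis card.empty zero_le)
    then obtain e0 where e0: "e0 \<in> ?X" by blast
    have "4 \<le> card (?X - {e0})" using \<open>\<not> card ?X \<le> 4\<close> e0 finX by (simp add: card_Diff_singleton_if)
    then obtain xs where xs: "distinct xs" "set xs \<subseteq> ?X - {e0}" "length xs = 4" "sorted (map (lp e0) xs)"
      using ex_sorted_sublist[of "?X - {e0}" 4 "lp e0"] finX by auto
    define e where "e i = xs ! i" for i
    have eX: "e i \<in> ?X" "e0 \<noteq> e i" if "i < 4" for i
      using subsetD[OF xs(2) nth_mem[of i xs]] xs(3) that unfolding e_def by auto
    have edist: "e i \<noteq> e j" if "i < 4" "j < 4" "i \<noteq> j" for i j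
      using xs(1,3) that unfolding e_def by (simp add: nth_eq_iff_index_eq)
    have esort: "lp e0 (e i) \<le> lp e0 (e j)" if "i < j" "j < 4" for i j
      using xs(3,4) that sorted_nth_mono[OF xs(4), of i j] unfolding e_def by auto
    have y_notin: "el e0 (e j) \<notin> set (P (e i))" if "i < j" "j < 4" for i j
      using far[OF e0 eX(1) eX(1) eX(2) eX(2) esort[OF that]] that by auto
    \<comment> \<open>One fault of \<open>e j\<close> was found on the walk of \<open>e0\<close> and
      is missing on the earlier walks; only one candidate remains for all of them.\<close>
    have el_same: "el (e i) (e j) \<in> set (P (e l))" if "i < j" "l < j" "j < 4" "i \<noteq> l" for i j l
    proof -
      have X: "e i \<in> ?X" "e j \<in> ?X" "e l \<in> ?X" and ne: "e i \<noteq> e j" "e l \<noteq> e j" "e0 \<noteq> e j"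
        using eX[of i] eX[of j] eX[of l] edist[of i j] edist[of l j] that by auto
      have F: "finite (F (e j))" "card (F (e j)) \<le> 2" using FP X by auto
      have "el e0 (e j) \<in> F (e j)" "el (e i) (e j) \<in> F (e j)" "el (e l) (e j) \<in> F (e j)"
        using el[OF e0 X(2) ne(3)] el[OF X(1,2) ne(1)] el[OF X(3,2) ne(2)] by auto
      moreover have "el e0 (e j) \<noteq> el (e i) (e j)" "el e0 (e j) \<noteq> el (e l) (e j)"
        using y_notin[of i j] y_notin[of l j] el(1)[OF X(1,2) ne(1)] el(1)[OF X(3,2) ne(2)] that by auto
      ultimately have "el (e i) (e j) = el (e l) (e j)" using card_two_memb[OF F(2,1)] by metis
      then show ?thesis using el(1)[OF X(3,2) ne(2)] by simp
    qed
    have el_far: "el (e i) (e l) \<notin> set (P (e j))" if "i < j" "l < j" "j < 4" "i \<noteq> l" for i j l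
    proof -
      have X: "e i \<in> ?X" "e j \<in> ?X" "e l \<in> ?X" and ne: "e i \<noteq> e j" "e i \<noteq> e l"
        using eX[of i] eX[of j] eX[of l] edist[of i j] edist[of i l] that by auto
      have "lp (e i) (e j) < lp (e i) (e l)"
        using lp_max[OF X(1,3) ne(2) lp(1)[OF X(1,2) ne(1)]] el_same[OF that] unfolding el_def by blast
      then show ?thesis using far[OF X(1,2,3) ne] by simp
    qed
    have X: "e 0 \<in> ?X" "e 1 \<in> ?X" "e 2 \<in> ?X" "e 3 \<in> ?X"
      and ne: "e 0 \<noteq> e 1" "e 2 \<noteq> e 1" "e 3 \<noteq> e 1" using eX edist by auto
    have F: "finite (F (e 1))" "card (F (e 1)) \<le> 2" using FP X by auto
    have mem: "el (e 0) (e 1) \<in> F (e 1)" "el (e 2) (e 1) \<in> F (e 1)" "el (e 3) (e 1) \<in> F (e 1)"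
      using el(2)[OF X(1,2) ne(1)] el(2)[OF X(3,2) ne(2)] el(2)[OF X(4,2) ne(3)] by auto
    \<comment> \<open>Each of these faults is missing on a walk that contains a later one, so the
      three are pairwise different.\<close>
    have "el (e 0) (e 1) \<notin> set (P (e 2))" "el (e 0) (e 1) \<notin> set (P (e 3))" "el (e 2) (e 1) \<notin> set (P (e 3))"
      using el_far[of 0 2 1] el_far[of 0 3 1] el_far[of 2 3 1] by auto
    moreover have "el (e 2) (e 1) \<in> set (P (e 2))" "el (e 3) (e 1) \<in> set (P (e 3))"
      using el(1)[OF X(3,2) ne(2)] el(1)[OF X(4,2) ne(3)] by auto
    ultimately show False using card_two_memb[OF F(2,1) mem] by metis
  qed
  then show thesis using that[OF H(1)] H(2) unfolding preserves_def by blast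
qed

text \<open>With nested sources, the walk of the arc with the larger set need not meet the fault of
  the other. Take four critical arcs sorted so that all walks before \<open>e j\<close> meet its
  fault \<open>a j\<close>. Splicing on the walk of \<open>e 0\<close> puts the last
  \<open>a 2\<close> before the last \<open>a 1\<close>, and this keeps \<open>a 1\<close> off the
  walk of \<open>e 2\<close>. But \<open>a 3\<close> lies on the walks of \<open>e 1\<close> and
  \<open>e 2\<close>, and splicing there puts \<open>a 1\<close> on the latter. The sources grow
  along the list, so \<open>critical_hit\<close> applies to the earlier walk only if its own source
  set is tested against the later one.\<close>

theorem nested_preserver:
  assumes "finite B" "mono S"
  obtains H where "H \<subseteq> B" "\<And>v. card {y \<in> H. dst y = v} \<le> 3"
    "\<And>F (c :: nat). finite F \<Longrightarrow> card F \<le> 1 \<Longrightarrow> reach src dst (B - F) (S c) \<subseteq> reach src dst (H - F) (S c)"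
proof -
  let ?Q = "{(S c, F) | c F. finite F \<and> card F \<le> 1}"
  obtain H where H: "H \<subseteq> B" "preserves src dst B ?Q H"
    and "\<And>y. y \<in> H \<Longrightarrow> \<exists>S F P. (S, F) \<in> ?Q \<and> critical src dst H y S F P"
    by (rule minimal_preserver[OF assms(1), of src dst ?Q]) blast
  then have "\<forall>y. \<exists>c F P. y \<in> H \<longrightarrow> finite F \<and> card F \<le> 1 \<and> critical src dst H y (S c) F P" by blast
  then obtain c F P where FP: "\<And>y. y \<in> H \<Longrightarrow> finite (F y) \<and> card (F y) \<le> 1 \<and> critical src dst H y (S (c y)) (F y) (P y)"
    by metis
  have "card {y \<in> H. dst y = v} \<le> 3" for v
  proof (rule ccontr)
    let ?X = "{y \<in> H. dst y = v}"
    assume "\<not> card ?X \<le> 3"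
    have finX: "finite ?X" using H(1) assms finite_subset by fastforce
    obtain xs where xs: "distinct xs" "set xs \<subseteq> ?X" "length xs = 4" "sorted (map c xs)"
      using ex_sorted_sublist[OF finX, of 4 c] \<open>\<not> card ?X \<le> 3\<close> by auto
    define e where "e i = xs ! i" for i
    have eX: "e i \<in> ?X" if "i < 4" for i
      using subsetD[OF xs(2) nth_mem[of i xs]] xs(3) that unfolding e_def by auto
    have edist: "e i \<noteq> e j" if "i < 4" "j < 4" "i \<noteq> j" for i j
      using xs(1,3) that unfolding e_def by (simp add: nth_eq_iff_index_eq)
    have esort: "S (c (e i)) \<subseteq> S (c (e j))" if "i < j" "j < 4" for i j
      using xs(3,4) that sorted_nth_mono[OF xs(4), of i j] assms(2) unfolding e_def by (auto simp: mono_def)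
    have crit: "critical src dst H (e i) (S (c (e i))) (F (e i)) (P (e i))" if "i < 4" for i
      using FP eX[OF that] by auto
    have uniq: "a = b" if "a \<in> F (e i)" "b \<in> F (e i)" "i < 4" for a b i
    proof (rule ccontr)
      assume "a \<noteq> b"
      then have "card {a, b} \<le> card (F (e i))" using that FP eX[of i] by (intro card_mono) auto
      then show False using \<open>a \<noteq> b\<close> FP[of "e i"] eX[OF that(3)] by auto
    qed
    have hit: "\<exists>k<length (P (e i)). P (e i) ! k \<in> F (e j)" if "i < j" "j < 4" for i j
      using critical_hit[OF crit crit _ _ esort[OF that]] that eX[of i] eX[of j] edist[of i j] by auto
    have splice: "\<exists>l. k < l \<and> l < length (P (e i)) \<and> P (e i) ! l \<in> F (e j)"
      if "k < length (P (e i))" "P (e i) ! k \<in> set (P (e j))" "i < 4" "j < 4" "i \<noteq> j" for i j k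
      using critical_splice[OF crit crit _ _ that(1,2)] that eX[of i] eX[of j] edist[of i j] by auto
    define a where "a j = (SOME z. z \<in> F (e j))" for j
    have a: "a j \<in> F (e j)" "a j \<in> set (P (e i))" if "i < j" "j < 4" for i j
    proof -
      have "\<exists>k<length (P (e i)). P (e i) ! k \<in> F (e j)" by (rule hit[OF that])
      then obtain k where k: "k < length (P (e i))" "P (e i) ! k \<in> F (e j)" by blast
      then show "a j \<in> F (e j)" unfolding a_def by (metis someI)
      then have "a j = P (e i) ! k" using uniq k that by blast
      then show "a j \<in> set (P (e i))" using k by simp
    qed
    define R where "R j k \<longleftrightarrow> k < length (P (e 0)) \<and> P (e 0) ! k = a j" for j k
    define g where "g j = Greatest (R j)" for j
    have gR: "R j (g j)" and gmax: "\<And>k. R j k \<Longrightarrow> k \<le> g j" if "0 < j" "j < 4" for j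
    proof -
      have "\<exists>k. R j k" using a(2)[of 0 j] that unfolding R_def by (metis in_set_conv_nth)
      then obtain k where k: "R j k" by blast
      show "R j (g j)" unfolding g_def using GreatestI_nat[of "R j" k "length (P (e 0))"] k by (auto simp: R_def)
      show "R j k \<Longrightarrow> k \<le> g j" for k unfolding g_def using Greatest_le_nat[of "R j" k "length (P (e 0))"] by (auto simp: R_def)
    qed
    have "g 2 < g 1"
    proof -
      have "g 2 < length (P (e 0))" "P (e 0) ! g 2 \<in> set (P (e 1))" using gR[of 2] a(2)[of 1 2] unfolding R_def by auto
      then obtain l where l: "g 2 < l" "l < length (P (e 0))" "P (e 0) ! l \<in> F (e 1)" using splice[of "g 2" 0 1] by auto
      then have "R 1 l" using uniq[of "P (e 0) ! l" 1 "a 1"] a(1)[of 0 1] unfolding R_def by auto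
      then show ?thesis using gmax[of 1 l] l by simp
    qed
    have "a 1 \<notin> set (P (e 2))"
    proof
      assume "a 1 \<in> set (P (e 2))"
      then have "g 1 < length (P (e 0))" "P (e 0) ! g 1 \<in> set (P (e 2))" using gR[of 1] unfolding R_def by auto
      then obtain l where l: "g 1 < l" "l < length (P (e 0))" "P (e 0) ! l \<in> F (e 2)" using splice[of "g 1" 0 2] by auto
      then have "R 2 l" using uniq[of "P (e 0) ! l" 2 "a 2"] a(1)[of 0 2] unfolding R_def by auto
      then show False using gmax[of 2 l] l \<open>g 2 < g 1\<close> by simp
    qed
    moreover have "a 1 \<in> set (P (e 2))"
    proof -
      obtain k where "k < length (P (e 2))" "P (e 2) ! k = a 3" using a(2)[of 2 3] by (auto simp: in_set_conv_nth)
      then obtain l where l: "l < length (P (e 2))" "P (e 2) ! l \<in> F (e 1)"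
        using splice[of k 2 1] a(2)[of 1 3] by auto
      then have "P (e 2) ! l = a 1" using uniq[of _ 1] a(1)[of 0 1] by auto
      then show ?thesis using l by (metis nth_mem)
    qed
    ultimately show False by blast
  qed
  then show thesis using that[OF H(1)] H(2) unfolding preserves_def by blast
qed

section \<open>Prefixes, suffixes and segments of walks\<close>

lemma walk_take: "walk a b p ys q \<Longrightarrow> j < length ys \<Longrightarrow> walk a b p (take j ys) (a (ys ! j))"
proof (induction ys arbitrary: p j)
  case (Cons y ys) then show ?case by (cases j) auto
qed simp

lemma walk_take_Suc: "walk a b p ys q \<Longrightarrow> j < length ys \<Longrightarrow> walk a b p (take (Suc j) ys) (b (ys ! j))"
proof (induction ys arbitrary: p j)
  case (Cons y ys) then show ?case by (cases j) auto
qed simp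

lemma walk_drop: "walk a b p ys q \<Longrightarrow> i < length ys \<Longrightarrow> walk a b (a (ys ! i)) (drop i ys) q"
proof (induction ys arbitrary: p i)
  case (Cons y ys) then show ?case by (cases i) auto
qed simp

lemma walk_drop_Suc: "walk a b p ys q \<Longrightarrow> i < length ys \<Longrightarrow> walk a b (b (ys ! i)) (drop (Suc i) ys) q"
proof (induction ys arbitrary: p i)
  case (Cons y ys) then show ?case by (cases i) auto
qed simp

lemma walk_segment:
  assumes "walk a b p ys q" "i \<le> j" "j < length ys"
  shows "walk a b (a (ys ! i)) (drop i (take j ys)) (a (ys ! j))"
    "walk a b (b (ys ! i)) (drop (Suc i) (take (Suc j) ys)) (b (ys ! j))"
proof -
  show "walk a b (a (ys ! i)) (drop i (take j ys)) (a (ys ! j))"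
    using walk_drop[OF walk_take[OF assms(1,3)], of i] assms by (cases "i = j") auto
  show "walk a b (b (ys ! i)) (drop (Suc i) (take (Suc j) ys)) (b (ys ! j))"
    using walk_drop_Suc[OF walk_take_Suc[OF assms(1,3)], of i] assms by auto
qed

section \<open>Integral flows and residual reachability\<close>

definition sdiff :: "'a set \<Rightarrow> 'a set \<Rightarrow> 'a set" where
  "sdiff A B = (A - B) \<union> (B - A)"

locale network =
  fixes m n :: nat and ta he :: "nat \<Rightarrow> nat" and s t :: nat
  assumes ta_less: "y < m \<Longrightarrow> ta y < n" and he_less: "y < m \<Longrightarrow> he y < n"
    and s_less: "s < n" and t_less: "t < n" and s_neq_t: "s \<noteq> t"
begin

text \<open>Tail and head of an arc in the residual graph of \<open>A\<close>: the arcs of \<open>A\<close> are reversed.\<close>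

definition rt :: "nat set \<Rightarrow> nat \<Rightarrow> nat" where "rt A y = (if y \<in> A then he y else ta y)"
definition rh :: "nat set \<Rightarrow> nat \<Rightarrow> nat" where "rh A y = (if y \<in> A then ta y else he y)"

definition ex :: "nat set \<Rightarrow> nat \<Rightarrow> int" where
  "ex A v = (\<Sum>y\<in>A. of_bool (ta y = v) - of_bool (he y = v))"

text \<open>An integral flow is represented by the arcs that carry it. Demanding balance at every
  number is no restriction: the ends of arcs are below \<open>n\<close>, so the excess vanishes
  beyond.\<close>

definition isflow :: "nat set \<Rightarrow> nat \<Rightarrow> bool" where
  "isflow A k \<longleftrightarrow> A \<subseteq> {..<m} \<and> (\<forall>v. ex A v = int k * (of_bool (v = s) - of_bool (v = t)))"

definition st_cut :: "nat set \<Rightarrow> bool" where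
  "st_cut X \<longleftrightarrow> X \<subseteq> {..<n} \<and> s \<in> X \<and> t \<notin> X"

definition outs :: "nat set \<Rightarrow> nat set \<Rightarrow> nat set" where
  "outs P X = {y \<in> P. ta y \<in> X \<and> he y \<notin> X}"

definition ins :: "nat set \<Rightarrow> nat set \<Rightarrow> nat set" where
  "ins P X = {y \<in> P. ta y \<notin> X \<and> he y \<in> X}"

definition resout :: "nat set \<Rightarrow> nat set \<Rightarrow> nat set \<Rightarrow> nat set" where
  "resout A B X = {y \<in> B. rt A y \<in> X \<and> rh A y \<notin> X}"

definition mcut :: "nat set \<Rightarrow> nat set \<Rightarrow> nat" where
  "mcut F X = card (outs ({..<m} - F) X)"

text \<open>Maximality after the failure of \<open>F\<close> is always witnessed by a cut.\<close>

definition max_cert :: "nat set \<Rightarrow> nat set \<Rightarrow> bool" where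
  "max_cert F A \<longleftrightarrow> A \<inter> F = {} \<and> (\<exists>k X. isflow A k \<and> st_cut X \<and> mcut F X \<le> k)"

lemma rt_less: "y < m \<Longrightarrow> rt A y < n" and rh_less: "y < m \<Longrightarrow> rh A y < n"
  using ta_less he_less by (auto simp: rt_def rh_def)

lemma isflow_subset: "isflow A k \<Longrightarrow> A \<subseteq> {..<m}" and isflow_finite: "isflow A k \<Longrightarrow> finite A"
  unfolding isflow_def using finite_subset by auto

lemma net_crossing:
  assumes "finite P" "finite X"
  shows "(\<Sum>v\<in>X. ex P v) = int (card (outs P X)) - int (card (ins P X))"
proof -
  have "(\<Sum>v\<in>X. ex P v) = (\<Sum>y\<in>P. \<Sum>v\<in>X. of_bool (ta y = v) - of_bool (he y = v))"
    unfolding ex_def by (rule sum.swap)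
  also have "\<dots> = (\<Sum>y\<in>P. of_bool (ta y \<in> X) - of_bool (he y \<in> X))"
    using assms by (intro sum.cong refl) (simp add: sum_subtractf of_bool_def)
  also have "\<dots> = (\<Sum>y\<in>P. of_bool (ta y \<in> X \<and> he y \<notin> X) - of_bool (ta y \<notin> X \<and> he y \<in> X))"
    by (intro sum.cong refl) auto
  also have "\<dots> = int (card (outs P X)) - int (card (ins P X))"
    unfolding outs_def ins_def using assms by (simp add: sum_subtractf of_bool_def sum.If_cases Int_def conj_commute)
  finally show ?thesis .
qed

lemma flow_crossing:
  assumes "isflow P k" "st_cut X"
  shows "card (outs P X) = k + card (ins P X)"
proof -
  have X: "finite X" "s \<in> X" "t \<notin> X" using assms(2) finite_subset unfolding st_cut_def by auto
  have "(\<Sum>v\<in>X. ex P v) = (\<Sum>v\<in>X. if v = s then int k else 0)"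
    using assms(1) X s_neq_t unfolding isflow_def by (intro sum.cong refl) auto
  also have "\<dots> = int k" using X by simp
  finally show ?thesis using net_crossing[OF isflow_finite[OF assms(1)] X(1)] by simp
qed

text \<open>A leaving arc is residual unless it carries flow, an entering arc is residual if it
  does; leaving and entering flow differ by \<open>k\<close>.\<close>

lemma mcut_eq_resout:
  assumes "isflow A k" "st_cut X" "A \<inter> F = {}"
  shows "mcut F X = k + card (resout A ({..<m} - F) X)"
proof -
  let ?O = "outs ({..<m} - F - A) X"
  have A: "A \<subseteq> {..<m}" "finite A" using assms(1) isflow_subset isflow_finite by auto
  have "outs ({..<m} - F) X = ?O \<union> outs A X" using A assms(3) by (auto simp: outs_def)
  moreover have "?O \<inter> outs A X = {}" "finite ?O" "finite (outs A X)" using A by (auto simp: outs_def)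
  ultimately have 1: "mcut F X = card ?O + card (outs A X)" unfolding mcut_def by (simp add: card_Un_disjoint)
  have "resout A ({..<m} - F) X = ?O \<union> ins A X" using A assms(3) by (auto simp: outs_def ins_def resout_def rt_def rh_def)
  moreover have "?O \<inter> ins A X = {}" "finite (ins A X)" using A by (auto simp: outs_def ins_def)
  ultimately have "card (resout A ({..<m} - F) X) = card ?O + card (ins A X)" using \<open>finite ?O\<close> by (simp add: card_Un_disjoint)
  then show ?thesis using 1 flow_crossing[OF assms(1,2)] by simp
qed

lemma mcut_delete:
  assumes "F \<subseteq> {..<m}"
  shows "mcut {} X = mcut F X + card (outs F X)"
proof -
  have "outs ({..<m} - {}) X = outs ({..<m} - F) X \<union> outs F X" using assms by (auto simp: outs_def)
  moreover have "outs ({..<m} - F) X \<inter> outs F X = {}" "finite (outs ({..<m} - F) X)" "finite (outs F X)"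
    using assms finite_subset[OF assms] by (auto simp: outs_def)
  ultimately show ?thesis unfolding mcut_def by (simp add: card_Un_disjoint)
qed

lemma mcut_antimono: "F \<subseteq> F' \<Longrightarrow> mcut F' X \<le> mcut F X"
  unfolding mcut_def outs_def by (intro card_mono) auto

section \<open>Sums, differences and augmentations of integral flows\<close>

lemma ex_disjoint_union: "finite A \<Longrightarrow> finite B \<Longrightarrow> A \<inter> B = {} \<Longrightarrow> ex (A \<union> B) v = ex A v + ex B v"
  unfolding ex_def by (rule sum.union_disjoint)

lemma isflow_empty: "isflow {} 0"
  by (simp add: isflow_def ex_def)

lemma isflow_union: "isflow A k \<Longrightarrow> isflow B l \<Longrightarrow> A \<inter> B = {} \<Longrightarrow> isflow (A \<union> B) (k + l)"
  using isflow_finite[of A k] isflow_finite[of B l]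
  by (auto simp: isflow_def ex_disjoint_union algebra_simps)

lemma ex_Diff: "finite A \<Longrightarrow> B \<subseteq> A \<Longrightarrow> ex (A - B) v = ex A v - ex B v"
  unfolding ex_def by (rule sum_diff)

lemma isflow_diff: "isflow A k \<Longrightarrow> isflow B l \<Longrightarrow> B \<subseteq> A \<Longrightarrow> l \<le> k \<Longrightarrow> isflow (A - B) (k - l)"
  using isflow_finite[of A k] unfolding isflow_def by (auto simp: ex_Diff of_nat_diff left_diff_distrib)

lemma walk_telescope:
  "walk a b p ys q \<Longrightarrow> (\<Sum>y\<leftarrow>ys. (of_bool (a y = v) - of_bool (b y = v) :: int)) = of_bool (p = v) - of_bool (q = v)"
  by (induction ys arbitrary: p) auto

text \<open>In the residual orientation every toggled arc changes the excess by tail minus head,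
  whether it is added or removed, and these changes telescope along the walk.\<close>

lemma ex_toggle:
  assumes "finite A" "walk (rt A) (rh A) p ys q" "distinct ys"
  shows "ex (sdiff A (set ys)) v = ex A v + of_bool (p = v) - of_bool (q = v)"
proof -
  let ?g = "\<lambda>y. (of_bool (ta y = v) - of_bool (he y = v) :: int)"
  let ?h = "\<lambda>y. (of_bool (rt A y = v) - of_bool (rh A y = v) :: int)"
  have "sum ?h (set ys) = of_bool (p = v) - of_bool (q = v)"
    using walk_telescope[OF assms(2), of v] assms(3) by (simp add: sum_list_distinct_conv_sum_set)
  moreover have "sum ?h (set ys) = sum ?h (set ys - A) + sum ?h (set ys \<inter> A)"
    by (metis (no_types, lifting) List.finite_set add.commute sum.Int_Diff)
  moreover have "sum ?h (set ys - A) = sum ?g (set ys - A)" by (intro sum.cong) (auto simp: rt_def rh_def)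
  moreover have "sum ?h (set ys \<inter> A) = - sum ?g (set ys \<inter> A)"
    unfolding sum_negf[symmetric] by (intro sum.cong) (auto simp: rt_def rh_def)
  moreover have "sum ?g A = sum ?g (A - set ys) + sum ?g (set ys \<inter> A)"
    using assms(1) by (metis (no_types, lifting) Int_commute add.commute sum.Int_Diff)
  moreover have "sum ?g (sdiff A (set ys)) = sum ?g (A - set ys) + sum ?g (set ys - A)"
    unfolding sdiff_def using assms(1) by (intro sum.union_disjoint) auto
  ultimately show ?thesis unfolding ex_def by linarith
qed

lemma isflow_augment:
  assumes "isflow A k" "walk (rt A) (rh A) s ys t" "distinct ys" "set ys \<subseteq> {..<m}"
  shows "isflow (sdiff A (set ys)) (Suc k)"
proof -
  have "ex (sdiff A (set ys)) v = int (Suc k) * (of_bool (v = s) - of_bool (v = t))" for v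
  proof -
    have "ex A v = int k * (of_bool (v = s) - of_bool (v = t))" using assms(1) unfolding isflow_def by blast
    then show ?thesis using ex_toggle[OF isflow_finite[OF assms(1)] assms(2,3), of v]
      by (auto simp: algebra_simps of_bool_def)
  qed
  then show ?thesis using assms(4) isflow_subset[OF assms(1)] unfolding isflow_def by (auto simp: sdiff_def)
qed

text \<open>A residual detour from the tail to the head of \<open>x\<close> moves one unit, and
  dropping \<open>x\<close> takes that unit away from the same two vertices.\<close>

lemma isflow_reroute:
  assumes "isflow A k" "walk (rt A) (rh A) u ys v" "distinct ys" "set ys \<subseteq> {..<m}" "x \<in> A" "x \<notin> set ys"
    "ta x = u" "he x = v"
  shows "isflow (sdiff A (set ys) - {x}) k"
proof -
  have x: "x \<in> sdiff A (set ys)" and fin: "finite (sdiff A (set ys))"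
    using assms isflow_finite[OF assms(1)] by (auto simp: sdiff_def)
  have "ex (sdiff A (set ys) - {x}) w = ex A w" for w
    using ex_toggle[OF isflow_finite[OF assms(1)] assms(2,3), of w] x fin assms(7,8)
    unfolding ex_def by (simp add: sum_diff1)
  then show ?thesis using assms unfolding isflow_def sdiff_def by auto
qed

lemma isflow_path: "walk ta he s ys t \<Longrightarrow> distinct ys \<Longrightarrow> set ys \<subseteq> {..<m} \<Longrightarrow> isflow (set ys) 1"
  using isflow_augment[OF isflow_empty, of ys] walk_cong[of ys "rt {}" ta "rh {}" he s t]
  by (simp add: rt_def rh_def sdiff_def)

lemma isflow_UN:
  assumes "\<And>i. i < k \<Longrightarrow> isflow (P i) 1" "\<And>i j. i < k \<Longrightarrow> j < k \<Longrightarrow> i \<noteq> j \<Longrightarrow> P i \<inter> P j = {}"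
  shows "isflow (\<Union>i<k. P i) k"
  using assms
proof (induction k)
  case (Suc k)
  have "isflow ((\<Union>i<k. P i) \<union> P k) (k + 1)"
  proof (intro isflow_union Suc.IH)
    have "P i \<inter> P k = {}" if "i < k" for i using Suc.prems(2)[of i k] that by simp
    then show "(\<Union>i<k. P i) \<inter> P k = {}" by blast
  qed (use Suc.prems in auto)
  then show ?case by (simp add: lessThan_Suc Un_commute)
qed (simp add: isflow_empty)

lemma simple_walk_exists:
  assumes "q \<in> reach a b B {p}"
  obtains ys where "walk a b p ys q" "set ys \<subseteq> B" "distinct (p # map b ys)" "distinct ys"
proof -
  obtain zs where "walk a b p zs q" "set zs \<subseteq> B" using assms unfolding reach_def by auto
  then obtain ys where "walk a b p ys q" "set ys \<subseteq> B" "distinct (p # map b ys)" using walk_simple by (metis subset_trans)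
  moreover from this have "distinct ys" by (simp add: distinct_map)
  ultimately show thesis using that by blast
qed

section \<open>Maximum flows, minimum cuts and path decompositions by residual reachability\<close>

lemma reach_closed: "resout A B (reach (rt A) (rh A) B S) = {}"
  by (auto simp: resout_def intro: reach_step)

lemma st_cut_reach: "B \<subseteq> {..<m} \<Longrightarrow> s \<in> S \<Longrightarrow> S \<subseteq> {..<n} \<Longrightarrow> t \<notin> reach (rt A) (rh A) B S \<Longrightarrow> st_cut (reach (rt A) (rh A) B S)"
  unfolding st_cut_def using reach_superset[of S "rt A" "rh A" B] reach_subset_verts[of S "{..<n}" B "rh A" "rt A"]
  by (meson lessThan_iff rh_less subsetD)

text \<open>Values are bounded by the number of arcs. A flow of largest value has no augmenting
  walk, so the vertices that \<open>s\<close> reaches in its residual graph form a cut of that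
  value.\<close>

lemma max_flow_exists: "\<exists>k A X. isflow A k \<and> st_cut X \<and> mcut {} X = k"
proof -
  let ?P = "\<lambda>k. \<exists>A. isflow A k"
  have st0: "st_cut {s}" using s_less s_neq_t by (simp add: st_cut_def)
  have "k \<le> m" if "isflow A k" for A k
  proof -
    have "k \<le> card (outs A {s})" using flow_crossing[OF that st0] by simp
    also have "\<dots> \<le> card {..<m}" using isflow_subset[OF that] by (intro card_mono) (auto simp: outs_def)
    finally show ?thesis by simp
  qed
  then have b: "\<forall>k. ?P k \<longrightarrow> k \<le> m" by blast
  define k where "k = Greatest ?P"
  have "?P k" using GreatestI_nat[of ?P 0 m] isflow_empty b unfolding k_def by blast
  then obtain A where A: "isflow A k" by blast
  let ?X = "reach (rt A) (rh A) {..<m} {s}"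
  have "t \<notin> ?X"
  proof
    assume "t \<in> ?X"
    then obtain ys where "walk (rt A) (rh A) s ys t" "set ys \<subseteq> {..<m}" "distinct ys" by (rule simple_walk_exists)
    then have "?P (Suc k)" using isflow_augment[OF A] by blast
    then have "Suc k \<le> k" unfolding k_def using Greatest_le_nat[of ?P _ m] b by blast
    then show False by simp
  qed
  then have X: "st_cut ?X" using s_less by (intro st_cut_reach) auto
  have "mcut {} ?X = k" using mcut_eq_resout[OF A X, of "{}"] reach_closed[of A "{..<m}" "{s}"] by simp
  then show ?thesis using A X by blast
qed

definition simple_path :: "nat list \<Rightarrow> bool" where
  "simple_path ys \<longleftrightarrow> walk ta he s ys t \<and> distinct (s # map he ys) \<and> set ys \<subseteq> {..<m}"

lemma simple_path_isflow: "simple_path ys \<Longrightarrow> isflow (set ys) 1"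
  unfolding simple_path_def using isflow_path by (simp add: distinct_map)

lemma flow_has_path:
  assumes "isflow A (Suc k)"
  obtains ys where "simple_path ys" "set ys \<subseteq> A" "isflow (A - set ys) k"
proof -
  let ?X = "reach ta he A {s}"
  have sub: "A \<subseteq> {..<m}" using assms isflow_subset by blast
  have "t \<in> ?X"
  proof (rule ccontr)
    assume "t \<notin> ?X"
    have "?X \<subseteq> {..<n}" using s_less he_less sub by (intro reach_subset_verts) auto
    then have "st_cut ?X" unfolding st_cut_def using \<open>t \<notin> ?X\<close> reach_superset[of "{s}" ta he A] by auto
    moreover have "outs A ?X = {}" by (auto simp: outs_def intro: reach_step)
    ultimately show False using flow_crossing[OF assms, of ?X] by simp
  qed
  then obtain ys where ys: "walk ta he s ys t" "set ys \<subseteq> A" "distinct (s # map he ys)" by (rule simple_walk_exists)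
  then have sp: "simple_path ys" using sub unfolding simple_path_def by blast
  have "isflow (A - set ys) k" using isflow_diff[OF assms simple_path_isflow[OF sp] ys(2)] by simp
  then show thesis using that sp ys(2) by blast
qed

lemma flow_decomposition:
  "isflow A k \<Longrightarrow> \<exists>pl. (\<forall>i<k. simple_path (pl i) \<and> set (pl i) \<subseteq> A) \<and>
     (\<forall>i<k. \<forall>j<k. i \<noteq> j \<longrightarrow> set (pl i) \<inter> set (pl j) = {})"
proof (induction k arbitrary: A)
  case (Suc k)
  obtain ys where ys: "simple_path ys" "set ys \<subseteq> A" "isflow (A - set ys) k" using flow_has_path[OF Suc.prems] by blast
  obtain pl where pl: "\<forall>i<k. simple_path (pl i) \<and> set (pl i) \<subseteq> A - set ys"
    "\<forall>i<k. \<forall>j<k. i \<noteq> j \<longrightarrow> set (pl i) \<inter> set (pl j) = {}" using Suc.IH[OF ys(3)] by blast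
  show ?case
  proof (intro exI[of _ "pl(k := ys)"] conjI allI impI)
    fix i assume "i < Suc k"
    then show "simple_path ((pl(k := ys)) i)" "set ((pl(k := ys)) i) \<subseteq> A" using pl(1) ys by (auto simp: less_Suc_eq)
  next
    fix i j assume "i < Suc k" "j < Suc k" "i \<noteq> j"
    then consider "i < k" "j < k" | "i = k" "j < k" | "i < k" "j = k" by linarith
    then show "set ((pl(k := ys)) i) \<inter> set ((pl(k := ys)) j) = {}"
      using pl \<open>i \<noteq> j\<close> by cases (simp, (simp, blast)+)
  qed
qed auto

end

section \<open>Two failures\<close>

locale path_system = network +
  fixes k :: nat and pl :: "nat \<Rightarrow> nat list" and X0 :: "nat set"
  assumes simple: "i < k \<Longrightarrow> simple_path (pl i)"
    and disjoint: "i < k \<Longrightarrow> j < k \<Longrightarrow> i \<noteq> j \<Longrightarrow> set (pl i) \<inter> set (pl j) = {}"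
    and X0: "st_cut X0" "mcut {} X0 = k"
begin

text \<open>Circulations that the decomposition leaves over do not enter \<open>A\<close>; the cut
  \<open>X0\<close> shows that it is a maximum flow nevertheless.\<close>

definition A :: "nat set" where "A = (\<Union>i<k. set (pl i))"

text \<open>Vertices before and behind a failed arc. Counting the suffix in \<open>Tr\<close> from
  its end makes both families increase with \<open>c\<close>, as nested preservers require.\<close>

definition Sf :: "nat \<Rightarrow> nat \<Rightarrow> nat set" where
  "Sf i c = {ta (pl i ! l) | l. l < length (pl i) \<and> l < c}"

definition Tr :: "nat \<Rightarrow> nat \<Rightarrow> nat set" where
  "Tr i c = {he (pl i ! l) | l. l < length (pl i) \<and> length (pl i) \<le> l + c}"

lemma isflow_A: "isflow A k"
  unfolding A_def by (rule isflow_UN) (simp_all add: simple simple_path_isflow[simplified] disjoint)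

lemma A_subset: "A \<subseteq> {..<m}"
  using isflow_A isflow_subset by blast

lemma pl_subset: "i < k \<Longrightarrow> set (pl i) \<subseteq> A"
  by (auto simp: A_def)

lemma pl_walk: "i < k \<Longrightarrow> walk ta he s (pl i) t" and pl_distinct: "i < k \<Longrightarrow> distinct (pl i)"
  and pl_arcs: "i < k \<Longrightarrow> set (pl i) \<subseteq> {..<m}" and pl_nonempty: "i < k \<Longrightarrow> pl i \<noteq> []"
  and pl_distinct_he: "i < k \<Longrightarrow> distinct (s # map he (pl i))"
  using simple[of i] s_neq_t unfolding simple_path_def by (auto simp: distinct_map)

lemma pl_length: "i < k \<Longrightarrow> length (pl i) < n"
  by (rule simple_walk_length[OF pl_walk pl_distinct_he s_less]) (auto intro: he_less dest: subsetD[OF pl_arcs])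

lemma max_cert_full: "isflow A' k \<Longrightarrow> A' \<inter> F = {} \<Longrightarrow> max_cert F A'"
  unfolding max_cert_def using X0 mcut_antimono[of "{}" F X0] by auto

text \<open>A prefix vertex outside \<open>X\<close> forces the path to enter \<open>X\<close>
  before position \<open>l\<close>, a suffix vertex inside forces it to enter behind
  \<open>l\<close>; one entry cannot serve both.\<close>

lemma Sf_or_Tr:
  assumes "i < k" "l < length (pl i)" "ta (pl i ! l) \<in> X" "he (pl i ! l) \<notin> X" "card (ins (set (pl i)) X) \<le> 1"
  shows "Sf i (Suc l) \<subseteq> X \<or> Tr i (length (pl i) - l) \<inter> X = {}"
    and "ins (set (pl i)) X = {} \<Longrightarrow> Sf i (Suc l) \<subseteq> X \<and> Tr i (length (pl i) - l) \<inter> X = {}"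
proof -
  have below: "\<exists>y. y \<in> ins (set (take l (pl i))) X" if "\<not> Sf i (Suc l) \<subseteq> X"
  proof -
    obtain l' where l': "l' \<le> l" "ta (pl i ! l') \<notin> X" using \<open>\<not> Sf i (Suc l) \<subseteq> X\<close> unfolding Sf_def less_Suc_eq_le by blast
    have "walk ta he (ta (pl i ! l')) (drop l' (take l (pl i))) (ta (pl i ! l))"
      by (rule walk_segment(1)[OF pl_walk]) (use assms l' in auto)
    from walk_crossing[OF this, of "- X"] show ?thesis using l' assms(3) set_drop_subset[of l' "take l (pl i)"]
      by (auto simp: ins_def)
  qed
  have above: "\<exists>y. y \<in> ins (set (drop (Suc l) (pl i))) X" if "Tr i (length (pl i) - l) \<inter> X \<noteq> {}"
  proof -
    obtain l' where l': "l \<le> l'" "l' < length (pl i)" "he (pl i ! l') \<in> X" using \<open>Tr i (length (pl i) - l) \<inter> X \<noteq> {}\<close> assms(2) unfolding Tr_def by force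
    have "walk ta he (he (pl i ! l)) (drop (Suc l) (take (Suc l') (pl i))) (he (pl i ! l'))"
      by (rule walk_segment(2)[OF pl_walk]) (use assms l' in auto)
    from walk_crossing[OF this, of "- X"] show ?thesis using l' assms(4)
      by (auto simp: ins_def drop_take dest: in_set_takeD)
  qed
  have sub: "set (take l (pl i)) \<subseteq> set (pl i)" "set (drop (Suc l) (pl i)) \<subseteq> set (pl i)"
    by (auto dest: in_set_takeD in_set_dropD)
  show "ins (set (pl i)) X = {} \<Longrightarrow> Sf i (Suc l) \<subseteq> X \<and> Tr i (length (pl i) - l) \<inter> X = {}"
    using below above sub unfolding ins_def by blast
  show "Sf i (Suc l) \<subseteq> X \<or> Tr i (length (pl i) - l) \<inter> X = {}"
  proof (rule ccontr)
    assume "\<not> ?thesis"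
    then obtain y y' where y: "y \<in> ins (set (take l (pl i))) X" "y' \<in> ins (set (drop (Suc l) (pl i))) X"
      using below above by blast
    have "set (take l (pl i)) \<inter> set (drop (Suc l) (pl i)) = {}"
      using pl_distinct[OF assms(1)] by (simp add: set_take_disj_set_drop_if_distinct)
    then have "y \<noteq> y'" using y unfolding ins_def by blast
    moreover have "card {y, y'} \<le> card (ins (set (pl i)) X)"
      using y sub by (intro card_mono) (auto simp: ins_def)
    ultimately show False using assms(5) by simp
  qed
qed

text \<open>\<open>E\<close> does not stand for the failed arcs but for the residual arcs of
  \<open>A\<close> that leave the cut of the last search. The suffixes are treated in the reversed
  residual graph.\<close>

definition dual_preserver :: "nat \<Rightarrow> nat set \<Rightarrow> bool" where
  "dual_preserver i N \<longleftrightarrow> (\<forall>E c. finite E \<longrightarrow> card E \<le> 1 \<longrightarrow>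
     reach (rt A) (rh A) ({..<m} - E) (Sf i c) \<subseteq> reach (rt A) (rh A) (N - E) (Sf i c) \<and>
     reach (rh A) (rt A) ({..<m} - E) (Tr i c) \<subseteq> reach (rh A) (rt A) (N - E) (Tr i c))"

lemma dual_preserverD:
  assumes "dual_preserver i N" "finite E" "card E \<le> 1"
  shows "reach (rt A) (rh A) ({..<m} - E) (Sf i c) \<subseteq> reach (rt A) (rh A) (N - E) (Sf i c)"
    "reach (rh A) (rt A) ({..<m} - E) (Tr i c) \<subseteq> reach (rh A) (rt A) (N - E) (Tr i c)"
  using assms unfolding dual_preserver_def by blast+

lemma dual_preserver_mono: "dual_preserver i N \<Longrightarrow> N \<subseteq> N' \<Longrightarrow> dual_preserver i N'"
  unfolding dual_preserver_def
  by (meson Diff_mono reach_mono subset_refl subset_trans)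

definition Sfs :: "(nat \<times> nat) set \<Rightarrow> nat set" where "Sfs I = (\<Union>(i, l)\<in>I. Sf i (Suc l))"
definition Trs :: "(nat \<times> nat) set \<Rightarrow> nat set" where "Trs I = (\<Union>(i, l)\<in>I. Tr i (length (pl i) - l))"

lemma reach_UN: "reach a b B (\<Union>i\<in>I. S i) = (\<Union>i\<in>I. reach a b B (S i))"
  unfolding reach_def by blast

text \<open>\<open>X\<close> is a cut of the sparse subgraph \<open>N\<close> whose outgoing residual arcs are \<open>E\<close>; \<open>I\<close> lists the failed arcs that
  leave \<open>X\<close> by path number and position.\<close>

lemma lift_cut:
  assumes I: "\<And>i l. (i, l) \<in> I \<Longrightarrow> i < k \<and> l < length (pl i) \<and> dual_preserver i N \<and> pl i ! l \<in> F \<and>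
      ta (pl i ! l) \<in> X \<and> he (pl i ! l) \<notin> X"
    and "I \<noteq> {}" "st_cut X" "resout A N X \<subseteq> E" "finite E" "card E \<le> 1" "F \<subseteq> {..<m}"
    and or: "Sfs I \<subseteq> X \<or> Trs I \<inter> X = {}"
  shows "\<exists>Y. st_cut Y \<and> mcut F Y + card ((\<lambda>(i, l). pl i ! l) ` I) \<le> k + card E"
proof -
  have X: "X \<subseteq> {..<n}" "s \<in> X" "t \<notin> X" using assms(3) unfolding st_cut_def by auto
  obtain i0 l0 where il: "(i0, l0) \<in> I" using \<open>I \<noteq> {}\<close> by auto
  have pl0: "walk ta he s (pl i0) t" "pl i0 \<noteq> []" "i0 < k" "l0 < length (pl i0)" using I[OF il] pl_walk pl_nonempty by auto
  have "\<exists>Y. st_cut Y \<and> resout A {..<m} Y \<subseteq> E \<and> (\<lambda>(i, l). pl i ! l) ` I \<subseteq> outs F Y"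
    using or
  proof
    assume S: "Sfs I \<subseteq> X"
    \<comment> \<open>Regrow the cut in the full residual graph from the prefixes of the failed
      arcs. The preservers keep it inside \<open>X\<close>, so the failed arcs still leave it, while
      \<open>E\<close> covers all its outgoing residual arcs.\<close>
    define Y where "Y = reach (rt A) (rh A) ({..<m} - E) (Sfs I)"
    have "Y = (\<Union>(i, l)\<in>I. reach (rt A) (rh A) ({..<m} - E) (Sf i (Suc l)))"
      unfolding Y_def Sfs_def by (simp add: case_prod_unfold reach_UN)
    also have "\<dots> \<subseteq> (\<Union>(i, l)\<in>I. reach (rt A) (rh A) (N - E) (Sf i (Suc l)))"
    proof (intro UN_mono subset_refl, clarify)
      fix i l x assume "(i, l) \<in> I" "x \<in> reach (rt A) (rh A) ({..<m} - E) (Sf i (Suc l))"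
      then show "x \<in> reach (rt A) (rh A) (N - E) (Sf i (Suc l))"
        using dual_preserverD(1)[of i N E "Suc l"] I[of i l] assms(5,6) by blast
    qed
    also have "\<dots> \<subseteq> X"
    proof (intro UN_least, clarify)
      fix i l x assume "(i, l) \<in> I" "x \<in> reach (rt A) (rh A) (N - E) (Sf i (Suc l))"
      moreover have "reach (rt A) (rh A) (N - E) (Sf i (Suc l)) \<subseteq> X"
        using S \<open>(i, l) \<in> I\<close> assms(4) by (intro reach_least) (auto simp: Sfs_def resout_def)
      ultimately show "x \<in> X" by blast
    qed
    finally have YX: "Y \<subseteq> X" .
    have "ta (pl i0 ! 0) = s" using pl0(1,2) by (cases "pl i0") auto
    then have "s \<in> Sf i0 (Suc l0)" using pl0 unfolding Sf_def by force
    then have "s \<in> Y" using il reach_superset[of "Sfs I" "rt A" "rh A" "{..<m} - E"] unfolding Y_def Sfs_def by blast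
    then have "st_cut Y" using YX X unfolding st_cut_def by blast
    moreover have "resout A {..<m} Y \<subseteq> E"
      using reach_step[of "rt A" _ "rh A" "{..<m} - E" "Sfs I"] unfolding Y_def resout_def by blast
    moreover have "pl i ! l \<in> outs F Y" if "(i, l) \<in> I" for i l
    proof -
      have "ta (pl i ! l) \<in> Sf i (Suc l)" using I[OF that] unfolding Sf_def by force
      then have "ta (pl i ! l) \<in> Y" using that reach_superset[of "Sfs I" "rt A" "rh A" "{..<m} - E"] unfolding Y_def Sfs_def by blast
      then show ?thesis using I[OF that] YX unfolding outs_def by blast
    qed
    ultimately show ?thesis by (intro exI[of _ Y]) auto
  next
    assume T: "Trs I \<inter> X = {}"
    \<comment> \<open>Dually, everything that reaches a suffix in the full residual graph is removed
      from the vertex set; it stays disjoint from \<open>X\<close>.\<close>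
    define Z where "Z = reach (rh A) (rt A) ({..<m} - E) (Trs I)"
    define Y where "Y = {..<n} - Z"
    have "Z = (\<Union>(i, l)\<in>I. reach (rh A) (rt A) ({..<m} - E) (Tr i (length (pl i) - l)))"
      unfolding Z_def Trs_def by (simp add: case_prod_unfold reach_UN)
    also have "\<dots> \<subseteq> (\<Union>(i, l)\<in>I. reach (rh A) (rt A) (N - E) (Tr i (length (pl i) - l)))"
    proof (intro UN_mono subset_refl, clarify)
      fix i l x assume "(i, l) \<in> I" "x \<in> reach (rh A) (rt A) ({..<m} - E) (Tr i (length (pl i) - l))"
      then show "x \<in> reach (rh A) (rt A) (N - E) (Tr i (length (pl i) - l))"
        using dual_preserverD(2)[of i N E "length (pl i) - l"] I[of i l] assms(5,6) by blast
    qed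
    also have "\<dots> \<subseteq> - X"
    proof (intro UN_least, clarify)
      fix i l x assume "(i, l) \<in> I" "x \<in> reach (rh A) (rt A) (N - E) (Tr i (length (pl i) - l))" "x \<in> X"
      moreover have "reach (rh A) (rt A) (N - E) (Tr i (length (pl i) - l)) \<subseteq> - X"
        using T \<open>(i, l) \<in> I\<close> assms(4) by (intro reach_least) (auto simp: Trs_def resout_def)
      ultimately show False by blast
    qed
    finally have ZX: "Z \<inter> X = {}" by blast
    have "he (pl i0 ! (length (pl i0) - 1)) = t" using walk_last[OF pl0(1,2)] pl0(2) by (simp add: last_conv_nth)
    then have "t \<in> Tr i0 (length (pl i0) - l0)" using pl0 unfolding Tr_def by force
    then have "t \<in> Z" using il reach_superset[of "Trs I" "rh A" "rt A" "{..<m} - E"] unfolding Z_def Trs_def by blast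
    then have "st_cut Y" using ZX X unfolding st_cut_def Y_def by blast
    moreover have "resout A {..<m} Y \<subseteq> E"
      using reach_step[of "rh A" _ "rt A" "{..<m} - E" "Trs I"] rh_less unfolding Y_def Z_def resout_def by blast
    moreover have "pl i ! l \<in> outs F Y" if "(i, l) \<in> I" for i l
    proof -
      have "he (pl i ! l) \<in> Tr i (length (pl i) - l)" using I[OF that] unfolding Tr_def by force
      then have "he (pl i ! l) \<in> Z" using that reach_superset[of "Trs I" "rh A" "rt A" "{..<m} - E"] unfolding Z_def Trs_def by blast
      then show ?thesis using I[OF that] ZX X unfolding outs_def Y_def by blast
    qed
    ultimately show ?thesis by (intro exI[of _ Y]) auto
  qed
  then obtain Y where Y: "st_cut Y" "resout A {..<m} Y \<subseteq> E" "(\<lambda>(i, l). pl i ! l) ` I \<subseteq> outs F Y" by blast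
  \<comment> \<open>Before the failure the cut has capacity \<open>k\<close> plus its residual arcs;
    each failed arc that leaves it is then subtracted.\<close>
  have "mcut {} Y \<le> k + card E" using mcut_eq_resout[OF isflow_A Y(1), of "{}"] card_mono[OF assms(5) Y(2)] by simp
  moreover have "finite (outs F Y)" using assms(7) finite_subset[OF assms(7)] by (auto simp: outs_def)
  ultimately show ?thesis using Y mcut_delete[OF assms(7), of Y] card_mono[OF _ Y(3)] by (intro exI[of _ Y]) auto
qed

text \<open>As \<open>X\<close> is closed for \<open>B'\<close> inside \<open>N\<close>,
  \<open>B'\<close> uses every arc of \<open>N\<close> leaving \<open>X\<close> and none entering
  it. Across \<open>X\<close> the two flows thus differ exactly in the residual arcs of
  \<open>B\<close> that leave it, and each of these accounts for one unit of value.\<close>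

lemma augmented_crossing:
  assumes "isflow B b" "isflow B' (b + r)" "sdiff B B' \<subseteq> N" "N \<subseteq> {..<m}" "st_cut X" "resout B' N X = {}"
  shows "card (resout B N X) = r"
proof -
  have fin: "finite B" "finite B'" "finite N" using assms isflow_finite finite_subset[of N "{..<m}"] by auto
  let ?O = "outs (N - B) X" and ?I = "ins (N \<inter> B) X"
  have cl: "outs N X \<subseteq> B'" "ins N X \<inter> B' = {}"
    using assms(6) unfolding resout_def outs_def ins_def rt_def rh_def by (auto split: if_splits)
  have "outs B' X = outs B X \<union> ?O" using cl assms(3) unfolding outs_def sdiff_def by blast
  moreover have "outs B X \<inter> ?O = {}" unfolding outs_def by blast
  ultimately have 1: "card (outs B' X) = card (outs B X) + card ?O" using fin by (simp add: card_Un_disjoint outs_def)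
  have "ins B X = ins B' X \<union> ?I" using cl assms(3) unfolding ins_def sdiff_def by blast
  moreover have "ins B' X \<inter> ?I = {}" using cl unfolding ins_def by blast
  ultimately have 2: "card (ins B X) = card (ins B' X) + card ?I" using fin by (simp add: card_Un_disjoint ins_def)
  have "resout B N X = ?O \<union> ?I" unfolding resout_def outs_def ins_def rt_def rh_def by auto
  moreover have "?O \<inter> ?I = {}" unfolding outs_def ins_def by blast
  ultimately have "card (resout B N X) = card ?O + card ?I" using fin by (simp add: card_Un_disjoint ins_def outs_def)
  then show ?thesis using 1 2 flow_crossing[OF assms(1,5)] flow_crossing[OF assms(2,5)] by linarith
qed

text \<open>Put the two dropped paths back and count their crossings with \<open>X\<close>:
  |\<open>E\<close>| + 2 = \<open>r\<close> + q, where \<open>E\<close> are the residual arcs of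
  \<open>A\<close> in \<open>N\<close> leaving \<open>X\<close>, and q of the two failed arcs leave
  \<open>X\<close>. As \<open>r \<le> 1\<close>, at most one arc is in \<open>E\<close> and at least
  one failed arc leaves. The lifted cut has capacity at most \<open>k\<close> + |\<open>E\<close>| -
  q = \<open>k - 2 + r\<close>.\<close>

lemma dual_failure:
  assumes ij: "i < k" "j < k" "i \<noteq> j" "l < length (pl i)" "l' < length (pl j)"
    and F: "F = {pl i ! l, pl j ! l'}"
    and N: "set (pl i) \<subseteq> N" "set (pl j) \<subseteq> N" "N \<subseteq> {..<m}" "dual_preserver i N" "dual_preserver j N"
    and B: "isflow B' (k - 2 + r)" "r \<le> 1" "sdiff (A - set (pl i) - set (pl j)) B' \<subseteq> N - F"
    and X: "st_cut X" "resout B' (N - F) X = {}"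
  shows "\<exists>Y. st_cut Y \<and> mcut F Y \<le> k - 2 + r"
proof -
  let ?pi = "set (pl i)" and ?pj = "set (pl j)" and ?e = "pl i ! l" and ?e' = "pl j ! l'"
  let ?A0 = "A - ?pi - ?pj"
  have dj: "?pi \<inter> ?pj = {}" using disjoint ij by blast
  have pA: "?pi \<subseteq> A" "?pj \<subseteq> A" using pl_subset ij by auto
  have e: "?e \<in> ?pi" "?e' \<in> ?pj" using ij by auto
  have fi: "isflow ?pi 1" "isflow ?pj 1" using simple_path_isflow simple ij by auto
  have k2: "2 \<le> k" using ij by linarith
  have "isflow (A - ?pi) (k - 1)" using isflow_diff[OF isflow_A fi(1) pA(1)] k2 by simp
  moreover have "?pj \<subseteq> A - ?pi" "k - 1 - 1 = k - 2" "1 \<le> k - 1" using pA dj k2 by auto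
  ultimately have A0: "isflow ?A0 (k - 2)" using isflow_diff[of "A - ?pi" "k - 1" ?pj 1] fi(2) by metis
  define R where "R = resout ?A0 (N - F) X"
  define E where "E = resout A N X"
  have o: "card R = r" unfolding R_def by (rule augmented_crossing[OF A0 B(1,3)]) (use N X in auto)
  have finN: "finite N" using N(3) finite_subset by blast
  let ?q = "?pi \<union> ?pj"
  \<comment> \<open>Each path leaves \<open>X\<close> once more than it enters it; a leaving arc
    that has not failed is residual once its path is dropped.\<close>
  have in_out: "card (ins ?pi X) + 1 = card (R \<inter> ?pi) + card ({?e} \<inter> outs ?pi X)"
    "card (ins ?pj X) + 1 = card (R \<inter> ?pj) + card ({?e'} \<inter> outs ?pj X)"
  proof -
    have 1: "outs ?pi X = (R \<inter> ?pi) \<union> ({?e} \<inter> outs ?pi X)" "(R \<inter> ?pi) \<inter> ({?e} \<inter> outs ?pi X) = {}"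
      using N(1) e dj unfolding F R_def by (auto simp: outs_def resout_def rt_def rh_def split: if_splits)
    have 2: "outs ?pj X = (R \<inter> ?pj) \<union> ({?e'} \<inter> outs ?pj X)" "(R \<inter> ?pj) \<inter> ({?e'} \<inter> outs ?pj X) = {}"
      using N(2) e dj unfolding F R_def by (auto simp: outs_def resout_def rt_def rh_def split: if_splits)
    show "card (ins ?pi X) + 1 = card (R \<inter> ?pi) + card ({?e} \<inter> outs ?pi X)"
      using flow_crossing[OF fi(1) X(1)] card_Un_disjoint[OF _ _ 1(2)] 1(1) by auto
    show "card (ins ?pj X) + 1 = card (R \<inter> ?pj) + card ({?e'} \<inter> outs ?pj X)"
      using flow_crossing[OF fi(2) X(1)] card_Un_disjoint[OF _ _ 2(2)] 2(1) by auto
  qed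
  have fo: "finite R" using finN unfolding R_def by (auto simp: resout_def)
  have fin: "finite (ins ?pi X)" "finite (ins ?pj X)" by (auto simp: ins_def)
  have oc: "card R = card (R - ?q) + card (R \<inter> ?pi) + card (R \<inter> ?pj)"
  proof -
    have "R = (R - ?q) \<union> ((R \<inter> ?pi) \<union> (R \<inter> ?pj))" by blast
    also have "card \<dots> = card (R - ?q) + card ((R \<inter> ?pi) \<union> (R \<inter> ?pj))" using fo by (intro card_Un_disjoint) auto
    also have "card ((R \<inter> ?pi) \<union> (R \<inter> ?pj)) = card (R \<inter> ?pi) + card (R \<inter> ?pj)"
      using fo dj by (intro card_Un_disjoint) auto
    finally show ?thesis by simp
  qed
  \<comment> \<open>With the paths back in the flow, their leaving arcs are no longer residual, and
    their entering arcs are.\<close>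
  have Eeq: "E = (R - ?q) \<union> (ins ?pi X \<union> ins ?pj X)"
    using pA N e unfolding F E_def R_def by (auto simp: resout_def ins_def rt_def rh_def split: if_splits)
  have finE: "finite E" using finN unfolding E_def by (auto simp: resout_def)
  have Ec: "card E = card (R - ?q) + card (ins ?pi X) + card (ins ?pj X)"
  proof -
    have "card E = card (R - ?q) + card (ins ?pi X \<union> ins ?pj X)"
      unfolding Eeq using fo fin by (intro card_Un_disjoint) (auto simp: ins_def)
    also have "card (ins ?pi X \<union> ins ?pj X) = card (ins ?pi X) + card (ins ?pj X)"
      using fin dj by (intro card_Un_disjoint) (auto simp: ins_def)
    finally show ?thesis by simp
  qed
  have main: "card E + 2 = r + card ({?e} \<inter> outs ?pi X) + card ({?e'} \<inter> outs ?pj X)"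
    using Ec oc o in_out by linarith
  have c1: "card ({?e} \<inter> outs ?pi X) = (if ?e \<in> outs ?pi X then 1 else 0)"
    "card ({?e'} \<inter> outs ?pj X) = (if ?e' \<in> outs ?pj X then 1 else 0)" by auto
  have Fm: "F \<subseteq> {..<m}" unfolding F using e N by auto
  have E1: "card E \<le> 1" using main c1 B(2) by (auto split: if_splits)
  have Si: "Sf i (Suc l) \<subseteq> X \<or> Tr i (length (pl i) - l) \<inter> X = {}"
    "ins ?pi X = {} \<Longrightarrow> Sf i (Suc l) \<subseteq> X \<and> Tr i (length (pl i) - l) \<inter> X = {}" if "?e \<in> outs ?pi X"
    using Sf_or_Tr[OF ij(1,4), of X] that E1 Ec by (auto simp: outs_def)
  have Sj: "Sf j (Suc l') \<subseteq> X \<or> Tr j (length (pl j) - l') \<inter> X = {}"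
    "ins ?pj X = {} \<Longrightarrow> Sf j (Suc l') \<subseteq> X \<and> Tr j (length (pl j) - l') \<inter> X = {}" if "?e' \<in> outs ?pj X"
    using Sf_or_Tr[OF ij(2,5), of X] that E1 Ec by (auto simp: outs_def)
  define I where "I = {z. z = (i, l) \<and> ?e \<in> outs ?pi X \<or> z = (j, l') \<and> ?e' \<in> outs ?pj X}"
  have Ine: "I \<noteq> {}" using main c1 B(2) unfolding I_def by (auto split: if_splits)
  \<comment> \<open>A path that never enters \<open>X\<close> satisfies both alternatives, so it can
    follow the one that holds for the other path.\<close>
  have "ins ?pi X = {} \<or> ins ?pj X = {}"
  proof (rule ccontr)
    assume "\<not> ?thesis"
    then have "card (ins ?pi X) \<noteq> 0" "card (ins ?pj X) \<noteq> 0" using fin by auto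
    then show False using E1 Ec by linarith
  qed
  then have "Sfs I \<subseteq> X \<or> Trs I \<inter> X = {}"
    using Si Sj unfolding I_def Sfs_def Trs_def by (auto 0 3)
  moreover have "a < k \<and> b < length (pl a) \<and> dual_preserver a N \<and> pl a ! b \<in> F \<and> ta (pl a ! b) \<in> X \<and> he (pl a ! b) \<notin> X"
    if "(a, b) \<in> I" for a b using that ij N F unfolding I_def by (auto simp: outs_def)
  ultimately obtain Y where Y: "st_cut Y" "mcut F Y + card ((\<lambda>(i, l). pl i ! l) ` I) \<le> k + card E"
    using lift_cut[of I N F X E] E_def Ine X(1) finE E1 Fm by blast
  have "(\<lambda>(i, l). pl i ! l) ` I = ({?e} \<inter> outs ?pi X) \<union> ({?e'} \<inter> outs ?pj X)" unfolding I_def by auto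
  moreover have "({?e} \<inter> outs ?pi X) \<inter> ({?e'} \<inter> outs ?pj X) = {}" using dj e by auto
  ultimately have "card ((\<lambda>(i, l). pl i ! l) ` I) = card ({?e} \<inter> outs ?pi X) + card ({?e'} \<inter> outs ?pj X)"
    by (simp add: card_Un_disjoint)
  then show ?thesis using Y main k2 by (intro exI[of _ Y]) linarith
qed

section \<open>Sparse blocks and optimality after two failures\<close>

definition block :: "nat \<Rightarrow> nat set \<Rightarrow> bool" where
  "block i N \<longleftrightarrow> set (pl i) \<subseteq> N \<and> N \<subseteq> {..<m} \<and> dual_preserver i N \<and>
     (\<forall>F. finite F \<longrightarrow> card F \<le> 2 \<longrightarrow>
        reach (rt (A - set (pl i))) (rh (A - set (pl i))) ({..<m} - F) {s} \<subseteq>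
        reach (rt (A - set (pl i))) (rh (A - set (pl i))) (N - F) {s})"

lemma block_mono: "block i N \<Longrightarrow> N \<subseteq> N' \<Longrightarrow> N' \<subseteq> {..<m} \<Longrightarrow> block i N'"
  unfolding block_def using dual_preserver_mono[of i N N']
  by (meson Diff_mono reach_mono subset_refl subset_trans)

lemma card_bounded_indegree:
  assumes "finite H" "\<And>y. y \<in> H \<Longrightarrow> f y < (q::nat)" "\<And>v. card {y \<in> H. f y = v} \<le> d"
  shows "card H \<le> d * q"
proof -
  have "H = (\<Union>v<q. {y \<in> H. f y = v})" using assms(2) by auto
  moreover have "card (\<Union>v<q. {y \<in> H. f y = v}) \<le> (\<Sum>v<q. card {y \<in> H. f y = v})" by (rule card_UN_le) simp
  ultimately have "card H \<le> (\<Sum>v<q. card {y \<in> H. f y = v})" by simp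
  also have "\<dots> \<le> (\<Sum>v<q. d)" by (intro sum_mono assms(3))
  finally show ?thesis by (simp add: mult.commute)
qed

text \<open>The 11 is 1 + 4 + 3 + 3: a simple path has fewer than \<open>n\<close> arcs, the
  two-fault preserver has in-degree 4, and the preservers for prefixes and suffixes have degree 3,
  the latter counted at the residual tails.\<close>

lemma block_exists:
  assumes "i < k"
  shows "\<exists>N. block i N \<and> card N \<le> 11 * n"
proof -
  let ?A0 = "A - set (pl i)"
  obtain H2 where H2: "H2 \<subseteq> {..<m}" "\<And>v. card {y \<in> H2. rh ?A0 y = v} \<le> 4"
    "\<And>F. finite F \<Longrightarrow> card F \<le> 2 \<Longrightarrow> reach (rt ?A0) (rh ?A0) ({..<m} - F) {s} \<subseteq> reach (rt ?A0) (rh ?A0) (H2 - F) {s}"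
    using two_fault_preserver[of "{..<m}" "rh ?A0" "rt ?A0" s] by auto
  have m1: "mono (Sf i)" unfolding mono_def Sf_def by fastforce
  have m2: "mono (Tr i)" unfolding mono_def Tr_def by fastforce
  obtain Hf where Hf: "Hf \<subseteq> {..<m}" "\<And>v. card {y \<in> Hf. rh A y = v} \<le> 3"
    "\<And>F c. finite F \<Longrightarrow> card F \<le> 1 \<Longrightarrow> reach (rt A) (rh A) ({..<m} - F) (Sf i c) \<subseteq> reach (rt A) (rh A) (Hf - F) (Sf i c)"
    using nested_preserver[OF _ m1, of "{..<m}" "rh A" "rt A"] by auto
  obtain Hr where Hr: "Hr \<subseteq> {..<m}" "\<And>v. card {y \<in> Hr. rt A y = v} \<le> 3"
    "\<And>F c. finite F \<Longrightarrow> card F \<le> 1 \<Longrightarrow> reach (rh A) (rt A) ({..<m} - F) (Tr i c) \<subseteq> reach (rh A) (rt A) (Hr - F) (Tr i c)"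
    using nested_preserver[OF _ m2, of "{..<m}" "rt A" "rh A"] by auto
  let ?N = "set (pl i) \<union> H2 \<union> Hf \<union> Hr"
  have "block i ?N"
    unfolding block_def dual_preserver_def
  proof (intro conjI allI impI)
    fix F :: "nat set" assume "finite F" "card F \<le> 2"
    then show "reach (rt ?A0) (rh ?A0) ({..<m} - F) {s} \<subseteq> reach (rt ?A0) (rh ?A0) (?N - F) {s}"
      by (rule subset_trans[OF H2(3) reach_mono]) auto
  next
    fix E :: "nat set" and c assume E: "finite E" "card E \<le> 1"
    show "reach (rt A) (rh A) ({..<m} - E) (Sf i c) \<subseteq> reach (rt A) (rh A) (?N - E) (Sf i c)"
      by (rule subset_trans[OF Hf(3)[OF E] reach_mono]) auto
    show "reach (rh A) (rt A) ({..<m} - E) (Tr i c) \<subseteq> reach (rh A) (rt A) (?N - E) (Tr i c)"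
      by (rule subset_trans[OF Hr(3)[OF E] reach_mono]) auto
  qed (use H2 Hf Hr pl_arcs[OF assms] in auto)
  moreover have "card ?N \<le> 11 * n"
  proof -
    have fin: "finite H2" "finite Hf" "finite Hr"
      using finite_subset[OF H2(1)] finite_subset[OF Hf(1)] finite_subset[OF Hr(1)] by simp_all
    have "card (set (pl i)) \<le> n" using pl_length[OF assms] card_length[of "pl i"] by linarith
    moreover have "card H2 \<le> 4 * n" by (rule card_bounded_indegree[OF fin(1) _ H2(2)]) (use H2(1) rh_less in auto)
    moreover have "card Hf \<le> 3 * n" by (rule card_bounded_indegree[OF fin(2) _ Hf(2)]) (use Hf(1) rh_less in auto)
    moreover have "card Hr \<le> 3 * n" by (rule card_bounded_indegree[OF fin(3) _ Hr(2)]) (use Hr(1) rt_less in auto)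
    moreover have "card ?N \<le> card (set (pl i)) + card H2 + card Hf + card Hr"
      by (meson add_le_mono card_Un_le le_refl order_trans)
    ultimately show ?thesis by linarith
  qed
  ultimately show ?thesis by blast
qed

text \<open>If as many augmentations succeed as paths were dropped, the old value is back and
  \<open>X0\<close> certifies it. Otherwise the last search left a closed cut. If one path was hit,
  reachability from \<open>s\<close> without that path is preserved under all failures; if two were
  hit, each contains exactly one failure.\<close>

theorem two_failures:
  fixes F :: "nat set"
  defines "I \<equiv> {i. i < k \<and> set (pl i) \<inter> F \<noteq> {}}"
  assumes F: "F \<subseteq> {..<m}" "card F \<le> 2" and "I \<noteq> {}"
    and N: "\<And>i. i \<in> I \<Longrightarrow> block i N"
    and B: "isflow B' (k - card I + r)" "sdiff (A - (\<Union>i\<in>I. set (pl i))) B' \<subseteq> N - F"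
    and X: "2 \<le> r \<or> (\<exists>X. st_cut X \<and> resout B' (N - F) X = {})"
  shows "max_cert F B'"
proof -
  let ?A0 = "A - (\<Union>i\<in>I. set (pl i))"
  have finF: "finite F" using F finite_subset by blast
  have finI: "finite I" "I \<subseteq> {..<k}" unfolding I_def by auto
  have A0F: "?A0 \<inter> F = {}" unfolding A_def I_def by auto
  then have BF: "B' \<inter> F = {}" using B(2) unfolding sdiff_def by auto
  have "\<forall>i. \<exists>y. i \<in> I \<longrightarrow> y \<in> set (pl i) \<inter> F" unfolding I_def by blast
  then obtain g where g: "\<And>i. i \<in> I \<Longrightarrow> g i \<in> set (pl i) \<inter> F" by metis
  have ginj: "inj_on g I"
  proof (rule inj_onI, rule ccontr)
    fix a b assume "a \<in> I" "b \<in> I" "g a = g b" "a \<noteq> b"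
    then show False using g[of a] g[of b] disjoint[of a b] unfolding I_def by auto
  qed
  have gF: "g ` I \<subseteq> F" using g by auto
  have "card I \<le> card F" using card_inj_on_le[OF ginj gF finF] .
  then have cI: "card I = 1 \<or> card I = 2" using F(2) \<open>I \<noteq> {}\<close> finI by (metis One_nat_def card_0_eq le_SucE le_trans le_zero_eq numeral_2_eq_2)
  have kI: "card I \<le> k" using card_mono[OF _ finI(2)] by simp
  have full: "max_cert F B'" if "card I \<le> r"
  proof -
    have "mcut F X0 \<le> k - card I + r" using mcut_antimono[of "{}" F X0] X0 that kI by simp
    then show ?thesis unfolding max_cert_def using BF B(1) X0(1) by blast
  qed
  show ?thesis
  proof (cases "card I \<le> r")
    case True then show ?thesis by (rule full)
  next
    case False
    then obtain X where X: "st_cut X" "resout B' (N - F) X = {}" using X cI by auto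
    from cI show ?thesis
    proof
      assume "card I = 1"
      then obtain i where i: "I = {i}" by (auto simp: card_1_singleton_iff)
      have r0: "r = 0" using False \<open>card I = 1\<close> by simp
      have ik: "i < k" using i unfolding I_def by auto
      let ?A = "A - set (pl i)"
      have fl: "isflow ?A (k - 1)"
        using isflow_diff[OF isflow_A simple_path_isflow[OF simple[OF ik]] pl_subset[OF ik]] ik by simp
      have blk: "block i N" using N i by simp
      have Nm: "N \<subseteq> {..<m}" using blk unfolding block_def by blast
      have "card (resout ?A (N - F) X) = 0"
        by (rule augmented_crossing[OF fl, of B' 0]) (use B i r0 Nm X in auto)
      then have cl: "resout ?A (N - F) X = {}" using Nm finite_subset[of N "{..<m}"] by (auto simp: resout_def)
      let ?Y = "reach (rt ?A) (rh ?A) ({..<m} - F) {s}"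
      have "?Y \<subseteq> reach (rt ?A) (rh ?A) (N - F) {s}" using blk finF F(2) unfolding block_def by blast
      also have "\<dots> \<subseteq> X" using X(1) cl by (intro reach_least) (auto simp: st_cut_def resout_def)
      finally have "?Y \<subseteq> X" .
      then have Y: "st_cut ?Y" using X(1) s_less by (intro st_cut_reach) (auto simp: st_cut_def)
      have "mcut F ?Y = k - 1"
        using mcut_eq_resout[OF fl Y] A0F i reach_closed[of ?A "{..<m} - F" "{s}"] by auto
      then show ?thesis unfolding max_cert_def using BF B(1) Y r0 \<open>card I = 1\<close>
        by (intro conjI exI[of _ "k - 1"] exI[of _ ?Y]) auto
    next
      assume c2: "card I = 2"
      then obtain i j where ij: "I = {i, j}" "i \<noteq> j" by (auto simp: card_2_iff)
      have ijk: "i < k" "j < k" using ij unfolding I_def by auto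
      have blk: "block i N" "block j N" using N ij by auto
      have "g i \<noteq> g j" using ginj ij unfolding inj_on_def by auto
      then have "card {g i, g j} = 2" by simp
      moreover have "{g i, g j} \<subseteq> F" using gF ij by auto
      ultimately have Fg: "F = {g i, g j}" using card_seteq[OF finF, of "{g i, g j}"] F(2) by simp
      obtain l where l: "l < length (pl i)" "pl i ! l = g i" using g[of i] ij by (auto simp: in_set_conv_nth)
      obtain l' where l': "l' < length (pl j)" "pl j ! l' = g j" using g[of j] ij by (auto simp: in_set_conv_nth)
      have "A - set (pl i) - set (pl j) = ?A0" using ij by auto
      then have "\<exists>Y. st_cut Y \<and> mcut F Y \<le> k - 2 + r"
        using dual_failure[OF ijk ij(2) l(1) l'(1), of F N B' r X] blk Fg l l' B False c2 X
        unfolding block_def by simp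
      then show ?thesis unfolding max_cert_def using BF B(1) c2 by metis
    qed
  qed
qed

end

section \<open>Static dictionaries\<close>

text \<open>Two-level perfect hashing with the functions \<open>x \<mapsto> (a * x mod (T * R)) div T\<close>. For \<open>x \<noteq> y\<close>
  a collision forces \<open>a * (y - x)\<close> to be within \<open>T\<close> of a multiple of \<open>T * R\<close>, so only about \<open>T\<close> of the \<open>T * R\<close> multipliers
  collide, and no primality assumption is needed.\<close>

definition hash :: "nat \<Rightarrow> nat \<Rightarrow> nat \<Rightarrow> nat \<Rightarrow> nat" where
  "hash T R a x = (a * x mod (T * R)) div T"

lemma hash_less: "0 < T \<Longrightarrow> 0 < R \<Longrightarrow> hash T R a x < R"
  unfolding hash_def by (rule less_mult_imp_div_less) (simp add: mult.commute)

text \<open>The products lie in a window of width \<open>2 * T\<close>, and consecutive multipliers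
  move the product by \<open>d\<close>.\<close>

lemma card_near_multiples:
  fixes d T :: nat and c :: int
  assumes "0 < d" "finite S" "\<And>a. a \<in> S \<Longrightarrow> \<bar>int a * int d - c\<bar> < int T"
  shows "card S \<le> 2 * T div d + 1"
proof (cases "S = {}")
  case False
  let ?q = "Min S"
  have q: "?q \<in> S" using assms(2) False by simp
  have "S \<subseteq> {?q..?q + 2 * T div d}"
  proof
    fix a assume a: "a \<in> S"
    have le: "?q \<le> a" using a assms(2) by simp
    have "int a * int d - int ?q * int d < 2 * int T" using assms(3)[OF a] assms(3)[OF q] by linarith
    then have "int ((a - ?q) * d) < int (2 * T)" using le by (simp add: of_nat_diff left_diff_distrib)
    then have "(a - ?q) * d \<le> 2 * T" by linarith
    then have "a - ?q \<le> 2 * T div d" using assms(1) by (simp add: less_eq_div_iff_mult_less_eq)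
    then show "a \<in> {?q..?q + 2 * T div d}" using le by auto
  qed
  then have "card S \<le> card {?q..?q + 2 * T div d}" by (intro card_mono) auto
  then show ?thesis by simp
qed simp

lemma same_quotient:
  fixes u v T :: nat
  assumes "u div T = v div T" "0 < T"
  shows "\<bar>int v - int u\<bar> < int T"
proof -
  obtain q where q: "q = u div T" "q = v div T" using assms(1) by simp
  have "u = T * q + u mod T" unfolding q(1) by simp
  moreover have "v = T * q + v mod T" unfolding q(2) by simp
  moreover have "u mod T < T" "v mod T < T" using assms(2) by simp_all
  ultimately show ?thesis by (smt (verit) of_nat_add of_nat_less_iff of_nat_0_le_iff)
qed

lemma hash_collisions_less:
  assumes "x < y" "y < T" "0 < R"
  shows "card {a. a < T * R \<and> hash T R a x = hash T R a y} \<le> 6 * T"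
proof -
  let ?M = "T * R" and ?d = "y - x"
  let ?S = "\<lambda>j. {a. a < ?M \<and> \<bar>int a * int ?d - int j * int ?M\<bar> < int T}"
  have T: "0 < T" "0 < ?d" using assms by auto
  have "{a. a < ?M \<and> hash T R a x = hash T R a y} \<subseteq> (\<Union>j\<le>?d. ?S j)"
  proof
    fix a assume "a \<in> {a. a < ?M \<and> hash T R a x = hash T R a y}"
    then have a: "a < ?M" "hash T R a x = hash T R a y" by auto
    let ?u = "a * x mod ?M" and ?v = "a * y mod ?M"
    \<comment> \<open>The number of periods between the two products. Their distance is
      \<open>a\<close> times \<open>y - x\<close> and \<open>a\<close> is below the period, so
      \<open>j\<close> is at most \<open>y - x\<close>.\<close>
    define j where "j = a * y div ?M - a * x div ?M"
    have le: "a * x div ?M \<le> a * y div ?M" using assms(1) by (intro div_le_mono) simp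
    have "?u div T = ?v div T" using a(2) unfolding hash_def .
    then have uv: "\<bar>int ?v - int ?u\<bar> < int T" using T by (intro same_quotient)
    have "int (a * y) = int (a * y div ?M) * int ?M + int ?v" "int (a * x) = int (a * x div ?M) * int ?M + int ?u"
      by (metis div_mult_mod_eq of_nat_add of_nat_mult)+
    then have "int (a * y) - int (a * x) = int j * int ?M + (int ?v - int ?u)"
      unfolding j_def using le by (simp add: of_nat_diff algebra_simps)
    moreover have "int (a * y) - int (a * x) = int a * int ?d" using assms(1) by (simp add: of_nat_diff algebra_simps)
    ultimately have "\<bar>int a * int ?d - int j * int ?M\<bar> < int T" using uv by simp
    moreover have "j \<le> ?d"
    proof -
      have "a * y = a * x + a * ?d" using assms(1) by (simp add: algebra_simps diff_mult_distrib2)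
      also have "\<dots> \<le> a * x + ?d * ?M" using a(1) by (simp add: mult.commute mult_le_mono1)
      finally have "a * y div ?M \<le> (a * x + ?d * ?M) div ?M" by (rule div_le_mono)
      also have "\<dots> = ?d + a * x div ?M" using T assms(3) by (intro div_mult_self1) simp
      finally show ?thesis unfolding j_def by simp
    qed
    ultimately show "a \<in> (\<Union>j\<le>?d. ?S j)" using a(1) by blast
  qed
  then have "card {a. a < ?M \<and> hash T R a x = hash T R a y} \<le> card (\<Union>j\<le>?d. ?S j)" by (intro card_mono) auto
  also have "\<dots> \<le> (\<Sum>j\<le>?d. card (?S j))" by (rule card_UN_le) simp
  also have "\<dots> \<le> (\<Sum>j\<le>?d. 2 * T div ?d + 1)"
  proof (rule sum_mono)
    fix j
    show "card (?S j) \<le> 2 * T div ?d + 1" by (rule card_near_multiples[OF T(2), of _ "int j * int ?M"]) auto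
  qed
  also have "\<dots> = (?d + 1) * (2 * T div ?d + 1)" by simp
  \<comment> \<open>Three parts of at most \<open>2 * T\<close> each: the first by division, the
    second trivially, and the last because \<open>y < T\<close>.\<close>
  also have "\<dots> = ?d * (2 * T div ?d) + 2 * T div ?d + ?d + 1" by (simp add: algebra_simps)
  also have "\<dots> \<le> 6 * T"
  proof -
    have "?d * (2 * T div ?d) \<le> 2 * T" by simp
    moreover have "2 * T div ?d \<le> 2 * T" by simp
    moreover have "?d + 1 \<le> 2 * T" using assms by linarith
    ultimately show ?thesis by linarith
  qed
  finally show ?thesis .
qed

lemma hash_collisions:
  assumes "x \<noteq> y" "x < T" "y < T" "0 < R"
  shows "card {a. a < T * R \<and> hash T R a x = hash T R a y} \<le> 6 * T"
proof (cases "x < y")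
  case True then show ?thesis using hash_collisions_less assms by blast
next
  case False
  then have "y < x" using assms by simp
  moreover have "{a. a < T * R \<and> hash T R a x = hash T R a y} = {a. a < T * R \<and> hash T R a y = hash T R a x}" by auto
  ultimately show ?thesis using hash_collisions_less[of y x T R] assms by simp
qed

text \<open>Averaging: each of at most \<open>card S * card S\<close> pairs collides for at most
  \<open>6 * T\<close> of the \<open>T * R\<close> multipliers, so some multiplier does not exceed
  the average.\<close>

lemma good_multiplier:
  assumes "finite S" "S \<subseteq> {..<T}" "0 < R" "0 < T"
  shows "\<exists>a<T * R. card {(x, y). x \<in> S \<and> y \<in> S \<and> x \<noteq> y \<and> hash T R a x = hash T R a y} * R \<le> 6 * (card S * card S)"
proof (rule ccontr)
  let ?P = "{(x, y). x \<in> S \<and> y \<in> S \<and> x \<noteq> y}" and ?M = "T * R"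
  let ?C = "\<lambda>a. {p \<in> ?P. hash T R a (fst p) = hash T R a (snd p)}"
  have C: "{(x, y). x \<in> S \<and> y \<in> S \<and> x \<noteq> y \<and> hash T R a x = hash T R a y} = ?C a" for a by auto
  have finP: "finite ?P" by (rule finite_subset[of _ "S \<times> S"]) (use assms(1) in auto)
  have Pc: "card ?P \<le> card S * card S"
    using card_mono[of "S \<times> S" ?P] assms(1) by (auto simp: card_cartesian_product)
  assume neg: "\<not> ?thesis"
  have "6 * (card S * card S) + 1 \<le> card (?C a) * R" if "a < ?M" for a using neg that C[of a] by force
  then have "(\<Sum>a<?M. 6 * (card S * card S) + 1) \<le> (\<Sum>a<?M. card (?C a) * R)" by (intro sum_mono) auto
  then have 1: "?M * (6 * (card S * card S) + 1) \<le> (\<Sum>a<?M. card (?C a)) * R" by (simp only: sum_distrib_right sum_constant card_lessThan of_nat_id)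
  have "(\<Sum>a<?M. card (?C a)) = (\<Sum>p\<in>?P. card {a \<in> {..<?M}. hash T R a (fst p) = hash T R a (snd p)})"
    by (rule sum_multicount_gen) (use finP in auto)
  also have "\<dots> \<le> (\<Sum>p\<in>?P. 6 * T)"
  proof (rule sum_mono)
    fix p assume "p \<in> ?P"
    then have "fst p \<noteq> snd p" "fst p < T" "snd p < T" using assms(2) by auto
    then show "card {a \<in> {..<?M}. hash T R a (fst p) = hash T R a (snd p)} \<le> 6 * T"
      using hash_collisions[of "fst p" "snd p" T R] assms(3) by simp
  qed
  also have "\<dots> = card ?P * (6 * T)" by simp
  finally have "(\<Sum>a<?M. card (?C a)) * R \<le> card ?P * (6 * T) * R" by (rule mult_le_mono1)
  with 1 have "?M * (6 * (card S * card S) + 1) \<le> card ?P * (6 * T) * R" by (rule order_trans)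
  also have "\<dots> \<le> card S * card S * (6 * T) * R" using Pc by (intro mult_le_mono) auto
  also have "\<dots> = ?M * (6 * (card S * card S))" by (simp add: algebra_simps)
  finally show False using assms by simp
qed

text \<open>The scheme of Fredman, Komlos and Szemeredi. With \<open>k\<close> buckets at most
  \<open>6 * k\<close> pairs collide, so the squared bucket sizes sum to at most
  \<open>7 * k\<close>. An inner table with six times the squared bucket size plus one cells has a
  multiplier with fewer than one collision. Placed one after the other, the tables take at most 6 *
  7 * k + k = 43 * k cells.\<close>

theorem perfect_hashing:
  assumes S: "finite S" "S \<subseteq> {..<T}" "S \<noteq> {}"
  defines "k \<equiv> card S"
  obtains a1 :: nat and a2 R2 off :: "nat \<Rightarrow> nat" where
    "a1 < T * k"
    "\<And>b. 0 < R2 b" "\<And>b. R2 b \<le> 6 * (k * k) + 1" "\<And>b. a2 b < T * R2 b"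
    "\<And>b. b < k \<Longrightarrow> off b + R2 b \<le> 43 * k"
    "inj_on (\<lambda>x. off (hash T k a1 x) + hash T (R2 (hash T k a1 x)) (a2 (hash T k a1 x)) x) S"
proof -
  have k: "0 < k" unfolding k_def using S by (simp add: card_gt_0_iff)
  have T: "0 < T" using S by auto
  obtain a1 where a1: "a1 < T * k" and
    c1: "card {(x, y). x \<in> S \<and> y \<in> S \<and> x \<noteq> y \<and> hash T k a1 x = hash T k a1 y} * k \<le> 6 * (k * k)"
    using good_multiplier[OF S(1,2) k T] unfolding k_def by blast
  let ?h = "hash T k a1"
  define B where "B b = {x \<in> S. ?h x = b}" for b
  define R2 where "R2 b = 6 * (card (B b) * card (B b)) + 1" for b
  have finB: "finite (B b)" "B b \<subseteq> {..<T}" "B b \<subseteq> S" for b using S unfolding B_def by auto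
  have cB: "card (B b) \<le> k" for b unfolding k_def by (intro card_mono S finB)
  have "\<exists>a<T * R2 b. inj_on (hash T (R2 b) a) (B b)" for b
  proof -
    obtain a where a: "a < T * R2 b" and
      c: "card {(x, y). x \<in> B b \<and> y \<in> B b \<and> x \<noteq> y \<and> hash T (R2 b) a x = hash T (R2 b) a y} * R2 b \<le> 6 * (card (B b) * card (B b))" (is "card ?C * _ \<le> _")
      using good_multiplier[OF finB(1,2), of "R2 b"] T unfolding R2_def by auto
    have "card ?C = 0"
    proof (rule ccontr)
      assume "card ?C \<noteq> 0"
      then have "1 * R2 b \<le> card ?C * R2 b" by (intro mult_le_mono1) simp
      then have "R2 b \<le> 6 * (card (B b) * card (B b))" using c by linarith
      then show False unfolding R2_def by simp
    qed
    moreover have "finite ?C" by (rule finite_subset[of _ "B b \<times> B b"]) (use finB in auto)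
    ultimately have "?C = {}" by simp
    then show ?thesis using a unfolding inj_on_def by blast
  qed
  then obtain a2 where a2: "\<And>b. a2 b < T * R2 b" "\<And>b. inj_on (hash T (R2 b) (a2 b)) (B b)" by metis
  define off where "off b = (\<Sum>b'<b. R2 b')" for b
  have sum: "(\<Sum>b<k. card (B b) * card (B b)) \<le> 7 * k"
  proof -
    let ?E = "{(x, y). x \<in> S \<and> y \<in> S \<and> ?h x = ?h y}" and ?C = "{(x, y). x \<in> S \<and> y \<in> S \<and> x \<noteq> y \<and> ?h x = ?h y}"
    have finE: "finite ?E" by (rule finite_subset[of _ "S \<times> S"]) (use S(1) in auto)
    have finC: "finite ?C" by (rule finite_subset[OF _ finE]) auto
    have "(\<Sum>b<k. card (B b) * card (B b)) = (\<Sum>b<k. card (B b \<times> B b))" by (simp only: card_cartesian_product)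
    also have "\<dots> = card (\<Union>b<k. B b \<times> B b)"
      by (rule card_UN_disjoint[symmetric]) (use finB in \<open>auto simp: B_def\<close>)
    also have "\<dots> \<le> card ?E" by (intro card_mono finE) (auto simp: B_def)
    also have "\<dots> \<le> card ((\<lambda>x. (x, x)) ` S \<union> ?C)" by (intro card_mono) (use finC S in auto)
    also have "\<dots> \<le> card ((\<lambda>x. (x, x)) ` S) + card ?C" by (rule card_Un_le)
    also have "card ((\<lambda>x. (x, x)) ` S) \<le> k" unfolding k_def by (rule card_image_le[OF S(1)])
    also have "card ?C \<le> 6 * k" using c1 k by (simp add: mult.assoc[symmetric])
    finally show ?thesis by simp
  qed
  have offk: "off k \<le> 43 * k"
  proof -
    have "off k = 6 * (\<Sum>b<k. card (B b) * card (B b)) + k"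
      unfolding off_def R2_def by (simp only: sum.distrib sum_distrib_left sum_constant card_lessThan mult_1_right of_nat_id)
    then show ?thesis using sum by simp
  qed
  have off_mono: "off b + R2 b \<le> off b'" if "b < b'" for b b'
  proof -
    have "off b + R2 b = off (Suc b)" unfolding off_def by simp
    also have "\<dots> \<le> off b'" unfolding off_def using that by (intro sum_mono2) auto
    finally show ?thesis .
  qed
  have R2pos: "0 < R2 b" for b unfolding R2_def by simp
  show thesis
  proof (rule that[of a1 R2 a2 off])
    show "R2 b \<le> 6 * (k * k) + 1" for b unfolding R2_def using cB[of b] by (simp add: mult_le_mono)
    show "off b + R2 b \<le> 43 * k" if "b < k" for b using off_mono[OF that] offk by simp
    show "inj_on (\<lambda>x. off (?h x) + hash T (R2 (?h x)) (a2 (?h x)) x) S"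
    proof (rule inj_onI)
      fix x y assume xy: "x \<in> S" "y \<in> S" and eq: "off (?h x) + hash T (R2 (?h x)) (a2 (?h x)) x = off (?h y) + hash T (R2 (?h y)) (a2 (?h y)) y"
      have l: "hash T (R2 b) (a2 b) z < R2 b" for b z by (rule hash_less[OF T R2pos])
      have "?h x = ?h y"
      proof (cases "?h x" "?h y" rule: linorder_cases)
        case less
        then show ?thesis using off_mono[OF less] eq l[of "?h x" x] by linarith
      next
        case greater
        then show ?thesis using off_mono[OF greater] eq l[of "?h y" y] by linarith
      qed
      then have "x \<in> B (?h x)" "y \<in> B (?h x)" "hash T (R2 (?h x)) (a2 (?h x)) x = hash T (R2 (?h x)) (a2 (?h x)) y"
        using eq xy unfolding B_def by auto
      then show "x = y" using inj_onD[OF a2(2)] by blast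
    qed
  qed (use a1 a2 R2pos in auto)
qed

section \<open>Rerouting a single failure along forests\<close>

definition parents :: "(nat \<Rightarrow> bool) \<Rightarrow> (nat \<Rightarrow> nat) \<Rightarrow> (nat \<times> nat) set" where
  "parents nr par = {(p, par p) | p. nr p}"

lemma parents_single_valued: "single_valued (parents nr par)"
  unfolding parents_def single_valued_def by auto

lemma parents_trancl_depth:
  assumes "\<And>p. nr p \<Longrightarrow> d (par p) < (d p :: nat)" "(p, q) \<in> (parents nr par)\<^sup>+"
  shows "d q < d p"
  using assms(2) by (induction rule: trancl_induct) (use assms(1) in \<open>auto simp: parents_def intro: less_trans\<close>)

text \<open>Preorder numbers, where \<open>pre\<close> to \<open>post\<close> is the interval of a
  subtree and \<open>nr\<close> marks non-roots. A deepest vertex \<open>y\<close> is a leaf and is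
  removed first. If it is a root, it receives the last number; otherwise it is inserted directly
  behind its parent, and all later numbers move up.\<close>

lemma forest_numbering:
  assumes "finite W" "\<And>p. nr p \<Longrightarrow> d (par p) < (d p :: nat)" "\<And>p. p \<in> W \<Longrightarrow> nr p \<Longrightarrow> par p \<in> W"
  shows "\<exists>pre post. inj_on pre W \<and> (\<forall>p\<in>W. 1 \<le> pre p \<and> pre p \<le> card W \<and> post p \<le> card W) \<and>
    (\<forall>q\<in>W. \<forall>p\<in>W. (p, q) \<in> (parents nr par)\<^sup>* \<longleftrightarrow> pre q \<le> pre p \<and> pre p \<le> (post q :: nat))"
  using assms(1,3)
proof (induction "card W" arbitrary: W)
  case 0
  then show ?case by simp
next
  case (Suc k)
  let ?E = "parents nr par"
  have "W \<noteq> {}" using Suc by auto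
  then obtain y where y: "y \<in> W" "\<And>z. z \<in> W \<Longrightarrow> d z \<le> d y"
    using Suc.prems(1) by (metis (mono_tags, lifting) Max_ge Max_in finite_imageI image_iff image_is_empty)
  let ?V = "W - {y}"
  have ny: "par z \<noteq> y" if "z \<in> W" "nr z" for z using assms(2)[OF that(2)] y(2)[OF that(1)] by auto
  have V: "finite ?V" "card ?V = k" "\<And>p. p \<in> ?V \<Longrightarrow> nr p \<Longrightarrow> par p \<in> ?V" using Suc y(1) ny by auto
  obtain pre post where IH: "inj_on pre ?V" "\<And>p. p \<in> ?V \<Longrightarrow> 1 \<le> pre p \<and> pre p \<le> k \<and> post p \<le> k"
    "\<And>q p. q \<in> ?V \<Longrightarrow> p \<in> ?V \<Longrightarrow> (p, q) \<in> ?E\<^sup>* \<longleftrightarrow> pre q \<le> pre p \<and> pre p \<le> post q"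
    using Suc.hyps(1)[OF _ V(1,3)] V(2) by metis
  have stay: "q \<in> ?V" if "(p, q) \<in> ?E\<^sup>*" "p \<in> ?V" for p q
    using that by (induction rule: rtrancl_induct) (use V(3) in \<open>auto simp: parents_def\<close>)
  have k: "card W = Suc k" using Suc.hyps by simp
  show ?case
  proof (cases "nr y")
    case False
    define pre' where "pre' = pre(y := Suc k)"
    define post' where "post' = post(y := Suc k)"
    have yq: "(y, q) \<in> ?E\<^sup>* \<longleftrightarrow> q = y" for q
      using False by (auto simp: parents_def elim: converse_rtranclE)
    have "inj_on pre' W"
    proof (rule inj_onI)
      fix a b assume "a \<in> W" "b \<in> W" "pre' a = pre' b"
      then show "a = b" using inj_onD[OF IH(1), of a b] IH(2)[of a] IH(2)[of b] unfolding pre'_def by (auto split: if_splits)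
    qed
    moreover have "(p, q) \<in> ?E\<^sup>* \<longleftrightarrow> pre' q \<le> pre' p \<and> pre' p \<le> post' q" if qp: "q \<in> W" "p \<in> W" for p q
    proof -
      consider "p \<in> ?V" "q \<in> ?V" | "p = y" "q = y" | "p = y" "q \<in> ?V" | "p \<in> ?V" "q = y" using qp by blast
      then show ?thesis
      proof cases
        case 1 then show ?thesis using IH(3)[of q p] unfolding pre'_def post'_def by auto
      next
        case 2 then show ?thesis by (simp add: pre'_def post'_def)
      next
        case 3 then show ?thesis using IH(2)[OF 3(2)] yq[of q] unfolding pre'_def post'_def by auto
      next
        case 4 then show ?thesis using stay[of p q] IH(2)[of p] unfolding pre'_def post'_def by auto
      qed
    qed
    ultimately show ?thesis using IH(2) unfolding k
      by (intro exI[of _ pre'] exI[of _ post']) (auto simp: pre'_def post'_def le_SucI)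
  next
    case True
    let ?x = "par y"
    have x: "?x \<in> ?V" using Suc.prems(2)[OF y(1) True] ny[OF y(1) True] by auto
    define pre' where "pre' = (\<lambda>z. if z = y then pre ?x + 1 else if pre z > pre ?x then pre z + 1 else pre z)"
    \<comment> \<open>An interval that ends at or behind the parent either contains the parent and
      grows, or lies behind it and shifts.\<close>
    define post' where "post' = (\<lambda>z. if z = y then pre ?x + 1 else if post z \<ge> pre ?x then post z + 1 else post z)"
    have yq: "(y, q) \<in> ?E\<^sup>* \<longleftrightarrow> q = y \<or> (?x, q) \<in> ?E\<^sup>*" for q
    proof
      assume "(y, q) \<in> ?E\<^sup>*" then show "q = y \<or> (?x, q) \<in> ?E\<^sup>*" by (auto simp: parents_def elim: converse_rtranclE)
    next
      have "(y, ?x) \<in> ?E" using True by (auto simp: parents_def)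
      then show "q = y \<or> (?x, q) \<in> ?E\<^sup>* \<Longrightarrow> (y, q) \<in> ?E\<^sup>*" by (auto intro: converse_rtrancl_into_rtrancl)
    qed
    have "inj_on pre' W"
    proof (rule inj_onI)
      fix a b assume "a \<in> W" "b \<in> W" "pre' a = pre' b"
      then show "a = b" using inj_onD[OF IH(1), of a b] unfolding pre'_def by (auto split: if_splits)
    qed
    moreover have "(p, q) \<in> ?E\<^sup>* \<longleftrightarrow> pre' q \<le> pre' p \<and> pre' p \<le> post' q" if qp: "q \<in> W" "p \<in> W" for p q
    proof -
      consider "p \<in> ?V" "q \<in> ?V" | "p = y" "q = y" | "p = y" "q \<in> ?V" | "p \<in> ?V" "q = y" using qp by blast
      then show ?thesis
      proof cases
        case 1 then show ?thesis using IH(3)[of q p] unfolding pre'_def post'_def by auto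
      next
        case 2 then show ?thesis by (simp add: pre'_def post'_def)
      next
        case 3 then show ?thesis using IH(3)[OF 3(2) x] yq[of q] unfolding pre'_def post'_def by auto
      next
        case 4 then show ?thesis using stay[of p q] unfolding pre'_def post'_def by auto
      qed
    qed
    moreover have "1 \<le> pre' p \<and> pre' p \<le> card W \<and> post' p \<le> card W" if "p \<in> W" for p
      using IH(2)[of p] IH(2)[OF x] that unfolding k pre'_def post'_def by auto
    ultimately show ?thesis by blast
  qed
qed

lemma forest_path:
  assumes pin: "\<And>p. nr p \<Longrightarrow> src (pin p) = p" and d: "\<And>p. nr p \<Longrightarrow> d (dst (pin p)) < (d p :: nat)"
    and uz: "(u, z) \<in> (parents nr (\<lambda>p. dst (pin p)))\<^sup>*" (is "_ \<in> ?E\<^sup>*")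
  shows "\<exists>ys. walk src dst u ys z \<and> distinct ys \<and> set ys = {pin p | p. (u, p) \<in> ?E\<^sup>* \<and> (p, z) \<in> ?E\<^sup>+}"
  using uz
proof (induction rule: converse_rtrancl_induct)
  case base
  have "\<not> ((z, p) \<in> ?E\<^sup>* \<and> (p, z) \<in> ?E\<^sup>+)" for p
    using parents_trancl_depth[of nr d "\<lambda>p. dst (pin p)" z z] d by (auto dest: rtrancl_trancl_trancl)
  then show ?case by (intro exI[of _ "[]"]) auto
next
  case (step u u')
  obtain ys where ys: "walk src dst u' ys z" "distinct ys" "set ys = {pin p | p. (u', p) \<in> ?E\<^sup>* \<and> (p, z) \<in> ?E\<^sup>+}"
    using step.IH by blast
  have u: "nr u" "u' = dst (pin u)" using step.hyps(1) by (auto simp: parents_def)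
  have uz: "(u, z) \<in> ?E\<^sup>+" using step.hyps by auto
  have up: "(u, p) \<in> ?E\<^sup>* \<longleftrightarrow> p = u \<or> (u', p) \<in> ?E\<^sup>*" for p
  proof
    assume "(u, p) \<in> ?E\<^sup>*"
    then show "p = u \<or> (u', p) \<in> ?E\<^sup>*" using u by (auto simp: parents_def elim: converse_rtranclE)
  qed (use step.hyps(1) in \<open>auto intro: converse_rtrancl_into_rtrancl\<close>)
  have "pin u \<notin> set ys"
  proof
    assume "pin u \<in> set ys"
    then obtain p where p: "pin u = pin p" "(u', p) \<in> ?E\<^sup>*" "(p, z) \<in> ?E\<^sup>+" using ys(3) by auto
    have "nr p" using p(3) by (auto simp: parents_def elim: converse_tranclE)
    then have "p = u" using pin u(1) p(1) by metis
    then have "(u, u) \<in> ?E\<^sup>+" using p(2) step.hyps(1) by auto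
    then show False using parents_trancl_depth[of nr d "\<lambda>p. dst (pin p)" u u] d by auto
  qed
  then have "distinct (pin u # ys)" using ys(2) by simp
  moreover have "walk src dst u (pin u # ys) z" using ys(1) u pin by simp
  moreover have "set (pin u # ys) = {pin p | p. (u, p) \<in> ?E\<^sup>* \<and> (p, z) \<in> ?E\<^sup>+}"
    using ys(3) up uz by auto
  ultimately show ?case by blast
qed

section \<open>Forests inside strongly connected components\<close>

definition scc_root :: "('a \<Rightarrow> nat) \<Rightarrow> ('a \<Rightarrow> nat) \<Rightarrow> 'a set \<Rightarrow> nat \<Rightarrow> nat" where
  "scc_root src dst B p = (LEAST r. r \<in> reach src dst B {p} \<and> p \<in> reach src dst B {r})"

lemma reach_refl: "p \<in> reach src dst B {p}"
  using reach_superset by fast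

lemma reach_trans: "q \<in> reach src dst B {p} \<Longrightarrow> r \<in> reach src dst B {q} \<Longrightarrow> r \<in> reach src dst B {p}"
  unfolding reach_def by simp (metis Un_least set_append walk_append)

lemma reach_converseI:
  assumes "p \<in> reach src dst B {q}"
  shows "q \<in> reach dst src B {p}"
proof -
  obtain ys where "walk src dst q ys p" "set ys \<subseteq> B" using assms unfolding reach_def by auto
  then have "walk dst src p (rev ys) q" "set (rev ys) \<subseteq> B" by (auto simp: walk_rev)
  then show ?thesis unfolding reach_def by blast
qed

lemma reach_converse: "q \<in> reach dst src B {p} \<longleftrightarrow> p \<in> reach src dst B {q}"
  using reach_converseI[of p src dst B q] reach_converseI[of q dst src B p] by blast

text \<open>Mutual reachability does not change when all arcs are reversed, so in-forest and
  out-forest have the same roots. This guarantees that the two tree paths of a detour meet.\<close>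

lemma scc_root_converse: "scc_root dst src B = scc_root src dst B"
  unfolding scc_root_def by (auto simp: reach_converse[of _ dst src] conj_commute)

lemma scc_root: "scc_root src dst B p \<in> reach src dst B {p} \<and> p \<in> reach src dst B {scc_root src dst B p}"
  unfolding scc_root_def by (rule LeastI[of _ p]) (simp add: reach_refl)

lemma scc_root_eq:
  assumes "q \<in> reach src dst B {p}" "p \<in> reach src dst B {q}"
  shows "scc_root src dst B p = scc_root src dst B q"
proof -
  have "(r \<in> reach src dst B {p} \<and> p \<in> reach src dst B {r}) = (r \<in> reach src dst B {q} \<and> q \<in> reach src dst B {r})" for r
    using assms reach_trans by metis
  then show ?thesis unfolding scc_root_def by simp
qed

text \<open>The first arc of a shortest walk to the root stays in the component and lowers the
  distance \<open>d\<close>. Exchanging \<open>src\<close> and \<open>dst\<close> gives the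
  out-forest.\<close>

lemma scc_forest:
  fixes src dst :: "'a \<Rightarrow> nat" and B :: "'a set"
  defines "rho \<equiv> scc_root src dst B"
  shows "\<exists>pin (d :: nat \<Rightarrow> nat). \<forall>p. rho p \<noteq> p \<longrightarrow>
    pin p \<in> B \<and> src (pin p) = p \<and> rho (dst (pin p)) = rho p \<and> d (dst (pin p)) < d p"
proof -
  let ?W = "\<lambda>p l. \<exists>ys. walk src dst p ys (rho p) \<and> set ys \<subseteq> B \<and> length ys = l"
  define d where "d p = (LEAST l. ?W p l)" for p
  have ex: "\<exists>l. ?W p l" for p using scc_root[of src dst B p] unfolding rho_def reach_def by auto
  have dW: "?W p (d p)" for p unfolding d_def using LeastI_ex[OF ex] .
  have "\<exists>y. y \<in> B \<and> src y = p \<and> rho (dst y) = rho p \<and> d (dst y) < d p" if p: "rho p \<noteq> p" for p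
  proof -
    obtain ys where ys: "walk src dst p ys (rho p)" "set ys \<subseteq> B" "length ys = d p" using dW by blast
    then obtain y zs where yz: "ys = y # zs" using p by (cases ys) auto
    have y: "y \<in> B" "src y = p" "walk src dst (dst y) zs (rho p)" "set zs \<subseteq> B" using ys yz by auto
    have "dst y \<in> reach src dst B {p}" using reach_step[of src y dst B "{p}"] y reach_refl[of p src dst B] by simp
    moreover have "rho p \<in> reach src dst B {dst y}" using y unfolding reach_def by auto
    then have "p \<in> reach src dst B {dst y}" using scc_root[of src dst B p] reach_trans unfolding rho_def by metis
    ultimately have eq: "rho (dst y) = rho p" unfolding rho_def using scc_root_eq by metis
    then have "?W (dst y) (length zs)" using y by auto
    then have "d (dst y) \<le> length zs" unfolding d_def by (rule Least_le)
    then show ?thesis using y eq ys(3) yz by auto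
  qed
  then have "\<forall>p. \<exists>y. rho p \<noteq> p \<longrightarrow> y \<in> B \<and> src y = p \<and> rho (dst y) = rho p \<and> d (dst y) < d p" by blast
  from choice[OF this] show ?thesis by blast
qed

lemma forest_to_root:
  assumes "\<And>p. rho p \<noteq> p \<Longrightarrow> rho (par p) = rho p \<and> d (par p) < (d p :: nat)"
  shows "(p, rho p) \<in> (parents (\<lambda>p. rho p \<noteq> p) par)\<^sup>*"
proof (induction "d p" arbitrary: p rule: less_induct)
  case less
  show ?case
  proof (cases "rho p = p")
    case False
    then have "(par p, rho p) \<in> (parents (\<lambda>p. rho p \<noteq> p) par)\<^sup>*" using less[of "par p"] assms[OF False] by simp
    moreover have "(p, par p) \<in> parents (\<lambda>p. rho p \<noteq> p) par" using False by (auto simp: parents_def)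
    ultimately show ?thesis by (rule converse_rtrancl_into_rtrancl[rotated])
  qed simp
qed

text \<open>The ancestors of \<open>u\<close> form a chain, so among them preorder numbers alone
  decide which of \<open>p\<close> and \<open>z\<close> is the lower one.\<close>

lemma forest_interval:
  assumes num: "inj_on pre W" "\<forall>q\<in>W. \<forall>p\<in>W. (p, q) \<in> E\<^sup>* \<longleftrightarrow> pre q \<le> pre p \<and> pre p \<le> (post q :: nat)"
    and sv: "single_valued E" and W: "u \<in> W" "p \<in> W" "z \<in> W" and uz: "(u, z) \<in> E\<^sup>*"
    and acyc: "\<And>q. (q, q) \<notin> E\<^sup>+"
  shows "(u, p) \<in> E\<^sup>* \<and> (p, z) \<in> E\<^sup>+ \<longleftrightarrow> pre p \<le> pre u \<and> pre u \<le> post p \<and> pre z < (pre p :: nat)"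
proof -
  have iff: "\<And>a b. a \<in> W \<Longrightarrow> b \<in> W \<Longrightarrow> (a, b) \<in> E\<^sup>* \<longleftrightarrow> pre b \<le> pre a \<and> pre a \<le> post b" using num(2) by blast
  have "(p, z) \<in> E\<^sup>+ \<longleftrightarrow> pre z < pre p" if up: "(u, p) \<in> E\<^sup>*"
  proof
    assume a: "(p, z) \<in> E\<^sup>+"
    then have "p \<noteq> z" using acyc by blast
    then have "pre p \<noteq> pre z" using num(1) W unfolding inj_on_def by blast
    moreover have "pre z \<le> pre p" using iff[OF W(2,3)] a by (simp add: trancl_into_rtrancl)
    ultimately show "pre z < pre p" by simp
  next
    assume a: "pre z < pre p"
    then have "(z, p) \<notin> E\<^sup>*" using iff[OF W(3,2)] by simp
    then have "(p, z) \<in> E\<^sup>*" using single_valued_confluent[OF sv up uz] by blast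
    moreover have "p \<noteq> z" using a by auto
    ultimately show "(p, z) \<in> E\<^sup>+" by (meson rtranclD)
  qed
  then show ?thesis using iff[OF W(1,2)] by blast
qed

text \<open>Channels \<open>0\<close> and \<open>1\<close> are the in- and out-forests: the tree arc \<open>y\<close> carries the preorder interval \<open>L y\<close>--\<open>U y\<close> of its
  subtree, the failed arc \<open>x\<close> the preorder number \<open>c x\<close> of an end point and that of the ancestor \<open>d x\<close> where the detour leaves the
  tree. Channel \<open>2\<close> compares path numbers. Zero labels never match.\<close>

definition changed :: "(nat \<Rightarrow> nat \<Rightarrow> nat) \<Rightarrow> (nat \<Rightarrow> nat \<Rightarrow> nat) \<Rightarrow> (nat \<Rightarrow> nat \<Rightarrow> nat) \<Rightarrow> (nat \<Rightarrow> nat \<Rightarrow> nat) \<Rightarrow>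
    nat \<Rightarrow> nat \<Rightarrow> bool" where
  "changed L U c d x y \<longleftrightarrow> (\<exists>j<3. L j y \<le> c j x \<and> c j x \<le> U j y \<and> d j x < L j y)"

section \<open>Labels that encode the response to every single failure\<close>

context path_system
begin

text \<open>Backwards along the path, \<open>ta x\<close> reaches \<open>s\<close>, and
  \<open>t\<close> reaches \<open>he x\<close>. So the vertices reachable from \<open>ta x\<close>
  include \<open>s\<close> but not \<open>t\<close>. They form a minimum cut that \<open>x\<close>
  leaves, and its failure lowers the capacity by one.\<close>

lemma path_drop_cert:
  assumes x: "i < k" "x \<in> set (pl i)" and nr: "he x \<notin> reach (rt A) (rh A) {..<m} {ta x}"
  shows "max_cert {x} (A - set (pl i))"
proof -
  let ?Y = "reach (rt A) (rh A) {..<m} {ta x}"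
  obtain l where l: "l < length (pl i)" "pl i ! l = x" using x by (auto simp: in_set_conv_nth)
  have xA: "x \<in> A" "x < m" using x pl_subset[OF x(1)] A_subset by auto
  have bwd: "walk (rt A) (rh A) q (rev ys) p" if "walk ta he p ys q" "set ys \<subseteq> set (pl i)" for p q ys
  proof -
    have "walk he ta q (rev ys) p" using that(1) by (simp add: walk_rev)
    moreover have "set (rev ys) \<subseteq> A" using that(2) pl_subset[OF x(1)] by auto
    ultimately show ?thesis using walk_cong[of "rev ys" he "rt A" ta "rh A" q p] by (auto simp: rt_def rh_def subset_iff)
  qed
  have "walk (rt A) (rh A) (ta x) (rev (take l (pl i))) s"
    using bwd[OF walk_take[OF pl_walk[OF x(1)] l(1)]] l by (auto dest: in_set_takeD)
  then have sY: "s \<in> ?Y" using reach_walk[OF reach_refl] pl_arcs[OF x(1)] by (metis set_rev set_take_subset subset_trans)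
  have "walk (rt A) (rh A) t (rev (drop (Suc l) (pl i))) (he x)"
    using bwd[OF walk_drop_Suc[OF pl_walk[OF x(1)] l(1)]] l by (auto dest: in_set_dropD)
  then have "he x \<in> ?Y" if "t \<in> ?Y" using reach_walk[OF that] pl_arcs[OF x(1)] by (metis set_rev set_drop_subset subset_trans)
  then have tY: "t \<notin> ?Y" using nr by blast
  have "?Y \<subseteq> {..<n}" using xA ta_less rh_less by (intro reach_subset_verts) auto
  then have Y: "st_cut ?Y" using sY tY unfolding st_cut_def by blast
  have "mcut {} ?Y = k" using mcut_eq_resout[OF isflow_A Y, of "{}"] reach_closed[of A "{..<m}" "{ta x}"] by simp
  moreover have "outs {x} ?Y = {x}" using nr reach_refl[of "ta x" "rt A" "rh A" "{..<m}"] by (auto simp: outs_def)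
  ultimately have "mcut {x} ?Y \<le> k - 1" using mcut_delete[of "{x}" ?Y] xA by simp
  moreover have "isflow (A - set (pl i)) (k - 1)"
    using isflow_diff[OF isflow_A simple_path_isflow[OF simple[OF x(1)]] pl_subset[OF x(1)]] x(1) by simp
  ultimately show ?thesis unfolding max_cert_def using Y x(2) by auto
qed

theorem single_failure_labels:
  obtains K Tree L U c d where
    "K = A \<union> Tree" "Tree \<subseteq> {..<m}" "card Tree \<le> 2 * n"
    "\<And>j y. y \<notin> K \<Longrightarrow> L j y = 0 \<and> U j y = 0 \<and> c j y = 0 \<and> d j y = 0"
    "\<And>j y. L j y \<le> n + k \<and> U j y \<le> n + k \<and> c j y \<le> n + k \<and> d j y \<le> n + k"
    "\<And>x. x < m \<Longrightarrow> max_cert {x} (sdiff A {y. changed L U c d x y} - {x})"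
    "\<And>x. x \<notin> A \<Longrightarrow> {y. changed L U c d x y} = {}"
    "\<And>x i. i < k \<Longrightarrow> x \<in> set (pl i) \<Longrightarrow> {y. changed L U c d x y} \<subseteq> Tree \<union> set (pl i)"
proof -
  let ?B = "{..<m}" and ?src = "rt A" and ?dst = "rh A"
  define rho where "rho = scc_root ?src ?dst ?B"
  have rho': "rho = scc_root ?dst ?src ?B" unfolding rho_def by (rule scc_root_converse[symmetric])
  define nr where "nr p \<longleftrightarrow> rho p \<noteq> p" for p
  obtain pin din where pin: "\<And>p. nr p \<Longrightarrow> pin p \<in> ?B \<and> ?src (pin p) = p \<and> rho (?dst (pin p)) = rho p \<and> din (?dst (pin p)) < (din p :: nat)"
    using scc_forest[of ?src ?dst ?B] unfolding rho_def[symmetric] nr_def by blast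
  obtain pout dout where pout: "\<And>p. nr p \<Longrightarrow> pout p \<in> ?B \<and> ?dst (pout p) = p \<and> rho (?src (pout p)) = rho p \<and> dout (?src (pout p)) < (dout p :: nat)"
    using scc_forest[of ?dst ?src ?B] unfolding rho'[symmetric] nr_def by blast
  let ?E = "parents nr (\<lambda>p. ?dst (pin p))" and ?E' = "parents nr (\<lambda>p. ?src (pout p))"
  have E_less: "din q < din p" if "(p, q) \<in> ?E\<^sup>+" for p q using parents_trancl_depth[of nr din, OF _ that] pin by blast
  have E'_less: "dout q < dout p" if "(p, q) \<in> ?E'\<^sup>+" for p q using parents_trancl_depth[of nr dout, OF _ that] pout by blast
  have root: "(p, rho p) \<in> ?E\<^sup>*" "(p, rho p) \<in> ?E'\<^sup>*" for p
    using forest_to_root[of rho "\<lambda>p. ?dst (pin p)" din p] forest_to_root[of rho "\<lambda>p. ?src (pout p)" dout p] pin pout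
    unfolding nr_def by auto
  have "\<exists>pre post. inj_on pre {..<n} \<and> (\<forall>p\<in>{..<n}. 1 \<le> pre p \<and> pre p \<le> card {..<n} \<and> post p \<le> card {..<n}) \<and>
      (\<forall>q\<in>{..<n}. \<forall>p\<in>{..<n}. (p, q) \<in> ?E\<^sup>* \<longleftrightarrow> pre q \<le> pre p \<and> pre p \<le> (post q :: nat))"
    by (rule forest_numbering[of _ nr din]) (use pin rh_less in auto)
  then obtain pre post where num: "inj_on pre {..<n}" "\<forall>p\<in>{..<n}. 1 \<le> pre p \<and> pre p \<le> card {..<n} \<and> post p \<le> card {..<n}"
    "\<forall>q\<in>{..<n}. \<forall>p\<in>{..<n}. (p, q) \<in> ?E\<^sup>* \<longleftrightarrow> pre q \<le> pre p \<and> pre p \<le> (post q :: nat)" by blast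
  have "\<exists>pre post. inj_on pre {..<n} \<and> (\<forall>p\<in>{..<n}. 1 \<le> pre p \<and> pre p \<le> card {..<n} \<and> post p \<le> card {..<n}) \<and>
      (\<forall>q\<in>{..<n}. \<forall>p\<in>{..<n}. (p, q) \<in> ?E'\<^sup>* \<longleftrightarrow> pre q \<le> pre p \<and> pre p \<le> (post q :: nat))"
    by (rule forest_numbering[of _ nr dout]) (use pout rt_less in auto)
  then obtain pre' post' where num': "inj_on pre' {..<n}" "\<forall>p\<in>{..<n}. 1 \<le> pre' p \<and> pre' p \<le> card {..<n} \<and> post' p \<le> card {..<n}"
    "\<forall>q\<in>{..<n}. \<forall>p\<in>{..<n}. (p, q) \<in> ?E'\<^sup>* \<longleftrightarrow> pre' q \<le> pre' p \<and> pre' p \<le> (post' q :: nat)" by blast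
  have stay: "q < n" if "(p, q) \<in> ?E\<^sup>*" "p < n" for p q
    using that by (induction rule: rtrancl_induct) (use pin rh_less in \<open>auto simp: parents_def\<close>)
  have stay': "q < n" if "(p, q) \<in> ?E'\<^sup>*" "p < n" for p q
    using that by (induction rule: rtrancl_induct) (use pout rt_less in \<open>auto simp: parents_def\<close>)
  define rer where "rer x \<longleftrightarrow> x \<in> A \<and> he x \<in> reach ?src ?dst ?B {ta x}" for x
  \<comment> \<open>Vertices where a detour can change from the in-tree of the tail to the out-tree
    of the head; the common root is one. Choosing the deepest in the in-forest ensures that no
    earlier vertex of the in-tree path lies on the out-tree path.\<close>
  define Z where "Z x q \<longleftrightarrow> (ta x, q) \<in> ?E\<^sup>* \<and> (he x, q) \<in> ?E'\<^sup>*" for x q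
  have "\<exists>q. Z x q \<and> (\<forall>r. Z x r \<longrightarrow> din r \<le> din q)" if x: "rer x" for x
  proof -
    have xm: "x < m" "x \<in> A" using x A_subset unfolding rer_def by auto
    have "ta x \<in> reach ?src ?dst ?B {he x}"
      using reach_step[of ?src x ?dst ?B "{he x}"] reach_refl[of "he x" ?src ?dst ?B] xm by (simp add: rt_def rh_def)
    then have "rho (ta x) = rho (he x)" using x unfolding rer_def rho_def by (intro scc_root_eq) auto
    then have "Z x (rho (ta x))" unfolding Z_def using root by metis
    moreover have "din r \<le> din (ta x)" if "Z x r" for r
      using E_less[of "ta x" r] that unfolding Z_def by (metis less_imp_le order_refl rtranclD)
    then have "\<forall>r. Z x r \<longrightarrow> din r < Suc (din (ta x))" by (simp add: less_Suc_eq_le)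
    ultimately show ?thesis by (rule ex_has_greatest_nat)
  qed
  then have "\<forall>x. \<exists>q. rer x \<longrightarrow> Z x q \<and> (\<forall>r. Z x r \<longrightarrow> din r \<le> din q)" by blast
  from choice[OF this] obtain z where "\<And>x. rer x \<Longrightarrow> Z x (z x) \<and> (\<forall>r. Z x r \<longrightarrow> din r \<le> din (z x))" by blast
  then have z: "\<And>x. rer x \<Longrightarrow> (ta x, z x) \<in> ?E\<^sup>*" "\<And>x. rer x \<Longrightarrow> (he x, z x) \<in> ?E'\<^sup>*"
    "\<And>x q. rer x \<Longrightarrow> (ta x, q) \<in> ?E\<^sup>* \<Longrightarrow> (he x, q) \<in> ?E'\<^sup>* \<Longrightarrow> din q \<le> din (z x)" unfolding Z_def by simp_all
  define Tree where "Tree = pin ` {p. p < n \<and> nr p} \<union> pout ` {p. p < n \<and> nr p}"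
  define pid where "pid x = (THE i. i < k \<and> x \<in> set (pl i))" for x
  have pid: "pid x = i" if "i < k" "x \<in> set (pl i)" for x i
    unfolding pid_def by (rule the_equality) (use that disjoint in blast)+
  have pidA: "pid x < k" "x \<in> set (pl (pid x))" if "x \<in> A" for x
    using that pid unfolding A_def by auto
  define isin where "isin y \<longleftrightarrow> y < m \<and> nr (?src y) \<and> y = pin (?src y)" for y
  define isout where "isout y \<longleftrightarrow> y < m \<and> nr (?dst y) \<and> y = pout (?dst y)" for y
  \<comment> \<open>\<open>Suc\<close> separates path 0 from the label 0, which must never
    match.\<close>
  define L where "L j y = (if j = 0 then if isin y then pre (?src y) else 0
     else if j = 1 then if isout y then pre' (?dst y) else 0
     else if y \<in> A then Suc (pid y) else 0)" for j y :: nat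
  define U where "U j y = (if j = 0 then if isin y then post (?src y) else 0
     else if j = 1 then if isout y then post' (?dst y) else 0
     else if y \<in> A then Suc (pid y) else 0)" for j y :: nat
  define c where "c j x = (if j = 0 then if rer x then pre (ta x) else 0
     else if j = 1 then if rer x then pre' (he x) else 0
     else if x \<in> A \<and> \<not> rer x then Suc (pid x) else 0)" for j x :: nat
  define d where "d j x = (if j = 0 then if rer x then pre (z x) else 0
     else if j = 1 then if rer x then pre' (z x) else 0 else 0)" for j x :: nat
  have three: "(\<exists>j<3. P j) \<longleftrightarrow> P 0 \<or> P 1 \<or> P (2::nat)" for P by (auto simp: numeral_3_eq_3 less_Suc_eq numeral_2_eq_2)
  have TreeI: "y \<in> Tree" if "isin y \<or> isout y" for y
    using that rt_less[of y A] rh_less[of y A] unfolding isin_def isout_def Tree_def by blast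
  have rerlt: "ta x < n" "he x < n" "z x < n" if "rer x" for x
    using that A_subset ta_less he_less stay[OF z(1)[OF that]] unfolding rer_def by auto
  have drop: "{y. changed L U c d x y} = set (pl i)" if x: "i < k" "x \<in> set (pl i)" "\<not> rer x" for x i
  proof -
    have xA: "x \<in> A" using pl_subset[OF x(1)] x(2) by blast
    have "changed L U c d x y \<longleftrightarrow> y \<in> A \<and> pid y = pid x" for y
      unfolding changed_def three using x(3) xA by (auto simp: L_def U_def c_def d_def)
    moreover have "y \<in> A \<and> pid y = i \<longleftrightarrow> y \<in> set (pl i)" for y using pidA[of y] pid[OF x(1)] pl_subset[OF x(1)] by blast
    ultimately show ?thesis using pid[OF x(1,2)] by auto
  qed
  have none: "{y. changed L U c d x y} = {}" if "x \<notin> A" for x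
    unfolding changed_def three using that by (auto simp: L_def U_def c_def d_def rer_def)
  have rer_eq: "{y. changed L U c d x y} =
      {pin p | p. (ta x, p) \<in> ?E\<^sup>* \<and> (p, z x) \<in> ?E\<^sup>+} \<union> {pout p | p. (he x, p) \<in> ?E'\<^sup>* \<and> (p, z x) \<in> ?E'\<^sup>+}" if x: "rer x" for x
  proof -
    have 1: "(ta x, p) \<in> ?E\<^sup>* \<and> (p, z x) \<in> ?E\<^sup>+ \<longleftrightarrow> pre p \<le> pre (ta x) \<and> pre (ta x) \<le> post p \<and> pre (z x) < pre p" if "p < n" for p
      using forest_interval[OF num(1,3) parents_single_valued _ _ _ z(1)[OF x], of p] rerlt[OF x] that E_less by blast
    have 2: "(he x, p) \<in> ?E'\<^sup>* \<and> (p, z x) \<in> ?E'\<^sup>+ \<longleftrightarrow> pre' p \<le> pre' (he x) \<and> pre' (he x) \<le> post' p \<and> pre' (z x) < pre' p" if "p < n" for p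
      using forest_interval[OF num'(1,3) parents_single_valued _ _ _ z(2)[OF x], of p] rerlt[OF x] that E'_less by blast
    have 3: "(isin y \<and> pre (?src y) \<le> pre (ta x) \<and> pre (ta x) \<le> post (?src y) \<and> pre (z x) < pre (?src y)) \<longleftrightarrow>
        (\<exists>p. y = pin p \<and> (ta x, p) \<in> ?E\<^sup>* \<and> (p, z x) \<in> ?E\<^sup>+)" for y
    proof
      assume "isin y \<and> pre (?src y) \<le> pre (ta x) \<and> pre (ta x) \<le> post (?src y) \<and> pre (z x) < pre (?src y)"
      then show "\<exists>p. y = pin p \<and> (ta x, p) \<in> ?E\<^sup>* \<and> (p, z x) \<in> ?E\<^sup>+" using 1[of "?src y"] rt_less[of y A] unfolding isin_def by blast
    next
      assume "\<exists>p. y = pin p \<and> (ta x, p) \<in> ?E\<^sup>* \<and> (p, z x) \<in> ?E\<^sup>+"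
      then obtain p where p: "y = pin p" "(ta x, p) \<in> ?E\<^sup>*" "(p, z x) \<in> ?E\<^sup>+" by blast
      have "nr p" using p(3) by (auto simp: parents_def elim: converse_tranclE)
      moreover have "p < n" using stay p(2) rerlt[OF x] by blast
      ultimately show "isin y \<and> pre (?src y) \<le> pre (ta x) \<and> pre (ta x) \<le> post (?src y) \<and> pre (z x) < pre (?src y)"
        using 1[of p] p pin[of p] unfolding isin_def by auto
    qed
    have 4: "(isout y \<and> pre' (?dst y) \<le> pre' (he x) \<and> pre' (he x) \<le> post' (?dst y) \<and> pre' (z x) < pre' (?dst y)) \<longleftrightarrow>
        (\<exists>p. y = pout p \<and> (he x, p) \<in> ?E'\<^sup>* \<and> (p, z x) \<in> ?E'\<^sup>+)" for y
    proof
      assume "isout y \<and> pre' (?dst y) \<le> pre' (he x) \<and> pre' (he x) \<le> post' (?dst y) \<and> pre' (z x) < pre' (?dst y)"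
      then show "\<exists>p. y = pout p \<and> (he x, p) \<in> ?E'\<^sup>* \<and> (p, z x) \<in> ?E'\<^sup>+" using 2[of "?dst y"] rh_less[of y A] unfolding isout_def by blast
    next
      assume "\<exists>p. y = pout p \<and> (he x, p) \<in> ?E'\<^sup>* \<and> (p, z x) \<in> ?E'\<^sup>+"
      then obtain p where p: "y = pout p" "(he x, p) \<in> ?E'\<^sup>*" "(p, z x) \<in> ?E'\<^sup>+" by blast
      have "nr p" using p(3) by (auto simp: parents_def elim: converse_tranclE)
      moreover have "p < n" using stay' p(2) rerlt[OF x] by blast
      ultimately show "isout y \<and> pre' (?dst y) \<le> pre' (he x) \<and> pre' (he x) \<le> post' (?dst y) \<and> pre' (z x) < pre' (?dst y)"
        using 2[of p] p pout[of p] unfolding isout_def by auto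
    qed
    have "changed L U c d x y \<longleftrightarrow>
      (isin y \<and> pre (?src y) \<le> pre (ta x) \<and> pre (ta x) \<le> post (?src y) \<and> pre (z x) < pre (?src y)) \<or>
      (isout y \<and> pre' (?dst y) \<le> pre' (he x) \<and> pre' (he x) \<le> post' (?dst y) \<and> pre' (z x) < pre' (?dst y))" for y
      unfolding changed_def three using x by (auto simp: L_def U_def c_def d_def)
    then show ?thesis unfolding 3 4 by blast
  qed
  have rer_cert: "max_cert {x} (sdiff A {y. changed L U c d x y} - {x})" if x: "rer x" for x
  proof -
    let ?I = "{pin p | p. (ta x, p) \<in> ?E\<^sup>* \<and> (p, z x) \<in> ?E\<^sup>+}" and ?O = "{pout p | p. (he x, p) \<in> ?E'\<^sup>* \<and> (p, z x) \<in> ?E'\<^sup>+}"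
    have xA: "x \<in> A" "x < m" using x A_subset unfolding rer_def by auto
    obtain ys where ys: "walk ?src ?dst (ta x) ys (z x)" "distinct ys" "set ys = ?I"
      using forest_path[of nr ?src pin din ?dst "ta x" "z x"] z(1)[OF x] pin by blast
    obtain zs where zs: "walk ?dst ?src (he x) zs (z x)" "distinct zs" "set zs = ?O"
      using forest_path[of nr ?dst pout dout ?src "he x" "z x"] z(2)[OF x] pout by blast
    have far: "(he x, p) \<notin> ?E'\<^sup>*" if "(ta x, p) \<in> ?E\<^sup>*" "(p, z x) \<in> ?E\<^sup>+" for p
      using z(3)[OF x that(1)] E_less[OF that(2)] by force
    have nrE: "nr p" if "(p, q) \<in> ?E\<^sup>+" for p q using that by (auto simp: parents_def elim: converse_tranclE)
    have nrE': "nr p" if "(p, q) \<in> ?E'\<^sup>+" for p q using that by (auto simp: parents_def elim: converse_tranclE)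
    \<comment> \<open>A shared arc starts at an in-tree vertex \<open>p\<close> before
      \<open>z x\<close> and makes \<open>p\<close> the out-forest parent of \<open>q\<close>, hence
      an ancestor of \<open>he x\<close>: an earlier meeting vertex.\<close>
    have "?I \<inter> ?O = {}"
    proof (rule ccontr)
      assume "?I \<inter> ?O \<noteq> {}"
      then obtain p q where pq: "pin p = pout q" "(ta x, p) \<in> ?E\<^sup>*" "(p, z x) \<in> ?E\<^sup>+" "(he x, q) \<in> ?E'\<^sup>*" "(q, z x) \<in> ?E'\<^sup>+" by auto
      have "?src (pout q) = p" using pin[OF nrE[OF pq(3)]] pq(1) by simp
      then have "(q, p) \<in> ?E'" using nrE'[OF pq(5)] by (auto simp: parents_def)
      then have "(he x, p) \<in> ?E'\<^sup>*" using pq(4) by simp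
      then show False using far[OF pq(2,3)] by blast
    qed
    then have dist: "distinct (ys @ rev zs)" using ys zs by auto
    have w: "walk ?src ?dst (ta x) (ys @ rev zs) (he x)" using ys(1) zs(1) by (auto simp: walk_append walk_rev)
    \<comment> \<open>In the residual graph \<open>x\<close> runs from \<open>he x\<close> to
      \<open>ta x\<close>. On either tree path it would turn one of its own end points into an
      earlier meeting vertex.\<close>
    have xI: "x \<notin> ?I"
    proof
      assume "x \<in> ?I"
      then obtain p where p: "x = pin p" "(ta x, p) \<in> ?E\<^sup>*" "(p, z x) \<in> ?E\<^sup>+" by blast
      then have "p = he x" using pin[OF nrE[OF p(3)]] xA by (simp add: rt_def)
      then show False using far[OF p(2,3)] by simp
    qed
    have xO: "x \<notin> ?O"
    proof
      assume "x \<in> ?O"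
      then obtain q where q: "x = pout q" "(he x, q) \<in> ?E'\<^sup>*" "(q, z x) \<in> ?E'\<^sup>+" by blast
      then have qe: "q = ta x" using pout[OF nrE'[OF q(3)]] xA by (simp add: rh_def)
      then have "z x \<noteq> ta x" using E'_less[OF q(3)] by auto
      then have "(ta x, z x) \<in> ?E\<^sup>+" using z(1)[OF x] by (metis rtranclD)
      then show False using z(3)[OF x, of "ta x"] E_less q(2) qe by fastforce
    qed
    have sub: "set (ys @ rev zs) \<subseteq> {..<m}" using ys(3) zs(3) pin pout nrE nrE' by auto
    have "isflow (sdiff A (set (ys @ rev zs)) - {x}) k"
      by (rule isflow_reroute[OF isflow_A w dist sub xA(1)]) (use xI xO ys zs in auto)
    moreover have "set (ys @ rev zs) = {y. changed L U c d x y}" unfolding rer_eq[OF x] using ys(3) zs(3) by simp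
    ultimately show ?thesis by (intro max_cert_full) auto
  qed
  show thesis
  proof (rule that[of "A \<union> Tree" Tree L U c d])
    show "Tree \<subseteq> {..<m}" unfolding Tree_def using pin pout by auto
    have "card Tree \<le> card (pin ` {p. p < n \<and> nr p}) + card (pout ` {p. p < n \<and> nr p})" unfolding Tree_def by (rule card_Un_le)
    moreover have "card {p. p < n \<and> nr p} \<le> n" using card_mono[of "{..<n}" "{p. p < n \<and> nr p}"] by auto
    moreover have "finite {p. p < n \<and> nr p}" by simp
    ultimately show "card Tree \<le> 2 * n" using card_image_le[of "{p. p < n \<and> nr p}" pin] card_image_le[of "{p. p < n \<and> nr p}" pout] by linarith
    show "L j y = 0 \<and> U j y = 0 \<and> c j y = 0 \<and> d j y = 0" if "y \<notin> A \<union> Tree" for j y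
      using that TreeI[of y] by (auto simp: L_def U_def c_def d_def rer_def)
    have "pre p \<le> n" "post p \<le> n" "pre' p \<le> n" "post' p \<le> n" if "p < n" for p using num(2) num'(2) that by auto
    then show "L j y \<le> n + k \<and> U j y \<le> n + k \<and> c j y \<le> n + k \<and> d j y \<le> n + k" for j y
      using rt_less[of y A] rh_less[of y A] rerlt[of y] pidA[of y]
      by (auto simp: L_def U_def c_def d_def isin_def isout_def intro: trans_le_add1 trans_le_add2)
    show "max_cert {x} (sdiff A {y. changed L U c d x y} - {x})" if "x < m" for x
    proof -
      consider "x \<notin> A" | "rer x" | "x \<in> A" "\<not> rer x" by blast
      then show ?thesis
      proof cases
        case 1
        then show ?thesis using none[OF 1] isflow_A by (intro max_cert_full) (auto simp: sdiff_def)
      next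
        case 2 then show ?thesis by (rule rer_cert)
      next
        case 3
        have eq: "{y. changed L U c d x y} = set (pl (pid x))" using drop[OF pidA[OF 3(1)] 3(2)] .
        have "sdiff A (set (pl (pid x))) - {x} = A - set (pl (pid x))"
          using pl_subset[OF pidA(1)[OF 3(1)]] pidA(2)[OF 3(1)] by (auto simp: sdiff_def)
        then show ?thesis using path_drop_cert[OF pidA[OF 3(1)]] 3 unfolding eq rer_def by auto
      qed
    qed
    show "{y. changed L U c d x y} = {}" if "x \<notin> A" for x using none[OF that] .
    show "{y. changed L U c d x y} \<subseteq> Tree \<union> set (pl i)" if x: "i < k" "x \<in> set (pl i)" for x i
    proof (cases "rer x")
      case True
      have "p < n \<and> nr p" if "(ta x, p) \<in> ?E\<^sup>*" "(p, z x) \<in> ?E\<^sup>+" for p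
        using stay[OF that(1)] rerlt[OF True] that(2) by (auto simp: parents_def elim: converse_tranclE)
      moreover have "p < n \<and> nr p" if "(he x, p) \<in> ?E'\<^sup>*" "(p, z x) \<in> ?E'\<^sup>+" for p
        using stay'[OF that(1)] rerlt[OF True] that(2) by (auto simp: parents_def elim: converse_tranclE)
      ultimately show ?thesis unfolding rer_eq[OF True] Tree_def by blast
    next
      case False
      then show ?thesis using drop[OF x False] by simp
    qed
  qed simp
qed

end

section \<open>Reasoning about programs\<close>

fun seqs :: "com list \<Rightarrow> com" where
  "seqs [] = Skip"
| "seqs (c # cs) = Seq c (seqs cs)"

primrec loopfree :: "com \<Rightarrow> bool" where
  "loopfree Skip = True"
| "loopfree (Const i a) = True"
| "loopfree (Op b i j k) = True"
| "loopfree (Load i j) = True"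
| "loopfree (Store i j) = True"
| "loopfree (Emit i) = True"
| "loopfree (Seq c1 c2) = (loopfree c1 \<and> loopfree c2)"
| "loopfree (Cond b c1 c2) = (loopfree c1 \<and> loopfree c2)"
| "loopfree (While b c) = False"

text \<open>For loop-free code this bounds the running time, and \<open>run\<close> computes the
  final state by rewriting; the values of both at \<open>While\<close> are placeholders.\<close>

primrec csize :: "com \<Rightarrow> nat" where
  "csize Skip = 1"
| "csize (Const i a) = 1"
| "csize (Op b i j k) = 1"
| "csize (Load i j) = 1"
| "csize (Store i j) = 1"
| "csize (Emit i) = 1"
| "csize (Seq c1 c2) = csize c1 + csize c2"
| "csize (Cond b c1 c2) = 1 + csize c1 + csize c2"
| "csize (While b c) = 0"

primrec run :: "nat \<Rightarrow> com \<Rightarrow> state \<Rightarrow> state" where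
  "run w Skip \<sigma> = \<sigma>"
| "run w (Const i a) \<sigma> = \<sigma>\<lparr>regs := (regs \<sigma>)(i := a mod 2 ^ w)\<rparr>"
| "run w (Op b i j k) \<sigma> = \<sigma>\<lparr>regs := (regs \<sigma>)(i := bop_val w b (regs \<sigma> j) (regs \<sigma> k))\<rparr>"
| "run w (Load i j) \<sigma> = \<sigma>\<lparr>regs := (regs \<sigma>)(i := mem \<sigma> (regs \<sigma> j))\<rparr>"
| "run w (Store i j) \<sigma> = \<sigma>\<lparr>mem := (mem \<sigma>)(regs \<sigma> i := regs \<sigma> j)\<rparr>"
| "run w (Emit i) \<sigma> = \<sigma>\<lparr>out := out \<sigma> @ [regs \<sigma> i]\<rparr>"
| "run w (Seq c1 c2) \<sigma> = run w c2 (run w c1 \<sigma>)"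
| "run w (Cond b c1 c2) \<sigma> = (if test_val b \<sigma> then run w c1 \<sigma> else run w c2 \<sigma>)"
| "run w (While b c) \<sigma> = \<sigma>"

lemma run_exec: "loopfree c \<Longrightarrow> \<exists>k\<le>csize c. exec w c \<sigma> k (run w c \<sigma>)"
proof (induction c arbitrary: \<sigma>)
  case (Seq c1 c2)
  then obtain k1 k2 where "k1 \<le> csize c1" "exec w c1 \<sigma> k1 (run w c1 \<sigma>)"
    "k2 \<le> csize c2" "exec w c2 (run w c1 \<sigma>) k2 (run w c2 (run w c1 \<sigma>))" by fastforce
  then show ?case by (intro exI[of _ "k1 + k2"]) (auto intro: exec.Seq)
next
  case (Cond b c1 c2)
  then obtain k1 k2 where k: "k1 \<le> csize c1" "exec w c1 \<sigma> k1 (run w c1 \<sigma>)" "k2 \<le> csize c2" "exec w c2 \<sigma> k2 (run w c2 \<sigma>)"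
    by fastforce
  show ?case
  proof (cases "test_val b \<sigma>")
    case True then show ?thesis using k by (intro exI[of _ "1 + k1"]) (auto intro: exec.CondT[simplified])
  next
    case False then show ?thesis using k by (intro exI[of _ "1 + k2"]) (auto intro: exec.CondF[simplified])
  qed
qed (auto intro: exec.intros[simplified])

definition halts :: "nat \<Rightarrow> com \<Rightarrow> state \<Rightarrow> nat \<Rightarrow> (state \<Rightarrow> bool) \<Rightarrow> bool" where
  "halts w c \<sigma> T Q \<longleftrightarrow> (\<exists>k \<tau>. exec w c \<sigma> k \<tau> \<and> k \<le> T \<and> Q \<tau>)"

lemma halts_run: "loopfree c \<Longrightarrow> csize c \<le> T \<Longrightarrow> Q (run w c \<sigma>) \<Longrightarrow> halts w c \<sigma> T Q"
  unfolding halts_def using run_exec[of c w \<sigma>] le_trans by blast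

lemma halts_Seq:
  assumes "halts w c1 \<sigma> T1 Q1" "\<And>\<tau>. Q1 \<tau> \<Longrightarrow> halts w c2 \<tau> T2 Q" "T1 + T2 \<le> T"
  shows "halts w (Seq c1 c2) \<sigma> T Q"
proof -
  obtain k1 \<tau>1 where 1: "exec w c1 \<sigma> k1 \<tau>1" "k1 \<le> T1" "Q1 \<tau>1" using assms(1) unfolding halts_def by blast
  obtain k2 \<tau>2 where 2: "exec w c2 \<tau>1 k2 \<tau>2" "k2 \<le> T2" "Q \<tau>2" using assms(2)[OF 1(3)] unfolding halts_def by blast
  have "exec w (Seq c1 c2) \<sigma> (k1 + k2) \<tau>2" using 1 2 by (blast intro: exec.Seq)
  moreover have "k1 + k2 \<le> T" using 1 2 assms(3) by simp
  ultimately show ?thesis unfolding halts_def using 2 by blast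
qed

lemma halts_Seq_run:
  assumes "loopfree c1" "halts w c2 (run w c1 \<sigma>) T2 Q" "csize c1 + T2 \<le> T"
  shows "halts w (Seq c1 c2) \<sigma> T Q"
proof -
  have "halts w c1 \<sigma> (csize c1) (\<lambda>\<tau>. \<tau> = run w c1 \<sigma>)" by (rule halts_run) (use assms(1) in auto)
  then show ?thesis by (rule halts_Seq[OF _ _ assms(3)]) (use assms(2) in simp)
qed

lemma halts_Seq_Skip: "halts w c \<sigma> T Q \<Longrightarrow> halts w (Seq c Skip) \<sigma> (T + 1) Q"
  by (rule halts_Seq[of _ _ _ T Q _ 1]) (auto intro: halts_run)

lemma halts_Cond:
  assumes "test_val b \<sigma> \<Longrightarrow> halts w c1 \<sigma> T Q" "\<not> test_val b \<sigma> \<Longrightarrow> halts w c2 \<sigma> T Q" "T + 1 \<le> T'"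
  shows "halts w (Cond b c1 c2) \<sigma> T' Q"
proof (cases "test_val b \<sigma>")
  case True
  then obtain k \<tau> where "exec w c1 \<sigma> k \<tau>" "k \<le> T" "Q \<tau>" using assms(1) unfolding halts_def by blast
  then show ?thesis unfolding halts_def using exec.CondT[OF True] assms(3) by (intro exI[of _ "1 + k"] exI[of _ \<tau>]) auto
next
  case False
  then obtain k \<tau> where "exec w c2 \<sigma> k \<tau>" "k \<le> T" "Q \<tau>" using assms(2) unfolding halts_def by blast
  then show ?thesis unfolding halts_def using exec.CondF[OF False] assms(3) by (intro exI[of _ "1 + k"] exI[of _ \<tau>]) auto
qed

lemma halts_weaken: "halts w c \<sigma> T Q \<Longrightarrow> T \<le> T' \<Longrightarrow> (\<And>\<tau>. Q \<tau> \<Longrightarrow> Q' \<tau>) \<Longrightarrow> halts w c \<sigma> T' Q'"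
  unfolding halts_def using le_trans by blast

text \<open>The index of the invariant is a fuel that every iteration lowers by some amount, so it
  bounds the number of iterations.\<close>

lemma halts_While:
  assumes lf: "loopfree c"
    and step: "\<And>j \<sigma>. I j \<sigma> \<Longrightarrow> test_val b \<sigma> \<Longrightarrow> \<exists>j'<j. I j' (run w c \<sigma>)"
    and init: "I j \<sigma>"
  shows "halts w (While b c) \<sigma> ((csize c + 1) * j + 1) (\<lambda>\<tau>. \<not> test_val b \<tau> \<and> (\<exists>j'. I j' \<tau>))"
  using init
proof (induction j arbitrary: \<sigma> rule: less_induct)
  case (less j)
  show ?case
  proof (cases "test_val b \<sigma>")
    case False
    then show ?thesis unfolding halts_def using less.prems exec.WhileF by (intro exI[of _ 1] exI[of _ \<sigma>]) auto
  next
    case True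
    obtain j' where j': "j' < j" "I j' (run w c \<sigma>)" using step[OF less.prems True] by blast
    obtain k1 where k1: "k1 \<le> csize c" "exec w c \<sigma> k1 (run w c \<sigma>)" using run_exec[OF lf] by blast
    obtain k2 \<tau> where k2: "exec w (While b c) (run w c \<sigma>) k2 \<tau>" "k2 \<le> (csize c + 1) * j' + 1" "\<not> test_val b \<tau>" "\<exists>j'. I j' \<tau>"
      using less.IH[OF j'] unfolding halts_def by blast
    have "exec w (While b c) \<sigma> (1 + k1 + k2) \<tau>" by (rule exec.WhileT[OF True k1(2) k2(1)])
    moreover have "1 + k1 + k2 \<le> (csize c + 1) * j + 1"
    proof -
      have "(csize c + 1) * j' + (csize c + 1) \<le> (csize c + 1) * j"
        using j'(1) mult_le_mono2[of "Suc j'" j "csize c + 1"] by simp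
      then show ?thesis using k1(1) k2(2) by linarith
    qed
    ultimately show ?thesis unfolding halts_def using k2 by blast
  qed
qed

text \<open>Register 8 is scratch space for the address, hence \<open>j \<noteq> 8\<close> in the
  evaluation rule.\<close>

definition ldf :: "nat \<Rightarrow> nat \<Rightarrow> nat \<Rightarrow> com" where
  "ldf i j c = seqs [Const 8 c, Op Add 8 j 8, Load i 8]"

definition ldh :: "nat \<Rightarrow> nat \<Rightarrow> com" where
  "ldh i c = seqs [Const i c, Load i i]"

lemma run_ldf [simp]:
  "regs \<sigma> j + c < 2 ^ w \<Longrightarrow> j \<noteq> 8 \<Longrightarrow>
   run w (ldf i j c) \<sigma> = \<sigma>\<lparr>regs := (regs \<sigma>)(8 := regs \<sigma> j + c, i := mem \<sigma> (regs \<sigma> j + c))\<rparr>"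
  by (simp add: ldf_def)

lemma run_ldh [simp]: "c < 2 ^ w \<Longrightarrow> run w (ldh i c) \<sigma> = \<sigma>\<lparr>regs := (regs \<sigma>)(i := mem \<sigma> c)\<rparr>"
  by (simp add: ldh_def)

lemma loopfree_seqs [simp]: "loopfree (seqs cs) \<longleftrightarrow> (\<forall>c\<in>set cs. loopfree c)"
  by (induction cs) auto

lemma loopfree_ldf [simp]: "loopfree (ldf i j c)" "loopfree (ldh i c)"
  by (simp_all add: ldf_def ldh_def)

lemma csize_ldf [simp]: "csize (ldf i j c) = 4" "csize (ldh i c) = 3"
  by (simp_all add: ldf_def ldh_def)

section \<open>The dictionary\<close>

text \<open>
  Memory cells \<open>0\<close>--\<open>3\<close> hold the parameters of the outer hash function and the address of the table of inner hash
  functions. A record has 15 cells: the key plus one, the flow bit, the address of the block (\<open>0\<close> if the arc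
  carries no flow), and the four labels of each of the three channels. The zero record at address \<open>10\<close> stands for
  all arcs that are not stored. Register \<open>60\<close> is never written and holds \<open>0\<close>, register \<open>61\<close> holds \<open>1\<close>.
\<close>

definition locate :: "nat \<Rightarrow> nat \<Rightarrow> com" where
  "locate X P = seqs [ldh 11 0, ldh 12 1, ldh 13 2,
     Op Mul 14 13 X, Op Mod 14 14 12, Op Div 14 14 11,
     Const 15 3, Op Mul 14 14 15, ldh 15 3, Op Add 14 14 15,
     Load 15 14, ldf 16 14 1, ldf 17 14 2,
     Op Mul 15 15 X, Op Mod 15 15 16, Op Div 15 15 11,
     Const 16 15, Op Mul 15 15 16, Op Add P 15 17,
     Load 15 P, Const 16 1, Op Add 16 X 16, Cond (Eq 15 16) Skip (Const P 10)]"

text \<open>Register \<open>R\<close> is set but never reset, so consecutive channels combine to a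
  disjunction.\<close>

definition test_channel :: "nat \<Rightarrow> nat \<Rightarrow> nat \<Rightarrow> nat \<Rightarrow> nat \<Rightarrow> nat \<Rightarrow> nat \<Rightarrow> com" where
  "test_channel Px Py R f1 f2 f3 f4 = seqs [ldf 11 Py f1, ldf 12 Py f2, ldf 13 Px f3, ldf 14 Px f4,
     Cond (Less 13 11) Skip (Cond (Less 12 13) Skip (Cond (Less 14 11) (Const R 1) Skip))]"

definition test_changed :: "nat \<Rightarrow> nat \<Rightarrow> nat \<Rightarrow> com" where
  "test_changed Px Py R = seqs [Const R 0, test_channel Px Py R 3 4 5 6,
     test_channel Px Py R 7 8 9 10, test_channel Px Py R 11 12 13 14]"

text \<open>The new flow is the old one toggled on the changed arcs, so the answer is the exclusive
  or of the two bits.\<close>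

definition lookup_prog :: com where
  "lookup_prog = seqs [locate 0 20, locate 1 21, test_changed 20 21 22, ldf 23 21 1,
     Cond (Eq 23 22) (Const 0 0) (Const 0 1)]"

definition frame :: "nat set \<Rightarrow> state \<Rightarrow> state \<Rightarrow> bool" where
  "frame R \<sigma> \<tau> \<longleftrightarrow> mem \<tau> = mem \<sigma> \<and> out \<tau> = out \<sigma> \<and> (\<forall>r. r \<notin> R \<longrightarrow> regs \<tau> r = regs \<sigma> r)"

text \<open>\<open>mu\<close> is the memory image of the data structure and \<open>N\<close> bounds
  its extent. The assumption \<open>slot\<close> mirrors the address arithmetic of
  \<open>locate\<close>, together with the bounds under which nothing wraps around.\<close>

locale dict_mem =
  fixes w m N :: nat and mu :: "nat \<Rightarrow> nat" and ptr :: "nat \<Rightarrow> nat"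
    and fb blk :: "nat \<Rightarrow> nat" and L U c d :: "nat \<Rightarrow> nat \<Rightarrow> nat"
  assumes N_less: "N < 2 ^ w" and N_ge: "30 \<le> N" and m_less: "m < 2 ^ w"
    and slot: "x < m \<Longrightarrow>
      (let b = (mu 2 * x mod mu 1) div mu 0; e = mu 3 + 3 * b;
           q = mu (e + 2) + 15 * ((mu e * x mod mu (e + 1)) div mu 0)
       in mu 2 * x < 2 ^ w \<and> e + 2 < N \<and> mu e * x < 2 ^ w \<and> q + 14 < N \<and> ptr x = (if mu q = x + 1 then q else 10))"
    and fields: "x < m \<Longrightarrow> ptr x + 14 < N \<and> mu (ptr x + 1) = fb x \<and> mu (ptr x + 2) = blk x \<and>
      (\<forall>j<3. mu (ptr x + (3 + 4 * j)) = L j x \<and> mu (ptr x + (4 + 4 * j)) = U j x \<and>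
        mu (ptr x + (5 + 4 * j)) = c j x \<and> mu (ptr x + (6 + 4 * j)) = d j x)"
begin

definition agrees :: "state \<Rightarrow> bool" where
  "agrees \<sigma> \<longleftrightarrow> (\<forall>a<N. mem \<sigma> a = mu a)"

lemma one_less: "1 < (2::nat) ^ w"
  using N_less N_ge by linarith

lemma w_pos: "0 < w"
  using one_less by (cases w) auto

lemma run_locate:
  assumes "agrees \<sigma>" "regs \<sigma> X = x" "x < m" "X \<notin> {8..19}" "P \<notin> {8..19}" "P \<noteq> X"
  shows "frame ({8..19} \<union> {P}) \<sigma> (run w (locate X P) \<sigma>)" "regs (run w (locate X P) \<sigma>) P = ptr x"
proof -
  define b where "b = (mu 2 * x mod mu 1) div mu 0"
  define e where "e = mu 3 + 3 * b"
  define q where "q = mu (e + 2) + 15 * ((mu e * x mod mu (e + 1)) div mu 0)"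
  have s: "mu 2 * x < 2 ^ w" "e + 2 < N" "mu e * x < 2 ^ w" "q + 14 < N" "ptr x = (if mu q = x + 1 then q else 10)"
    using slot[OF assms(3)] unfolding Let_def b_def e_def q_def by auto
  have ag: "\<And>a. a < N \<Longrightarrow> mem \<sigma> a = mu a" using assms(1) unfolding agrees_def by blast
  have X: "X \<noteq> 8" "X \<noteq> 11" "X \<noteq> 12" "X \<noteq> 13" "X \<noteq> 14" "X \<noteq> 15" "X \<noteq> 16" "X \<noteq> 17"
    "P \<noteq> 8" "P \<noteq> 11" "P \<noteq> 12" "P \<noteq> 13" "P \<noteq> 14" "P \<noteq> 15" "P \<noteq> 16" "P \<noteq> 17" using assms(4,5) by auto
  have c: "0 < (2::nat) ^ w" "1 < (2::nat) ^ w" "2 < (2::nat) ^ w" "3 < (2::nat) ^ w" "10 < (2::nat) ^ w" "15 < (2::nat) ^ w"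
    "Suc 0 < 2 ^ w" "0 < w"
    using N_less N_ge w_pos by auto
  have b3: "3 * b < 2 ^ w" "b * 3 < 2 ^ w" "3 * b + mu 3 = e" "b * 3 + mu 3 = e" and e: "e < 2 ^ w" "e + 1 < 2 ^ w" "e + 2 < 2 ^ w" "Suc e < 2 ^ w" "Suc (Suc e) < 2 ^ w"
    using s(2) N_less unfolding e_def by auto
  define r where "r = (mu e * x mod mu (e + 1)) div mu 0"
  have r: "15 * r < 2 ^ w" "r * 15 < 2 ^ w" "15 * r + mu (e + 2) = q" "r * 15 + mu (e + 2) = q" "r * 15 + mu (Suc (Suc e)) = q" and q: "q < 2 ^ w"
    using s(4) N_less unfolding q_def r_def by auto
  have x1: "x + 1 < 2 ^ w" "Suc x < 2 ^ w" using assms(3) m_less by auto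
  have m0: "mem \<sigma> 0 = mu 0" "mem \<sigma> 1 = mu 1" "mem \<sigma> 2 = mu 2" "mem \<sigma> 3 = mu 3" "mem \<sigma> e = mu e" "mem \<sigma> (e + 1) = mu (e + 1)" "mem \<sigma> (Suc e) = mu (e + 1)"
    "mem \<sigma> (e + 2) = mu (e + 2)" "mem \<sigma> (Suc (Suc e)) = mu (e + 2)" "mem \<sigma> q = mu q" "mem \<sigma> (Suc 0) = mu 1"
    using ag s N_ge by auto
  have eqs: "mu 2 * x mod mu 1 div mu 0 = b" "mu e * x mod mu (e + 1) div mu 0 = r" using b_def r_def by auto
  note facts = X assms(2,6) m0 c s(1,3) eqs b3 e r q x1
  have reg: "regs (run w (locate X P) \<sigma>) P = ptr x \<and> mem (run w (locate X P) \<sigma>) = mem \<sigma> \<and> out (run w (locate X P) \<sigma>) = out \<sigma>"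
    unfolding locate_def s(5) by (simp add: facts X[symmetric] assms(6)[symmetric] del: One_nat_def)
  have "regs (run w (locate X P) \<sigma>) z = regs \<sigma> z" if "z \<notin> {8..19} \<union> {P}" for z
  proof -
    have z: "z \<noteq> 8" "z \<noteq> 11" "z \<noteq> 12" "z \<noteq> 13" "z \<noteq> 14" "z \<noteq> 15" "z \<noteq> 16" "z \<noteq> 17" "z \<noteq> P" using that by auto
    show ?thesis unfolding locate_def by (simp add: z facts X[symmetric] assms(6)[symmetric] del: One_nat_def)
  qed
  then show "frame ({8..19} \<union> {P}) \<sigma> (run w (locate X P) \<sigma>)" using reg unfolding frame_def by blast
  show "regs (run w (locate X P) \<sigma>) P = ptr x" using reg by blast
qed

lemma run_test_channel:
  assumes "regs \<sigma> Px = p" "regs \<sigma> Py = q" "q + f1 < 2 ^ w" "q + f2 < 2 ^ w" "p + f3 < 2 ^ w" "p + f4 < 2 ^ w" "1 < (2::nat) ^ w"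
    "Px \<notin> {8..19}" "Py \<notin> {8..19}" "R \<notin> {8..19}"
  shows "frame ({8..19} \<union> {R}) \<sigma> (run w (test_channel Px Py R f1 f2 f3 f4) \<sigma>)"
    "regs (run w (test_channel Px Py R f1 f2 f3 f4) \<sigma>) R =
      (if mem \<sigma> (q + f1) \<le> mem \<sigma> (p + f3) \<and> mem \<sigma> (p + f3) \<le> mem \<sigma> (q + f2) \<and>
          mem \<sigma> (p + f4) < mem \<sigma> (q + f1) then 1 else regs \<sigma> R)"
proof -
  let ?c = "test_channel Px Py R f1 f2 f3 f4"
  have X: "Px \<noteq> 8" "Px \<noteq> 11" "Px \<noteq> 12" "Px \<noteq> 13" "Px \<noteq> 14" "Py \<noteq> 8" "Py \<noteq> 11" "Py \<noteq> 12" "Py \<noteq> 13" "Py \<noteq> 14"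
    "R \<noteq> 8" "R \<noteq> 11" "R \<noteq> 12" "R \<noteq> 13" "R \<noteq> 14" using assms(8-10) by auto
  have w: "0 < w" using assms(7) by (cases w) auto
  note facts = X X[symmetric] assms(1-7) w
  show "regs (run w ?c \<sigma>) R = (if mem \<sigma> (q + f1) \<le> mem \<sigma> (p + f3) \<and> mem \<sigma> (p + f3) \<le> mem \<sigma> (q + f2) \<and>
          mem \<sigma> (p + f4) < mem \<sigma> (q + f1) then 1 else regs \<sigma> R)"
    unfolding test_channel_def by (auto simp: facts)
  have "regs (run w ?c \<sigma>) z = regs \<sigma> z" if "z \<notin> {8..19} \<union> {R}" for z
  proof -
    have z: "z \<noteq> 8" "z \<noteq> 11" "z \<noteq> 12" "z \<noteq> 13" "z \<noteq> 14" "z \<noteq> R" using that by auto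
    show ?thesis unfolding test_channel_def by (simp add: facts z)
  qed
  moreover have "mem (run w ?c \<sigma>) = mem \<sigma> \<and> out (run w ?c \<sigma>) = out \<sigma>"
    unfolding test_channel_def by (simp add: facts)
  ultimately show "frame ({8..19} \<union> {R}) \<sigma> (run w ?c \<sigma>)" unfolding frame_def by blast
qed

lemma frame_trans: "frame R \<sigma> \<tau> \<Longrightarrow> frame R' \<tau> \<rho> \<Longrightarrow> R \<union> R' \<subseteq> R'' \<Longrightarrow> frame R'' \<sigma> \<rho>"
  unfolding frame_def by (metis Un_iff subset_iff)

lemma agrees_frame: "agrees \<sigma> \<Longrightarrow> frame R \<sigma> \<tau> \<Longrightarrow> agrees \<tau>"
  unfolding agrees_def frame_def by simp

lemma run_test_changed:
  assumes "agrees \<sigma>" "regs \<sigma> Px = ptr x" "regs \<sigma> Py = ptr y" "x < m" "y < m"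
    "Px \<notin> {8..19}" "Py \<notin> {8..19}" "R \<notin> {8..19}" "Px \<noteq> R" "Py \<noteq> R"
  shows "frame ({8..19} \<union> {R}) \<sigma> (run w (test_changed Px Py R) \<sigma>)"
    "regs (run w (test_changed Px Py R) \<sigma>) R = (if changed L U c d x y then 1 else 0)"
proof -
  define p where "p = ptr x"
  define q where "q = ptr y"
  define \<sigma>0 where "\<sigma>0 = run w (Const R 0) \<sigma>"
  define \<sigma>1 where "\<sigma>1 = run w (test_channel Px Py R 3 4 5 6) \<sigma>0"
  define \<sigma>2 where "\<sigma>2 = run w (test_channel Px Py R 7 8 9 10) \<sigma>1"
  define \<sigma>3 where "\<sigma>3 = run w (test_channel Px Py R 11 12 13 14) \<sigma>2"
  have r: "run w (test_changed Px Py R) \<sigma> = \<sigma>3"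
    unfolding test_changed_def \<sigma>3_def \<sigma>2_def \<sigma>1_def \<sigma>0_def by simp
  have bnd: "p + 14 < N" "q + 14 < N" using fields[OF assms(4)] fields[OF assms(5)] unfolding p_def q_def by auto
  have bnd': "p + 14 < 2 ^ w" "q + 14 < 2 ^ w" using bnd N_less by linarith+
  have f0: "frame {R} \<sigma> \<sigma>0" "regs \<sigma>0 R = 0" unfolding \<sigma>0_def frame_def by auto
  have P0: "regs \<sigma>0 Px = p" "regs \<sigma>0 Py = q" using f0 assms unfolding frame_def p_def q_def by auto
  have f1: "frame ({8..19} \<union> {R}) \<sigma>0 \<sigma>1" and v1: "regs \<sigma>1 R = (if mem \<sigma>0 (q + 3) \<le> mem \<sigma>0 (p + 5) \<and> mem \<sigma>0 (p + 5) \<le> mem \<sigma>0 (q + 4) \<and>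
          mem \<sigma>0 (p + 6) < mem \<sigma>0 (q + 3) then 1 else regs \<sigma>0 R)"
    unfolding \<sigma>1_def using run_test_channel[OF P0, of 3 4 5 6 R] bnd' one_less assms(6-8) by auto
  have P1: "regs \<sigma>1 Px = p" "regs \<sigma>1 Py = q" using f1 P0 assms(6-10) unfolding frame_def by auto
  have f2: "frame ({8..19} \<union> {R}) \<sigma>1 \<sigma>2" and v2: "regs \<sigma>2 R = (if mem \<sigma>1 (q + 7) \<le> mem \<sigma>1 (p + 9) \<and> mem \<sigma>1 (p + 9) \<le> mem \<sigma>1 (q + 8) \<and>
          mem \<sigma>1 (p + 10) < mem \<sigma>1 (q + 7) then 1 else regs \<sigma>1 R)"
    unfolding \<sigma>2_def using run_test_channel[OF P1, of 7 8 9 10 R] bnd' one_less assms(6-8) by auto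
  have P2: "regs \<sigma>2 Px = p" "regs \<sigma>2 Py = q" using f2 P1 assms(6-10) unfolding frame_def by auto
  have f3: "frame ({8..19} \<union> {R}) \<sigma>2 \<sigma>3" and v3: "regs \<sigma>3 R = (if mem \<sigma>2 (q + 11) \<le> mem \<sigma>2 (p + 13) \<and> mem \<sigma>2 (p + 13) \<le> mem \<sigma>2 (q + 12) \<and>
          mem \<sigma>2 (p + 14) < mem \<sigma>2 (q + 11) then 1 else regs \<sigma>2 R)"
    unfolding \<sigma>3_def using run_test_channel[OF P2, of 11 12 13 14 R] bnd' one_less assms(6-8) by auto
  have "frame ({8..19} \<union> {R}) \<sigma> \<sigma>1" by (rule frame_trans[OF f0(1) f1]) auto
  then have "frame ({8..19} \<union> {R}) \<sigma> \<sigma>2" by (rule frame_trans[OF _ f2]) auto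
  then show "frame ({8..19} \<union> {R}) \<sigma> (run w (test_changed Px Py R) \<sigma>)" unfolding r by (rule frame_trans[OF _ f3]) auto
  have mm: "mem \<sigma>0 = mem \<sigma>" "mem \<sigma>1 = mem \<sigma>" "mem \<sigma>2 = mem \<sigma>" using f0 f1 f2 unfolding frame_def by auto
  have ag: "\<And>a. a < N \<Longrightarrow> mem \<sigma> a = mu a" using assms(1) unfolding agrees_def by blast
  have three: "(\<exists>j<3. P j) \<longleftrightarrow> P 0 \<or> P 1 \<or> P (2::nat)" for P by (auto simp: numeral_3_eq_3 less_Suc_eq numeral_2_eq_2)
  have all3: "(\<forall>j<3. P j) \<longleftrightarrow> P 0 \<and> P 1 \<and> P (2::nat)" for P by (auto simp: numeral_3_eq_3 less_Suc_eq numeral_2_eq_2)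
  have Fx: "mu (p + 5) = c 0 x" "mu (p + 6) = d 0 x" "mu (p + 9) = c 1 x" "mu (p + 10) = d 1 x" "mu (p + 13) = c 2 x" "mu (p + 14) = d 2 x"
    using fields[OF assms(4)] unfolding p_def all3 by auto
  have Fy: "mu (q + 3) = L 0 y" "mu (q + 4) = U 0 y" "mu (q + 7) = L 1 y" "mu (q + 8) = U 1 y" "mu (q + 11) = L 2 y" "mu (q + 12) = U 2 y"
    using fields[OF assms(5)] unfolding q_def all3 by auto
  have M: "mem \<sigma> (p + a) = mu (p + a)" "mem \<sigma> (q + a) = mu (q + a)" if "a \<le> 14" for a using ag bnd that by auto
  show "regs (run w (test_changed Px Py R) \<sigma>) R = (if changed L U c d x y then 1 else 0)"
    unfolding r v3 v2 v1 mm f0(2) changed_def three by (simp add: M Fx Fy del: One_nat_def)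
qed

lemma lookup_correct:
  assumes "agrees \<sigma>" "regs \<sigma> 0 = x" "regs \<sigma> 1 = y" "x < m" "y < m" "fb y \<le> 1"
  shows "halts w lookup_prog \<sigma> (csize lookup_prog) (\<lambda>\<tau>. regs \<tau> 0 = (if (fb y = 1) \<noteq> changed L U c d x y then 1 else 0))"
proof (rule halts_run)
  show "loopfree lookup_prog" by (simp add: lookup_prog_def locate_def test_changed_def test_channel_def)
  define \<sigma>1 where "\<sigma>1 = run w (locate 0 20) \<sigma>"
  define \<sigma>2 where "\<sigma>2 = run w (locate 1 21) \<sigma>1"
  define \<sigma>3 where "\<sigma>3 = run w (test_changed 20 21 22) \<sigma>2"
  have 1: "frame ({8..19} \<union> {20}) \<sigma> \<sigma>1" "regs \<sigma>1 20 = ptr x"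
    unfolding \<sigma>1_def using run_locate[OF assms(1,2,4), of 20] by auto
  have a1: "agrees \<sigma>1" using agrees_frame[OF assms(1) 1(1)] .
  have "regs \<sigma>1 1 = y" using 1(1) assms(3) unfolding frame_def by simp
  then have 2: "frame ({8..19} \<union> {21}) \<sigma>1 \<sigma>2" "regs \<sigma>2 21 = ptr y"
    unfolding \<sigma>2_def using run_locate[OF a1 _ assms(5), of 1 21] by auto
  have a2: "agrees \<sigma>2" using agrees_frame[OF a1 2(1)] .
  have "regs \<sigma>2 20 = ptr x" using 2(1) 1(2) unfolding frame_def by simp
  then have 3: "frame ({8..19} \<union> {22}) \<sigma>2 \<sigma>3" "regs \<sigma>3 22 = (if changed L U c d x y then 1 else 0)"
    unfolding \<sigma>3_def using run_test_changed[OF a2 _ 2(2) assms(4,5), of 20 22] by auto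
  have a3: "agrees \<sigma>3" using agrees_frame[OF a2 3(1)] .
  have p: "regs \<sigma>3 21 = ptr y" using 3(1) 2(2) unfolding frame_def by simp
  have b: "ptr y + 1 < N" "mu (ptr y + 1) = fb y" using fields[OF assms(5)] by auto
  have b': "ptr y + 1 < 2 ^ w" using b(1) N_less by linarith
  have m: "mem \<sigma>3 (ptr y + 1) = fb y" using a3 b unfolding agrees_def by simp
  have "run w lookup_prog \<sigma> = run w (Cond (Eq 23 22) (Const 0 0) (Const 0 1)) (run w (ldf 23 21 1) \<sigma>3)"
    unfolding lookup_prog_def \<sigma>3_def \<sigma>2_def \<sigma>1_def by simp
  then show "regs (run w lookup_prog \<sigma>) 0 = (if (fb y = 1) \<noteq> changed L U c d x y then 1 else 0)"
    using p b' m 3(2) assms(6) w_pos by (auto simp del: One_nat_def)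
qed simp

end

section \<open>Blocks\<close>

text \<open>
  A block starts with the addresses of its first entry and of its end, followed by the heads of the adjacency lists of
  all vertices. Each arc has two entries, one per direction, with the cells: arc, source, target, toggle value that makes
  the entry a residual arc, next entry of the adjacency list, and whether the arc lies on the path of the block.
\<close>

fun linked :: "(nat \<Rightarrow> nat) \<Rightarrow> nat \<Rightarrow> nat list \<Rightarrow> bool" where
  "linked f p [] \<longleftrightarrow> p = 0"
| "linked f p (x # xs) \<longleftrightarrow> p = x \<and> x \<noteq> 0 \<and> linked f (f (x + 4)) xs"

definition forblk :: "nat \<Rightarrow> com \<Rightarrow> com" where
  "forblk B body = seqs [ldf 50 B 0, ldf 51 B 1, While (Less 50 51) (seqs [body, Const 8 6, Op Add 50 50 8])]"

text \<open>The failed arc is skipped: it counts as changed when its path is dropped, but it is no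
  arc of the remaining graph.\<close>

definition report1 :: com where
  "report1 = seqs [Const 61 1, locate 1 20, ldf 30 20 2, Cond (Eq 30 60) Skip
     (forblk 30 (seqs [Load 33 50, locate 33 21, test_changed 20 21 22,
        Cond (Eq 22 61) (Cond (Eq 33 1) Skip (Emit 33)) Skip]))]"

context dict_mem
begin

definition entries :: "nat \<Rightarrow> nat \<Rightarrow> nat list" where
  "entries st M = map (\<lambda>q. st + 6 * q) [0..<M]"

definition block_ok :: "nat \<Rightarrow> nat \<Rightarrow> nat \<Rightarrow> nat \<Rightarrow> bool" where
  "block_ok n b st M \<longleftrightarrow> b \<noteq> 0 \<and> st \<noteq> 0 \<and> mu b = st \<and> mu (b + 1) = st + 6 * M \<and> st + 6 * M \<le> N \<and> b + 2 + n \<le> N \<and>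
     (\<forall>e\<in>set (entries st M). mu e < m \<and> mu (e + 1) < n \<and> mu (e + 2) < n) \<and>
     (\<forall>v<n. linked mu (mu (b + 2 + v)) (filter (\<lambda>e. mu (e + 1) = v) (entries st M)))"

text \<open>The index of \<open>P\<close> counts the processed entries. \<open>P\<close> has to
  survive writes to the registers 8, 50 and 51, which belong to the loop itself.\<close>

lemma halts_forblk:
  fixes P :: "nat \<Rightarrow> state \<Rightarrow> bool"
  assumes blk: "block_ok n b st M" and \<sigma>: "agrees \<sigma>" "regs \<sigma> B = b" "B \<noteq> 8" "B \<noteq> 50" and lf: "loopfree body"
    and init: "P 0 \<sigma>"
    and stable: "\<And>q \<sigma> \<tau>. P q \<sigma> \<Longrightarrow> frame {8, 50, 51} \<sigma> \<tau> \<Longrightarrow> P q \<tau>"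
    and step: "\<And>q \<sigma>. q < M \<Longrightarrow> agrees \<sigma> \<Longrightarrow> regs \<sigma> 50 = st + 6 * q \<Longrightarrow> P q \<sigma> \<Longrightarrow>
      agrees (run w body \<sigma>) \<and> regs (run w body \<sigma>) 50 = regs \<sigma> 50 \<and> regs (run w body \<sigma>) 51 = regs \<sigma> 51 \<and>
      P (q + 1) (run w body \<sigma>)"
  shows "halts w (forblk B body) \<sigma> ((csize body + 4) * M + 10) (\<lambda>\<tau>. agrees \<tau> \<and> P M \<tau>)"
proof -
  have b: "b + 1 < N" "mu b = st" "mu (b + 1) = st + 6 * M" "st + 6 * M \<le> N" using blk unfolding block_ok_def by auto
  have bw: "b + 1 < 2 ^ w" "b < 2 ^ w" "st + 6 * M < 2 ^ w" "6 < (2::nat) ^ w" using b N_less N_ge by linarith+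
  let ?c = "seqs [body, Const 8 6, Op Add 50 50 8]"
  define I :: "nat \<Rightarrow> state \<Rightarrow> bool" where "I j \<sigma> \<longleftrightarrow> (\<exists>q. q + j = M \<and> agrees \<sigma> \<and> regs \<sigma> 50 = st + 6 * q \<and> regs \<sigma> 51 = st + 6 * M \<and> P q \<sigma>)" for j \<sigma>
  define \<sigma>1 where "\<sigma>1 = run w (ldf 51 B 1) (run w (ldf 50 B 0) \<sigma>)"
  have mb: "mem \<sigma> b = st" "mem \<sigma> (b + 1) = st + 6 * M" using \<sigma>(1) b unfolding agrees_def by auto
  have s1: "\<sigma>1 = \<sigma>\<lparr>regs := (regs \<sigma>)(50 := st, 8 := b + 1, 51 := st + 6 * M)\<rparr>"
    unfolding \<sigma>1_def using \<sigma>(2-4) bw mb by (simp add: fun_upd_twist)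
  have fr: "frame {8, 50, 51} \<sigma> \<sigma>1" unfolding s1 frame_def by simp
  have I1: "I M \<sigma>1" unfolding I_def using agrees_frame[OF \<sigma>(1) fr] stable[OF init fr] s1 by (intro exI[of _ 0]) simp
  have "halts w (While (Less 50 51) ?c) \<sigma>1 ((csize ?c + 1) * M + 1) (\<lambda>\<tau>. \<not> test_val (Less 50 51) \<tau> \<and> (\<exists>j. I j \<tau>))"
  proof (rule halts_While[where I = I, OF _ _ I1])
    show "loopfree ?c" using lf by simp
    fix j \<sigma> assume a: "I j \<sigma>" "test_val (Less 50 51) \<sigma>"
    then obtain q where q: "q + j = M" "agrees \<sigma>" "regs \<sigma> 50 = st + 6 * q" "regs \<sigma> 51 = st + 6 * M" "P q \<sigma>" unfolding I_def by blast
    have qM: "q < M" using a(2) q by simp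
    let ?s = "run w body \<sigma>"
    have s: "agrees ?s" "regs ?s 50 = st + 6 * q" "regs ?s 51 = st + 6 * M" "P (q + 1) ?s" using step[OF qM q(2,3,5)] q by auto
    have lt: "st + 6 * q + 6 < 2 ^ w" using qM bw by linarith
    have r: "run w ?c \<sigma> = ?s\<lparr>regs := (regs ?s)(8 := 6, 50 := st + 6 * q + 6)\<rparr>" using s(2) lt bw by simp
    have f: "frame {8, 50, 51} ?s (run w ?c \<sigma>)" unfolding r frame_def by simp
    have "I (j - 1) (run w ?c \<sigma>)" unfolding I_def
      using agrees_frame[OF s(1) f] stable[OF s(4) f] s(3) q(1) qM by (intro exI[of _ "q + 1"] conjI) (simp_all add: r del: run.simps seqs.simps)
    moreover have "j - 1 < j" using q qM by simp
    ultimately show "\<exists>j'<j. I j' (run w ?c \<sigma>)" by blast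
  qed
  moreover have "agrees \<tau> \<and> P M \<tau>" if "\<not> test_val (Less 50 51) \<tau> \<and> (\<exists>j. I j \<tau>)" for \<tau>
    using that unfolding I_def by auto
  ultimately have h: "halts w (While (Less 50 51) ?c) \<sigma>1 ((csize ?c + 1) * M + 1) (\<lambda>\<tau>. agrees \<tau> \<and> P M \<tau>)"
    by (rule halts_weaken[OF _ order_refl]) blast
  have eq: "forblk B body = Seq (ldf 50 B 0) (Seq (ldf 51 B 1) (Seq (While (Less 50 51) ?c) Skip))"
    by (simp add: forblk_def)
  have "halts w (forblk B body) \<sigma> ((csize ?c + 1) * M + 10) (\<lambda>\<tau>. agrees \<tau> \<and> P M \<tau>)"
    unfolding eq
    by (rule halts_Seq_run[OF loopfree_ldf(1) halts_Seq_run[OF loopfree_ldf(1) halts_Seq_Skip[OF h[unfolded \<sigma>1_def]] order_refl]]) simp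
  then show ?thesis by (rule halts_weaken) (auto simp: algebra_simps)
qed

lemma report1_correct:
  assumes \<sigma>: "agrees \<sigma>" "regs \<sigma> 1 = x" "x < m" "regs \<sigma> 60 = 0" "out \<sigma> = []"
    and blk: "blk x \<noteq> 0 \<Longrightarrow> block_ok n (blk x) st M"
  shows "halts w report1 \<sigma> (csize report1 + (csize (locate 33 21) + 100) * M + 100)
    (\<lambda>\<tau>. set (out \<tau>) = (if blk x = 0 then {} else {y \<in> mu ` set (entries st M). changed L U c d x y \<and> y \<noteq> x}))"
proof -
  define \<sigma>0 where "\<sigma>0 = run w (Const 61 1) \<sigma>"
  define \<sigma>1 where "\<sigma>1 = run w (locate 1 20) \<sigma>0"
  define \<sigma>2 where "\<sigma>2 = run w (ldf 30 20 2) \<sigma>1"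
  have 0: "frame {61} \<sigma> \<sigma>0" "regs \<sigma>0 61 = 1" using w_pos unfolding \<sigma>0_def frame_def by auto
  have a0: "agrees \<sigma>0" using agrees_frame[OF \<sigma>(1) 0(1)] .
  have "regs \<sigma>0 1 = x" using 0(1) \<sigma>(2) unfolding frame_def by simp
  then have 1: "frame ({8..19} \<union> {20}) \<sigma>0 \<sigma>1" "regs \<sigma>1 20 = ptr x"
    unfolding \<sigma>1_def using run_locate[OF a0 _ \<sigma>(3), of 1 20] by auto
  have a1: "agrees \<sigma>1" using agrees_frame[OF a0 1(1)] .
  have b: "ptr x + 2 < N" "mu (ptr x + 2) = blk x" using fields[OF \<sigma>(3)] by auto
  have bw: "ptr x + 2 < 2 ^ w" using b(1) N_less by linarith
  have m2: "mem \<sigma>1 (ptr x + 2) = blk x" using a1 b unfolding agrees_def by simp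
  have s2: "\<sigma>2 = \<sigma>1\<lparr>regs := (regs \<sigma>1)(8 := ptr x + 2, 30 := blk x)\<rparr>"
    unfolding \<sigma>2_def using 1(2) bw m2 by simp
  have r2: "agrees \<sigma>2" "regs \<sigma>2 30 = blk x" "regs \<sigma>2 60 = 0" "regs \<sigma>2 61 = 1" "regs \<sigma>2 20 = ptr x" "regs \<sigma>2 1 = x" "out \<sigma>2 = []"
    using a1 0 1 \<sigma> unfolding s2 agrees_def frame_def by auto
  let ?body = "seqs [Load 33 50, locate 33 21, test_changed 20 21 22, Cond (Eq 22 61) (Cond (Eq 33 1) Skip (Emit 33)) Skip]"
  let ?Q = "\<lambda>\<tau>. set (out \<tau>) = (if blk x = 0 then {} else {y \<in> mu ` set (entries st M). changed L U c d x y \<and> y \<noteq> x})"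
  have main: "halts w (forblk 30 ?body) \<sigma>2 ((csize ?body + 4) * M + 10) ?Q" if nz: "blk x \<noteq> 0"
  proof -
    have blk': "block_ok n (blk x) st M" using blk nz .
    define P :: "nat \<Rightarrow> state \<Rightarrow> bool" where "P q \<sigma> \<longleftrightarrow> regs \<sigma> 20 = ptr x \<and> regs \<sigma> 1 = x \<and> regs \<sigma> 61 = 1 \<and>
      set (out \<sigma>) = {y. \<exists>i<q. y = mu (st + 6 * i) \<and> changed L U c d x y \<and> y \<noteq> x}" for q \<sigma>
    have "halts w (forblk 30 ?body) \<sigma>2 ((csize ?body + 4) * M + 10) (\<lambda>\<tau>. agrees \<tau> \<and> P M \<tau>)"
    proof (rule halts_forblk[OF blk'])
      show "P 0 \<sigma>2" unfolding P_def using r2 by simp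
      show "\<And>q \<sigma> \<tau>. P q \<sigma> \<Longrightarrow> frame {8, 50, 51} \<sigma> \<tau> \<Longrightarrow> P q \<tau>" unfolding P_def frame_def by simp
      fix q \<sigma> assume q: "q < M" "agrees \<sigma>" "regs \<sigma> 50 = st + 6 * q" "P q \<sigma>"
      define y where "y = mu (st + 6 * q)"
      have qe: "st + 6 * q \<in> set (entries st M)" using q(1) unfolding entries_def by auto
      have ym: "y < m" using blk' qe unfolding block_ok_def y_def by blast
      have "st + 6 * q < N" using q(1) blk' unfolding block_ok_def by auto
      then have my: "mem \<sigma> (st + 6 * q) = y" using q(2) unfolding agrees_def y_def by simp
      define \<tau>1 where "\<tau>1 = run w (Load 33 50) \<sigma>"
      define \<tau>2 where "\<tau>2 = run w (locate 33 21) \<tau>1"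
      define \<tau>3 where "\<tau>3 = run w (test_changed 20 21 22) \<tau>2"
      have t1: "frame {33} \<sigma> \<tau>1" "regs \<tau>1 33 = y" unfolding \<tau>1_def frame_def using q(3) my by auto
      have g1: "agrees \<tau>1" using agrees_frame[OF q(2) t1(1)] .
      have t2: "frame ({8..19} \<union> {21}) \<tau>1 \<tau>2" "regs \<tau>2 21 = ptr y"
        unfolding \<tau>2_def using run_locate[OF g1 t1(2) ym, of 21] by auto
      have g2: "agrees \<tau>2" using agrees_frame[OF g1 t2(1)] .
      have "regs \<tau>2 20 = ptr x" using t1 t2 q(4) unfolding P_def frame_def by auto
      then have t3: "frame ({8..19} \<union> {22}) \<tau>2 \<tau>3" "regs \<tau>3 22 = (if changed L U c d x y then 1 else 0)"
        unfolding \<tau>3_def using run_test_changed[OF g2 _ t2(2) \<sigma>(3) ym, of 20 22] by auto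
      have g3: "agrees \<tau>3" using agrees_frame[OF g2 t3(1)] .
      have k: "regs \<tau>3 33 = y" "regs \<tau>3 1 = x" "regs \<tau>3 61 = 1" "regs \<tau>3 20 = ptr x" "regs \<tau>3 50 = regs \<sigma> 50" "regs \<tau>3 51 = regs \<sigma> 51" "out \<tau>3 = out \<sigma>"
        using t1 t2 t3 q(4) unfolding P_def frame_def by auto
      have r: "run w ?body \<sigma> = (if changed L U c d x y \<and> y \<noteq> x then \<tau>3\<lparr>out := out \<tau>3 @ [y]\<rparr> else \<tau>3)"
        unfolding seqs.simps run.simps \<tau>1_def[unfolded run.simps, symmetric] \<tau>2_def[symmetric] \<tau>3_def[symmetric] using k t3(2) by auto
      have "{y. \<exists>i<q + 1. y = mu (st + 6 * i) \<and> changed L U c d x y \<and> y \<noteq> x} =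
        {y. \<exists>i<q. y = mu (st + 6 * i) \<and> changed L U c d x y \<and> y \<noteq> x} \<union> {z. z = y \<and> changed L U c d x y \<and> y \<noteq> x}"
        unfolding y_def by (auto simp: less_Suc_eq)
      then show "agrees (run w ?body \<sigma>) \<and> regs (run w ?body \<sigma>) 50 = regs \<sigma> 50 \<and> regs (run w ?body \<sigma>) 51 = regs \<sigma> 51 \<and> P (q + 1) (run w ?body \<sigma>)"
        unfolding r P_def using k g3 q(4) unfolding P_def agrees_def by auto
    qed (use r2 in \<open>auto simp: locate_def test_changed_def test_channel_def\<close>)
    then show ?thesis
    proof (rule halts_weaken[OF _ order_refl])
      fix \<tau> assume "agrees \<tau> \<and> P M \<tau>"
      then show "?Q \<tau>" using nz unfolding P_def entries_def by auto
    qed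
  qed
  let ?C = "Cond (Eq 30 60) Skip (forblk 30 ?body)"
  have h: "halts w ?C \<sigma>2 ((csize ?body + 4) * M + 11) ?Q"
    by (rule halts_Cond[of _ _ _ _ "(csize ?body + 4) * M + 10"]) (use r2 main in \<open>auto intro: halts_run\<close>)
  have lf: "loopfree (locate 1 20)" by (simp add: locate_def)
  have eq: "report1 = Seq (Const 61 1) (Seq (locate 1 20) (Seq (ldf 30 20 2) (Seq ?C Skip)))"
    by (simp add: report1_def)
  have h3: "halts w report1 \<sigma> (csize (locate 1 20) + (csize ?body + 4) * M + 17) ?Q"
    unfolding eq
    by (rule halts_Seq_run[OF _ halts_Seq_run[OF lf halts_Seq_run[OF loopfree_ldf(1) halts_Seq_Skip[OF h[unfolded \<sigma>2_def \<sigma>1_def \<sigma>0_def]] order_refl] order_refl]]) simp_all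
  have cs: "csize ?body + 4 \<le> csize (locate 33 21) + 100" "csize (locate 1 20) \<le> csize report1"
    by (auto simp: test_changed_def test_channel_def report1_def)
  have "(csize ?body + 4) * M \<le> (csize (locate 33 21) + 100) * M" using cs(1) by (rule mult_le_mono1)
  then have "csize (locate 1 20) + (csize ?body + 4) * M + 17 \<le> csize report1 + (csize (locate 33 21) + 100) * M + 100" using cs(2) by linarith
  then show ?thesis by (rule halts_weaken[OF h3])
qed

end

section \<open>Search and augmentation\<close>

text \<open>
  The working memory behind the data structure is all zero at the start, so that no initialization is needed. It consists of
  a toggle table for the arcs at \<open>N\<close> (\<open>0\<close> unchanged, \<open>1\<close> changed, \<open>2\<close> failed), one table of parent entries per round at
  \<open>N + m\<close> and \<open>N + m + n\<close> (\<open>0\<close> for unvisited vertices), and a stack of suffixes of adjacency lists.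
\<close>

definition push :: "nat \<Rightarrow> nat \<Rightarrow> com" where
  "push B V = seqs [Op Add 52 B V, ldf 53 52 2, Store 45 53, Op Add 45 45 61]"

definition visit :: com where
  "visit = seqs [ldf 54 50 2, Op Add 55 41 54, Load 53 55,
     Cond (Eq 53 60) (seqs [Store 55 50, push 30 54, push 31 54]) Skip]"

text \<open>The list on top of the stack is replaced by its tail before the entry is examined, so a
  visit can simply push the lists of the new vertex.\<close>

definition search_body :: com where
  "search_body = seqs [Op Sub 45 45 61, Load 50 45,
     Cond (Eq 50 60) Skip (seqs [ldf 53 50 4, Store 45 53, Op Add 45 45 61,
       Load 51 50, Op Add 51 51 40, Load 51 51, ldf 52 50 3, Cond (Eq 51 52) visit Skip])]"

text \<open>The parent value 1 of the source is no entry; it only marks the source as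
  visited.\<close>

definition search :: com where
  "search = seqs [Op Add 52 41 43, Store 52 61, Op Add 45 42 60, push 30 43, push 31 43,
     While (Less 42 45) search_body]"

definition aug_body :: com where
  "aug_body = seqs [Op Add 52 41 54, Load 50 52, Load 51 50, Op Add 51 51 40, Load 52 51, Op Sub 52 61 52,
     Store 51 52, ldf 54 50 1, Cond (Eq 54 43) (Const 55 0) Skip]"

definition augment :: com where
  "augment = seqs [Op Add 52 41 44, Load 53 52, Cond (Eq 53 60) Skip
     (seqs [Op Add 54 44 60, Const 55 1, While (Eq 55 61) aug_body])]"

lemma bop_val_Sub: "b \<le> a \<Longrightarrow> a < 2 ^ w \<Longrightarrow> bop_val w Sub a b = a - b"
proof -
  assume a: "b \<le> a" "a < 2 ^ w"
  have "int a - int b = int (a - b)" using a by simp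
  moreover have "int (a - b) mod 2 ^ w = int (a - b)"
  proof (rule mod_pos_pos_trivial)
    have "a - b < 2 ^ w" using a by simp
    then have "int (a - b) < int (2 ^ w)" by presburger
    then show "int (a - b) < 2 ^ w" by simp
  qed simp
  ultimately show ?thesis by (simp only: bop_val.simps nat_int)
qed

lemma bop_val_Add: "a + b < 2 ^ w \<Longrightarrow> bop_val w Add a b = a + b"
  by simp

text \<open>The two blocks may overlap or coincide. By \<open>orient\<close>, the toggle value under
  which an arc can be traversed fixes the direction, so a single search never uses an arc both ways.
  \<open>space\<close> keeps all addresses up to the top of the stack below the word bound.\<close>

locale blocks_mem = dict_mem +
  fixes n s t b1 st1 M1 b2 st2 M2 :: nat
  assumes blocks: "block_ok n b1 st1 M1" "block_ok n b2 st2 M2"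
    and st: "s < n" "t < n" "s \<noteq> t"
    and space: "N + m + 2 * n + (M1 + M2 + 2 * n) + 4 < 2 ^ w"
    and orient: "e \<in> set (entries st1 M1) \<union> set (entries st2 M2) \<Longrightarrow> e' \<in> set (entries st1 M1) \<union> set (entries st2 M2) \<Longrightarrow>
      mu e = mu e' \<Longrightarrow> mu (e + 3) = mu (e' + 3) \<Longrightarrow> mu (e + 2) = mu (e' + 2)"
    and gbit: "e \<in> set (entries st1 M1) \<union> set (entries st2 M2) \<Longrightarrow> mu (e + 3) \<le> 1"
begin

definition ent :: "nat set" where "ent = set (entries st1 M1) \<union> set (entries st2 M2)"
definition ch1 :: "nat \<Rightarrow> nat list" where "ch1 v = filter (\<lambda>e. mu (e + 1) = v) (entries st1 M1)"
definition ch2 :: "nat \<Rightarrow> nat list" where "ch2 v = filter (\<lambda>e. mu (e + 1) = v) (entries st2 M2)"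
definition S :: nat where "S = N + m + 2 * n"

definition cregs :: "nat \<Rightarrow> state \<Rightarrow> bool" where
  "cregs V \<sigma> \<longleftrightarrow> regs \<sigma> 30 = b1 \<and> regs \<sigma> 31 = b2 \<and> regs \<sigma> 40 = N \<and> regs \<sigma> 41 = V \<and> regs \<sigma> 42 = S \<and>
     regs \<sigma> 43 = s \<and> regs \<sigma> 44 = t \<and> regs \<sigma> 60 = 0 \<and> regs \<sigma> 61 = 1"

lemma ent_facts: "e \<in> ent \<Longrightarrow> e \<noteq> 0 \<and> e + 5 < N \<and> mu e < m \<and> mu (e + 1) < n \<and> mu (e + 2) < n \<and> mu (e + 3) \<le> 1"
  using blocks gbit[of e] unfolding ent_def block_ok_def by (auto simp: entries_def)

lemma linked_heads: "v < n \<Longrightarrow> linked mu (mu (b1 + v + 2)) (ch1 v)" "v < n \<Longrightarrow> linked mu (mu (b2 + v + 2)) (ch2 v)"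
  using blocks unfolding block_ok_def ch1_def ch2_def by (auto simp: add.commute add.left_commute)

lemma b_bounds: "v < n \<Longrightarrow> b1 + v + 2 < N" "v < n \<Longrightarrow> b2 + v + 2 < N"
  using blocks unfolding block_ok_def by auto

lemma ch_ent: "e \<in> set (ch1 v) \<union> set (ch2 v) \<longleftrightarrow> e \<in> ent \<and> mu (e + 1) = v"
  unfolding ch1_def ch2_def ent_def by auto

definition usable :: "(nat \<Rightarrow> nat) \<Rightarrow> nat \<Rightarrow> bool" where
  "usable tog e \<longleftrightarrow> tog (mu e) = mu (e + 3)"

text \<open>Each new vertex is fresh, so these paths are simple; this bounds their length by
  \<open>n\<close> and with it the time of an augmentation.\<close>

inductive tpath :: "(nat \<Rightarrow> nat) \<Rightarrow> (nat \<Rightarrow> nat) \<Rightarrow> nat \<Rightarrow> nat list \<Rightarrow> bool" for tog par where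
  tpath_source: "tpath tog par s []"
| tpath_step: "tpath tog par p es \<Longrightarrow> e \<in> ent \<Longrightarrow> usable tog e \<Longrightarrow> mu (e + 1) = p \<Longrightarrow> q = mu (e + 2) \<Longrightarrow> q \<noteq> s \<Longrightarrow>
    q \<notin> (\<lambda>e. mu (e + 2)) ` set es \<Longrightarrow> par q = e \<Longrightarrow> tpath tog par q (es @ [e])"

lemma tpath_par: "tpath tog par q es \<Longrightarrow> e \<in> set es \<Longrightarrow> par (mu (e + 2)) = e \<and> e \<in> ent \<and> usable tog e"
proof (induction rule: tpath.induct)
  case (tpath_step p es e' q)
  have "par (mu (e' + 2)) = e'" using tpath_step.hyps(5,8) by (rule subst)
  moreover have "e = e' \<or> e \<in> set es" using tpath_step.prems by (metis Un_iff empty_iff list.set(1) set_ConsD set_append)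
  ultimately show ?case using tpath_step.IH tpath_step.hyps(2,3) by blast
next
  case tpath_source
  then show ?case by (metis empty_iff list.set(1))
qed

lemma tpath_mono:
  assumes "tpath tog par q es" "\<And>v. par v \<noteq> 0 \<Longrightarrow> par' v = par v"
  shows "tpath tog par' q es"
  using assms(1)
proof (induction rule: tpath.induct)
  case (tpath_step p es e q)
  have "e \<noteq> 0" using ent_facts[OF tpath_step.hyps(2)] by blast
  then have "par' q = e" using assms(2)[of q] tpath_step.hyps(8) by metis
  then show ?case using tpath.tpath_step[OF tpath_step.IH tpath_step.hyps(2-7)] by blast
qed (rule tpath_source)

text \<open>The potential that bounds the number of search steps; every step decreases it.\<close>

definition pot :: "(nat \<Rightarrow> nat) \<Rightarrow> nat list list \<Rightarrow> nat" where
  "pot par xss = (\<Sum>xs\<leftarrow>xss. length xs + 1) + (\<Sum>v | v < n \<and> par v = 0. length (ch1 v) + length (ch2 v) + 2)"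

lemma length_le_pot: "length xss \<le> pot par xss"
  unfolding pot_def by (induction xss) auto

lemma sum_length_filter: "(\<And>e. e \<in> set es \<Longrightarrow> f e < n) \<Longrightarrow> (\<Sum>v<n. length (filter (\<lambda>e. f e = v) es)) = length es"
proof (induction es)
  case (Cons a es)
  have "(\<Sum>v<n. length (filter (\<lambda>e. f e = v) (a # es))) = (\<Sum>v<n. (if v = f a then 1 else 0) + length (filter (\<lambda>e. f e = v) es))"
    by (intro sum.cong) auto
  also have "\<dots> = 1 + length es" using Cons by (simp add: sum.distrib)
  finally show ?case by simp
qed simp

lemma pot_total: "(\<Sum>v<n. length (ch1 v) + length (ch2 v) + 2) = M1 + M2 + 2 * n"
proof -
  have l: "length (entries st M) = M" for st M by (simp add: entries_def)
  have "(\<Sum>v<n. length (ch1 v)) = M1" unfolding ch1_def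
    using sum_length_filter[of "entries st1 M1" "\<lambda>e. mu (e + 1)"] blocks(1) unfolding l block_ok_def by blast
  moreover have "(\<Sum>v<n. length (ch2 v)) = M2" unfolding ch2_def
    using sum_length_filter[of "entries st2 M2" "\<lambda>e. mu (e + 1)"] blocks(2) unfolding l block_ok_def by blast
  ultimately show ?thesis by (simp only: sum.distrib) simp
qed

text \<open>Pushing the two adjacency lists of \<open>v\<close> costs what \<open>v\<close>
  contributed while unvisited; its 2 pays for removing the two lists when they are
  exhausted.\<close>

lemma pot_visit:
  assumes "v < n" "par v = 0" "z \<noteq> 0"
  shows "pot (par(v := z)) (xss @ [xs, ys]) + (length (ch1 v) + length (ch2 v)) = pot par xss + length xs + length ys"
proof -
  let ?f = "\<lambda>v. length (ch1 v) + length (ch2 v) + 2"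
  have "{u. u < n \<and> par u = 0} = insert v {u. u < n \<and> (par(v := z)) u = 0}" using assms by auto
  moreover have "v \<notin> {u. u < n \<and> (par(v := z)) u = 0}" using assms by auto
  ultimately have "(\<Sum>u | u < n \<and> par u = 0. ?f u) = ?f v + (\<Sum>u | u < n \<and> (par(v := z)) u = 0. ?f u)" by simp
  then show ?thesis unfolding pot_def by simp
qed

text \<open>Once the stack is empty, the third conjunct says that the visited vertices are closed
  under usable entries, so they form a cut if \<open>t\<close> is not among them.\<close>

definition good :: "(nat \<Rightarrow> nat) \<Rightarrow> (nat \<Rightarrow> nat) \<Rightarrow> nat list list \<Rightarrow> bool" where
  "good tog par xss \<longleftrightarrow> par s \<noteq> 0 \<and>
     (\<forall>q<n. par q \<noteq> 0 \<longrightarrow> (\<exists>es. tpath tog par q es)) \<and>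
     (\<forall>e\<in>ent. par (mu (e + 1)) \<noteq> 0 \<longrightarrow> usable tog e \<longrightarrow> par (mu (e + 2)) \<noteq> 0 \<or> (\<exists>xs\<in>set xss. e \<in> set xs)) \<and>
     (\<forall>xs\<in>set xss. \<forall>e\<in>set xs. e \<in> ent \<and> par (mu (e + 1)) \<noteq> 0)"

lemma good_visit:
  assumes "good tog par (ys @ [e # xs])" "usable tog e" "par (mu (e + 2)) = 0"
  shows "good tog (par(mu (e + 2) := e)) (ys @ [xs, ch1 (mu (e + 2)), ch2 (mu (e + 2))])"
proof -
  let ?q = "mu (e + 2)" and ?par = "par(mu (e + 2) := e)"
  have e: "e \<in> ent" "par (mu (e + 1)) \<noteq> 0" using assms(1) unfolding good_def by auto
  have e0: "e \<noteq> 0" "mu (e + 1) < n" using ent_facts[OF e(1)] by auto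
  have sq: "?q \<noteq> s" using assms unfolding good_def by auto
  have mono: "\<And>v. par v \<noteq> 0 \<Longrightarrow> ?par v = par v" using assms(3) by auto
  obtain es where es: "tpath tog par (mu (e + 1)) es" using assms(1) e e0 unfolding good_def by blast
  \<comment> \<open>A vertex on the tree path has its entry recorded as parent, and entries have
    nonzero addresses.\<close>
  have "?q \<notin> (\<lambda>e. mu (e + 2)) ` set es"
  proof
    assume "?q \<in> (\<lambda>e. mu (e + 2)) ` set es"
    then obtain e' where "e' \<in> set es" "mu (e' + 2) = ?q" by auto
    then have "par ?q = e'" "e' \<in> ent" using tpath_par[OF es, of e'] by metis+
    then show False using ent_facts assms(3) by auto
  qed
  then have tq: "tpath tog ?par ?q (es @ [e])"
    by (intro tpath.tpath_step[OF tpath_mono[OF es mono] e(1) assms(2)] sq) auto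
  have "\<exists>es. tpath tog ?par q es" if q: "q < n" "?par q \<noteq> 0" for q
  proof (cases "q = ?q")
    case True then show ?thesis using tq by blast
  next
    case False
    then obtain es' where "tpath tog par q es'" using q assms(1) unfolding good_def by auto
    then show ?thesis using tpath_mono[of tog par q es' ?par] mono by blast
  qed
  moreover have "?par (mu (f + 2)) \<noteq> 0 \<or> (\<exists>zs\<in>set (ys @ [xs, ch1 ?q, ch2 ?q]). f \<in> set zs)"
    if f: "f \<in> ent" "?par (mu (f + 1)) \<noteq> 0" "usable tog f" for f
  proof (cases "mu (f + 1) = ?q")
    case True
    then have "f \<in> set (ch1 ?q) \<union> set (ch2 ?q)" using ch_ent f(1) by blast
    then show ?thesis by auto
  next
    case False
    then have "par (mu (f + 2)) \<noteq> 0 \<or> (\<exists>zs\<in>set (ys @ [e # xs]). f \<in> set zs)" using f assms(1) unfolding good_def by auto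
    then show ?thesis using e0 by auto
  qed
  moreover have "f \<in> ent \<and> ?par (mu (f + 1)) \<noteq> 0" if zs: "zs \<in> set (ys @ [xs, ch1 ?q, ch2 ?q])" "f \<in> set zs" for f zs
  proof (cases "zs \<in> set (ys @ [xs])")
    case True
    then have "f \<in> ent \<and> par (mu (f + 1)) \<noteq> 0" using zs(2) assms(1) unfolding good_def by auto
    then show ?thesis using e0 by auto
  next
    case False
    then have "f \<in> set (ch1 ?q) \<union> set (ch2 ?q)" using zs by auto
    then have "f \<in> ent" "mu (f + 1) = ?q" using ch_ent by blast+
    then show ?thesis using e0 by simp
  qed
  ultimately show ?thesis unfolding good_def using e0 sq assms(1) unfolding good_def by simp
qed

lemma good_skip:
  assumes "good tog par (ys @ [e # xs])" "\<not> usable tog e \<or> par (mu (e + 2)) \<noteq> 0"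
  shows "good tog par (ys @ [xs])"
proof -
  have "par (mu (f + 2)) \<noteq> 0 \<or> (\<exists>zs\<in>set (ys @ [xs]). f \<in> set zs)"
    if "f \<in> ent" "par (mu (f + 1)) \<noteq> 0" "usable tog f" for f
  proof -
    have "par (mu (f + 2)) \<noteq> 0 \<or> (\<exists>zs\<in>set (ys @ [e # xs]). f \<in> set zs)" using that assms(1) unfolding good_def by blast
    then show ?thesis using assms(2) that(3) by (cases "f = e") auto
  qed
  moreover have "f \<in> ent \<and> par (mu (f + 1)) \<noteq> 0" if "zs \<in> set (ys @ [xs])" "f \<in> set zs" for f zs
    using that assms(1) unfolding good_def by auto
  ultimately show ?thesis using assms(1) unfolding good_def by blast
qed

definition mem_ok :: "nat \<Rightarrow> (nat \<Rightarrow> nat) \<Rightarrow> (nat \<Rightarrow> nat) \<Rightarrow> state \<Rightarrow> bool" where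
  "mem_ok V M0 par \<sigma> \<longleftrightarrow> (\<forall>a<S. \<not> (V \<le> a \<and> a < V + n) \<longrightarrow> mem \<sigma> a = M0 a) \<and> (\<forall>v<n. mem \<sigma> (V + v) = par v)"

definition stack_ok :: "nat list list \<Rightarrow> state \<Rightarrow> bool" where
  "stack_ok xss \<sigma> \<longleftrightarrow> regs \<sigma> 45 = S + length xss \<and> (\<forall>i<length xss. linked mu (mem \<sigma> (S + i)) (xss ! i))"

definition base_ok :: "nat \<Rightarrow> (nat \<Rightarrow> nat) \<Rightarrow> (nat \<Rightarrow> nat) \<Rightarrow> bool" where
  "base_ok V M0 tog \<longleftrightarrow> (V = N + m \<or> V = N + m + n) \<and> (\<forall>a<N. M0 a = mu a) \<and> (\<forall>y<m. M0 (N + y) = tog y)"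

lemma run_push:
  assumes "cregs V \<sigma>" "base_ok V M0 tog" "mem_ok V M0 par \<sigma>" "stack_ok xss \<sigma>" "length xss + 1 < M1 + M2 + 2 * n + 4"
    "B = 30 \<or> B = 31" "R \<notin> {8, 45, 52, 53}" "regs \<sigma> R = v" "v < n"
  shows "frame {8, 45, 52, 53} (\<sigma>\<lparr>mem := mem (run w (push B R) \<sigma>)\<rparr>) (run w (push B R) \<sigma>)" (is ?F)
    and "mem_ok V M0 par (run w (push B R) \<sigma>)"
    and "stack_ok (xss @ [if B = 30 then ch1 v else ch2 v]) (run w (push B R) \<sigma>)"
proof -
  define b where "b = (if B = 30 then b1 else b2)"
  have b: "regs \<sigma> B = b" "b + v + 2 < N" using assms(1,6,9) b_bounds unfolding b_def cregs_def by auto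
  let ?k = "length xss"
  have sp: "regs \<sigma> 45 = S + ?k" "S + ?k + 1 < 2 ^ w" using assms(4,5) space unfolding stack_ok_def S_def by auto
  have NS: "N + m + n \<le> S" "N < 2 ^ w" using space unfolding S_def by auto
  have bw: "b + v < 2 ^ w" "b + v + 2 < 2 ^ w" using b NS by auto
  have mb: "mem \<sigma> (b + v + 2) = mu (b + v + 2)" using assms(2,3) b NS unfolding mem_ok_def base_ok_def by auto
  have R: "R \<noteq> 8" "R \<noteq> 45" "R \<noteq> 52" "R \<noteq> 53" using assms(7) by auto
  have B: "B \<noteq> 8" "B \<noteq> 45" "B \<noteq> 52" "B \<noteq> 53" using assms(6) by auto
  have c61: "regs \<sigma> 61 = 1" using assms(1) unfolding cregs_def by simp
  have run: "run w (push B R) \<sigma> = \<sigma>\<lparr>regs := (regs \<sigma>)(52 := b + v, 8 := b + v + 2, 53 := mu (b + v + 2), 45 := S + ?k + 1),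
      mem := (mem \<sigma>)(S + ?k := mu (b + v + 2))\<rparr>"
    unfolding push_def using b(1) assms(8) bw mb sp c61 R B by (simp add: fun_upd_twist)
  show ?F unfolding run frame_def by simp
  show "mem_ok V M0 par (run w (push B R) \<sigma>)"
    using assms(2,3) unfolding run mem_ok_def base_ok_def S_def by auto
  have l: "linked mu (mu (b + v + 2)) (if B = 30 then ch1 v else ch2 v)"
    using linked_heads[OF assms(9)] unfolding b_def by simp
  show "stack_ok (xss @ [if B = 30 then ch1 v else ch2 v]) (run w (push B R) \<sigma>)"
    using assms(4) l unfolding run stack_ok_def by (auto simp: nth_append less_Suc_eq)
qed

definition sinv :: "nat \<Rightarrow> (nat \<Rightarrow> nat) \<Rightarrow> (nat \<Rightarrow> nat) \<Rightarrow> nat list \<Rightarrow> nat \<Rightarrow> state \<Rightarrow> bool" where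
  "sinv V M0 tog o0 j \<sigma> \<longleftrightarrow> (\<exists>par xss. cregs V \<sigma> \<and> mem_ok V M0 par \<sigma> \<and> stack_ok xss \<sigma> \<and> out \<sigma> = o0 \<and>
     good tog par xss \<and> j = pot par xss \<and> j \<le> M1 + M2 + 2 * n)"

lemma mem_facts:
  assumes "base_ok V M0 tog" "mem_ok V M0 par \<sigma>"
  shows "a < N \<Longrightarrow> mem \<sigma> a = mu a" "y < m \<Longrightarrow> mem \<sigma> (N + y) = tog y" "v < n \<Longrightarrow> mem \<sigma> (V + v) = par v"
    "N + m \<le> V" "V + n \<le> S" "S = N + m + 2 * n"
  using assms unfolding base_ok_def mem_ok_def S_def by auto

lemma run_visit:
  assumes "regs \<tau> 50 = e" "regs \<tau> 41 = V" "regs \<tau> 60 = 0" "mem \<tau> (e + 2) = q" "e + 2 < 2 ^ w" "V + q < 2 ^ w"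
  shows "run w visit \<tau> = (let \<rho> = \<tau>\<lparr>regs := (regs \<tau>)(8 := e + 2, 54 := q, 55 := V + q, 53 := mem \<tau> (V + q))\<rparr> in
    if mem \<tau> (V + q) = 0 then run w (push 31 54) (run w (push 30 54) (\<rho>\<lparr>mem := (mem \<tau>)(V + q := e)\<rparr>)) else \<rho>)"
proof -
  define \<rho> where "\<rho> = run w (Load 53 55) (run w (Op Add 55 41 54) (run w (ldf 54 50 2) \<tau>))"
  have r: "\<rho> = \<tau>\<lparr>regs := (regs \<tau>)(8 := e + 2, 54 := q, 55 := V + q, 53 := mem \<tau> (V + q))\<rparr>"
    unfolding \<rho>_def using assms by (simp add: fun_upd_twist)
  have v: "run w visit \<tau> = (if regs \<rho> 53 = regs \<rho> 60 then run w (push 31 54) (run w (push 30 54) (run w (Store 55 50) \<rho>)) else \<rho>)"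
    unfolding visit_def \<rho>_def by simp
  have st: "run w (Store 55 50) \<rho> = \<rho>\<lparr>mem := (mem \<tau>)(V + q := e)\<rparr>" using assms(1) by (simp add: r)
  have "regs \<rho> 53 = mem \<tau> (V + q)" "regs \<rho> 60 = 0" using assms(3) by (simp_all add: r)
  then show ?thesis unfolding v st Let_def r[symmetric] by simp
qed

lemma search_step:
  assumes base: "base_ok V M0 tog" and inv: "sinv V M0 tog o0 j \<sigma>" and test: "test_val (Less 42 45) \<sigma>"
  shows "\<exists>j'<j. sinv V M0 tog o0 j' (run w search_body \<sigma>)"
proof -
  obtain par xss where I: "cregs V \<sigma>" "mem_ok V M0 par \<sigma>" "stack_ok xss \<sigma>" "out \<sigma> = o0" "good tog par xss" "j = pot par xss" "j \<le> M1 + M2 + 2 * n"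
    using inv unfolding sinv_def by blast
  have "xss \<noteq> []" using test I(1,3) unfolding cregs_def stack_ok_def by auto
  then obtain ys x where xss: "xss = ys @ [x]" by (metis rev_exhaust)
  let ?k = "length ys"
  have lk: "linked mu (mem \<sigma> (S + i)) (xss ! i)" if "i < length xss" for i using I(3) that unfolding stack_ok_def by blast
  have sp: "regs \<sigma> 45 = S + ?k + 1" "linked mu (mem \<sigma> (S + ?k)) x"
    using I(3) lk[of ?k] unfolding stack_ok_def xss by auto
  have stk: "linked mu (mem \<sigma> (S + i)) (ys ! i)" if "i < ?k" for i
    using lk[of i] that unfolding xss by (simp add: nth_append)
  \<comment> \<open>The potential also bounds the height of the stack and thereby its
    addresses.\<close>
  have kb: "?k + 1 \<le> M1 + M2 + 2 * n" using length_le_pot[of xss par] I(6,7) unfolding xss by simp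
  have mf: "\<And>a. a < N \<Longrightarrow> mem \<sigma> a = mu a" "\<And>y. y < m \<Longrightarrow> mem \<sigma> (N + y) = tog y" "\<And>v. v < n \<Longrightarrow> mem \<sigma> (V + v) = par v"
    "N + m \<le> V" "V + n \<le> S" "S = N + m + 2 * n" using mem_facts[OF base I(2)] by blast+
  have Sw: "S + ?k + 1 < 2 ^ w" using kb space mf(6) by linarith
  have cr: "regs \<sigma> 30 = b1" "regs \<sigma> 31 = b2" "regs \<sigma> 40 = N" "regs \<sigma> 41 = V" "regs \<sigma> 42 = S" "regs \<sigma> 43 = s" "regs \<sigma> 44 = t" "regs \<sigma> 60 = 0" "regs \<sigma> 61 = 1"
    using I(1) unfolding cregs_def by auto
  have sub: "bop_val w Sub (Suc (S + ?k)) (Suc 0) = S + ?k" using bop_val_Sub[of 1 "S + ?k + 1" w] Sw by (simp del: bop_val.simps)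
  have inc: "bop_val w Add (S + ?k) (Suc 0) = Suc (S + ?k)" using bop_val_Add[of "S + ?k" 1 w] Sw by (simp del: bop_val.simps)
  show ?thesis
  proof (cases x)
    case Nil
    have p: "mem \<sigma> (S + ?k) = 0" using sp(2) Nil by simp
    have r: "run w search_body \<sigma> = \<sigma>\<lparr>regs := (regs \<sigma>)(45 := S + ?k, 50 := 0)\<rparr>"
      unfolding search_body_def by (simp add: sp(1) cr p sub del: bop_val.simps)
    have "good tog par ys" using I(5) unfolding xss Nil good_def by auto
    moreover have "pot par xss = pot par ys + 1" unfolding pot_def xss Nil by simp
    moreover have "cregs V (run w search_body \<sigma>)" using I(1) unfolding r cregs_def by simp
    moreover have "mem_ok V M0 par (run w search_body \<sigma>)" using I(2) unfolding r mem_ok_def by simp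
    moreover have "stack_ok ys (run w search_body \<sigma>)" using stk unfolding r stack_ok_def by simp
    moreover have "out (run w search_body \<sigma>) = o0" using I(4) unfolding r by simp
    ultimately have "sinv V M0 tog o0 (pot par ys) (run w search_body \<sigma>)" "pot par ys < j" unfolding sinv_def using I(6,7) by auto
    then show ?thesis by blast
  next
    case (Cons e xs)
    have p: "mem \<sigma> (S + ?k) = e" "e \<noteq> 0" "linked mu (mu (e + 4)) xs" using sp(2) Cons by auto
    have e: "e \<in> ent" using I(5) unfolding good_def xss Cons by auto
    have ef: "e + 5 < N" "mu e < m" "mu (e + 1) < n" "mu (e + 2) < n" using ent_facts[OF e] by auto
    define \<tau> where "\<tau> = \<sigma>\<lparr>mem := (mem \<sigma>)(S + ?k := mu (e + 4)),
      regs := (regs \<sigma>)(45 := S + ?k + 1, 50 := e, 8 := e + 3, 53 := mu (e + 4), 51 := tog (mu e), 52 := mu (e + 3))\<rparr>"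
    have bw: "e + 4 < 2 ^ w" "e + 3 < 2 ^ w" "e + 2 < 2 ^ w" "mu e + N < 2 ^ w" using ef N_less space by linarith+
    have ne: "e \<noteq> S + ?k" "e + 3 \<noteq> S + ?k" "e + 4 \<noteq> S + ?k" "N + mu e \<noteq> S + ?k" "mu e + N \<noteq> S + ?k" using ef mf(6) by auto
    have mm: "mem \<sigma> (e + 4) = mu (e + 4)" "mem \<sigma> (e + 3) = mu (e + 3)" "mem \<sigma> e = mu e" "mem \<sigma> (mu e + N) = tog (mu e)"
      using mf(1) ef mf(2)[OF ef(2)] by (auto simp: add.commute)
    have r: "run w search_body \<sigma> = (if usable tog e then run w visit \<tau> else \<tau>)"
      unfolding search_body_def \<tau>_def usable_def
      by (simp add: sp(1) cr p(1,2) sub inc bop_val_Add bw mm ne fun_upd_twist del: bop_val.simps)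
    have c\<tau>: "cregs V \<tau>" using I(1) unfolding \<tau>_def cregs_def by simp
    have m\<tau>: "mem_ok V M0 par \<tau>" using I(2) mf(4,5) unfolding \<tau>_def mem_ok_def by auto
    have s\<tau>: "stack_ok (ys @ [xs]) \<tau>" using stk p(3) unfolding \<tau>_def stack_ok_def by (auto simp: nth_append less_Suc_eq)
    have o\<tau>: "out \<tau> = o0" using I(4) unfolding \<tau>_def by simp
    have pot1: "pot par xss = pot par (ys @ [xs]) + 1" unfolding pot_def xss Cons by simp
    show ?thesis
    proof (cases "usable tog e \<and> par (mu (e + 2)) = 0")
      case False
      have g: "good tog par (ys @ [xs])" by (rule good_skip[of tog par ys e xs]) (use I(5) False xss Cons in auto)
      have "\<exists>R. run w search_body \<sigma> = \<tau>\<lparr>regs := R\<rparr> \<and> (\<forall>r. r \<notin> {8, 53, 54, 55} \<longrightarrow> R r = regs \<tau> r)"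
      proof (cases "usable tog e")
        case True
        then have nz: "par (mu (e + 2)) \<noteq> 0" using False by simp
        have t: "regs \<tau> 50 = e" "regs \<tau> 41 = V" "regs \<tau> 60 = 0" "mem \<tau> (e + 2) = mu (e + 2)" "mem \<tau> (V + mu (e + 2)) = par (mu (e + 2))"
          using cr mf(1)[of "e + 2"] mf(3)[OF ef(4)] ef mf(4-6) unfolding \<tau>_def by auto
        have Vw: "V + mu (e + 2) < 2 ^ w" using mf(5,6) ef(4) space by linarith
        have "run w visit \<tau> = \<tau>\<lparr>regs := (regs \<tau>)(54 := mu (e + 2), 8 := e + 2, 55 := V + mu (e + 2), 53 := par (mu (e + 2)))\<rparr>"
          using run_visit[OF t(1-4) bw(3) Vw] nz t(5) by (simp add: fun_upd_twist)
        then show ?thesis using True unfolding r by (auto simp del: add_2_eq_Suc')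
      next
        case False
        then show ?thesis unfolding r by (intro exI[of _ "regs \<tau>"]) simp
      qed
      then obtain R where R: "run w search_body \<sigma> = \<tau>\<lparr>regs := R\<rparr>" "\<And>r. r \<notin> {8, 53, 54, 55} \<Longrightarrow> R r = regs \<tau> r" by blast
      have "cregs V (run w search_body \<sigma>)" using c\<tau> unfolding R(1) cregs_def by (simp add: R(2))
      moreover have "mem_ok V M0 par (run w search_body \<sigma>)" using m\<tau> unfolding R(1) mem_ok_def by simp
      moreover have "stack_ok (ys @ [xs]) (run w search_body \<sigma>)" using s\<tau> unfolding R(1) stack_ok_def by (simp add: R(2))
      moreover have "out (run w search_body \<sigma>) = o0" using o\<tau> unfolding R(1) by simp
      ultimately have "sinv V M0 tog o0 (pot par (ys @ [xs])) (run w search_body \<sigma>)" "pot par (ys @ [xs]) < j"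
        unfolding sinv_def using g I(6,7) pot1 by auto
      then show ?thesis by blast
    next
      case True
      then have us: "usable tog e" and z: "par (mu (e + 2)) = 0" by auto
      let ?q = "mu (e + 2)"
      define par' where "par' = par(?q := e)"
      define \<tau>1 where "\<tau>1 = \<tau>\<lparr>regs := (regs \<tau>)(8 := e + 2, 54 := ?q, 55 := V + ?q, 53 := 0), mem := (mem \<tau>)(V + ?q := e)\<rparr>"
      define \<tau>2 where "\<tau>2 = run w (push 30 54) \<tau>1"
      define \<tau>3 where "\<tau>3 = run w (push 31 54) \<tau>2"
      have t: "regs \<tau> 50 = e" "regs \<tau> 41 = V" "regs \<tau> 60 = 0" "mem \<tau> (e + 2) = ?q" "mem \<tau> (V + ?q) = 0"
        using cr mf(1)[of "e + 2"] mf(3)[OF ef(4)] z ef mf(4-6) unfolding \<tau>_def by auto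
      have Vw: "V + ?q < 2 ^ w" using mf(5,6) ef(4) space by linarith
      have r3: "run w search_body \<sigma> = \<tau>3"
        using run_visit[OF t(1-4) bw(3) Vw] t(5) us unfolding r \<tau>3_def \<tau>2_def \<tau>1_def by simp
      have c1: "cregs V \<tau>1" using c\<tau> unfolding \<tau>1_def cregs_def by simp
      have m1: "mem_ok V M0 par' \<tau>1" using m\<tau> ef(4) unfolding \<tau>1_def mem_ok_def par'_def by (auto simp del: add_2_eq_Suc')
      have s1: "stack_ok (ys @ [xs]) \<tau>1" using s\<tau> ef(4) mf(4-6) unfolding \<tau>1_def stack_ok_def by (auto simp del: add_2_eq_Suc')
      have q1: "regs \<tau>1 54 = ?q" unfolding \<tau>1_def by simp
      have pv: "pot par' ((ys @ [xs]) @ [ch1 ?q, ch2 ?q]) = pot par (ys @ [xs])"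
        using pot_visit[of ?q par e "ys @ [xs]" "ch1 ?q" "ch2 ?q"] ef(4) z p(2) unfolding par'_def by simp
      have len: "length (ys @ [xs]) + 2 \<le> M1 + M2 + 2 * n"
        using length_le_pot[of "(ys @ [xs]) @ [ch1 ?q, ch2 ?q]" par'] pv pot1 I(6,7) by simp
      have f2: "frame {8, 45, 52, 53} (\<tau>1\<lparr>mem := mem \<tau>2\<rparr>) \<tau>2" and m2: "mem_ok V M0 par' \<tau>2" and s2: "stack_ok (ys @ [xs, ch1 ?q]) \<tau>2"
        using run_push[OF c1 base m1 s1, of 30 54 ?q] len q1 ef(4) unfolding \<tau>2_def by auto
      have c2: "cregs V \<tau>2" using f2 c1 unfolding frame_def cregs_def by simp
      have q2: "regs \<tau>2 54 = ?q" using f2 q1 unfolding frame_def by simp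
      have f3: "frame {8, 45, 52, 53} (\<tau>2\<lparr>mem := mem \<tau>3\<rparr>) \<tau>3" and m3: "mem_ok V M0 par' \<tau>3" and s3: "stack_ok (ys @ [xs, ch1 ?q, ch2 ?q]) \<tau>3"
        using run_push[OF c2 base m2 s2, of 31 54 ?q] len q2 ef(4) unfolding \<tau>3_def by auto
      have c3: "cregs V \<tau>3" using f3 c2 unfolding frame_def cregs_def by simp
      have o3: "out \<tau>3 = o0" using f3 f2 o\<tau> unfolding frame_def \<tau>1_def by simp
      have g: "good tog par' (ys @ [xs, ch1 ?q, ch2 ?q])" unfolding par'_def by (rule good_visit) (use I(5) us z in \<open>auto simp: xss Cons\<close>)
      have pj: "pot par' (ys @ [xs, ch1 ?q, ch2 ?q]) < j" using pv pot1 I(6) by simp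
      moreover have "sinv V M0 tog o0 (pot par' (ys @ [xs, ch1 ?q, ch2 ?q])) \<tau>3"
        unfolding sinv_def
        by (intro exI[of _ par'] exI[of _ "ys @ [xs, ch1 ?q, ch2 ?q]"] conjI c3 m3 s3 o3 g refl) (use pj I(7) in linarith)
      ultimately      show ?thesis unfolding r3 by blast
    qed
  qed
qed

lemma search_correct:
  assumes cr: "cregs V \<sigma>" and base: "base_ok V (mem \<sigma>) tog" and zero: "\<And>v. v < n \<Longrightarrow> mem \<sigma> (V + v) = 0"
  shows "halts w search \<sigma> ((csize search_body + 1) * (M1 + M2 + 2 * n) + 25)
    (\<lambda>\<tau>. \<exists>par. cregs V \<tau> \<and> mem_ok V (mem \<sigma>) par \<tau> \<and> out \<tau> = out \<sigma> \<and> good tog par [])"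
proof -
  let ?J = "M1 + M2 + 2 * n"
  define \<sigma>1 where "\<sigma>1 = run w (Op Add 45 42 60) (run w (Store 52 61) (run w (Op Add 52 41 43) \<sigma>))"
  define \<sigma>2 where "\<sigma>2 = run w (push 30 43) \<sigma>1"
  define \<sigma>3 where "\<sigma>3 = run w (push 31 43) \<sigma>2"
  define par :: "nat \<Rightarrow> nat" where "par = (\<lambda>_. 0)(s := 1)"
  have cr': "regs \<sigma> 40 = N" "regs \<sigma> 41 = V" "regs \<sigma> 42 = S" "regs \<sigma> 43 = s" "regs \<sigma> 60 = 0" "regs \<sigma> 61 = 1"
    using cr unfolding cregs_def by auto
  have V: "N + m \<le> V" "V + n \<le> S" "S = N + m + 2 * n" using base unfolding base_ok_def S_def by auto
  have Vw: "V + s < 2 ^ w" "S < 2 ^ w" using V st(1) space by linarith+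
  have s1: "\<sigma>1 = \<sigma>\<lparr>mem := (mem \<sigma>)(V + s := 1), regs := (regs \<sigma>)(52 := V + s, 45 := S)\<rparr>"
    unfolding \<sigma>1_def using cr' Vw by simp
  have c1: "cregs V \<sigma>1" using cr unfolding s1 cregs_def by simp
  have m1: "mem_ok V (mem \<sigma>) par \<sigma>1" using zero st(1) unfolding s1 mem_ok_def par_def by auto
  have k1: "stack_ok [] \<sigma>1" unfolding s1 stack_ok_def by simp
  have q1: "regs \<sigma>1 43 = s" using c1 unfolding cregs_def by simp
  have n0: "2 \<le> 2 * n" using st(1) by linarith
  have f2: "frame {8, 45, 52, 53} (\<sigma>1\<lparr>mem := mem \<sigma>2\<rparr>) \<sigma>2" and m2: "mem_ok V (mem \<sigma>) par \<sigma>2" and k2: "stack_ok [ch1 s] \<sigma>2"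
    using run_push[OF c1 base m1 k1, of 30 43 s] n0 q1 st(1) unfolding \<sigma>2_def by auto
  have c2: "cregs V \<sigma>2" using f2 c1 unfolding frame_def cregs_def by simp
  have q2: "regs \<sigma>2 43 = s" using c2 unfolding cregs_def by simp
  have f3: "frame {8, 45, 52, 53} (\<sigma>2\<lparr>mem := mem \<sigma>3\<rparr>) \<sigma>3" and m3: "mem_ok V (mem \<sigma>) par \<sigma>3" and k3: "stack_ok [ch1 s, ch2 s] \<sigma>3"
    using run_push[OF c2 base m2 k2, of 31 43 s] n0 q2 st(1) unfolding \<sigma>3_def by auto
  have c3: "cregs V \<sigma>3" using f3 c2 unfolding frame_def cregs_def by simp
  have o3: "out \<sigma>3 = out \<sigma>" using f3 f2 unfolding frame_def s1 by simp
  have g: "good tog par [ch1 s, ch2 s]"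
  proof -
    have "\<exists>es. tpath tog par q es" if "par q \<noteq> 0" for q
    proof -
      have "q = s" using that unfolding par_def by (auto split: if_splits)
      then show ?thesis using tpath_source by blast
    qed
    moreover have "par (mu (e + 1)) \<noteq> 0 \<Longrightarrow> e \<in> ent \<Longrightarrow> e \<in> set (ch1 s) \<union> set (ch2 s)" for e
      using ch_ent[of e s] unfolding par_def by (auto split: if_splits)
    moreover have "e \<in> set (ch1 s) \<union> set (ch2 s) \<Longrightarrow> e \<in> ent \<and> par (mu (e + 1)) \<noteq> 0" for e
      using ch_ent[of e s] unfolding par_def by auto
    moreover have "par s \<noteq> 0" unfolding par_def by simp
    ultimately show ?thesis unfolding good_def by (metis UnE UnI1 UnI2 list.set_intros set_ConsD empty_iff list.set(1))
  qed
  have p: "pot par [ch1 s, ch2 s] = ?J"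
  proof -
    have "pot (\<lambda>_. 0) [] = ?J" unfolding pot_def using pot_total by (simp add: lessThan_def)
    then show ?thesis using pot_visit[of s "\<lambda>_. 0" 1 "[]" "ch1 s" "ch2 s"] st(1) unfolding par_def by simp
  qed
  have I: "sinv V (mem \<sigma>) tog (out \<sigma>) ?J \<sigma>3"
    unfolding sinv_def by (intro exI[of _ par] exI[of _ "[ch1 s, ch2 s]"] conjI c3 m3 k3 o3 g p[symmetric] order_refl)
  have h: "halts w (While (Less 42 45) search_body) \<sigma>3 ((csize search_body + 1) * ?J + 1)
      (\<lambda>\<tau>. \<not> test_val (Less 42 45) \<tau> \<and> (\<exists>j. sinv V (mem \<sigma>) tog (out \<sigma>) j \<tau>))"
    by (rule halts_While[where I = "sinv V (mem \<sigma>) tog (out \<sigma>)", OF _ search_step[OF base] I])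
       (auto simp: search_body_def visit_def push_def)
  have h': "halts w (While (Less 42 45) search_body) \<sigma>3 ((csize search_body + 1) * ?J + 1)
    (\<lambda>\<tau>. \<exists>par. cregs V \<tau> \<and> mem_ok V (mem \<sigma>) par \<tau> \<and> out \<tau> = out \<sigma> \<and> good tog par [])"
  proof (rule halts_weaken[OF h order_refl])
    fix \<tau> assume a: "\<not> test_val (Less 42 45) \<tau> \<and> (\<exists>j. sinv V (mem \<sigma>) tog (out \<sigma>) j \<tau>)"
    then obtain par xss where x: "cregs V \<tau>" "mem_ok V (mem \<sigma>) par \<tau>" "stack_ok xss \<tau>" "out \<tau> = out \<sigma>" "good tog par xss"
      unfolding sinv_def by blast
    have "xss = []" using a x(1,3) unfolding cregs_def stack_ok_def by auto
    then show "\<exists>par. cregs V \<tau> \<and> mem_ok V (mem \<sigma>) par \<tau> \<and> out \<tau> = out \<sigma> \<and> good tog par []" using x by blast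
  qed
  have eq: "search = Seq (Op Add 52 41 43) (Seq (Store 52 61) (Seq (Op Add 45 42 60) (Seq (push 30 43) (Seq (push 31 43)
      (Seq (While (Less 42 45) search_body) Skip)))))" by (simp add: search_def)
  have lf: "loopfree (push B R)" "csize (push B R) = 8" for B R by (simp_all add: push_def)
  show ?thesis unfolding eq
    by (rule halts_Seq_run[OF _ halts_Seq_run[OF _ halts_Seq_run[OF _ halts_Seq_run[OF lf(1) halts_Seq_run[OF lf(1)
        halts_Seq_Skip[OF h'[unfolded \<sigma>3_def \<sigma>2_def \<sigma>1_def]] order_refl] order_refl] order_refl] order_refl]]) (simp_all add: lf)
qed

section \<open>Augmentation along the path in the search tree\<close>

lemma tpath_distinct: "tpath tog par q es \<Longrightarrow> distinct es"
proof (induction rule: tpath.induct)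
  case (tpath_step p es e q)
  have "e \<notin> set es" using tpath_step.hyps(5,7) by blast
  then show ?case using tpath_step.IH by simp
qed simp

text \<open>Two entries of one arc on the path are both usable, so they ask for the same toggle
  value and by \<open>orient\<close> share their target; but only one entry is recorded as the
  parent there.\<close>

lemma tpath_inj:
  assumes "tpath tog par q es"
  shows "inj_on mu (set es)"
proof (rule inj_onI)
  fix e e' assume a: "e \<in> set es" "e' \<in> set es" "mu e = mu e'"
  have "e \<in> ent" "e' \<in> ent" "usable tog e" "usable tog e'" "par (mu (e + 2)) = e" "par (mu (e' + 2)) = e'"
    using tpath_par[OF assms] a by blast+
  then show "e = e'" using orient[of e e'] a(3) unfolding usable_def ent_def by metis
qed

lemma tpath_walk: "tpath tog par q es \<Longrightarrow> walk (\<lambda>e. mu (e + 1)) (\<lambda>e. mu (e + 2)) s es q"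
proof (induction rule: tpath.induct)
  case (tpath_step p es e q)
  then show ?case using walk_append[of "\<lambda>e. mu (e + 1)" "\<lambda>e. mu (e + 2)" s es "[e]" q] by (metis walk.simps)
qed simp

lemma tpath_length: "tpath tog par q es \<Longrightarrow> length es < n"
proof -
  assume a: "tpath tog par q es"
  have d: "distinct (s # map (\<lambda>e. mu (e + 2)) es)" using a
  proof (induction rule: tpath.induct)
    case (tpath_step p es e q)
    then show ?case using tpath_step.hyps(5-7) by auto
  qed simp
  show ?thesis
  proof (rule simple_walk_length[OF tpath_walk[OF a] d st(1)])
    fix e assume "e \<in> set es"
    then show "mu (e + 2) < n" using tpath_par[OF a] ent_facts by blast
  qed
qed

definition toggled :: "(nat \<Rightarrow> nat) \<Rightarrow> nat list \<Rightarrow> nat \<Rightarrow> nat" where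
  "toggled tog fs y = (if y \<in> mu ` set fs then 1 - tog y else tog y)"

definition round_mem :: "nat \<Rightarrow> (nat \<Rightarrow> nat) \<Rightarrow> (nat \<Rightarrow> nat) \<Rightarrow> state \<Rightarrow> bool" where
  "round_mem V M0 tog \<sigma> \<longleftrightarrow> (\<forall>a<N. mem \<sigma> a = mu a) \<and> (\<forall>y<m. mem \<sigma> (N + y) = tog y) \<and>
     (\<forall>a<S. N + m \<le> a \<longrightarrow> \<not> (V \<le> a \<and> a < V + n) \<longrightarrow> mem \<sigma> a = M0 a)"

text \<open>Toggles change while the path is followed backwards. As its arcs are distinct, each is
  still in the state that the search saw when its turn comes.\<close>

lemma augment_path:
  assumes tp: "tpath tog par t es0" and V: "V = N + m \<or> V = N + m + n"
    and \<sigma>: "cregs V \<sigma>" "round_mem V M0 tog \<sigma>" "\<And>v. v < n \<Longrightarrow> mem \<sigma> (V + v) = par v" "regs \<sigma> 54 = t" "regs \<sigma> 55 = 1"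
  shows "halts w (While (Eq 55 61) aug_body) \<sigma> ((csize aug_body + 1) * n + 1)
    (\<lambda>\<tau>. cregs V \<tau> \<and> round_mem V M0 (toggled tog es0) \<tau> \<and> out \<tau> = out \<sigma>)"
proof -
  define I :: "nat \<Rightarrow> state \<Rightarrow> bool" where "I j \<rho> \<longleftrightarrow> (\<exists>es fs q. es0 = es @ fs \<and> j = length es \<and> tpath tog par q es \<and> q < n \<and>
    regs \<rho> 54 = q \<and> regs \<rho> 55 = (if q = s then 0 else 1) \<and> cregs V \<rho> \<and> out \<rho> = out \<sigma> \<and>
    round_mem V M0 (toggled tog fs) \<rho> \<and> (\<forall>v<n. mem \<rho> (V + v) = par v))" for j \<rho>
  have Vf: "N + m \<le> V" "V + n \<le> S" "S = N + m + 2 * n" using V unfolding S_def by auto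
  have "I (length es0) \<sigma>" unfolding I_def
    by (intro exI[of _ es0] exI[of _ "[]"] exI[of _ t]) (use tp st \<sigma> in \<open>auto simp: toggled_def[abs_def]\<close>)
  moreover have "\<exists>j'<j. I j' (run w aug_body \<rho>)" if I: "I j \<rho>" and test: "test_val (Eq 55 61) \<rho>" for j \<rho>
  proof -
    obtain es fs q where i: "es0 = es @ fs" "j = length es" "tpath tog par q es" "q < n" "regs \<rho> 54 = q" "regs \<rho> 55 = (if q = s then 0 else 1)"
      "cregs V \<rho>" "out \<rho> = out \<sigma>" "round_mem V M0 (toggled tog fs) \<rho>" "\<forall>v<n. mem \<rho> (V + v) = par v"
      using I unfolding I_def by blast
    have qs: "q \<noteq> s" using test i(6,7) unfolding cregs_def by auto
    from i(3) obtain p es' e where e: "es = es' @ [e]" "tpath tog par p es'" "e \<in> ent" "usable tog e" "mu (e + 1) = p" "q = mu (e + 2)" "par q = e"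
      using qs by (cases rule: tpath.cases) auto
    have ef: "e + 5 < N" "mu e < m" "mu (e + 1) < n" "mu (e + 3) \<le> 1" using ent_facts[OF e(3)] by auto
    have cr: "regs \<rho> 40 = N" "regs \<rho> 41 = V" "regs \<rho> 43 = s" "regs \<rho> 60 = 0" "regs \<rho> 61 = 1" using i(7) unfolding cregs_def by auto
    have y: "mu e \<notin> mu ` set fs"
    proof
      assume "mu e \<in> mu ` set fs"
      then obtain f where f: "f \<in> set fs" "mu f = mu e" by auto
      have "e \<in> set es0" "f \<in> set es0" using i(1) e(1) f(1) by auto
      then have "f = e" using tpath_inj[OF tp] f(2) unfolding inj_on_def by blast
      moreover have "distinct es0" using tpath_distinct[OF tp] .
      ultimately show False using f(1) unfolding i(1) e(1) by auto
    qed
    have ty: "tog (mu e) \<le> 1" using e(4) ef(4) unfolding usable_def by simp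
    have mm: "mem \<rho> (V + q) = e" "mem \<rho> e = mu e" "mem \<rho> (mu e + N) = tog (mu e)" "mem \<rho> (e + 1) = mu (e + 1)"
      using i(4,9,10) e(7) ef y unfolding round_mem_def toggled_def by (auto simp: add.commute)
    have bw: "V + q < 2 ^ w" "mu e + N < 2 ^ w" "e + 1 < 2 ^ w" using Vf i(4) ef space by linarith+
    have sub: "bop_val w Sub 1 (tog (mu e)) = 1 - tog (mu e)" using bop_val_Sub[of "tog (mu e)" 1 w] ty one_less by blast
    have ne: "e + 1 \<noteq> mu e + N" using ef by linarith
    define R where "R = (if p = s then (regs \<rho>)(52 := 1 - tog (mu e), 50 := e, 51 := mu e + N, 8 := e + 1, 54 := p, 55 := 0)
      else (regs \<rho>)(52 := 1 - tog (mu e), 50 := e, 51 := mu e + N, 8 := e + 1, 54 := p))"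
    have r: "run w aug_body \<rho> = \<rho>\<lparr>mem := (mem \<rho>)(mu e + N := 1 - tog (mu e)), regs := R\<rparr>"
      unfolding aug_body_def R_def using e(5)
      by (simp add: cr i(5) mm bw ne sub bop_val_Add fun_upd_twist del: bop_val.simps add_Suc_right One_nat_def)
    have r55: "regs \<rho> 55 = 1" using i(6) qs by simp
    have c: "cregs V (run w aug_body \<rho>)" using i(7) unfolding r cregs_def R_def by (simp split: if_split)
    have rm: "round_mem V M0 (toggled tog (e # fs)) (run w aug_body \<rho>)"
      using i(9) ef y unfolding r round_mem_def toggled_def by (auto simp: add.commute)
    have pv: "\<forall>v<n. mem (run w aug_body \<rho>) (V + v) = par v" using i(10) ef(2) Vf unfolding r by auto
    have r54: "regs (run w aug_body \<rho>) 54 = p" "regs (run w aug_body \<rho>) 55 = (if p = s then 0 else 1)" "out (run w aug_body \<rho>) = out \<sigma>"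
      using r55 i(8) unfolding r R_def by simp_all
    have es0: "es0 = es' @ e # fs" using i(1) e(1) by simp
    have pn: "p < n" using ef(3) e(5) by metis
    have "I (length es') (run w aug_body \<rho>)" unfolding I_def
      by (intro exI[of _ es'] exI[of _ "e # fs"] exI[of _ p] conjI es0 refl e(2) pn r54 c rm pv)
    moreover have "length es' < j" using i(2) e(1) by simp
    ultimately show ?thesis by blast
  qed
  ultimately have "halts w (While (Eq 55 61) aug_body) \<sigma> ((csize aug_body + 1) * length es0 + 1) (\<lambda>\<tau>. \<not> test_val (Eq 55 61) \<tau> \<and> (\<exists>j. I j \<tau>))"
    by (intro halts_While[where I = I]) (auto simp: aug_body_def)
  moreover have "(csize aug_body + 1) * length es0 + 1 \<le> (csize aug_body + 1) * n + 1"
    using tpath_length[OF tp] by (intro add_le_mono1 mult_le_mono2) simp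
  ultimately show ?thesis
  proof (rule halts_weaken)
    fix \<tau> assume a: "\<not> test_val (Eq 55 61) \<tau> \<and> (\<exists>j. I j \<tau>)"
    then obtain es fs q where i: "es0 = es @ fs" "tpath tog par q es" "regs \<tau> 55 = (if q = s then 0 else 1)" "cregs V \<tau>" "out \<tau> = out \<sigma>" "round_mem V M0 (toggled tog fs) \<tau>"
      unfolding I_def by blast
    have "q = s" using a i(3,4) unfolding cregs_def by (auto split: if_splits)
    from i(2) this have "es = []" by cases auto
    then show "cregs V \<tau> \<and> round_mem V M0 (toggled tog es0) \<tau> \<and> out \<tau> = out \<sigma>" using i by simp
  qed
qed

text \<open>The outcome of a round without machine states, so that the flow argument can be carried
  out apart from the program.\<close>

definition round_post :: "(nat \<Rightarrow> nat) \<Rightarrow> (nat \<Rightarrow> nat) \<Rightarrow> bool" where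
  "round_post tog tog' \<longleftrightarrow>
     (tog' = tog \<and> (\<exists>X\<subseteq>{..<n}. s \<in> X \<and> t \<notin> X \<and> (\<forall>e\<in>ent. mu (e + 1) \<in> X \<longrightarrow> usable tog e \<longrightarrow> mu (e + 2) \<in> X))) \<or>
     (\<exists>es. walk (\<lambda>e. mu (e + 1)) (\<lambda>e. mu (e + 2)) s es t \<and> distinct (map mu es) \<and> set es \<subseteq> ent \<and>
        (\<forall>e\<in>set es. usable tog e) \<and> tog' = toggled tog es)"

lemma round_correct:
  assumes cr: "cregs V \<sigma>" and base: "base_ok V (mem \<sigma>) tog" and zero: "\<And>v. v < n \<Longrightarrow> mem \<sigma> (V + v) = 0"
  shows "halts w (Seq search augment) \<sigma> ((csize search_body + csize aug_body + 2) * (M1 + M2 + 3 * n) + 40)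
    (\<lambda>\<tau>. cregs V \<tau> \<and> out \<tau> = out \<sigma> \<and> (\<exists>tog'. round_mem V (mem \<sigma>) tog' \<tau> \<and> round_post tog tog'))"
proof -
  let ?M0 = "mem \<sigma>"
  let ?Q = "\<lambda>\<tau>. cregs V \<tau> \<and> out \<tau> = out \<sigma> \<and> (\<exists>tog'. round_mem V ?M0 tog' \<tau> \<and> round_post tog tog')"
  have V: "V = N + m \<or> V = N + m + n" using base unfolding base_ok_def by blast
  have aug: "halts w augment \<tau> ((csize aug_body + 1) * n + 10) ?Q"
    if a: "\<exists>par. cregs V \<tau> \<and> mem_ok V ?M0 par \<tau> \<and> out \<tau> = out \<sigma> \<and> good tog par []" for \<tau>
  proof -
    obtain par where p: "cregs V \<tau>" "mem_ok V ?M0 par \<tau>" "out \<tau> = out \<sigma>" "good tog par []" using a by blast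
    have mf: "\<And>a. a < N \<Longrightarrow> mem \<tau> a = mu a" "\<And>y. y < m \<Longrightarrow> mem \<tau> (N + y) = tog y" "\<And>v. v < n \<Longrightarrow> mem \<tau> (V + v) = par v"
      "N + m \<le> V" "V + n \<le> S" "S = N + m + 2 * n" using mem_facts[OF base p(2)] by blast+
    have rm: "round_mem V ?M0 tog \<tau>" using p(2) mf(1,2) unfolding round_mem_def mem_ok_def by simp
    have cr: "regs \<tau> 41 = V" "regs \<tau> 44 = t" "regs \<tau> 60 = 0" using p(1) unfolding cregs_def by auto
    have Vw: "V + t < 2 ^ w" "t < 2 ^ w" using mf(5,6) st space by linarith+
    define \<tau>1 where "\<tau>1 = run w (Load 53 52) (run w (Op Add 52 41 44) \<tau>)"
    have t1: "\<tau>1 = \<tau>\<lparr>regs := (regs \<tau>)(52 := V + t, 53 := par t)\<rparr>"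
      unfolding \<tau>1_def using cr Vw mf(3)[OF st(2)] by simp
    have c1: "cregs V \<tau>1" "out \<tau>1 = out \<sigma>" "round_mem V ?M0 tog \<tau>1" using p(1,3) rm unfolding t1 cregs_def round_mem_def by simp_all
    let ?W = "While (Eq 55 61) aug_body"
    let ?B = "seqs [Op Add 54 44 60, Const 55 1, ?W]"
    have hC: "halts w (Cond (Eq 53 60) Skip ?B) \<tau>1 ((csize aug_body + 1) * n + 6) ?Q"
    proof (rule halts_Cond[of _ _ _ _ "(csize aug_body + 1) * n + 5"])
      assume "test_val (Eq 53 60) \<tau>1"
      then have z: "par t = 0" using cr unfolding t1 by simp
      let ?X = "{v. v < n \<and> par v \<noteq> 0}"
      have "s \<in> ?X" "t \<notin> ?X" using p(4) st z unfolding good_def by auto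
      moreover have "\<forall>e\<in>ent. mu (e + 1) \<in> ?X \<longrightarrow> usable tog e \<longrightarrow> mu (e + 2) \<in> ?X" using p(4) ent_facts unfolding good_def by auto
      ultimately have "round_post tog tog" unfolding round_post_def by (intro disjI1 conjI refl exI[of _ ?X]) auto
      then show "halts w Skip \<tau>1 ((csize aug_body + 1) * n + 5) ?Q" using c1 by (intro halts_run) auto
    next
      assume "\<not> test_val (Eq 53 60) \<tau>1"
      then have "par t \<noteq> 0" using cr unfolding t1 by simp
      then obtain es0 where es0: "tpath tog par t es0" using p(4) st unfolding good_def by blast
      define \<tau>2 where "\<tau>2 = run w (Const 55 1) (run w (Op Add 54 44 60) \<tau>1)"
      have t2: "\<tau>2 = \<tau>1\<lparr>regs := (regs \<tau>1)(54 := t, 55 := 1)\<rparr>"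
        unfolding \<tau>2_def using c1(1) Vw w_pos unfolding cregs_def by simp
      have c2: "cregs V \<tau>2" "round_mem V ?M0 tog \<tau>2" using c1 unfolding t2 cregs_def round_mem_def by simp_all
      have v2: "mem \<tau>2 (V + v) = par v" if "v < n" for v using mf(3)[OF that] unfolding t2 t1 by simp
      have r2: "regs \<tau>2 54 = t" "regs \<tau>2 55 = 1" unfolding t2 by simp_all
      have hW: "halts w ?W \<tau>2 ((csize aug_body + 1) * n + 1) ?Q"
      proof (rule halts_weaken[OF augment_path[OF es0 V c2 v2 r2] order_refl])
        fix \<rho> assume x: "cregs V \<rho> \<and> round_mem V ?M0 (toggled tog es0) \<rho> \<and> out \<rho> = out \<tau>2"
        have "round_post tog (toggled tog es0)" unfolding round_post_def
          using tpath_walk[OF es0] tpath_inj[OF es0] tpath_distinct[OF es0] tpath_par[OF es0]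
          by (intro disjI2 exI[of _ es0] conjI) (auto simp: distinct_map)
        then show "?Q \<rho>" using x c1(2) unfolding t2 by auto
      qed
      have W: "halts w (Seq ?W Skip) \<tau>2 ((csize aug_body + 1) * n + 2) ?Q"
        by (rule halts_weaken[OF halts_Seq_Skip[OF hW]]) auto
      have B: "?B = Seq (Op Add 54 44 60) (Seq (Const 55 1) (Seq ?W Skip))" by simp
      show "halts w ?B \<tau>1 ((csize aug_body + 1) * n + 5) ?Q" unfolding B
        by (rule halts_Seq_run[OF _ halts_Seq_run[OF _ W[unfolded \<tau>2_def] order_refl]]) simp_all
    qed simp
    have C: "halts w (Seq (Cond (Eq 53 60) Skip ?B) Skip) \<tau>1 ((csize aug_body + 1) * n + 7) ?Q"
      by (rule halts_weaken[OF halts_Seq_Skip[OF hC]]) auto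
    have eq: "augment = Seq (Op Add 52 41 44) (Seq (Load 53 52) (Seq (Cond (Eq 53 60) Skip ?B) Skip))" by (simp add: augment_def)
    show ?thesis unfolding eq
      by (rule halts_Seq_run[OF _ halts_Seq_run[OF _ C[unfolded \<tau>1_def] order_refl]]) simp_all
  qed
  have le: "(csize search_body + 1) * (M1 + M2 + 2 * n) + 25 + ((csize aug_body + 1) * n + 10) \<le> (csize search_body + csize aug_body + 2) * (M1 + M2 + 3 * n) + 40"
    by (simp add: algebra_simps)
  show ?thesis by (rule halts_Seq[OF search_correct[OF assms] aug le])
qed

end

section \<open>Two failures: dropping paths, two rounds of augmentation, output\<close>

definition scan :: com where
  "scan = seqs [ldf 52 50 5, Cond (Eq 52 61) (seqs [Load 52 50, Op Add 52 40 52, Store 52 61]) Skip]"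

definition emit_toggled :: com where
  "emit_toggled = seqs [Load 52 50, Op Add 53 40 52, Load 53 53, Cond (Eq 53 61) (Emit 52) Skip]"

text \<open>Failures are marked after the scans, since a failed arc on a dropped path must end with
  toggle 2. The second round uses a fresh parent table, and stack cells are written before they are
  read, so nothing has to be cleared.\<close>

definition report2_main :: com where
  "report2_main = seqs [ldh 40 4, ldh 42 7, ldh 43 8, ldh 44 9, forblk 30 scan, forblk 31 scan,
     seqs [Op Add 52 40 1, Const 53 2, Store 52 53, Op Add 52 40 2, Store 52 53, ldh 41 5],
     Seq search augment, ldh 41 6, Seq search augment, forblk 30 emit_toggled, forblk 31 emit_toggled]"

context blocks_mem
begin

definition dregs :: "state \<Rightarrow> bool" where
  "dregs \<sigma> \<longleftrightarrow> regs \<sigma> 30 = b1 \<and> regs \<sigma> 31 = b2 \<and> regs \<sigma> 40 = N \<and> regs \<sigma> 42 = S \<and>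
     regs \<sigma> 43 = s \<and> regs \<sigma> 44 = t \<and> regs \<sigma> 60 = 0 \<and> regs \<sigma> 61 = 1"

definition tmem :: "(nat \<Rightarrow> nat) \<Rightarrow> state \<Rightarrow> bool" where
  "tmem f \<sigma> \<longleftrightarrow> (\<forall>y<m. mem \<sigma> (N + y) = f y)"

definition zmem :: "state \<Rightarrow> bool" where
  "zmem \<sigma> \<longleftrightarrow> (\<forall>a<S. N + m \<le> a \<longrightarrow> mem \<sigma> a = 0)"

lemma scan_correct:
  assumes blk: "block_ok n b st M" and B: "regs \<sigma> B = b" "B = 30 \<or> B = 31"
    and \<sigma>: "agrees \<sigma>" "dregs \<sigma>" "tmem f \<sigma>" "zmem \<sigma>" "out \<sigma> = []" "regs \<sigma> 1 = x1" "regs \<sigma> 2 = x2"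
  shows "halts w (forblk B scan) \<sigma> ((csize scan + 4) * M + 10) (\<lambda>\<tau>. agrees \<tau> \<and> dregs \<tau> \<and>
     tmem (\<lambda>y. if \<exists>e\<in>set (entries st M). mu (e + 5) = 1 \<and> mu e = y then 1 else f y) \<tau> \<and>
     zmem \<tau> \<and> out \<tau> = [] \<and> regs \<tau> 1 = x1 \<and> regs \<tau> 2 = x2)"
proof -
  define P :: "nat \<Rightarrow> state \<Rightarrow> bool" where "P q \<tau> \<longleftrightarrow> dregs \<tau> \<and>
    tmem (\<lambda>y. if \<exists>i<q. mu (st + 6 * i + 5) = 1 \<and> mu (st + 6 * i) = y then 1 else f y) \<tau> \<and>
    zmem \<tau> \<and> out \<tau> = [] \<and> regs \<tau> 1 = x1 \<and> regs \<tau> 2 = x2" for q \<tau>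
  have "halts w (forblk B scan) \<sigma> ((csize scan + 4) * M + 10) (\<lambda>\<tau>. agrees \<tau> \<and> P M \<tau>)"
  proof (rule halts_forblk[OF blk \<sigma>(1) B(1)])
    show "P 0 \<sigma>" unfolding P_def using \<sigma> by simp
    show "\<And>q \<sigma> \<tau>. P q \<sigma> \<Longrightarrow> frame {8, 50, 51} \<sigma> \<tau> \<Longrightarrow> P q \<tau>" unfolding P_def frame_def dregs_def tmem_def zmem_def by simp
    fix q \<sigma> assume q: "q < M" "agrees \<sigma>" "regs \<sigma> 50 = st + 6 * q" "P q \<sigma>"
    let ?e = "st + 6 * q"
    have qe: "?e \<in> set (entries st M)" using q(1) unfolding entries_def by auto
    have ym: "mu ?e < m" using blk qe unfolding block_ok_def by blast
    have eN: "?e + 5 < N" using q(1) blk unfolding block_ok_def by auto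
    have mm: "mem \<sigma> ?e = mu ?e" "mem \<sigma> (?e + 5) = mu (?e + 5)" using q(2) eN unfolding agrees_def by auto
    have cr: "regs \<sigma> 40 = N" "regs \<sigma> 61 = 1" using q(4) unfolding P_def dregs_def by auto
    have bw: "?e + 5 < 2 ^ w" "N + mu ?e < 2 ^ w" using eN ym N_less space by linarith+
    have r: "run w scan \<sigma> = (if mu (?e + 5) = 1
      then \<sigma>\<lparr>regs := (regs \<sigma>)(8 := ?e + 5, 52 := N + mu ?e), mem := (mem \<sigma>)(N + mu ?e := 1)\<rparr>
      else \<sigma>\<lparr>regs := (regs \<sigma>)(8 := ?e + 5, 52 := mu (?e + 5))\<rparr>)"
      unfolding scan_def by (simp add: q(3) cr bw mm del: One_nat_def)
    have ag: "agrees (run w scan \<sigma>)" using q(2) unfolding r agrees_def by auto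
    have pr: "dregs (run w scan \<sigma>)" "zmem (run w scan \<sigma>)" "out (run w scan \<sigma>) = []" "regs (run w scan \<sigma>) 1 = x1" "regs (run w scan \<sigma>) 2 = x2"
      "regs (run w scan \<sigma>) 50 = regs \<sigma> 50" "regs (run w scan \<sigma>) 51 = regs \<sigma> 51"
      using q(4) ym unfolding P_def r dregs_def zmem_def by auto
    have tm: "tmem (\<lambda>y. if \<exists>i<q + 1. mu (st + 6 * i + 5) = 1 \<and> mu (st + 6 * i) = y then 1 else f y) (run w scan \<sigma>)"
      unfolding tmem_def
    proof (intro allI impI)
      fix y assume "y < m"
      have old: "mem \<sigma> (N + y) = (if \<exists>i<q. mu (st + 6 * i + 5) = 1 \<and> mu (st + 6 * i) = y then 1 else f y)"
        using q(4) \<open>y < m\<close> unfolding P_def tmem_def by blast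
      have ex: "(\<exists>i<q + 1. mu (st + 6 * i + 5) = 1 \<and> mu (st + 6 * i) = y) \<longleftrightarrow>
        (\<exists>i<q. mu (st + 6 * i + 5) = 1 \<and> mu (st + 6 * i) = y) \<or> mu (?e + 5) = 1 \<and> mu ?e = y"
        by (auto simp: less_Suc_eq)
      have "mem (run w scan \<sigma>) (N + y) = (if mu (?e + 5) = 1 \<and> mu ?e = y then 1 else mem \<sigma> (N + y))" unfolding r by auto
      then show "mem (run w scan \<sigma>) (N + y) = (if \<exists>i<q + 1. mu (st + 6 * i + 5) = 1 \<and> mu (st + 6 * i) = y then 1 else f y)"
        unfolding ex old by auto
    qed
    show "agrees (run w scan \<sigma>) \<and> regs (run w scan \<sigma>) 50 = regs \<sigma> 50 \<and> regs (run w scan \<sigma>) 51 = regs \<sigma> 51 \<and> P (q + 1) (run w scan \<sigma>)"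
      unfolding P_def using ag pr tm by blast
  qed (use B in \<open>auto simp: scan_def\<close>)
  moreover have "(\<exists>e\<in>set (entries st M). mu (e + 5) = 1 \<and> mu e = y) \<longleftrightarrow> (\<exists>i<M. mu (st + 6 * i + 5) = 1 \<and> mu (st + 6 * i) = y)" for y
    unfolding entries_def by auto
  ultimately show ?thesis unfolding P_def by simp
qed

lemma emit_correct:
  assumes blk: "block_ok n b st M" and B: "regs \<sigma> B = b" "B = 30 \<or> B = 31"
    and \<sigma>: "agrees \<sigma>" "dregs \<sigma>" "tmem f \<sigma>" "set (out \<sigma>) = Z"
  shows "halts w (forblk B emit_toggled) \<sigma> ((csize emit_toggled + 4) * M + 10)
    (\<lambda>\<tau>. agrees \<tau> \<and> dregs \<tau> \<and> tmem f \<tau> \<and> set (out \<tau>) = Z \<union> {y \<in> mu ` set (entries st M). f y = 1})"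
proof -
  define P :: "nat \<Rightarrow> state \<Rightarrow> bool" where "P q \<tau> \<longleftrightarrow> dregs \<tau> \<and> tmem f \<tau> \<and>
    set (out \<tau>) = Z \<union> {y. \<exists>i<q. y = mu (st + 6 * i) \<and> f y = 1}" for q \<tau>
  have "halts w (forblk B emit_toggled) \<sigma> ((csize emit_toggled + 4) * M + 10) (\<lambda>\<tau>. agrees \<tau> \<and> P M \<tau>)"
  proof (rule halts_forblk[OF blk \<sigma>(1) B(1)])
    show "P 0 \<sigma>" unfolding P_def using \<sigma> by simp
    show "\<And>q \<sigma> \<tau>. P q \<sigma> \<Longrightarrow> frame {8, 50, 51} \<sigma> \<tau> \<Longrightarrow> P q \<tau>" unfolding P_def frame_def dregs_def tmem_def by simp
    fix q \<sigma> assume q: "q < M" "agrees \<sigma>" "regs \<sigma> 50 = st + 6 * q" "P q \<sigma>"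
    let ?e = "st + 6 * q"
    have qe: "?e \<in> set (entries st M)" using q(1) unfolding entries_def by auto
    have ym: "mu ?e < m" using blk qe unfolding block_ok_def by blast
    have eN: "?e + 5 < N" using q(1) blk unfolding block_ok_def by auto
    have mm: "mem \<sigma> ?e = mu ?e" "mem \<sigma> (N + mu ?e) = f (mu ?e)" using q(2,4) eN ym unfolding agrees_def P_def tmem_def by auto
    have cr: "regs \<sigma> 40 = N" "regs \<sigma> 61 = 1" using q(4) unfolding P_def dregs_def by auto
    have bw: "N + mu ?e < 2 ^ w" using eN ym N_less space by linarith+
    define R where "R = (regs \<sigma>)(52 := mu ?e, 53 := f (mu ?e))"
    have r: "run w emit_toggled \<sigma> = (if f (mu ?e) = 1 then \<sigma>\<lparr>regs := R, out := out \<sigma> @ [mu ?e]\<rparr> else \<sigma>\<lparr>regs := R\<rparr>)"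
      unfolding emit_toggled_def R_def by (simp add: q(3) cr bw mm del: One_nat_def)
    have "{y. \<exists>i<q + 1. y = mu (st + 6 * i) \<and> f y = 1} = {y. \<exists>i<q. y = mu (st + 6 * i) \<and> f y = 1} \<union> {y. y = mu ?e \<and> f y = 1}"
      by (auto simp: less_Suc_eq)
    then show "agrees (run w emit_toggled \<sigma>) \<and> regs (run w emit_toggled \<sigma>) 50 = regs \<sigma> 50 \<and> regs (run w emit_toggled \<sigma>) 51 = regs \<sigma> 51 \<and> P (q + 1) (run w emit_toggled \<sigma>)"
      using q(2,4) unfolding r P_def R_def agrees_def dregs_def tmem_def by auto
  qed (use B in \<open>auto simp: emit_toggled_def\<close>)
  moreover have "{y \<in> mu ` set (entries st M). f y = 1} = {y. \<exists>i<M. y = mu (st + 6 * i) \<and> f y = 1}"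
    unfolding entries_def by auto
  ultimately show ?thesis unfolding P_def by simp
qed

lemma report2_main_correct:
  assumes hdr: "mu 4 = N" "mu 5 = N + m" "mu 6 = N + m + n" "mu 7 = S" "mu 8 = s" "mu 9 = t"
    and \<sigma>: "agrees \<sigma>" "regs \<sigma> 30 = b1" "regs \<sigma> 31 = b2" "regs \<sigma> 60 = 0" "regs \<sigma> 61 = 1" "out \<sigma> = []"
      "regs \<sigma> 1 = x1" "regs \<sigma> 2 = x2" "x1 < m" "x2 < m" "\<And>a. N \<le> a \<Longrightarrow> a < S \<Longrightarrow> mem \<sigma> a = 0"
  defines "tog0 \<equiv> \<lambda>y. if y = x1 \<or> y = x2 then 2 else if \<exists>e\<in>ent. mu (e + 5) = 1 \<and> mu e = y then 1 else 0"
  shows "halts w report2_main \<sigma>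
    (2 * (csize search_body + csize aug_body + csize scan + csize emit_toggled + 20) * (M1 + M2 + 3 * n) + 200)
    (\<lambda>\<tau>. \<exists>tog1 tog2. round_post tog0 tog1 \<and> round_post tog1 tog2 \<and> set (out \<tau>) = {y \<in> mu ` ent. tog2 y = 1})"
proof -
  let ?Q = "\<lambda>\<tau>. \<exists>tog1 tog2. round_post tog0 tog1 \<and> round_post tog1 tog2 \<and> set (out \<tau>) = {y \<in> mu ` ent. tog2 y = 1}"
  let ?V1 = "N + m" and ?V2 = "N + m + n"
  have Sdef: "S = N + m + 2 * n" unfolding S_def ..
  have cw: "4 < (2::nat) ^ w" "5 < (2::nat) ^ w" "6 < (2::nat) ^ w" "7 < (2::nat) ^ w" "8 < (2::nat) ^ w" "9 < (2::nat) ^ w" "2 < (2::nat) ^ w"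
    using N_less N_ge by linarith+
  define TE where "TE = (csize emit_toggled + 4) * M1 + (csize emit_toggled + 4) * M2 + 22"
  define TR where "TR = (csize search_body + csize aug_body + 2) * (M1 + M2 + 3 * n) + 40"
  define TS where "TS = (csize scan + 4) * M1 + (csize scan + 4) * M2 + 20"
  have emit: "halts w (seqs [forblk 30 emit_toggled, forblk 31 emit_toggled]) \<tau> TE ?Q"
    if a: "agrees \<tau>" "dregs \<tau>" "tmem tog2 \<tau>" "out \<tau> = []" "round_post tog0 tog1" "round_post tog1 tog2" for \<tau> tog1 tog2
  proof -
    have b: "regs \<tau> 30 = b1" using a(2) unfolding dregs_def by blast
    show ?thesis unfolding seqs.simps TE_def
    proof (rule halts_Seq[OF emit_correct[OF blocks(1) b _ a(1-3) refl], of _ "(csize emit_toggled + 4) * M2 + 11"])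
      fix \<rho> assume x: "agrees \<rho> \<and> dregs \<rho> \<and> tmem tog2 \<rho> \<and> set (out \<rho>) = set (out \<tau>) \<union> {y \<in> mu ` set (entries st1 M1). tog2 y = 1}"
      have b': "regs \<rho> 31 = b2" using x unfolding dregs_def by blast
      have "halts w (forblk 31 emit_toggled) \<rho> ((csize emit_toggled + 4) * M2 + 10) ?Q"
      proof (rule halts_weaken[OF emit_correct[OF blocks(2) b', of tog2] order_refl])
        fix \<rho>' assume y: "agrees \<rho>' \<and> dregs \<rho>' \<and> tmem tog2 \<rho>' \<and> set (out \<rho>') = set (out \<rho>) \<union> {y \<in> mu ` set (entries st2 M2). tog2 y = 1}"
        have "set (out \<rho>') = {y \<in> mu ` ent. tog2 y = 1}" using x y a(4) unfolding ent_def by auto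
        then show "?Q \<rho>'" using a(5,6) by blast
      qed (use x in auto)
      then show "halts w (Seq (forblk 31 emit_toggled) Skip) \<rho> ((csize emit_toggled + 4) * M2 + 11) ?Q"
        by (intro halts_weaken[OF halts_Seq_Skip]) auto
    qed auto
  qed
  have rounds: "halts w (seqs [Seq search augment, ldh 41 6, Seq search augment, forblk 30 emit_toggled, forblk 31 emit_toggled]) \<tau> (2 * TR + TE + 3) ?Q"
    if a: "cregs ?V1 \<tau>" "agrees \<tau>" "tmem tog0 \<tau>" "zmem \<tau>" "out \<tau> = []" for \<tau>
  proof -
    have base: "base_ok ?V1 (mem \<tau>) tog0" using a(2,3) unfolding base_ok_def agrees_def tmem_def by auto
    have z: "mem \<tau> (?V1 + v) = 0" if "v < n" for v using a(4) that unfolding zmem_def Sdef by auto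
    show ?thesis unfolding seqs.simps(2)[of "Seq search augment"]
    proof (rule halts_Seq[OF round_correct[OF a(1) base z], of _ "TR + TE + 3"])
      fix \<rho> assume x: "cregs ?V1 \<rho> \<and> out \<rho> = out \<tau> \<and> (\<exists>tog'. round_mem ?V1 (mem \<tau>) tog' \<rho> \<and> round_post tog0 tog')"
      then obtain tog1 where t1: "round_mem ?V1 (mem \<tau>) tog1 \<rho>" "round_post tog0 tog1" by blast
      define \<rho>1 where "\<rho>1 = run w (ldh 41 6) \<rho>"
      have m6: "mem \<rho> 6 = ?V2" using t1(1) N_ge hdr(3) unfolding round_mem_def by auto
      have r1: "\<rho>1 = \<rho>\<lparr>regs := (regs \<rho>)(41 := ?V2)\<rparr>" unfolding \<rho>1_def using cw m6 by simp
      have c1: "cregs ?V2 \<rho>1" using x unfolding r1 cregs_def by simp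
      have base1: "base_ok ?V2 (mem \<rho>1) tog1" using t1(1) unfolding r1 base_ok_def round_mem_def by auto
      have z1: "mem \<rho>1 (?V2 + v) = 0" if "v < n" for v
      proof -
        have "mem \<rho> (?V2 + v) = mem \<tau> (?V2 + v)" using t1(1) that unfolding round_mem_def Sdef by auto
        also have "\<dots> = 0" using a(4) that unfolding zmem_def Sdef by auto
        finally show ?thesis unfolding r1 by simp
      qed
      have hh: "halts w (Seq (Seq search augment) (seqs [forblk 30 emit_toggled, forblk 31 emit_toggled])) \<rho>1 (TR + TE) ?Q"
      proof (rule halts_Seq[OF round_correct[OF c1 base1 z1], of _ TE])
        fix \<rho>2 assume y: "cregs ?V2 \<rho>2 \<and> out \<rho>2 = out \<rho>1 \<and> (\<exists>tog'. round_mem ?V2 (mem \<rho>1) tog' \<rho>2 \<and> round_post tog1 tog')"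
        then obtain tog2 where t2: "round_mem ?V2 (mem \<rho>1) tog2 \<rho>2" "round_post tog1 tog2" by blast
        show "halts w (seqs [forblk 30 emit_toggled, forblk 31 emit_toggled]) \<rho>2 TE ?Q"
        proof (rule emit[OF _ _ _ _ t1(2) t2(2)])
          show "agrees \<rho>2" "tmem tog2 \<rho>2" using t2(1) unfolding round_mem_def agrees_def tmem_def by auto
          show "dregs \<rho>2" using y unfolding dregs_def cregs_def by auto
          show "out \<rho>2 = []" using y x a(5) unfolding r1 by simp
        qed
      qed ((use TR_def in linarith)+)
      show "halts w (seqs [ldh 41 6, Seq search augment, forblk 30 emit_toggled, forblk 31 emit_toggled]) \<rho> (TR + TE + 3) ?Q"
        unfolding seqs.simps(2)[of "ldh 41 6"] seqs.simps(2)[of "Seq search augment"]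
        by (rule halts_Seq_run[OF loopfree_ldf(2) hh[unfolded \<rho>1_def]]) simp
    qed ((use TR_def in linarith)+)
  qed
  let ?rest = "[Seq search augment, ldh 41 6, Seq search augment, forblk 30 emit_toggled, forblk 31 emit_toggled]"
  let ?mid = "seqs [Op Add 52 40 1, Const 53 2, Store 52 53, Op Add 52 40 2, Store 52 53, ldh 41 5]"
  have mid: "halts w (seqs (?mid # ?rest)) \<tau> (2 * TR + TE + 20) ?Q"
    if a: "agrees \<tau>" "dregs \<tau>" "tmem f \<tau>" "zmem \<tau>" "out \<tau> = []" "regs \<tau> 1 = x1" "regs \<tau> 2 = x2"
      and f: "\<And>y. f y = (if \<exists>e\<in>ent. mu (e + 5) = 1 \<and> mu e = y then 1 else 0)" for \<tau> f
  proof -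
    have cr: "regs \<tau> 40 = N" using a(2) unfolding dregs_def by simp
    have bw: "N + x1 < 2 ^ w" "N + x2 < 2 ^ w" using \<sigma>(9,10) space by linarith+
    have m5: "mem \<tau> 5 = ?V1" using a(1) hdr(2) N_ge unfolding agrees_def by auto
    have r: "run w ?mid \<tau> = \<tau>\<lparr>mem := (mem \<tau>)(N + x1 := 2, N + x2 := 2), regs := (regs \<tau>)(52 := N + x2, 53 := 2, 41 := ?V1)\<rparr>"
      using cr bw a(6,7) cw m5 N_ge by (simp add: fun_upd_twist)
    have hm: "halts w (seqs ?rest) (run w ?mid \<tau>) (2 * TR + TE + 3) ?Q"
    proof (rule rounds)
      show "cregs ?V1 (run w ?mid \<tau>)" using a(2) unfolding r cregs_def dregs_def by simp
      show "agrees (run w ?mid \<tau>)" using a(1) unfolding r agrees_def by auto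
      show "tmem tog0 (run w ?mid \<tau>)" using a(3) f unfolding r tmem_def tog0_def by auto
      show "zmem (run w ?mid \<tau>)" using a(4) \<sigma>(9,10) unfolding r zmem_def by auto
      show "out (run w ?mid \<tau>) = []" using a(5) unfolding r by simp
    qed
    show ?thesis unfolding seqs.simps(2)[of ?mid] by (rule halts_Seq_run[OF _ hm]) simp_all
  qed
  have scans: "halts w (seqs (forblk 30 scan # forblk 31 scan # ?mid # ?rest)) \<tau> (TS + 2 * TR + TE + 20) ?Q"
    if a: "agrees \<tau>" "dregs \<tau>" "tmem (\<lambda>_. 0) \<tau>" "zmem \<tau>" "out \<tau> = []" "regs \<tau> 1 = x1" "regs \<tau> 2 = x2" for \<tau>
  proof -
    have b: "regs \<tau> 30 = b1" using a(2) unfolding dregs_def by blast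
    show ?thesis unfolding seqs.simps(2)[of "forblk 30 scan"]
    proof (rule halts_Seq[OF scan_correct[OF blocks(1) b _ a], of _ "(csize scan + 4) * M2 + 10 + 2 * TR + TE + 20"])
      fix \<rho> assume x: "agrees \<rho> \<and> dregs \<rho> \<and> tmem (\<lambda>y. if \<exists>e\<in>set (entries st1 M1). mu (e + 5) = 1 \<and> mu e = y then 1 else 0) \<rho> \<and>
        zmem \<rho> \<and> out \<rho> = [] \<and> regs \<rho> 1 = x1 \<and> regs \<rho> 2 = x2"
      have b': "regs \<rho> 31 = b2" using x unfolding dregs_def by blast
      show "halts w (seqs (forblk 31 scan # ?mid # ?rest)) \<rho> ((csize scan + 4) * M2 + 10 + 2 * TR + TE + 20) ?Q"
        unfolding seqs.simps(2)[of "forblk 31 scan"]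
      proof (rule halts_Seq[OF scan_correct[OF blocks(2) b' _], of _ _ _ _ "2 * TR + TE + 20"])
        fix \<rho>' assume y: "agrees \<rho>' \<and> dregs \<rho>' \<and> tmem (\<lambda>y. if \<exists>e\<in>set (entries st2 M2). mu (e + 5) = 1 \<and> mu e = y then 1
            else if \<exists>e\<in>set (entries st1 M1). mu (e + 5) = 1 \<and> mu e = y then 1 else 0) \<rho>' \<and>
          zmem \<rho>' \<and> out \<rho>' = [] \<and> regs \<rho>' 1 = x1 \<and> regs \<rho>' 2 = x2"
        show "halts w (seqs (?mid # ?rest)) \<rho>' (2 * TR + TE + 20) ?Q"
          by (rule mid[of \<rho>' "\<lambda>y. if \<exists>e\<in>set (entries st2 M2). mu (e + 5) = 1 \<and> mu e = y then 1
            else if \<exists>e\<in>set (entries st1 M1). mu (e + 5) = 1 \<and> mu e = y then 1 else 0"]) (use y in \<open>auto simp: ent_def\<close>)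
      qed (use x in auto)
    qed (use TS_def in \<open>auto\<close>)
  qed
  define \<sigma>4 where "\<sigma>4 = run w (ldh 44 9) (run w (ldh 43 8) (run w (ldh 42 7) (run w (ldh 40 4) \<sigma>)))"
  have mh: "mem \<sigma> 4 = N" "mem \<sigma> 7 = S" "mem \<sigma> 8 = s" "mem \<sigma> 9 = t" using \<sigma>(1) hdr N_ge unfolding agrees_def by auto
  have r4: "\<sigma>4 = \<sigma>\<lparr>regs := (regs \<sigma>)(40 := N, 42 := S, 43 := s, 44 := t)\<rparr>" unfolding \<sigma>4_def using mh cw by simp
  have h4: "halts w (seqs (forblk 30 scan # forblk 31 scan # ?mid # ?rest)) \<sigma>4 (TS + 2 * TR + TE + 20) ?Q"
    by (rule scans) (use \<sigma> Sdef in \<open>auto simp: r4 agrees_def dregs_def tmem_def zmem_def\<close>)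
  have eq: "report2_main = Seq (ldh 40 4) (Seq (ldh 42 7) (Seq (ldh 43 8) (Seq (ldh 44 9) (seqs (forblk 30 scan # forblk 31 scan # ?mid # ?rest)))))"
    unfolding report2_main_def by simp
  have "halts w report2_main \<sigma> (12 + (TS + 2 * TR + TE + 20)) ?Q" unfolding eq
    by (rule halts_Seq_run[OF loopfree_ldf(2) halts_Seq_run[OF loopfree_ldf(2) halts_Seq_run[OF loopfree_ldf(2) halts_Seq_run[OF loopfree_ldf(2)
      h4[unfolded \<sigma>4_def] order_refl] order_refl] order_refl]]) simp
  moreover have "12 + (TS + 2 * TR + TE + 20) \<le>
      2 * (csize search_body + csize aug_body + csize scan + csize emit_toggled + 20) * (M1 + M2 + 3 * n) + 200"
    unfolding TS_def TR_def TE_def by (simp add: algebra_simps)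
  ultimately show ?thesis by (rule halts_weaken) blast
qed

end

section \<open>The report program\<close>

text \<open>If only one failed arc carries flow, its block also takes the place of the missing one,
  so that the main part always handles two blocks. If neither carries flow, nothing changes.\<close>

definition report2 :: com where
  "report2 = seqs [Const 61 1, locate 1 20, ldf 30 20 2, locate 2 21, ldf 31 21 2,
     Cond (Eq 30 60) (Op Add 30 31 60) Skip, Cond (Eq 31 60) (Op Add 31 30 60) Skip,
     Cond (Eq 30 60) Skip report2_main]"

text \<open>The reported flow must not depend on the order in which the failed arcs are listed.\<close>

definition sort_query :: com where
  "sort_query = Cond (Less 2 1) (seqs [Op Add 3 1 60, Op Add 1 2 60, Op Add 2 3 60, Const 3 0]) Skip"

text \<open>Register 3 is cleared before sorting, so that \<open>report2\<close> finds an exact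
  start state of the sorted query.\<close>

definition report_prog :: com where
  "report_prog = seqs [Const 3 1, Cond (Eq 0 3) report1
     (seqs [Const 3 2, Cond (Eq 0 3) (seqs [Const 3 0, sort_query, report2]) Skip])]"

context dict_mem
begin

lemma report2_correct:
  assumes \<sigma>: "agrees \<sigma>" "regs \<sigma> 1 = x1" "regs \<sigma> 2 = x2" "x1 < m" "x2 < m" "regs \<sigma> 60 = 0" "out \<sigma> = []"
    and zero: "\<And>a. N \<le> a \<Longrightarrow> mem \<sigma> a = 0"
  defines "c1 \<equiv> if blk x1 = 0 then blk x2 else blk x1" and "c2 \<equiv> if blk x2 = 0 then blk x1 else blk x2"
  assumes blocks: "c1 \<noteq> 0 \<Longrightarrow> blocks_mem w m N mu ptr fb blk L U c d n s t c1 st1 M1 c2 st2 M2"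
    and hdr: "c1 \<noteq> 0 \<Longrightarrow> mu 4 = N \<and> mu 5 = N + m \<and> mu 6 = N + m + n \<and> mu 7 = N + m + 2 * n \<and> mu 8 = s \<and> mu 9 = t"
  defines "E \<equiv> set (entries st1 M1) \<union> set (entries st2 M2)"
  defines "tog0 \<equiv> \<lambda>y. if y = x1 \<or> y = x2 then 2 else if \<exists>e\<in>E. mu (e + 5) = 1 \<and> mu e = y then 1 else 0"
  shows "halts w report2 \<sigma> (2 * csize (locate 1 20) +
      2 * (csize search_body + csize aug_body + csize scan + csize emit_toggled + 20) * (M1 + M2 + 3 * n) + 300)
    (\<lambda>\<tau>. if c1 = 0 then out \<tau> = [] else
      \<exists>tog1 tog2. blocks_mem.round_post mu n s t st1 M1 st2 M2 tog0 tog1 \<and> blocks_mem.round_post mu n s t st1 M1 st2 M2 tog1 tog2 \<and>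
        set (out \<tau>) = {y \<in> mu ` E. tog2 y = 1})" (is "halts w report2 \<sigma> _ ?Q")
proof -
  define T where "T = 2 * (csize search_body + csize aug_body + csize scan + csize emit_toggled + 20) * (M1 + M2 + 3 * n) + 200"
  define \<sigma>0 where "\<sigma>0 = run w (Const 61 1) \<sigma>"
  define \<sigma>1 where "\<sigma>1 = run w (locate 1 20) \<sigma>0"
  define \<sigma>2 where "\<sigma>2 = run w (ldf 30 20 2) \<sigma>1"
  define \<sigma>3 where "\<sigma>3 = run w (locate 2 21) \<sigma>2"
  define \<sigma>4 where "\<sigma>4 = run w (ldf 31 21 2) \<sigma>3"
  define \<sigma>5 where "\<sigma>5 = run w (Cond (Eq 30 60) (Op Add 30 31 60) Skip) \<sigma>4"
  define \<sigma>6 where "\<sigma>6 = run w (Cond (Eq 31 60) (Op Add 31 30 60) Skip) \<sigma>5"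
  have 0: "frame {61} \<sigma> \<sigma>0" "regs \<sigma>0 61 = 1" using w_pos unfolding \<sigma>0_def frame_def by auto
  have a0: "agrees \<sigma>0" using agrees_frame[OF \<sigma>(1) 0(1)] .
  have "regs \<sigma>0 1 = x1" using 0(1) \<sigma>(2) unfolding frame_def by simp
  then have 1: "frame ({8..19} \<union> {20}) \<sigma>0 \<sigma>1" "regs \<sigma>1 20 = ptr x1"
    unfolding \<sigma>1_def using run_locate[OF a0 _ \<sigma>(4), of 1 20] by auto
  have a1: "agrees \<sigma>1" using agrees_frame[OF a0 1(1)] .
  have b: "ptr x1 + 2 < N" "mu (ptr x1 + 2) = blk x1" "ptr x2 + 2 < N" "mu (ptr x2 + 2) = blk x2" using fields[OF \<sigma>(4)] fields[OF \<sigma>(5)] by auto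
  have bw: "ptr x1 + 2 < 2 ^ w" "ptr x2 + 2 < 2 ^ w" using b N_less by linarith+
  have m2: "mem \<sigma>1 (ptr x1 + 2) = blk x1" using a1 b unfolding agrees_def by simp
  have s2: "\<sigma>2 = \<sigma>1\<lparr>regs := (regs \<sigma>1)(8 := ptr x1 + 2, 30 := blk x1)\<rparr>" unfolding \<sigma>2_def using 1(2) bw m2 by simp
  have 2: "frame {8, 30} \<sigma>1 \<sigma>2" "regs \<sigma>2 30 = blk x1" unfolding s2 frame_def by auto
  have a2: "agrees \<sigma>2" using agrees_frame[OF a1 2(1)] .
  have "regs \<sigma>2 2 = x2" using 0(1) 1(1) 2(1) \<sigma>(3) unfolding frame_def by auto
  then have 3: "frame ({8..19} \<union> {21}) \<sigma>2 \<sigma>3" "regs \<sigma>3 21 = ptr x2"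
    unfolding \<sigma>3_def using run_locate[OF a2 _ \<sigma>(5), of 2 21] by auto
  have a3: "agrees \<sigma>3" using agrees_frame[OF a2 3(1)] .
  have m4: "mem \<sigma>3 (ptr x2 + 2) = blk x2" using a3 b unfolding agrees_def by simp
  have s4: "\<sigma>4 = \<sigma>3\<lparr>regs := (regs \<sigma>3)(8 := ptr x2 + 2, 31 := blk x2)\<rparr>" unfolding \<sigma>4_def using 3(2) bw m4 by simp
  have 4: "frame {8, 31} \<sigma>3 \<sigma>4" "regs \<sigma>4 31 = blk x2" unfolding s4 frame_def by auto
  have r4: "regs \<sigma>4 30 = blk x1" "regs \<sigma>4 60 = 0" "regs \<sigma>4 61 = 1" "regs \<sigma>4 1 = x1" "regs \<sigma>4 2 = x2" "out \<sigma>4 = []" "mem \<sigma>4 = mem \<sigma>"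
    using 0 1(1) 2 3(1) 4(1) \<sigma>(2,3,6,7) unfolding frame_def by auto
  have blkw: "blk x1 < 2 ^ w" "blk x2 < 2 ^ w" if "c1 \<noteq> 0"
  proof -
    interpret B: blocks_mem w m N mu ptr fb blk L U c d n s t c1 st1 M1 c2 st2 M2 using blocks[OF that] .
    have "c1 < N" "c2 < N" using B.blocks unfolding block_ok_def by auto
    then show "blk x1 < 2 ^ w" "blk x2 < 2 ^ w" using N_less unfolding c1_def c2_def by (auto split: if_splits)
  qed
  have r5: "\<sigma>5 = (if blk x1 = 0 then \<sigma>4\<lparr>regs := (regs \<sigma>4)(30 := blk x2)\<rparr> else \<sigma>4)"
    unfolding \<sigma>5_def using r4 4(2) blkw(2) unfolding c1_def by (cases "blk x2 = 0") auto
  have r6: "\<sigma>6 = (if blk x2 = 0 then \<sigma>5\<lparr>regs := (regs \<sigma>5)(31 := blk x1)\<rparr> else \<sigma>5)"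
    unfolding \<sigma>6_def using r4 4(2) blkw(1) unfolding c1_def r5 by (cases "blk x1 = 0") auto
  have R: "regs \<sigma>6 30 = c1" "regs \<sigma>6 31 = c2" "regs \<sigma>6 60 = 0" "regs \<sigma>6 61 = 1" "regs \<sigma>6 1 = x1" "regs \<sigma>6 2 = x2" "out \<sigma>6 = []" "mem \<sigma>6 = mem \<sigma>"
    unfolding r6 r5 c1_def c2_def using r4 4(2) by auto
  have a6: "agrees \<sigma>6" using \<sigma>(1) R(8) unfolding agrees_def by simp
  have h: "halts w (Cond (Eq 30 60) Skip report2_main) \<sigma>6 (T + 1) ?Q"
  proof (rule halts_Cond[of _ _ _ _ T])
    assume "test_val (Eq 30 60) \<sigma>6"
    then have "c1 = 0" using R by simp
    then show "halts w Skip \<sigma>6 T ?Q" using R by (intro halts_run) (auto simp: T_def)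
  next
    assume "\<not> test_val (Eq 30 60) \<sigma>6"
    then have nz: "c1 \<noteq> 0" using R by simp
    interpret B: blocks_mem w m N mu ptr fb blk L U c d n s t c1 st1 M1 c2 st2 M2 using blocks[OF nz] .
    have ent: "B.ent = E" unfolding B.ent_def E_def ..
    have S: "B.S = N + m + 2 * n" unfolding B.S_def ..
    have z: "mem \<sigma>6 a = 0" if "N \<le> a" "a < B.S" for a using zero[OF that(1)] R(8) by simp
    show "halts w report2_main \<sigma>6 T ?Q"
      using B.report2_main_correct[OF _ _ _ _ _ _ a6 R(1,2,3,4,7,5,6) \<sigma>(4,5) z] hdr[OF nz] nz S
      unfolding T_def tog0_def ent by simp
  qed simp
  have eq: "report2 = Seq (Const 61 1) (Seq (locate 1 20) (Seq (ldf 30 20 2) (Seq (locate 2 21) (Seq (ldf 31 21 2)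
     (Seq (Cond (Eq 30 60) (Op Add 30 31 60) Skip) (Seq (Cond (Eq 31 60) (Op Add 31 30 60) Skip)
     (Seq (Cond (Eq 30 60) Skip report2_main) Skip)))))))" by (simp add: report2_def)
  have lf: "loopfree (locate X P)" "csize (locate X P) = csize (locate 1 20)" for X P by (simp_all add: locate_def)
  have lc: "loopfree (Cond (Eq 30 60) (Op Add 30 31 60) Skip)" "loopfree (Cond (Eq 31 60) (Op Add 31 30 60) Skip)" "loopfree (Const 61 1)" by simp_all
  show ?thesis unfolding eq
    by (rule halts_Seq_run[OF lc(3) halts_Seq_run[OF lf(1) halts_Seq_run[OF loopfree_ldf(1) halts_Seq_run[OF lf(1) halts_Seq_run[OF loopfree_ldf(1)
       halts_Seq_run[OF lc(1) halts_Seq_run[OF lc(2) halts_Seq_Skip[OF h[unfolded \<sigma>6_def \<sigma>5_def \<sigma>4_def \<sigma>3_def \<sigma>2_def \<sigma>1_def \<sigma>0_def]]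
       order_refl] order_refl] order_refl] order_refl] order_refl] order_refl]]) (simp add: lf(2)[of 2 21] T_def)
qed

lemma sort_query_start:
  assumes "x1 < x2" "x2 < m"
  shows "run w (seqs [Const 3 0, sort_query]) (start D [2, x1, x2]) = start D [2, x1, x2]"
    "run w (seqs [Const 3 0, sort_query]) (start D [2, x2, x1]) = start D [2, x1, x2]"
proof -
  have b: "x1 < 2 ^ w" "x2 < 2 ^ w" "2 < (2::nat) ^ w" using assms m_less N_less N_ge by linarith+
  have p: "pad [a, b, c] i = (if i = 0 then a else if i = 1 then b else if i = 2 then c else 0)" for a b c i :: nat
    unfolding pad_def by (auto simp: nth_Cons split: nat.split)
  show "run w (seqs [Const 3 0, sort_query]) (start D [2, x1, x2]) = start D [2, x1, x2]"
    unfolding sort_query_def start_def using assms b by (auto simp: p fun_eq_iff)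
  show "run w (seqs [Const 3 0, sort_query]) (start D [2, x2, x1]) = start D [2, x1, x2]"
    unfolding sort_query_def start_def using assms b by (auto simp: p fun_eq_iff)
qed

lemma report_two:
  assumes h: "halts w report2 (start D [2, x1, x2]) T Q" and x: "x1 < x2" "x2 < m" and xs: "xs = [x1, x2] \<or> xs = [x2, x1]"
  shows "halts w report_prog (start D (length xs # xs)) (T + csize sort_query + 20) Q"
proof -
  let ?s = "start D (length xs # xs)"
  have w: "1 < (2::nat) ^ w" "2 < (2::nat) ^ w" "0 < w" using N_less N_ge w_pos by linarith+
  have r0: "regs ?s 0 = 2" using xs unfolding start_def pad_def by auto
  define \<tau> where "\<tau> = run w (Const 3 2) (run w (Const 3 1) ?s)"
  have eq: "run w (Const 3 0) \<tau> = run w (Const 3 0) ?s" unfolding \<tau>_def by simp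
  have "run w (seqs [Const 3 0, sort_query]) ?s = start D [2, x1, x2]"
    using sort_query_start[OF x] xs by (auto simp: numeral_2_eq_2)
  then have sq: "run w sort_query (run w (Const 3 0) \<tau>) = start D [2, x1, x2]" unfolding eq by simp
  have lf: "loopfree sort_query" by (simp add: sort_query_def)
  have h1: "halts w (seqs [Const 3 0, sort_query, report2]) \<tau> (T + csize sort_query + 2) Q"
    unfolding seqs.simps
    by (rule halts_Seq_run[OF _ halts_Seq_run[OF lf halts_Seq_Skip[OF h[folded sq]] order_refl]]) simp_all
  have t3: "regs \<tau> 0 = regs \<tau> 3" unfolding \<tau>_def using r0 w by simp
  have h2: "halts w (Cond (Eq 0 3) (seqs [Const 3 0, sort_query, report2]) Skip) \<tau> (T + csize sort_query + 3) Q"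
    by (rule halts_Cond[of _ _ _ _ "T + csize sort_query + 2"]) (use h1 t3 in auto)
  let ?C = "seqs [Const 3 2, Cond (Eq 0 3) (seqs [Const 3 0, sort_query, report2]) Skip]"
  have h3: "halts w ?C (run w (Const 3 1) ?s) (T + csize sort_query + 5) Q"
    unfolding seqs.simps(2)[of "Const 3 2"] seqs.simps(2)[of "Cond b c d" for b c d] seqs.simps(1)
    by (rule halts_Seq_run[OF _ halts_Seq_Skip[OF h2[unfolded \<tau>_def]]]) simp_all
  have h4: "halts w (Cond (Eq 0 3) report1 ?C) (run w (Const 3 1) ?s) (T + csize sort_query + 6) Q"
    by (rule halts_Cond[of _ _ _ _ "T + csize sort_query + 5"]) (use h3 r0 w in auto)
  have eq: "report_prog = Seq (Const 3 1) (Seq (Cond (Eq 0 3) report1 ?C) Skip)" by (simp add: report_prog_def)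
  show ?thesis unfolding eq by (rule halts_Seq_run[OF _ halts_Seq_Skip[OF h4]]) simp_all
qed

lemma report_one:
  assumes h: "halts w report1 ((start D [1, x])\<lparr>regs := (regs (start D [1, x]))(3 := 1)\<rparr>) T Q"
  shows "halts w report_prog (start D [1, x]) (T + 20) Q"
proof -
  let ?s = "start D [1, x]"
  let ?C = "seqs [Const 3 2, Cond (Eq 0 3) (seqs [Const 3 0, sort_query, report2]) Skip]"
  have r: "run w (Const 3 1) ?s = ?s\<lparr>regs := (regs ?s)(3 := 1)\<rparr>" using w_pos by simp
  have "regs ?s 0 = 1" unfolding start_def pad_def by simp
  then have h4: "halts w (Cond (Eq 0 3) report1 ?C) (run w (Const 3 1) ?s) (T + 1) Q"
    unfolding r by (intro halts_Cond[of _ _ _ _ T]) (use h in auto)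
  have eq: "report_prog = Seq (Const 3 1) (Seq (Cond (Eq 0 3) report1 ?C) Skip)" by (simp add: report_prog_def)
  show ?thesis unfolding eq by (rule halts_Seq_run[OF _ halts_Seq_Skip[OF h4]]) simp_all
qed

lemma report_none: "halts w report_prog (start D [0]) 20 (\<lambda>\<tau>. out \<tau> = [])"
proof -
  let ?s = "start D [0]"
  let ?C = "seqs [Const 3 2, Cond (Eq 0 3) (seqs [Const 3 0, sort_query, report2]) Skip]"
  have w: "1 < (2::nat) ^ w" "2 < (2::nat) ^ w" "0 < w" using N_less N_ge w_pos by linarith+
  have r0: "regs ?s 0 = 0" "out ?s = []" unfolding start_def pad_def by auto
  define \<tau> where "\<tau> = run w (Const 3 2) (run w (Const 3 1) ?s)"
  have h2: "halts w (Cond (Eq 0 3) (seqs [Const 3 0, sort_query, report2]) Skip) \<tau> 3 (\<lambda>\<tau>. out \<tau> = [])"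
    by (rule halts_Cond[of _ _ _ _ 2]) (use r0 w in \<open>auto simp: \<tau>_def intro!: halts_run\<close>)
  have h3: "halts w ?C (run w (Const 3 1) ?s) 5 (\<lambda>\<tau>. out \<tau> = [])"
    unfolding seqs.simps(2)[of "Const 3 2"] seqs.simps(2)[of "Cond b c d" for b c d] seqs.simps(1)
    by (rule halts_Seq_run[OF _ halts_Seq_Skip[OF h2[unfolded \<tau>_def]]]) simp_all
  have h4: "halts w (Cond (Eq 0 3) report1 ?C) (run w (Const 3 1) ?s) 6 (\<lambda>\<tau>. out \<tau> = [])"
    by (rule halts_Cond[of _ _ _ _ 5]) (use h3 r0 w in auto)
  have eq: "report_prog = Seq (Const 3 1) (Seq (Cond (Eq 0 3) report1 ?C) Skip)" by (simp add: report_prog_def)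
  show ?thesis unfolding eq by (rule halts_Seq_run[OF _ halts_Seq_Skip[OF h4]]) simp_all
qed

end

section \<open>Toggle tables as flows\<close>

lemma walk_map: "walk src dst p (map f es) q \<longleftrightarrow> walk (\<lambda>e. src (f e)) (\<lambda>e. dst (f e)) p es q"
  by (induction es arbitrary: p) auto

context path_system
begin

text \<open>Toggles are relative to \<open>A\<close>: an arc that has not failed is off the current
  flow if its toggle equals its membership in \<open>A\<close>. The value at offset 3 thus makes an
  entry usable exactly when it is a residual arc in its direction.\<close>

definition fwd_entry :: "(nat \<Rightarrow> nat) \<Rightarrow> nat \<Rightarrow> nat \<Rightarrow> bool" where
  "fwd_entry mu e y \<longleftrightarrow> mu e = y \<and> mu (e + 1) = ta y \<and> mu (e + 2) = he y \<and> mu (e + 3) = of_bool (y \<in> A)"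

definition bwd_entry :: "(nat \<Rightarrow> nat) \<Rightarrow> nat \<Rightarrow> nat \<Rightarrow> bool" where
  "bwd_entry mu e y \<longleftrightarrow> mu e = y \<and> mu (e + 1) = he y \<and> mu (e + 2) = ta y \<and> mu (e + 3) = of_bool (y \<notin> A)"

definition encodes :: "(nat \<Rightarrow> nat) \<Rightarrow> nat set \<Rightarrow> nat set \<Rightarrow> bool" where
  "encodes mu E NN \<longleftrightarrow> (\<forall>e\<in>E. \<exists>y\<in>NN. fwd_entry mu e y \<or> bwd_entry mu e y) \<and>
     (\<forall>y\<in>NN. (\<exists>e\<in>E. fwd_entry mu e y) \<and> (\<exists>e\<in>E. bwd_entry mu e y))"

text \<open>Failed arcs are excluded explicitly, because toggle 2 differs from 1 and would leave a
  failed arc of \<open>A\<close> in the flow.\<close>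

definition curr :: "nat set \<Rightarrow> (nat \<Rightarrow> nat) \<Rightarrow> nat set" where
  "curr F tog = {y. y < m \<and> y \<notin> F \<and> (y \<in> A) \<noteq> (tog y = 1)}"

lemma isflow_value: "isflow B r \<Longrightarrow> ex B s = int r"
  using s_neq_t unfolding isflow_def by simp

lemma encodes_Un: "encodes mu E NN \<Longrightarrow> encodes mu E' NN' \<Longrightarrow> encodes mu (E \<union> E') (NN \<union> NN')"
  unfolding encodes_def by blast

lemma encodes_arcs: "encodes mu E NN \<Longrightarrow> mu ` E = NN"
  unfolding encodes_def fwd_entry_def bwd_entry_def by fast

lemma encodes_orient:
  assumes "encodes mu E NN" "e \<in> E" "e' \<in> E" "mu e = mu e'" "mu (e + 3) = mu (e' + 3)"
  shows "mu (e + 2) = mu (e' + 2)"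
proof -
  have "fwd_entry mu e (mu e) \<or> bwd_entry mu e (mu e)" "fwd_entry mu e' (mu e') \<or> bwd_entry mu e' (mu e')"
    using assms(1-3) unfolding encodes_def fwd_entry_def bwd_entry_def by metis+
  then show ?thesis using assms(4,5) unfolding fwd_entry_def bwd_entry_def by (cases "mu e' \<in> A") auto
qed

lemma usable_entry:
  assumes enc: "encodes mu E NN" and NN: "NN \<subseteq> {..<m}" and F: "\<And>y. tog y = 2 \<longleftrightarrow> y \<in> F"
    and e: "e \<in> E" "tog (mu e) = mu (e + 3)"
  shows "mu e \<in> NN - F" "mu (e + 1) = rt (curr F tog) (mu e)" "mu (e + 2) = rh (curr F tog) (mu e)" "tog (mu e) \<le> 1"
proof -
  obtain y where y: "y \<in> NN" "fwd_entry mu e y \<or> bwd_entry mu e y" using enc e(1) unfolding encodes_def by blast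
  have me: "mu e = y" using y(2) unfolding fwd_entry_def bwd_entry_def by blast
  have m3: "mu (e + 3) \<le> 1" using y(2) unfolding fwd_entry_def bwd_entry_def by auto
  have "tog y \<noteq> 2" using e(2) m3 me by auto
  then have yF: "y \<notin> F" using F by blast
  show "mu e \<in> NN - F" "tog (mu e) \<le> 1" using y(1) me yF e(2) m3 by auto
  have ym: "y < m" using y(1) NN by blast
  have "mu (e + 1) = rt (curr F tog) y \<and> mu (e + 2) = rh (curr F tog) y"
    using y(2)
  proof
    assume f: "fwd_entry mu e y"
    then have "y \<notin> curr F tog" using e(2) me unfolding fwd_entry_def curr_def by auto
    then show ?thesis using f unfolding fwd_entry_def rt_def rh_def by auto
  next
    assume f: "bwd_entry mu e y"
    then have "y \<in> curr F tog" using e(2) me ym yF unfolding bwd_entry_def curr_def by auto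
    then show ?thesis using f unfolding bwd_entry_def rt_def rh_def by auto
  qed
  then show "mu (e + 1) = rt (curr F tog) (mu e)" "mu (e + 2) = rh (curr F tog) (mu e)" unfolding me by auto
qed

lemma usable_exists:
  assumes enc: "encodes mu E NN" and F: "tog y \<le> 1" and y: "y \<in> NN - F" "NN \<subseteq> {..<m}"
  shows "\<exists>e\<in>E. mu e = y \<and> tog y = mu (e + 3) \<and> mu (e + 1) = rt (curr F tog) y \<and> mu (e + 2) = rh (curr F tog) y"
proof (cases "y \<in> curr F tog")
  case True
  obtain e where e: "e \<in> E" "bwd_entry mu e y" using enc y unfolding encodes_def by blast
  have "tog y = of_bool (y \<notin> A)" using True F unfolding curr_def by auto
  then show ?thesis using e True unfolding bwd_entry_def rt_def rh_def by auto
next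
  case False
  obtain e where e: "e \<in> E" "fwd_entry mu e y" using enc y unfolding encodes_def by blast
  have "tog y = of_bool (y \<in> A)" using False F y unfolding curr_def by (auto simp: le_Suc_eq)
  then show ?thesis using e False unfolding fwd_entry_def rt_def rh_def by auto
qed

text \<open>Usable entries are the residual arcs of the current flow in \<open>NN - F\<close>, so a
  closed vertex set becomes a cut without residual arcs and a walk of entries an augmenting
  walk.\<close>

lemma round_step:
  assumes enc: "encodes mu E NN" and NN: "NN \<subseteq> {..<m}" and F: "\<And>y. tog y = 2 \<longleftrightarrow> y \<in> F" "\<And>y. tog y \<le> 2"
    and flow: "isflow (curr F tog) r"
    and post: "(tog' = tog \<and> (\<exists>X\<subseteq>{..<n}. s \<in> X \<and> t \<notin> X \<and> (\<forall>e\<in>E. mu (e + 1) \<in> X \<longrightarrow> tog (mu e) = mu (e + 3) \<longrightarrow> mu (e + 2) \<in> X))) \<or>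
     (\<exists>es. walk (\<lambda>e. mu (e + 1)) (\<lambda>e. mu (e + 2)) s es t \<and> distinct (map mu es) \<and> set es \<subseteq> E \<and>
        (\<forall>e\<in>set es. tog (mu e) = mu (e + 3)) \<and> tog' = (\<lambda>y. if y \<in> mu ` set es then 1 - tog y else tog y))"
  shows "(tog' = tog \<and> (\<exists>X. st_cut X \<and> resout (curr F tog) (NN - F) X = {})) \<or>
    (isflow (curr F tog') (Suc r) \<and> sdiff (curr F tog) (curr F tog') \<subseteq> NN - F \<and> (\<forall>y. tog' y \<noteq> tog y \<longrightarrow> y \<in> NN - F) \<and>
      (\<forall>y. tog' y = 2 \<longleftrightarrow> y \<in> F) \<and> (\<forall>y. tog' y \<le> 2))"
  using post
proof
  assume "tog' = tog \<and> (\<exists>X\<subseteq>{..<n}. s \<in> X \<and> t \<notin> X \<and> (\<forall>e\<in>E. mu (e + 1) \<in> X \<longrightarrow> tog (mu e) = mu (e + 3) \<longrightarrow> mu (e + 2) \<in> X))"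
  then obtain X where X: "tog' = tog" "X \<subseteq> {..<n}" "s \<in> X" "t \<notin> X"
    "\<And>e. e \<in> E \<Longrightarrow> mu (e + 1) \<in> X \<Longrightarrow> tog (mu e) = mu (e + 3) \<Longrightarrow> mu (e + 2) \<in> X" by blast
  have "rh (curr F tog) y \<in> X" if y: "y \<in> NN - F" "rt (curr F tog) y \<in> X" for y
  proof -
    have "tog y \<le> 1" using F[of y] y(1) by (metis DiffD2 Suc_1 le_SucE One_nat_def)
    then obtain e where "e \<in> E" "mu e = y" "tog y = mu (e + 3)" "mu (e + 1) = rt (curr F tog) y" "mu (e + 2) = rh (curr F tog) y"
      using usable_exists[OF enc _ y(1) NN] by blast
    then show ?thesis using X(5)[of e] y(2) by metis
  qed
  then have "resout (curr F tog) (NN - F) X = {}" unfolding resout_def by blast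
  then show ?thesis using X unfolding st_cut_def by blast
next
  assume "\<exists>es. walk (\<lambda>e. mu (e + 1)) (\<lambda>e. mu (e + 2)) s es t \<and> distinct (map mu es) \<and> set es \<subseteq> E \<and>
        (\<forall>e\<in>set es. tog (mu e) = mu (e + 3)) \<and> tog' = (\<lambda>y. if y \<in> mu ` set es then 1 - tog y else tog y)"
  then obtain es where es: "walk (\<lambda>e. mu (e + 1)) (\<lambda>e. mu (e + 2)) s es t" "distinct (map mu es)" "set es \<subseteq> E"
    "\<And>e. e \<in> set es \<Longrightarrow> tog (mu e) = mu (e + 3)" "tog' = (\<lambda>y. if y \<in> mu ` set es then 1 - tog y else tog y)" by blast
  note ue = usable_entry[OF enc NN F(1) subsetD[OF es(3)] es(4)]
  let ?P = "map mu es"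
  have "walk (\<lambda>e. rt (curr F tog) (mu e)) (\<lambda>e. rh (curr F tog) (mu e)) s es t"
    using es(1) walk_cong[of es "\<lambda>e. mu (e + 1)" "\<lambda>e. rt (curr F tog) (mu e)" "\<lambda>e. mu (e + 2)" "\<lambda>e. rh (curr F tog) (mu e)" s t] ue(2,3) by blast
  then have w: "walk (rt (curr F tog)) (rh (curr F tog)) s ?P t" by (simp add: walk_map)
  have PN: "set ?P \<subseteq> NN - F" using ue(1) by auto
  have Pm: "set ?P \<subseteq> {..<m}" using PN NN by blast
  have le1: "tog y \<le> 1" if "y \<in> set ?P" for y using ue(4) that by auto
  have tg: "tog' y = (if y \<in> set ?P then 1 - tog y else tog y)" for y unfolding es(5) by simp
  have cur: "curr F tog' = sdiff (curr F tog) (set ?P)"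
  proof -
    have "y \<in> curr F tog' \<longleftrightarrow> y \<in> sdiff (curr F tog) (set ?P)" for y
    proof (cases "y \<in> set ?P")
      case True
      have "y < m" "y \<notin> F" using True PN Pm by auto
      moreover have "(tog' y = 1) \<longleftrightarrow> \<not> (tog y = 1)" using tg[of y] le1[OF True] True by auto
      ultimately show ?thesis using True unfolding curr_def sdiff_def by blast
    next
      case False
      then have "tog' y = tog y" using tg[of y] by simp
      then show ?thesis using False unfolding curr_def sdiff_def by simp
    qed
    then show ?thesis by blast
  qed
  have "isflow (curr F tog') (Suc r)" unfolding cur by (rule isflow_augment[OF flow w es(2) Pm])
  moreover have "sdiff (curr F tog) (curr F tog') \<subseteq> NN - F" using PN unfolding cur sdiff_def by blast
  moreover have "y \<in> NN - F" if "tog' y \<noteq> tog y" for y using that tg[of y] PN by (metis subsetD)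
  moreover have "tog' y = 2 \<longleftrightarrow> y \<in> F" for y
    using F(1)[of y] tg[of y] PN by (cases "y \<in> set ?P") auto
  moreover have "tog' y \<le> 2" for y using F(2)[of y] tg[of y] by auto
  ultimately show ?thesis by blast
qed

text \<open>Dropping the hit paths leaves the value \<open>k - card I\<close>; each round adds one
  unit or proves that none can be added.\<close>

theorem two_rounds:
  fixes F :: "nat set"
  defines "I \<equiv> {i. i < k \<and> set (pl i) \<inter> F \<noteq> {}}"
  assumes F: "F \<subseteq> {..<m}" "card F \<le> 2" and I: "I \<noteq> {}"
    and N: "\<And>i. i \<in> I \<Longrightarrow> block i NN" and enc: "encodes mu E NN"
    and pf: "\<And>y. (\<exists>e\<in>E. mu (e + 5) = 1 \<and> mu e = y) \<longleftrightarrow> y \<in> (\<Union>i\<in>I. set (pl i))"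
    and tog0: "tog0 = (\<lambda>y. if y \<in> F then 2 else if \<exists>e\<in>E. mu (e + 5) = 1 \<and> mu e = y then 1 else 0)"
    and post: "\<And>tog tog'. P tog tog' \<longleftrightarrow> (tog' = tog \<and> (\<exists>X\<subseteq>{..<n}. s \<in> X \<and> t \<notin> X \<and> (\<forall>e\<in>E. mu (e + 1) \<in> X \<longrightarrow> tog (mu e) = mu (e + 3) \<longrightarrow> mu (e + 2) \<in> X))) \<or>
     (\<exists>es. walk (\<lambda>e. mu (e + 1)) (\<lambda>e. mu (e + 2)) s es t \<and> distinct (map mu es) \<and> set es \<subseteq> E \<and>
        (\<forall>e\<in>set es. tog (mu e) = mu (e + 3)) \<and> tog' = (\<lambda>y. if y \<in> mu ` set es then 1 - tog y else tog y))"
    and P: "P tog0 tog1" "P tog1 tog2"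
  shows "max_cert F (curr F tog2)" "{y \<in> mu ` E. tog2 y = 1} = {y. y < m \<and> y \<notin> F \<and> (y \<in> curr F tog2) \<noteq> (y \<in> A)}"
proof -
  let ?U = "\<Union>i\<in>I. set (pl i)"
  obtain i0 where "i0 \<in> I" using I by blast
  have NN: "NN \<subseteq> {..<m}" using N[OF \<open>i0 \<in> I\<close>] unfolding block_def by blast
  have UN: "?U \<subseteq> NN" using N unfolding block_def by blast
  have UA: "?U \<subseteq> A" unfolding I_def A_def by auto
  have AF: "A \<inter> F \<subseteq> ?U" unfolding I_def A_def by auto
  have finI: "finite I" "I \<subseteq> {..<k}" unfolding I_def by auto
  have cI: "card I \<le> k" using card_mono[OF _ finI(2)] by simp
  have t0: "tog0 y = (if y \<in> F then 2 else if y \<in> ?U then 1 else 0)" for y unfolding tog0 using pf by simp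
  have c0: "curr F tog0 = A - ?U"
    unfolding curr_def t0 using A_subset UA AF by (auto split: if_splits)
  have fU: "isflow ?U (card I)"
  proof -
    obtain h where h: "bij_betw h {..<card I} I" using ex_bij_betw_nat_finite[OF finI(1)] by (auto simp: atLeast0LessThan)
    have "isflow (\<Union>i<card I. set (pl (h i))) (card I)"
    proof (rule isflow_UN)
      fix i assume "i < card I"
      then have "h i < k" using h finI(2) unfolding bij_betw_def by auto
      then show "isflow (set (pl (h i))) 1" using simple simple_path_isflow by blast
    next
      fix i j assume "i < card I" "j < card I" "i \<noteq> j"
      then have "h i < k" "h j < k" "h i \<noteq> h j" using h finI(2) unfolding bij_betw_def inj_on_def by auto
      then show "set (pl (h i)) \<inter> set (pl (h j)) = {}" using disjoint by blast
    qed
    moreover have "(\<Union>i<card I. set (pl (h i))) = (\<Union>i\<in>h ` {..<card I}. set (pl i))" by simp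
    moreover have "h ` {..<card I} = I" using h unfolding bij_betw_def by blast
    ultimately show ?thesis by simp
  qed
  have f0: "isflow (curr F tog0) (k - card I)" unfolding c0 by (rule isflow_diff[OF isflow_A fU UA cI])
  have F0: "\<And>y. tog0 y = 2 \<longleftrightarrow> y \<in> F" "\<And>y. tog0 y \<le> 2" unfolding t0 by auto
  have step1: "(tog1 = tog0 \<and> (\<exists>X. st_cut X \<and> resout (curr F tog0) (NN - F) X = {})) \<or>
    (isflow (curr F tog1) (Suc (k - card I)) \<and> sdiff (curr F tog0) (curr F tog1) \<subseteq> NN - F \<and> (\<forall>y. tog1 y \<noteq> tog0 y \<longrightarrow> y \<in> NN - F) \<and>
      (\<forall>y. tog1 y = 2 \<longleftrightarrow> y \<in> F) \<and> (\<forall>y. tog1 y \<le> 2))"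
    by (rule round_step[OF enc NN F0 f0]) (use P(1) post in blast)
  \<comment> \<open>Whether the first round augmented can be read off the toggle tables, because an
    augmentation changes the value of the flow.\<close>
  define r1 where "r1 = (if tog1 = tog0 then 0 else 1 :: nat)"
  have ne1: "tog1 \<noteq> tog0" if "isflow (curr F tog1) (Suc (k - card I))"
  proof
    assume "tog1 = tog0"
    then have "isflow (curr F tog0) (Suc (k - card I))" using that by simp
    then show False using isflow_value[OF f0] isflow_value[of "curr F tog0" "Suc (k - card I)"] by simp
  qed
  have A1: "isflow (curr F tog1) (k - card I + r1)" "sdiff (curr F tog0) (curr F tog1) \<subseteq> NN - F" "\<And>y. tog1 y \<noteq> tog0 y \<Longrightarrow> y \<in> NN - F"
    "\<And>y. tog1 y = 2 \<longleftrightarrow> y \<in> F" "\<And>y. tog1 y \<le> 2"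
    using step1 f0 F0 ne1 unfolding r1_def by (auto simp: sdiff_def split: if_splits)
  have step2: "(tog2 = tog1 \<and> (\<exists>X. st_cut X \<and> resout (curr F tog1) (NN - F) X = {})) \<or>
    (isflow (curr F tog2) (Suc (k - card I + r1)) \<and> sdiff (curr F tog1) (curr F tog2) \<subseteq> NN - F \<and> (\<forall>y. tog2 y \<noteq> tog1 y \<longrightarrow> y \<in> NN - F) \<and>
      (\<forall>y. tog2 y = 2 \<longleftrightarrow> y \<in> F) \<and> (\<forall>y. tog2 y \<le> 2))"
    by (rule round_step[OF enc NN A1(4,5,1)]) (use P(2) post in blast)
  have t2: "\<And>y. tog2 y \<noteq> tog1 y \<Longrightarrow> y \<in> NN - F" "\<And>y. tog2 y = 2 \<longleftrightarrow> y \<in> F" "sdiff (curr F tog1) (curr F tog2) \<subseteq> NN - F"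
    using step2 A1(4) by (auto simp: sdiff_def)
  have "\<exists>r. isflow (curr F tog2) (k - card I + r) \<and> (2 \<le> r \<or> (\<exists>X. st_cut X \<and> resout (curr F tog2) (NN - F) X = {}))"
  proof (cases "tog2 = tog1 \<and> (\<exists>X. st_cut X \<and> resout (curr F tog1) (NN - F) X = {})")
    case True then show ?thesis using A1(1) by blast
  next
    case False
    then have f2: "isflow (curr F tog2) (k - card I + Suc r1)" using step2 by auto
    show ?thesis
    proof (cases "r1 = 1")
      case True then show ?thesis using f2 by (intro exI[of _ 2]) auto
    next
      case F1: False
      then have eq: "tog1 = tog0" unfolding r1_def by (auto split: if_splits)
      then obtain X where X: "st_cut X" "resout (curr F tog0) (NN - F) X = {}" using step1 ne1 by blast
      have sdx: "sdiff (curr F tog0) (curr F tog2) \<subseteq> NN - F" using t2(3) eq by simp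
      text \<open>An augmenting walk in the second round would cross the closed cut of the first.\<close>
      have o: "card (outs (curr F tog2) X) \<le> card (outs (curr F tog0) X)"
      proof (rule card_mono)
        show "finite (outs (curr F tog0) X)" using isflow_finite[OF f0] unfolding outs_def by auto
        show "outs (curr F tog2) X \<subseteq> outs (curr F tog0) X"
        proof
          fix y assume y: "y \<in> outs (curr F tog2) X"
          show "y \<in> outs (curr F tog0) X"
          proof (rule ccontr)
            assume "y \<notin> outs (curr F tog0) X"
            then have "y \<notin> curr F tog0" "y \<in> NN - F" using y sdx unfolding outs_def sdiff_def by auto
            then have "y \<in> resout (curr F tog0) (NN - F) X" using y unfolding resout_def outs_def rt_def rh_def by auto
            then show False using X(2) by blast
          qed
        qed
      qed
      have i: "card (ins (curr F tog0) X) \<le> card (ins (curr F tog2) X)"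
      proof (rule card_mono)
        show "finite (ins (curr F tog2) X)" using isflow_finite[OF f2] unfolding ins_def by auto
        show "ins (curr F tog0) X \<subseteq> ins (curr F tog2) X"
        proof
          fix y assume y: "y \<in> ins (curr F tog0) X"
          show "y \<in> ins (curr F tog2) X"
          proof (rule ccontr)
            assume "y \<notin> ins (curr F tog2) X"
            then have "y \<in> curr F tog0" "y \<in> NN - F" using y sdx unfolding ins_def sdiff_def by auto
            then have "y \<in> resout (curr F tog0) (NN - F) X" using y unfolding resout_def ins_def rt_def rh_def by auto
            then show False using X(2) by blast
          qed
        qed
      qed
      have False using o i flow_crossing[OF f0 X(1)] flow_crossing[OF f2 X(1)] by linarith
      then show ?thesis ..
    qed
  qed
  then obtain r where r: "isflow (curr F tog2) (k - card I + r)" "2 \<le> r \<or> (\<exists>X. st_cut X \<and> resout (curr F tog2) (NN - F) X = {})" by blast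
  have sd: "sdiff (A - ?U) (curr F tog2) \<subseteq> NN - F" using A1(2) t2(3) unfolding c0 sdiff_def by blast
  show "max_cert F (curr F tog2)"
    using two_failures[OF F, of NN "curr F tog2" r] I N r sd unfolding I_def by blast
  have m1: "y \<in> NN" if "tog2 y = 1" for y
  proof -
    have "tog0 y = 1 \<or> tog2 y \<noteq> tog1 y \<or> tog1 y \<noteq> tog0 y" using that by auto
    then show ?thesis using t2(1) A1(3) UN unfolding t0 by (auto split: if_splits)
  qed
  have im: "mu ` E = NN" by (rule encodes_arcs[OF enc])
  show "{y \<in> mu ` E. tog2 y = 1} = {y. y < m \<and> y \<notin> F \<and> (y \<in> curr F tog2) \<noteq> (y \<in> A)}"
    unfolding im
  proof (intro equalityI subsetI CollectI)
    fix y assume "y \<in> {y \<in> NN. tog2 y = 1}"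
    then have y: "y \<in> NN" "tog2 y = 1" by auto
    have "y \<notin> F" using t2(2)[of y] y(2) by auto
    then show "y < m \<and> y \<notin> F \<and> (y \<in> curr F tog2) \<noteq> (y \<in> A)" using y NN unfolding curr_def by auto
  next
    fix y assume "y \<in> {y. y < m \<and> y \<notin> F \<and> (y \<in> curr F tog2) \<noteq> (y \<in> A)}"
    then have "tog2 y = 1" unfolding curr_def by auto
    then show "y \<in> NN \<and> tog2 y = 1" using m1 by blast
  qed
qed

end

section \<open>Memory layout\<close>

lemma div_mod_block: "f < c \<Longrightarrow> (c * b + f) div c = (b :: nat) \<and> (c * b + f) mod c = f"
  by (cases "c = 0") (auto simp: div_mult_self4)

context path_system
begin

text \<open>By increasing address: ten header cells, the zero record at 10 to 24, the inner hash
  functions, the record table, and \<open>k\<close> blocks of \<open>Z\<close> cells each. Every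
  block includes \<open>Tree\<close>, so that the report for a single failure meets all changed arcs
  in one block.\<close>

theorem layout:
  assumes k: "0 < k" and w: "(n + m) ^ 20 \<le> 2 ^ w"
  obtains mu N ptr fb blk L U c d b st M Nb Tree where
    "dict_mem w m N mu ptr fb blk L U c d" "\<And>a. N \<le> a \<Longrightarrow> mu a = 0" "\<And>a. mu a < 2 ^ w" "N \<le> 2200 * (k * n)"
    "mu 4 = N" "mu 5 = N + m" "mu 6 = N + m + n" "mu 7 = N + m + 2 * n" "mu 8 = s" "mu 9 = t"
    "\<And>x. fb x = of_bool (x \<in> A)" "\<And>x. x \<notin> A \<Longrightarrow> blk x = 0" "\<And>x i. i < k \<Longrightarrow> x \<in> set (pl i) \<Longrightarrow> blk x = b i" "\<And>i. b i \<noteq> 0"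
    "\<And>i. i < k \<Longrightarrow> dict_mem.block_ok m N mu n (b i) (st i) (M i)" "\<And>i. i < k \<Longrightarrow> M i \<le> 26 * n"
    "\<And>i. i < k \<Longrightarrow> encodes mu (set (dict_mem.entries (st i) (M i))) (Nb i)" "\<And>i. i < k \<Longrightarrow> block i (Nb i)" "\<And>i. i < k \<Longrightarrow> Tree \<subseteq> Nb i"
    "\<And>i y. i < k \<Longrightarrow> (\<exists>e\<in>set (dict_mem.entries (st i) (M i)). mu (e + 5) = 1 \<and> mu e = y) \<longleftrightarrow> y \<in> set (pl i)"
    "\<And>x. x < m \<Longrightarrow> max_cert {x} (sdiff A {y. changed L U c d x y} - {x})"
    "\<And>x. x \<notin> A \<Longrightarrow> {y. changed L U c d x y} = {}"
    "\<And>x i. i < k \<Longrightarrow> x \<in> set (pl i) \<Longrightarrow> {y. changed L U c d x y} \<subseteq> Tree \<union> set (pl i)"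
    "N + m + 60 * n + 4 < 2 ^ w"
proof -
  obtain K Tree L U c d where lab:
    "K = A \<union> Tree" "Tree \<subseteq> {..<m}" "card Tree \<le> 2 * n"
    "\<And>j y. y \<notin> K \<Longrightarrow> L j y = 0 \<and> U j y = 0 \<and> c j y = 0 \<and> d j y = 0"
    "\<And>j y. L j y \<le> n + k \<and> U j y \<le> n + k \<and> c j y \<le> n + k \<and> d j y \<le> n + k"
    "\<And>x. x < m \<Longrightarrow> max_cert {x} (sdiff A {y. changed L U c d x y} - {x})"
    "\<And>x. x \<notin> A \<Longrightarrow> {y. changed L U c d x y} = {}"
    "\<And>x i. i < k \<Longrightarrow> x \<in> set (pl i) \<Longrightarrow> {y. changed L U c d x y} \<subseteq> Tree \<union> set (pl i)"
    by (rule single_failure_labels) blast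
  define kap where "kap = card K"
  have Km: "K \<subseteq> {..<m}" using lab(1,2) A_subset by auto
  have finK: "finite K" using Km finite_subset by blast
  have "pl 0 \<noteq> []" using pl_nonempty[OF k] .
  then have K0: "K \<noteq> {}" using pl_subset[OF k] lab(1) by (cases "pl 0") auto
  have kap: "0 < kap" "kap \<le> m" using K0 finK card_mono[OF _ Km] unfolding kap_def by (auto simp: card_gt_0_iff)
  have n2: "2 \<le> n" using s_less t_less s_neq_t by linarith
  have kapkn: "kap \<le> 3 * (k * n)"
  proof -
    have "card A \<le> (\<Sum>i<k. card (set (pl i)))" unfolding A_def by (rule card_UN_le) simp
    also have "\<dots> \<le> (\<Sum>i<k. n)"
    proof (rule sum_mono)
      fix i assume "i \<in> {..<k}"
      then show "card (set (pl i)) \<le> n" using pl_length[of i] card_length[of "pl i"] by simp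
    qed
    finally have "card A \<le> k * n" by simp
    moreover have "kap \<le> card A + card Tree" unfolding kap_def lab(1) by (rule card_Un_le)
    moreover have "n \<le> k * n" using k by simp
    ultimately show ?thesis using lab(3) by linarith
  qed
  have km: "k \<le> m"
  proof -
    have "k \<le> card (outs A {s})" using flow_crossing[OF isflow_A, of "{s}"] s_less s_neq_t by (simp add: st_cut_def)
    also have "\<dots> \<le> card {..<m}" using A_subset by (intro card_mono) (auto simp: outs_def)
    finally show ?thesis by simp
  qed
  define T where "T = m + 1"
  have KT: "K \<subseteq> {..<T}" using Km unfolding T_def by auto
  obtain a1 :: nat and R2 a2 off :: "nat \<Rightarrow> nat" where ha:
    "a1 < T * kap" "\<And>b. 0 < R2 b" "\<And>b. R2 b \<le> 6 * (kap * kap) + 1" "\<And>b. a2 b < T * R2 b"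
    "\<And>b. b < kap \<Longrightarrow> off b + R2 b \<le> 43 * kap"
    "inj_on (\<lambda>x. off (hash T kap a1 x) + hash T (R2 (hash T kap a1 x)) (a2 (hash T kap a1 x)) x) K"
    unfolding kap_def by (rule perfect_hashing[OF finK KT K0]) blast
  define slot where "slot x = off (hash T kap a1 x) + hash T (R2 (hash T kap a1 x)) (a2 (hash T kap a1 x)) x" for x
  have T0: "0 < T" unfolding T_def by simp
  have hk: "hash T kap a1 x < kap" for x by (rule hash_less[OF T0 kap(1)])
  have slot43: "slot x < 43 * kap" for x
    using hash_less[OF T0 ha(2)[of "hash T kap a1 x"], of "a2 (hash T kap a1 x)" x] ha(5)[OF hk[of x]] unfolding slot_def by linarith
  have slot_inj: "inj_on slot K" using ha(6) unfolding slot_def[abs_def] .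
  have "\<forall>i. \<exists>N. i < k \<longrightarrow> block i N \<and> card N \<le> 11 * n" using block_exists by blast
  then obtain N0 where N0: "\<And>i. i < k \<Longrightarrow> block i (N0 i) \<and> card (N0 i) \<le> 11 * n" by metis
  define Nb where "Nb i = N0 i \<union> Tree" for i
  have Nb: "block i (Nb i)" "card (Nb i) \<le> 13 * n" "Nb i \<subseteq> {..<m}" "finite (Nb i)" if "i < k" for i
  proof -
    have b: "block i (N0 i)" "card (N0 i) \<le> 11 * n" using N0[OF that] by auto
    show m: "Nb i \<subseteq> {..<m}" using b(1) lab(2) unfolding Nb_def block_def by blast
    then show "finite (Nb i)" using finite_subset by blast
    show "block i (Nb i)" by (rule block_mono[OF b(1) _ m]) (simp add: Nb_def)
    show "card (Nb i) \<le> 13 * n" using card_Un_le[of "N0 i" Tree] b(2) lab(3) unfolding Nb_def by linarith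
  qed
  define ys where "ys i = sorted_list_of_set (Nb i)" for i
  define M where "M i = 2 * length (ys i)" for i
  have ys: "set (ys i) = Nb i" "M i \<le> 26 * n" if "i < k" for i
    using Nb[OF that] unfolding ys_def M_def by auto
  \<comment> \<open>648 is 3 cells per inner hash function plus 43 slots of 15 cells. In
    \<open>Z\<close>, 2 + n cells precede the entries, and 156 is 6 cells for each of the 26 n
    entries: two for each of at most 13 n arcs, where 13 is 11 plus 2 for
    \<open>Tree\<close>.\<close>
  define CB where "CB = 25 + 3 * kap"
  define BB where "BB = 25 + 648 * kap"
  define Z where "Z = 2 + 157 * n"
  define N where "N = BB + Z * k"
  define b where "b i = BB + Z * i" for i
  define st where "st i = b i + 2 + n" for i
  define ear where "ear i q = ys i ! (q div 2)" for i q
  define esr where "esr i q = (if even q then ta (ear i q) else he (ear i q))" for i q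
  define etg where "etg i q = (if even q then he (ear i q) else ta (ear i q))" for i q
  define egg where "egg i q = (of_bool (even q \<longleftrightarrow> ear i q \<in> A) :: nat)" for i q
  define epf where "epf i q = (of_bool (even q \<and> ear i q \<in> set (pl i)) :: nat)" for i q
  define nxt where "nxt i v j = (case filter (\<lambda>q. esr i q = v) [j..<M i] of [] \<Rightarrow> 0 | q # _ \<Rightarrow> st i + 6 * q)" for i v j
  define fb where "fb x = (of_bool (x \<in> A) :: nat)" for x
  define pid where "pid x = (THE i. i < k \<and> x \<in> set (pl i))" for x
  have pid: "pid x = i" if "i < k" "x \<in> set (pl i)" for x i
    unfolding pid_def by (rule the_equality) (use that disjoint in blast)+
  define blk where "blk x = (if x \<in> A then b (pid x) else 0)" for x
  define hdr where "hdr a = (if a = 0 then T else if a = 1 then T * kap else if a = 2 then a1 else if a = 3 then 25 else if a = 4 then N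
    else if a = 5 then N + m else if a = 6 then N + m + n else if a = 7 then N + m + 2 * n else if a = 8 then s else if a = 9 then t else 0)" for a :: nat
  define tab where "tab e f = (if f = 0 then a2 e else if f = 1 then T * R2 e else CB + 15 * off e)" for e f :: nat
  define rec where "rec x f = (if f = 0 then x + 1 else if f = 1 then fb x else if f = 2 then blk x else
    if (f - 3) mod 4 = 0 then L ((f - 3) div 4) x else if (f - 3) mod 4 = 1 then U ((f - 3) div 4) x
    else if (f - 3) mod 4 = 2 then c ((f - 3) div 4) x else d ((f - 3) div 4) x)" for x f :: nat
  define cell where "cell i f = (if i \<in> slot ` K then rec (inv_into K slot i) f else 0)" for i f
  define ent where "ent i q f = (if q < M i then if f = 0 then ear i q else if f = 1 then esr i q else if f = 2 then etg i q
    else if f = 3 then egg i q else if f = 4 then nxt i (esr i q) (q + 1) else epf i q else 0)" for i q f :: nat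
  define blkf where "blkf i j = (if j = 0 then st i else if j = 1 then st i + 6 * M i else if j < 2 + n then nxt i (j - 2) 0
    else ent i ((j - (2 + n)) div 6) ((j - (2 + n)) mod 6))" for i j :: nat
  define mu where "mu a = (if a < 25 then hdr a else if a < CB then tab ((a - 25) div 3) ((a - 25) mod 3)
    else if a < BB then cell ((a - CB) div 15) ((a - CB) mod 15)
    else if a < N then blkf ((a - BB) div Z) ((a - BB) mod Z) else 0)" for a
  have mu_hdr: "mu a = hdr a" if "a < 25" for a using that unfolding mu_def by simp
  have mu_tab: "mu (25 + 3 * e + f) = tab e f" if "e < kap" "f < 3" for e f
    using that div_mod_block[OF that(2), of e] unfolding mu_def CB_def by simp
  have mu_cell: "mu (CB + 15 * i + f) = cell i f" if "i < 43 * kap" "f < 15" for i f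
  proof -
    have "CB + 15 * i + f < BB" using that unfolding CB_def BB_def by simp
    then show ?thesis using div_mod_block[OF that(2), of i] unfolding mu_def by (simp add: CB_def)
  qed
  have blt: "BB + Z * i + j < N" if "i < k" "j < Z" for i j
  proof -
    have "Z * (i + 1) \<le> Z * k" using that(1) by (intro mult_le_mono2) simp
    then show ?thesis using that(2) unfolding N_def by simp
  qed
  have mu_blk: "mu (b i + j) = blkf i j" if "i < k" "j < Z" for i j
    using blt[OF that] div_mod_block[OF that(2), of i] unfolding mu_def b_def by (simp add: CB_def BB_def)
  have stM: "st i + 6 * M i \<le> b i + Z" if "i < k" for i using ys(2)[OF that] unfolding st_def Z_def by simp
  have mu_ent: "mu (st i + 6 * q + f) = ent i q f" if "i < k" "q < M i" "f < 6" for i q f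
  proof -
    have "2 + n + (6 * q + f) < Z" using stM[OF that(1)] that(2,3) unfolding st_def by linarith
    then have "mu (b i + (2 + n + (6 * q + f))) = blkf i (2 + n + (6 * q + f))" by (rule mu_blk[OF that(1)])
    also have "\<dots> = ent i q f" using div_mod_block[OF that(3), of q] unfolding blkf_def by simp
    finally show ?thesis unfolding st_def by (simp add: add.assoc)
  qed
  have bN: "b i + Z \<le> N" if "i < k" for i
  proof -
    have "Z * (i + 1) \<le> Z * k" using that by (intro mult_le_mono2) simp
    then show ?thesis unfolding N_def b_def by simp
  qed
  define u where "u = n + m"
  have u: "n \<le> u" "m + 1 \<le> u" "kap \<le> u" "k \<le> u" "2 \<le> u" using n2 kap km unfolding u_def by auto
  define P where "P = u * u * u * u * u"
  have u1: "1 \<le> u" using u by simp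
  have le1: "x \<le> x * u" for x :: nat using u1 by simp
  have Pb: "1 \<le> P" "u \<le> P" "u * u \<le> P" "u * u * u \<le> P" "u * u * u * u \<le> P"
    unfolding P_def using le1[of "u * u * u * u"] le1[of "u * u * u"] le1[of "u * u"] le1[of u] u1 by linarith+
  \<comment> \<open>All addresses and all products formed by hashing are at most a constant times
    \<open>u ^ 5\<close>. As \<open>u\<close> is at least 2, the constant 2 ^ 14 costs 14 further
    factors and strictness one more, which explains the exponent 20.\<close>
  have Pw: "16384 * P < 2 ^ w"
  proof -
    have "(2::nat) ^ 14 \<le> u ^ 14" using u(5) by (rule power_mono) simp
    then have "16384 * P \<le> u ^ 14 * P" by simp
    also have "\<dots> = u ^ 19" unfolding P_def by (simp add: eval_nat_numeral)
    also have "\<dots> < u ^ 20" using u(5) by (intro power_strict_increasing) auto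
    finally show ?thesis using w unfolding u_def by simp
  qed
  have kn: "k * n \<le> u * u" using u by (intro mult_le_mono) auto
  have Nle: "N \<le> 25 + 648 * kap + 2 * k + 157 * (k * n)" unfolding N_def BB_def Z_def by (simp add: algebra_simps)
  have NP: "N \<le> 832 * P" using Nle kn Pb u by linarith
  have spc: "N + m + 60 * n + 4 < 2 ^ w" using NP Pb u Pw by linarith
  have Tk: "T * kap \<le> u * u" using u unfolding T_def by (intro mult_le_mono) auto
  have TkP: "T * kap \<le> P" using Tk Pb by linarith
  have TRP: "T * R2 e \<le> 7 * P" for e
  proof -
    have "kap * kap \<le> u * u" using u by (intro mult_le_mono) auto
    moreover have "1 * 1 \<le> u * u" using u1 by (intro mult_le_mono) auto
    ultimately have "R2 e \<le> 7 * (u * u)" using ha(3)[of e] by linarith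
    then have "T * R2 e \<le> u * (7 * (u * u))" using u(2) unfolding T_def by (intro mult_le_mono) auto
    also have "\<dots> = 7 * (u * u * u)" by simp
    finally show ?thesis using Pb by linarith
  qed
  have a1x: "a1 * x \<le> P" if "x < m" for x
  proof -
    have "a1 * x \<le> (u * u) * u" using ha(1) Tk that u by (intro mult_le_mono) auto
    then show ?thesis using Pb by linarith
  qed
  have a2x: "a2 e * x \<le> 7 * P" if "x < m" for x e
  proof -
    have "kap * kap \<le> u * u" using u by (intro mult_le_mono) auto
    moreover have "1 * 1 \<le> u * u" using u1 by (intro mult_le_mono) auto
    ultimately have "R2 e \<le> 7 * (u * u)" using ha(3)[of e] by linarith
    then have "T * R2 e \<le> u * (7 * (u * u))" using u(2) unfolding T_def by (intro mult_le_mono) auto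
    then have "a2 e * x \<le> (u * (7 * (u * u))) * u" using ha(4)[of e] that u by (intro mult_le_mono) auto
    also have "\<dots> = 7 * (u * u * u * u)" by simp
    finally show ?thesis using Pb by linarith
  qed
  have earm: "ear i q < m" if "i < k" "q < M i" for i q
  proof -
    have "q div 2 < length (ys i)" using that(2) unfolding M_def by simp
    then have "ear i q \<in> Nb i" using ys(1)[OF that(1)] nth_mem unfolding ear_def by blast
    then show ?thesis using Nb(3)[OF that(1)] by blast
  qed
  have esrn: "esr i q < n" "etg i q < n" if "i < k" "q < M i" for i q
    using earm[OF that] ta_less he_less unfolding esr_def etg_def by auto
  have nxtN: "nxt i v j \<le> N" if "i < k" for i v j
  proof (cases "filter (\<lambda>q. esr i q = v) [j..<M i]")
    case Nil then show ?thesis unfolding nxt_def by simp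
  next
    case (Cons q qs)
    then have "q \<in> set (filter (\<lambda>q. esr i q = v) [j..<M i])" by simp
    then have "q < M i" by simp
    then show ?thesis using Cons stM[OF that] bN[OF that] unfolding nxt_def by simp
  qed
  have mu_less: "mu a < 2 ^ w" for a
  proof -
    have Lb: "L j y \<le> 2 * P" "U j y \<le> 2 * P" "c j y \<le> 2 * P" "d j y \<le> 2 * P" for j y
      using lab(5)[where j = j and y = y] u Pb by linarith+
    have big: "x \<le> 16384 * P \<Longrightarrow> x < 2 ^ w" for x using Pw by linarith
    have bk: "b i \<le> N" if "i < k" for i using bN[OF that] by simp
    have "hdr a \<le> 16384 * P" for a
      unfolding hdr_def using NP Pb u TkP ha(1) s_less t_less unfolding T_def by (auto split: if_splits)
    moreover have "tab ((a - 25) div 3) ((a - 25) mod 3) \<le> 16384 * P" if "a < CB" "25 \<le> a"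
    proof -
      have e: "(a - 25) div 3 < kap" using that unfolding CB_def by (simp add: less_mult_imp_div_less)
      have "CB + 15 * off ((a - 25) div 3) \<le> N" using ha(5)[OF e] unfolding CB_def N_def BB_def by simp
      then show ?thesis unfolding tab_def using NP TRP[of "(a - 25) div 3"] ha(4)[of "(a - 25) div 3"] by simp
    qed
    moreover have "cell i f \<le> 16384 * P" for i f
    proof (cases "i \<in> slot ` K")
      case True
      let ?x = "inv_into K slot i"
      have x: "?x \<in> K" using True by (rule inv_into_into)
      then have "?x < m" using Km by blast
      moreover have "blk ?x \<le> N"
      proof (cases "?x \<in> A")
        case True
        then obtain i' where "i' < k" "?x \<in> set (pl i')" unfolding A_def by blast
        then show ?thesis using pid[of i' ?x] bk[of i'] True unfolding blk_def by simp
      qed (simp add: blk_def)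
      ultimately show ?thesis using Lb[of "(f - 3) div 4" ?x] True NP Pb u unfolding cell_def rec_def fb_def by auto
    qed (simp add: cell_def)
    moreover have "blkf ((a - BB) div Z) ((a - BB) mod Z) \<le> 16384 * P" if "BB \<le> a" "a < N"
    proof -
      define i where "i = (a - BB) div Z"
      have ik: "i < k" unfolding i_def using that unfolding N_def by (intro less_mult_imp_div_less) (simp add: mult.commute)
      have e1: "st i + 6 * M i \<le> N" using stM[OF ik] bN[OF ik] by simp
      have e2: "ent i q f \<le> 16384 * P" for q f
      proof (cases "q < M i")
        case True
        have "ear i q \<le> 16384 * P" "esr i q \<le> 16384 * P" "etg i q \<le> 16384 * P" "nxt i (esr i q) (q + 1) \<le> 16384 * P"
          using earm[OF ik True] esrn[OF ik True] nxtN[OF ik, of "esr i q" "q + 1"] NP u Pb by linarith+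
        moreover have "egg i q \<le> 16384 * P" "epf i q \<le> 16384 * P" using Pb(1) unfolding egg_def epf_def by auto
        ultimately show ?thesis unfolding ent_def by simp
      qed (simp add: ent_def)
      have e3: "nxt i v j \<le> 16384 * P" for v j using nxtN[OF ik, of v j] NP by linarith
      have e4: "st i \<le> 16384 * P" "st i + 6 * M i \<le> 16384 * P" using e1 NP by linarith+
      show ?thesis unfolding i_def[symmetric] blkf_def using e2 e3 e4 by simp
    qed
    ultimately have "mu a \<le> 16384 * P" unfolding mu_def by auto
    then show ?thesis by (rule big)
  qed
  have rec_ptr: "mu (CB + 15 * slot x + f) = rec x f" if "x \<in> K" "f < 15" for x f
    using mu_cell[OF slot43[of x] that(2)] slot_inj that(1) unfolding cell_def by (simp add: inv_into_f_f)
  define ptr where "ptr x = (if x \<in> K then CB + 15 * slot x else 10)" for x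
  have CBN: "CB + 15 * i + 14 < N" if "i < 43 * kap" for i using that unfolding CB_def N_def BB_def by simp
  have N30: "30 \<le> N" unfolding N_def BB_def using kap(1) by simp
  have D: "dict_mem w m N mu ptr fb blk L U c d"
  proof
    show "N < 2 ^ w" "m < 2 ^ w" using spc by linarith+
    show "30 \<le> N" by (rule N30)
    fix x assume x: "x < m"
    define e where "e = hash T kap a1 x"
    have e: "e < kap" unfolding e_def by (rule hk)
    have h0: "mu 0 = T" "mu 1 = T * kap" "mu 2 = a1" "mu 3 = 25" by (simp_all add: mu_hdr hdr_def)
    have eb: "(mu 2 * x mod mu 1) div mu 0 = e" unfolding h0 e_def hash_def ..
    have t: "mu (25 + 3 * e) = a2 e" "mu (25 + 3 * e + 1) = T * R2 e" "mu (25 + 3 * e + 2) = CB + 15 * off e"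
      using mu_tab[OF e, of 0] mu_tab[OF e, of 1] mu_tab[OF e, of 2] unfolding tab_def by auto
    have q: "mu (25 + 3 * e + 2) + 15 * ((mu (25 + 3 * e) * x mod mu (25 + 3 * e + 1)) div mu 0) = CB + 15 * slot x"
      unfolding t h0 slot_def e_def[symmetric] hash_def[symmetric] by (simp add: hash_def[symmetric])
    \<comment> \<open>Keys are stored plus one: an empty cell matches no arc, and a slot occupied by
      another arc holds a different key.\<close>
    have pt: "ptr x = (if mu (CB + 15 * slot x) = x + 1 then CB + 15 * slot x else 10)"
    proof (cases "x \<in> K")
      case True
      then show ?thesis using rec_ptr[OF True, of 0] unfolding ptr_def rec_def by simp
    next
      case False
      have m0: "mu (CB + 15 * slot x) = cell (slot x) 0" using mu_cell[OF slot43[of x], of 0] by simp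
      have "cell (slot x) 0 \<noteq> x + 1"
      proof (cases "slot x \<in> slot ` K")
        case True
        then have "inv_into K slot (slot x) \<in> K" by (rule inv_into_into)
        then have "inv_into K slot (slot x) \<noteq> x" using False by metis
        then show ?thesis using True unfolding cell_def rec_def by simp
      qed (simp add: cell_def)
      then show ?thesis using False m0 unfolding ptr_def by simp
    qed
    show "let b = mu 2 * x mod mu 1 div mu 0; e = mu 3 + 3 * b; q = mu (e + 2) + 15 * (mu e * x mod mu (e + 1) div mu 0)
         in mu 2 * x < 2 ^ w \<and> e + 2 < N \<and> mu e * x < 2 ^ w \<and> q + 14 < N \<and> ptr x = (if mu q = x + 1 then q else 10)"
      unfolding Let_def eb h0(4) q using pt CBN[OF slot43[of x]] a1x[OF x] a2x[OF x, of e] Pw Pb e t(1) h0(3)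
      by (simp add: N_def BB_def)
    show "ptr x + 14 < N \<and> mu (ptr x + 1) = fb x \<and> mu (ptr x + 2) = blk x \<and>
      (\<forall>j<3. mu (ptr x + (3 + 4 * j)) = L j x \<and> mu (ptr x + (4 + 4 * j)) = U j x \<and> mu (ptr x + (5 + 4 * j)) = c j x \<and> mu (ptr x + (6 + 4 * j)) = d j x)"
    proof (cases "x \<in> K")
      case True
      have r: "mu (ptr x + f) = rec x f" if "f < 15" for f using rec_ptr[OF True that] True unfolding ptr_def by simp
      have "mu (ptr x + (3 + 4 * j)) = L j x \<and> mu (ptr x + (4 + 4 * j)) = U j x \<and> mu (ptr x + (5 + 4 * j)) = c j x \<and> mu (ptr x + (6 + 4 * j)) = d j x"
        if j: "j < 3" for j
      proof -
        have f: "3 + 4 * j < 15" "4 + 4 * j < 15" "5 + 4 * j < 15" "6 + 4 * j < 15" using j by auto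
        have dm: "(4 * j) div 4 = j" "(4 * j) mod 4 = 0" "(4 * j + 1) div 4 = j" "(4 * j + 1) mod 4 = 1"
          "(4 * j + 2) div 4 = j" "(4 * j + 2) mod 4 = 2" "(4 * j + 3) div 4 = j" "(4 * j + 3) mod 4 = 3"
          using div_mod_block[of 0 4 j] div_mod_block[of 1 4 j] div_mod_block[of 2 4 j] div_mod_block[of 3 4 j] by auto
        have sub: "3 + 4 * j - 3 = 4 * j" "4 + 4 * j - 3 = 4 * j + 1" "5 + 4 * j - 3 = 4 * j + 2" "6 + 4 * j - 3 = 4 * j + 3" by auto
        show ?thesis unfolding r[OF f(1)] r[OF f(2)] r[OF f(3)] r[OF f(4)] rec_def sub dm by simp
      qed
      moreover have "ptr x + 14 < N" using CBN[OF slot43[of x]] True unfolding ptr_def by simp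
      ultimately show ?thesis using r[of 1] r[of 2] unfolding rec_def by simp
    next
      case False
      have "mu f = 0" if "10 < f" "f < 25" for f using mu_hdr[of f] that unfolding hdr_def by simp
      moreover have "x \<notin> A" using False lab(1) by blast
      ultimately show ?thesis using False lab(4)[OF False] N30 unfolding ptr_def fb_def blk_def by auto
    qed
  qed
  interpret D: dict_mem w m N mu ptr fb blk L U c d by (rule D)
  have Eset: "set (D.entries (st i) (M i)) = (\<lambda>q. st i + 6 * q) ` {..<M i}" for i
    unfolding D.entries_def by auto
  have ef: "mu (st i + 6 * q) = ear i q" "mu (st i + 6 * q + 1) = esr i q" "mu (st i + 6 * q + 2) = etg i q"
    "mu (st i + 6 * q + 3) = egg i q" "mu (st i + 6 * q + 4) = nxt i (esr i q) (q + 1)" "mu (st i + 6 * q + 5) = epf i q" if "i < k" "q < M i" for i q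
    using mu_ent[OF that, of 0] mu_ent[OF that, of 1] mu_ent[OF that, of 2] mu_ent[OF that, of 3] mu_ent[OF that, of 4] mu_ent[OF that, of 5] that(2)
    unfolding ent_def by auto
  have stpos: "0 < st i" for i unfolding st_def by simp
  have link: "linked mu (nxt i v j) (map (\<lambda>q. st i + 6 * q) (filter (\<lambda>q. esr i q = v) [j..<M i]))" if ik: "i < k" for i v j
  proof (induction "M i - j" arbitrary: j)
    case 0
    then show ?case unfolding nxt_def by simp
  next
    case (Suc l)
    then have j: "j < M i" by simp
    have up: "[j..<M i] = j # [Suc j..<M i]" using j by (rule upt_conv_Cons)
    have IH: "linked mu (nxt i v (Suc j)) (map (\<lambda>q. st i + 6 * q) (filter (\<lambda>q. esr i q = v) [Suc j..<M i]))"
      using Suc by (intro Suc.hyps(1)) simp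
    show ?case
    proof (cases "esr i j = v")
      case True
      have "nxt i v j = st i + 6 * j" unfolding nxt_def up using True by simp
      then show ?thesis using IH ef(5)[OF ik j] True stpos unfolding up by simp
    next
      case False
      then have "nxt i v j = nxt i v (Suc j)" unfolding nxt_def up by simp
      then show ?thesis using IH False unfolding up by simp
    qed
  qed
  have blk_ok: "D.block_ok n (b i) (st i) (M i)" if ik: "i < k" for i
    unfolding D.block_ok_def
  proof (intro conjI ballI allI impI)
    show "b i \<noteq> 0" unfolding b_def BB_def by simp
    show "st i \<noteq> 0" using stpos[of i] by simp
    show "mu (b i) = st i" using mu_blk[OF ik, of 0] unfolding blkf_def Z_def by simp
    show "mu (b i + 1) = st i + 6 * M i" using mu_blk[OF ik, of 1] unfolding blkf_def Z_def by simp
    show "st i + 6 * M i \<le> N" using stM[OF ik] bN[OF ik] by simp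
    show "b i + 2 + n \<le> N" using bN[OF ik] unfolding Z_def by simp
    fix e assume "e \<in> set (D.entries (st i) (M i))"
    then obtain q where q: "q < M i" "e = st i + 6 * q" unfolding Eset by auto
    show "mu e < m" "mu (e + 1) < n" "mu (e + 2) < n" using ef[OF ik q(1)] earm[OF ik q(1)] esrn[OF ik q(1)] q(2) by auto
  next
    fix v assume v: "v < n"
    have "mu (b i + 2 + v) = nxt i v 0" using mu_blk[OF ik, of "2 + v"] v unfolding blkf_def Z_def by (simp add: add.assoc)
    moreover have "filter (\<lambda>e. mu (e + 1) = v) (D.entries (st i) (M i)) = map (\<lambda>q. st i + 6 * q) (filter (\<lambda>q. esr i q = v) [0..<M i])"
      unfolding D.entries_def filter_map
      by (rule arg_cong[of _ _ "map _"], rule filter_cong) (use ef(2)[OF ik] in auto)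
    ultimately show "linked mu (mu (b i + 2 + v)) (filter (\<lambda>e. mu (e + 1) = v) (D.entries (st i) (M i)))"
      using link[OF ik, of v 0] by simp
  qed
  have en: "encodes mu (set (D.entries (st i) (M i))) (Nb i)" if ik: "i < k" for i
    unfolding encodes_def
  proof (intro conjI ballI)
    fix e assume "e \<in> set (D.entries (st i) (M i))"
    then obtain q where q: "q < M i" "e = st i + 6 * q" unfolding Eset by auto
    have "q div 2 < length (ys i)" using q(1) unfolding M_def by simp
    then have "ear i q \<in> Nb i" using ys(1)[OF ik] nth_mem unfolding ear_def by blast
    moreover have "fwd_entry mu e (ear i q) \<or> bwd_entry mu e (ear i q)"
      using ef[OF ik q(1)] unfolding q(2) fwd_entry_def bwd_entry_def esr_def etg_def egg_def by auto
    ultimately show "\<exists>y\<in>Nb i. fwd_entry mu e y \<or> bwd_entry mu e y" by blast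
  next
    fix y assume "y \<in> Nb i"
    then obtain p where p: "p < length (ys i)" "ys i ! p = y" using ys(1)[OF ik] by (metis in_set_conv_nth)
    have q: "2 * p < M i" "2 * p + 1 < M i" "ear i (2 * p) = y" "ear i (2 * p + 1) = y" using p unfolding M_def ear_def by auto
    have "fwd_entry mu (st i + 6 * (2 * p)) y" using ef[OF ik q(1)] q(3) unfolding fwd_entry_def esr_def etg_def egg_def by simp
    then show "\<exists>e\<in>set (D.entries (st i) (M i)). fwd_entry mu e y" using q(1) unfolding Eset by blast
    have "bwd_entry mu (st i + 6 * (2 * p + 1)) y" using ef[OF ik q(2)] q(4) unfolding bwd_entry_def esr_def etg_def egg_def by simp
    then show "\<exists>e\<in>set (D.entries (st i) (M i)). bwd_entry mu e y" using q(2) unfolding Eset by blast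
  qed
  have pf: "(\<exists>e\<in>set (D.entries (st i) (M i)). mu (e + 5) = 1 \<and> mu e = y) \<longleftrightarrow> y \<in> set (pl i)" if ik: "i < k" for i y
  proof
    assume "\<exists>e\<in>set (D.entries (st i) (M i)). mu (e + 5) = 1 \<and> mu e = y"
    then obtain q where q: "q < M i" "mu (st i + 6 * q + 5) = 1" "mu (st i + 6 * q) = y" unfolding Eset by auto
    then have "epf i q = 1" "ear i q = y" using ef[OF ik q(1)] by auto
    then show "y \<in> set (pl i)" unfolding epf_def by (cases "ear i q \<in> set (pl i)") auto
  next
    assume y: "y \<in> set (pl i)"
    then have "y \<in> Nb i" using Nb(1)[OF ik] unfolding block_def by blast
    then obtain p where p: "p < length (ys i)" "ys i ! p = y" using ys(1)[OF ik] by (metis in_set_conv_nth)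
    have q: "2 * p < M i" "ear i (2 * p) = y" using p unfolding M_def ear_def by auto
    then have "mu (st i + 6 * (2 * p) + 5) = 1 \<and> mu (st i + 6 * (2 * p)) = y" using ef[OF ik q(1)] y unfolding epf_def by simp
    then show "\<exists>e\<in>set (D.entries (st i) (M i)). mu (e + 5) = 1 \<and> mu e = y" using q(1) unfolding Eset by blast
  qed
  show thesis
  proof (rule that[OF D, where ?b = b and ?st = st and ?M = M and ?Nb = Nb and ?Tree = Tree])
    show "mu a = 0" if "N \<le> a" for a using that unfolding mu_def N_def BB_def CB_def by simp
    show "mu a < 2 ^ w" for a by (rule mu_less)
    \<comment> \<open>Tables and records contribute 648 * 3, blocks 157; the lower terms fit into
      the remainder because \<open>k * n\<close> is at least 2.\<close>
    show "N \<le> 2200 * (k * n)"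
    proof -
      have "2 \<le> k * n" "k \<le> k * n" using k n2 mult_le_mono[of 1 k 2 n] by auto
      then show ?thesis using Nle kapkn by linarith
    qed
    show "mu 4 = N" "mu 5 = N + m" "mu 6 = N + m + n" "mu 7 = N + m + 2 * n" "mu 8 = s" "mu 9 = t" by (simp_all add: mu_hdr hdr_def)
    show "fb x = of_bool (x \<in> A)" for x unfolding fb_def ..
    show "blk x = 0" if "x \<notin> A" for x using that unfolding blk_def by simp
    show "blk x = b i" if "i < k" "x \<in> set (pl i)" for x i using pid[OF that] pl_subset[OF that(1)] that(2) unfolding blk_def by auto
    show "b i \<noteq> 0" for i unfolding b_def BB_def by simp
    show "D.block_ok n (b i) (st i) (M i)" if "i < k" for i by (rule blk_ok[OF that])
    show "M i \<le> 26 * n" if "i < k" for i by (rule ys(2)[OF that])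
    show "encodes mu (set (D.entries (st i) (M i))) (Nb i)" if "i < k" for i by (rule en[OF that])
    show "block i (Nb i)" if "i < k" for i by (rule Nb(1)[OF that])
    show "Tree \<subseteq> Nb i" for i unfolding Nb_def by simp
    show "(\<exists>e\<in>set (D.entries (st i) (M i)). mu (e + 5) = 1 \<and> mu e = y) \<longleftrightarrow> y \<in> set (pl i)" if "i < k" for i y by (rule pf[OF that])
    show "N + m + 60 * n + 4 < 2 ^ w" by (rule spc)
  qed (use lab in auto)
qed

end

section \<open>Answering queries\<close>

text \<open>A block has at most 26 n entries, whence the 26; the 110 is 2 * (26 + 26 + 3), for two
  blocks and the \<open>3 * n\<close> of the rounds.\<close>

definition cost :: nat where
  "cost = csize lookup_prog + csize report1 + 26 * (csize (locate 33 21) + 100) + 2 * csize (locate 1 20) +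
     110 * (csize search_body + csize aug_body + csize scan + csize emit_toggled + 20) + csize sort_query + 500"

lemma cost_bounds:
  assumes n: "1 \<le> (n::nat)"
  shows "20 \<le> cost * n"
    and "M \<le> 26 * n \<Longrightarrow> csize report1 + (csize (locate 33 21) + 100) * M + 100 + 20 \<le> cost * n"
    and "M1 \<le> 26 * n \<Longrightarrow> M2 \<le> 26 * n \<Longrightarrow> 2 * csize (locate 1 20) +
      2 * (csize search_body + csize aug_body + csize scan + csize emit_toggled + 20) * (M1 + M2 + 3 * n) + 300 + csize sort_query + 20 \<le> cost * n"
proof -
  define q1 where "q1 = csize (locate 33 21) + 100"
  define q2 where "q2 = csize search_body + csize aug_body + csize scan + csize emit_toggled + 20"
  have up: "x \<le> x * n" for x :: nat using n by simp
  have c: "cost * n = csize lookup_prog * n + csize report1 * n + 26 * (q1 * n) + 2 * (csize (locate 1 20) * n) + 110 * (q2 * n) + csize sort_query * n + 500 * n"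
    unfolding cost_def q1_def[symmetric] q2_def[symmetric] by (simp only: add_mult_distrib mult.assoc)
  show "20 \<le> cost * n" unfolding c using n by linarith
  show "csize report1 + q1 * M + 100 + 20 \<le> cost * n" if "M \<le> 26 * n"
  proof -
    have "q1 * M \<le> q1 * (26 * n)" using that by (rule mult_le_mono2)
    then have "q1 * M \<le> 26 * (q1 * n)" by simp
    then show ?thesis unfolding c using up[of "csize report1"] n by linarith
  qed
  show "2 * csize (locate 1 20) + 2 * q2 * (M1 + M2 + 3 * n) + 300 + csize sort_query + 20 \<le> cost * n" if "M1 \<le> 26 * n" "M2 \<le> 26 * n"
  proof -
    have "2 * q2 * (M1 + M2 + 3 * n) \<le> 2 * q2 * (55 * n)" using that by (intro mult_le_mono2) simp
    then have "2 * q2 * (M1 + M2 + 3 * n) \<le> 110 * (q2 * n)" by simp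
    then show ?thesis unfolding c using up[of "csize (locate 1 20)"] up[of "csize sort_query"] n by linarith
  qed
qed

context path_system
begin

text \<open>One and the same \<open>A'\<close> has to serve every order of the failed arcs and all
  lookups.\<close>

definition answered :: "nat \<Rightarrow> nat list \<Rightarrow> nat set \<Rightarrow> nat set \<Rightarrow> bool" where
  "answered w D F A' \<longleftrightarrow> max_cert F A' \<and>
     (\<forall>xs. distinct xs \<and> set xs = F \<longrightarrow> halts w report_prog (start D (length xs # xs)) (cost * n)
        (\<lambda>\<tau>. set (out \<tau>) = {e. e < m \<and> e \<notin> F \<and> (e \<in> A') \<noteq> (e \<in> A)})) \<and>
     (\<forall>x. F = {x} \<longrightarrow> (\<forall>e<m. e \<noteq> x \<longrightarrow> halts w lookup_prog (start D [x, e]) cost (\<lambda>\<tau>. regs \<tau> 0 = of_bool (e \<in> A'))))"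

text \<open>The memory is described abstractly so that the empty data structure for a flow of value
  0 is an instance as well.\<close>

lemma answered_exists:
  assumes dm: "dict_mem w m N mu ptr fb blk L U c d" and zero: "\<And>a. N \<le> a \<Longrightarrow> mu a = 0" and D: "pad D = mu"
    and hdr: "0 < k \<Longrightarrow> mu 4 = N \<and> mu 5 = N + m \<and> mu 6 = N + m + n \<and> mu 7 = N + m + 2 * n \<and> mu 8 = s \<and> mu 9 = t"
    and space: "0 < k \<Longrightarrow> N + m + 60 * n + 4 < 2 ^ w"
    and fb: "\<And>x. fb x = of_bool (x \<in> A)" and blk0: "\<And>x. x \<notin> A \<Longrightarrow> blk x = 0"
    and blk: "\<And>x i. i < k \<Longrightarrow> x \<in> set (pl i) \<Longrightarrow> blk x = b i" and b0: "\<And>i. b i \<noteq> 0"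
    and bok: "\<And>i. i < k \<Longrightarrow> dict_mem.block_ok m N mu n (b i) (st i) (M i)" and M: "\<And>i. i < k \<Longrightarrow> M i \<le> 26 * n"
    and enc: "\<And>i. i < k \<Longrightarrow> encodes mu (set (dict_mem.entries (st i) (M i))) (Nb i)"
    and Nb: "\<And>i. i < k \<Longrightarrow> block i (Nb i)" and Tree: "\<And>i. i < k \<Longrightarrow> Tree \<subseteq> Nb i"
    and pf: "\<And>i y. i < k \<Longrightarrow> (\<exists>e\<in>set (dict_mem.entries (st i) (M i)). mu (e + 5) = 1 \<and> mu e = y) \<longleftrightarrow> y \<in> set (pl i)"
    and single: "\<And>x. x < m \<Longrightarrow> max_cert {x} (sdiff A {y. changed L U c d x y} - {x})"
    and ch0: "\<And>x. x \<notin> A \<Longrightarrow> {y. changed L U c d x y} = {}"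
    and ch: "\<And>x i. i < k \<Longrightarrow> x \<in> set (pl i) \<Longrightarrow> {y. changed L U c d x y} \<subseteq> Tree \<union> set (pl i)"
    and F: "F \<subseteq> {..<m}" "card F \<le> 2"
  shows "\<exists>A'. answered w D F A'"
proof -
  interpret D: dict_mem w m N mu ptr fb blk L U c d by (rule dm)
  have n1: "1 \<le> n" using s_less by simp
  have finF: "finite F" using F(1) finite_subset by blast
  have ag: "D.agrees (start D xs)" for xs unfolding D.agrees_def start_def D by simp
  have z: "mem (start D xs) a = 0" if "N \<le> a" for xs a using zero[OF that] unfolding start_def D by simp
  have o: "out (start D xs) = []" for xs unfolding start_def by simp
  have Nbm: "Nb i \<subseteq> {..<m}" "set (pl i) \<subseteq> Nb i" if "i < k" for i using Nb[OF that] unfolding block_def by auto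
  consider (none) "F = {}" | (one) x where "F = {x}" | (two) x1 x2 where "F = {x1, x2}" "x1 < x2"
  proof -
    have "card F = 0 \<or> card F = 1 \<or> card F = 2" using F(2) by linarith
    then show thesis
    proof (elim disjE)
      assume "card F = 0" then show thesis using finF none by simp
    next
      assume "card F = 1" then show thesis using one by (auto simp: card_1_singleton_iff)
    next
      assume "card F = 2"
      then obtain x y where "F = {x, y}" "x \<noteq> y" by (auto simp: card_2_iff)
      then show thesis using two[of x y] two[of y x] by (cases "x < y") auto
    qed
  qed
  then show ?thesis
  proof cases
    case none
    have "answered w D F A"
      unfolding answered_def
    proof (intro conjI allI impI)
      show "max_cert F A" using max_cert_full[OF isflow_A] none by simp
      fix xs assume "distinct xs \<and> set xs = F"
      then have "xs = []" using none by simp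
      moreover have "halts w report_prog (start D [0]) (cost * n) (\<lambda>\<tau>. set (out \<tau>) = {e. e < m \<and> e \<notin> F \<and> (e \<in> A) \<noteq> (e \<in> A)})"
        by (rule halts_weaken[OF D.report_none cost_bounds(1)[OF n1]]) simp
      ultimately show "halts w report_prog (start D (length xs # xs)) (cost * n) (\<lambda>\<tau>. set (out \<tau>) = {e. e < m \<and> e \<notin> F \<and> (e \<in> A) \<noteq> (e \<in> A)})" by simp
    qed (use none in auto)
    then show ?thesis by blast
  next
    case (one x)
    then have x: "x < m" using F(1) by simp
    define A' where "A' = sdiff A {y. changed L U c d x y} - {x}"
    have memA': "e \<in> A' \<longleftrightarrow> (e \<in> A) \<noteq> changed L U c d x e" if "e \<noteq> x" for e using that unfolding A'_def sdiff_def by auto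
    have "\<exists>st0 M0. M0 \<le> 26 * n \<and> (blk x \<noteq> 0 \<longrightarrow> D.block_ok n (blk x) st0 M0) \<and>
      (if blk x = 0 then {} else {y \<in> mu ` set (D.entries st0 M0). changed L U c d x y \<and> y \<noteq> x}) = {e. e < m \<and> e \<notin> F \<and> (e \<in> A') \<noteq> (e \<in> A)}"
    proof (cases "x \<in> A")
      case True
      then obtain i where i: "i < k" "x \<in> set (pl i)" unfolding A_def by blast
      have bx: "blk x = b i" using blk[OF i] .
      have im: "mu ` set (D.entries (st i) (M i)) = Nb i" using encodes_arcs[OF enc[OF i(1)]] .
      have sub: "{y. changed L U c d x y} \<subseteq> Nb i" using ch[OF i] Tree[OF i(1)] Nbm[OF i(1)] by blast
      have "{y \<in> Nb i. changed L U c d x y \<and> y \<noteq> x} = {e. e < m \<and> e \<notin> F \<and> (e \<in> A') \<noteq> (e \<in> A)}"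
        using sub Nbm(1)[OF i(1)] memA' unfolding one by auto
      then show ?thesis using bok[OF i(1)] M[OF i(1)] bx b0[of i] im by (intro exI[of _ "st i"] exI[of _ "M i"]) simp
    next
      case False
      have "\<not> changed L U c d x e" for e using ch0[OF False] by blast
      then have "{e. e < m \<and> e \<notin> F \<and> (e \<in> A') \<noteq> (e \<in> A)} = {}" using memA' unfolding one by auto
      then show ?thesis using blk0[OF False] by (intro exI[of _ 0]) simp
    qed
    then obtain st0 M0 where M0: "M0 \<le> 26 * n" "blk x \<noteq> 0 \<Longrightarrow> D.block_ok n (blk x) st0 M0"
      "(if blk x = 0 then {} else {y \<in> mu ` set (D.entries st0 M0). changed L U c d x y \<and> y \<noteq> x}) = {e. e < m \<and> e \<notin> F \<and> (e \<in> A') \<noteq> (e \<in> A)}"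
      by blast
    have "answered w D F A'"
      unfolding answered_def
    proof (intro conjI allI impI)
      show "max_cert F A'" unfolding one A'_def by (rule single[OF x])
      fix xs assume "distinct xs \<and> set xs = F"
      then have "length xs = 1" "set xs = {x}" using distinct_card[of xs] one by auto
      then have xs: "xs = [x]" by (cases xs) auto
      define \<sigma> where "\<sigma> = (start D [1, x])\<lparr>regs := (regs (start D [1, x]))(3 := 1)\<rparr>"
      have \<sigma>: "D.agrees \<sigma>" "regs \<sigma> 1 = x" "regs \<sigma> 60 = 0" "out \<sigma> = []"
        using ag[of "[1, x]"] unfolding \<sigma>_def D.agrees_def start_def pad_def by auto
      have h: "halts w report1 \<sigma> (csize report1 + (csize (locate 33 21) + 100) * M0 + 100) (\<lambda>\<tau>. set (out \<tau>) = {e. e < m \<and> e \<notin> F \<and> (e \<in> A') \<noteq> (e \<in> A)})"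
        using D.report1_correct[OF \<sigma>(1,2) x \<sigma>(3,4) M0(2)] unfolding M0(3) by blast
      have "halts w report_prog (start D [1, x]) (cost * n) (\<lambda>\<tau>. set (out \<tau>) = {e. e < m \<and> e \<notin> F \<and> (e \<in> A') \<noteq> (e \<in> A)})"
        by (rule halts_weaken[OF D.report_one[OF h[unfolded \<sigma>_def]] cost_bounds(2)[OF n1 M0(1)]])
      then show "halts w report_prog (start D (length xs # xs)) (cost * n) (\<lambda>\<tau>. set (out \<tau>) = {e. e < m \<and> e \<notin> F \<and> (e \<in> A') \<noteq> (e \<in> A)})"
        unfolding xs by simp
    next
      fix x' e assume "F = {x'}" "e < m" "e \<noteq> x'"
      then have e: "x' = x" "e < m" "e \<noteq> x" using one by auto
      have r: "regs (start D [x, e]) 0 = x" "regs (start D [x, e]) 1 = e" unfolding start_def pad_def by auto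
      have f1: "fb e \<le> 1" unfolding fb by simp
      show "halts w lookup_prog (start D [x', e]) cost (\<lambda>\<tau>. regs \<tau> 0 = of_bool (e \<in> A'))"
        unfolding e(1)
      proof (rule halts_weaken[OF D.lookup_correct[OF ag r x e(2) f1]])
        show "csize lookup_prog \<le> cost" unfolding cost_def by simp
      qed (simp add: memA'[OF e(3)] fb)
    qed
    then show ?thesis by blast
  next
    case (two x1 x2)
    have x: "x1 < m" "x2 < m" using F(1) two(1) by auto
    define \<sigma> where "\<sigma> = start D [2, x1, x2]"
    have \<sigma>: "regs \<sigma> 1 = x1" "regs \<sigma> 2 = x2" "regs \<sigma> 60 = 0" unfolding \<sigma>_def start_def pad_def by auto
    have "\<exists>A' T. max_cert F A' \<and> T + csize sort_query + 20 \<le> cost * n \<and>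
      halts w report2 \<sigma> T (\<lambda>\<tau>. set (out \<tau>) = {e. e < m \<and> e \<notin> F \<and> (e \<in> A') \<noteq> (e \<in> A)})"
    proof (cases "x1 \<in> A \<or> x2 \<in> A")
      case False
      then have z0: "blk x1 = 0" "blk x2 = 0" using blk0 by auto
      have "max_cert F A" using max_cert_full[OF isflow_A] False two(1) by simp
      moreover have "halts w report2 \<sigma> (2 * csize (locate 1 20) + 2 * (csize search_body + csize aug_body + csize scan + csize emit_toggled + 20) * (0 + 0 + 3 * n) + 300) (\<lambda>\<tau>. set (out \<tau>) = {e. e < m \<and> e \<notin> F \<and> (e \<in> A) \<noteq> (e \<in> A)})"
        by (rule halts_weaken[OF D.report2_correct[OF ag[of "[2, x1, x2]", folded \<sigma>_def] \<sigma>(1,2) x \<sigma>(3) o[of "[2, x1, x2]", folded \<sigma>_def] z[of _ "[2, x1, x2]", folded \<sigma>_def]] order_refl])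
          (simp_all add: z0)
      moreover note cost_bounds(3)[OF n1, of 0 0]
      ultimately show ?thesis by blast
    next
      case True
      define c1 where "c1 = (if blk x1 = 0 then blk x2 else blk x1)"
      define c2 where "c2 = (if blk x2 = 0 then blk x1 else blk x2)"
      define I where "I = {i. i < k \<and> set (pl i) \<inter> F \<noteq> {}}"
      have uniq: "i' = i" if "i < k" "i' < k" "y \<in> set (pl i)" "y \<in> set (pl i')" for i i' y
        using disjoint[of i i'] that by blast
      \<comment> \<open>\<open>i\<close> and \<open>j\<close> coincide if both failures lie on one
        path or if one failed arc carries no flow; its block is then used twice.\<close>
      have "\<exists>i j. i < k \<and> j < k \<and> c1 = b i \<and> c2 = b j \<and> I = {i, j}"
      proof -
        have one_in: "\<exists>i. i < k \<and> y \<in> set (pl i) \<and> blk y = b i \<and> b i \<noteq> 0 \<and> (\<forall>i'. i' < k \<and> y \<in> set (pl i') \<longleftrightarrow> i' = i)" if "y \<in> A" for y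
        proof -
          obtain i where i: "i < k" "y \<in> set (pl i)" using \<open>y \<in> A\<close> unfolding A_def by blast
          then show ?thesis using blk[OF i] b0[of i] uniq[OF i(1) _ i(2)] by blast
        qed
        have notin: "y \<notin> set (pl i)" if "y \<notin> A" "i < k" for y i using that unfolding A_def by blast
        have Ieq: "I = {i. i < k \<and> x1 \<in> set (pl i)} \<union> {i. i < k \<and> x2 \<in> set (pl i)}" unfolding I_def two(1) by blast
        consider "x1 \<in> A" "x2 \<in> A" | "x1 \<in> A" "x2 \<notin> A" | "x1 \<notin> A" "x2 \<in> A" using True by blast
        then show ?thesis
        proof cases
          case 1
          obtain i where i: "i < k" "blk x1 = b i" "b i \<noteq> 0" "\<And>i'. i' < k \<and> x1 \<in> set (pl i') \<longleftrightarrow> i' = i" using one_in[OF 1(1)] by blast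
          obtain j where j: "j < k" "blk x2 = b j" "b j \<noteq> 0" "\<And>i'. i' < k \<and> x2 \<in> set (pl i') \<longleftrightarrow> i' = j" using one_in[OF 1(2)] by blast
          have "I = {i, j}" unfolding Ieq i(4) j(4) by auto
          then show ?thesis using i(1-3) j(1-3) unfolding c1_def c2_def by auto
        next
          case 2
          obtain i where i: "i < k" "blk x1 = b i" "b i \<noteq> 0" "\<And>i'. i' < k \<and> x1 \<in> set (pl i') \<longleftrightarrow> i' = i" using one_in[OF 2(1)] by blast
          have "I = {i, i}" unfolding Ieq i(4) using notin[OF 2(2)] by auto
          then show ?thesis using i(1-3) blk0[OF 2(2)] unfolding c1_def c2_def by auto
        next
          case 3
          obtain i where i: "i < k" "blk x2 = b i" "b i \<noteq> 0" "\<And>i'. i' < k \<and> x2 \<in> set (pl i') \<longleftrightarrow> i' = i" using one_in[OF 3(2)] by blast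
          have "I = {i, i}" unfolding Ieq i(4) using notin[OF 3(1)] by auto
          then show ?thesis using i(1-3) blk0[OF 3(1)] unfolding c1_def c2_def by auto
        qed
      qed
      then obtain i j where ij: "i < k" "j < k" "c1 = b i" "c2 = b j" "I = {i, j}" by blast
      have k0: "0 < k" using ij(1) by simp
      define E where "E = set (D.entries (st i) (M i)) \<union> set (D.entries (st j) (M j))"
      define NN where "NN = Nb i \<union> Nb j"
      have encE: "encodes mu E NN" unfolding E_def NN_def by (rule encodes_Un[OF enc[OF ij(1)] enc[OF ij(2)]])
      have NNm: "NN \<subseteq> {..<m}" using Nbm(1)[OF ij(1)] Nbm(1)[OF ij(2)] unfolding NN_def by blast
      interpret B: blocks_mem w m N mu ptr fb blk L U c d n s t "b i" "st i" "M i" "b j" "st j" "M j"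
      proof
        show "D.block_ok n (b i) (st i) (M i)" "D.block_ok n (b j) (st j) (M j)" using bok ij by auto
        show "s < n" "t < n" "s \<noteq> t" using s_less t_less s_neq_t by auto
        show "N + m + 2 * n + (M i + M j + 2 * n) + 4 < 2 ^ w" using space[OF k0] M[OF ij(1)] M[OF ij(2)] by linarith
        fix e assume e: "e \<in> set (D.entries (st i) (M i)) \<union> set (D.entries (st j) (M j))"
        then obtain y where "fwd_entry mu e y \<or> bwd_entry mu e y" using encE unfolding encodes_def E_def by blast
        then show "mu (e + 3) \<le> 1" unfolding fwd_entry_def bwd_entry_def by auto
        fix e' assume "e' \<in> set (D.entries (st i) (M i)) \<union> set (D.entries (st j) (M j))" "mu e = mu e'" "mu (e + 3) = mu (e' + 3)"
        then show "mu (e + 2) = mu (e' + 2)" using e by (intro encodes_orient[OF encE]) (auto simp: E_def)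
      qed
      define tog0 where "tog0 = (\<lambda>y. if y \<in> F then 2 else if \<exists>e\<in>E. mu (e + 5) = 1 \<and> mu e = y then 1 else (0::nat))"
      have tog0': "(\<lambda>y. if y = x1 \<or> y = x2 then 2 else if \<exists>e\<in>set (D.entries (st i) (M i)) \<union> set (D.entries (st j) (M j)). mu (e + 5) = 1 \<and> mu e = y then 1 else 0) = tog0"
        unfolding tog0_def E_def two(1) by (simp only: insert_iff empty_iff simp_thms)
      define T where "T = 2 * csize (locate 1 20) + 2 * (csize search_body + csize aug_body + csize scan + csize emit_toggled + 20) * (M i + M j + 3 * n) + 300"
      have "halts w report2 \<sigma> T (\<lambda>\<tau>. if c1 = 0 then out \<tau> = [] else
          \<exists>tog1 tog2. B.round_post tog0 tog1 \<and> B.round_post tog1 tog2 \<and> set (out \<tau>) = {y \<in> mu ` E. tog2 y = 1})"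
        unfolding T_def E_def tog0'[symmetric] c1_def
      proof (rule D.report2_correct)
        show "D.agrees \<sigma>" "out \<sigma> = []" "\<And>a. N \<le> a \<Longrightarrow> mem \<sigma> a = 0" unfolding \<sigma>_def using ag o z by auto
        show "blocks_mem w m N mu ptr fb blk L U c d n s t (if blk x1 = 0 then blk x2 else blk x1) (st i) (M i) (if blk x2 = 0 then blk x1 else blk x2) (st j) (M j)"
          unfolding c1_def[symmetric] c2_def[symmetric] ij(3,4) by (rule B.blocks_mem_axioms)
        show "mu 4 = N \<and> mu 5 = N + m \<and> mu 6 = N + m + n \<and> mu 7 = N + m + 2 * n \<and> mu 8 = s \<and> mu 9 = t" by (rule hdr[OF k0])
      qed (use \<sigma> x in auto)
      then obtain kk \<tau> tog1 tog2 where ex: "exec w report2 \<sigma> kk \<tau>" "kk \<le> T" "B.round_post tog0 tog1" "B.round_post tog1 tog2"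
        "set (out \<tau>) = {y \<in> mu ` E. tog2 y = 1}"
        unfolding halts_def ij(3) using b0[of i] by auto
      have Ine: "{i. i < k \<and> set (pl i) \<inter> F \<noteq> {}} \<noteq> {}" unfolding I_def[symmetric] ij(5) by simp
      have NNb: "block i' NN" if "i' \<in> {i. i < k \<and> set (pl i) \<inter> F \<noteq> {}}" for i'
      proof -
        have "i' = i \<or> i' = j" using that unfolding I_def[symmetric] ij(5) by simp
        moreover have "block i NN" by (rule block_mono[OF Nb[OF ij(1)] _ NNm]) (simp add: NN_def)
        moreover have "block j NN" by (rule block_mono[OF Nb[OF ij(2)] _ NNm]) (simp add: NN_def)
        ultimately show ?thesis by blast
      qed
      have pfE: "(\<exists>e\<in>E. mu (e + 5) = 1 \<and> mu e = y) \<longleftrightarrow> y \<in> (\<Union>i\<in>{i. i < k \<and> set (pl i) \<inter> F \<noteq> {}}. set (pl i))" for y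
      proof -
        have "(\<exists>e\<in>E. mu (e + 5) = 1 \<and> mu e = y) \<longleftrightarrow> y \<in> set (pl i) \<or> y \<in> set (pl j)"
          unfolding E_def using pf[OF ij(1), of y] pf[OF ij(2), of y] by (simp only: bex_Un)
        then show ?thesis unfolding I_def[symmetric] ij(5) by simp
      qed
      have post: "B.round_post tog tog' \<longleftrightarrow> (tog' = tog \<and> (\<exists>X\<subseteq>{..<n}. s \<in> X \<and> t \<notin> X \<and> (\<forall>e\<in>E. mu (e + 1) \<in> X \<longrightarrow> tog (mu e) = mu (e + 3) \<longrightarrow> mu (e + 2) \<in> X))) \<or>
         (\<exists>es. walk (\<lambda>e. mu (e + 1)) (\<lambda>e. mu (e + 2)) s es t \<and> distinct (map mu es) \<and> set es \<subseteq> E \<and>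
        (\<forall>e\<in>set es. tog (mu e) = mu (e + 3)) \<and> tog' = (\<lambda>y. if y \<in> mu ` set es then 1 - tog y else tog y))" for tog tog'
        unfolding B.round_post_def B.usable_def B.toggled_def[abs_def] B.ent_def E_def ..
      note R = two_rounds[where P = B.round_post and F = F and NN = NN and mu = mu and E = E and ?tog0.0 = tog0 and ?tog1.0 = tog1 and ?tog2.0 = tog2, OF F Ine NNb encE pfE tog0_def post ex(3,4)]
      have "halts w report2 \<sigma> T (\<lambda>\<tau>. set (out \<tau>) = {e. e < m \<and> e \<notin> F \<and> (e \<in> curr F tog2) \<noteq> (e \<in> A)})"
        unfolding halts_def by (intro exI[of _ kk] exI[of _ \<tau>] conjI ex(1,2) trans[OF ex(5) R(2)])
      moreover have "T + csize sort_query + 20 \<le> cost * n" unfolding T_def by (rule cost_bounds(3)[OF n1 M[OF ij(1)] M[OF ij(2)]])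
      ultimately show ?thesis by (intro exI[of _ "curr F tog2"] exI[of _ T] conjI R(1))
    qed
    then obtain A' T where A': "max_cert F A'" "T + csize sort_query + 20 \<le> cost * n"
      "halts w report2 \<sigma> T (\<lambda>\<tau>. set (out \<tau>) = {e. e < m \<and> e \<notin> F \<and> (e \<in> A') \<noteq> (e \<in> A)})" by blast
    have "answered w D F A'"
      unfolding answered_def
    proof (intro conjI allI impI)
      show "max_cert F A'" by (rule A'(1))
      fix xs assume xs: "distinct xs \<and> set xs = F"
      then have "length xs = 2" using distinct_card[of xs] two by auto
      then obtain y1 y2 where "xs = [y1, y2]" by (auto simp: length_Suc_conv numeral_2_eq_2)
      then have "xs = [x1, x2] \<or> xs = [x2, x1]" using xs two by (auto simp: doubleton_eq_iff)
      then show "halts w report_prog (start D (length xs # xs)) (cost * n) (\<lambda>\<tau>. set (out \<tau>) = {e. e < m \<and> e \<notin> F \<and> (e \<in> A') \<noteq> (e \<in> A)})"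
        by (intro halts_weaken[OF D.report_two[OF A'(3)[unfolded \<sigma>_def] two(2) x(2)] A'(2)])
    qed (use two in auto)
    then show ?thesis by blast
  qed
qed

theorem oracle_exists:
  assumes w: "(n + m) ^ 20 \<le> 2 ^ w"
  obtains D where "set D \<subseteq> {..<2 ^ w}" "length D \<le> 2200 * (k * n)"
    "\<And>F. F \<subseteq> {..<m} \<Longrightarrow> card F \<le> 2 \<Longrightarrow> \<exists>A'. answered w D F A'"
proof (cases "k = 0")
  case True
  have n2: "2 \<le> n + m" "m < n + m" using s_less t_less s_neq_t by linarith+
  have "(2::nat) ^ 20 \<le> (n + m) ^ 20" using n2(1) by (rule power_mono) simp
  then have w30: "30 < (2::nat) ^ w" using w by simp
  have "n + m \<le> (n + m) ^ 20" using n2 by (intro self_le_power) auto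
  then have wm: "m < 2 ^ w" using n2(2) w by linarith
  have A0: "A = {}" using True unfolding A_def by simp
  \<comment> \<open>Value 0 permits no storage at all. On zero memory every division by zero yields
    0, the key test at address 0 fails, and each arc gets the zero record at address 10; 30 only
    bounds the addresses.\<close>
  have dm: "dict_mem w m 30 (\<lambda>_. 0) (\<lambda>_. 10) (\<lambda>_. 0) (\<lambda>_. 0) (\<lambda>_ _. 0) (\<lambda>_ _. 0) (\<lambda>_ _. 0) (\<lambda>_ _. 0)"
    by unfold_locales (use w30 wm in \<open>auto simp: Let_def\<close>)
  have ch: "\<not> changed (\<lambda>_ _. 0) (\<lambda>_ _. 0) (\<lambda>_ _. 0) (\<lambda>_ _. 0) x y" for x y unfolding changed_def by simp
  have p: "pad [] = (\<lambda>_. 0)" by (rule ext) (simp add: pad_def)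
  show thesis
  proof (rule that[of "[]"])
    fix F assume F: "F \<subseteq> {..<m}" "card F \<le> 2"
    show "\<exists>A'. answered w [] F A'"
      by (rule answered_exists[OF dm _ p, where b = "\<lambda>_. 1" and Tree = "{}"])
        (use True A0 ch F max_cert_full[OF isflow_A] in \<open>auto simp: sdiff_def\<close>)
  qed auto
next
  case False
  then have k0: "0 < k" by simp
  show thesis
  proof (rule layout[OF k0 w])
    fix mu N ptr fb blk L U c d b st M Nb Tree
    assume h: "dict_mem w m N mu ptr fb blk L U c d" "\<And>a. N \<le> a \<Longrightarrow> mu a = 0" "\<And>a. mu a < 2 ^ w" "N \<le> 2200 * (k * n)"
    "mu 4 = N" "mu 5 = N + m" "mu 6 = N + m + n" "mu 7 = N + m + 2 * n" "mu 8 = s" "mu 9 = t"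
    "\<And>x. fb x = of_bool (x \<in> A)" "\<And>x. x \<notin> A \<Longrightarrow> blk x = 0" "\<And>x i. i < k \<Longrightarrow> x \<in> set (pl i) \<Longrightarrow> blk x = b i" "\<And>i. b i \<noteq> 0"
    "\<And>i. i < k \<Longrightarrow> dict_mem.block_ok m N mu n (b i) (st i) (M i)" "\<And>i. i < k \<Longrightarrow> M i \<le> 26 * n"
    "\<And>i. i < k \<Longrightarrow> encodes mu (set (dict_mem.entries (st i) (M i))) (Nb i)" "\<And>i. i < k \<Longrightarrow> block i (Nb i)" "\<And>i. i < k \<Longrightarrow> Tree \<subseteq> Nb i"
    "\<And>i y. i < k \<Longrightarrow> (\<exists>e\<in>set (dict_mem.entries (st i) (M i)). mu (e + 5) = 1 \<and> mu e = y) \<longleftrightarrow> y \<in> set (pl i)"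
    "\<And>x. x < m \<Longrightarrow> max_cert {x} (sdiff A {y. changed L U c d x y} - {x})"
    "\<And>x. x \<notin> A \<Longrightarrow> {y. changed L U c d x y} = {}"
    "\<And>x i. i < k \<Longrightarrow> x \<in> set (pl i) \<Longrightarrow> {y. changed L U c d x y} \<subseteq> Tree \<union> set (pl i)"
    "N + m + 60 * n + 4 < 2 ^ w"
    have p: "pad (map mu [0..<N]) = mu" by (rule ext) (auto simp: pad_def h(2))
    have hd: "mu 4 = N \<and> mu 5 = N + m \<and> mu 6 = N + m + n \<and> mu 7 = N + m + 2 * n \<and> mu 8 = s \<and> mu 9 = t" using h(5-10) by auto
    show thesis
    proof (rule that[of "map mu [0..<N]"])
      show "set (map mu [0..<N]) \<subseteq> {..<2 ^ w}" using h(3) by auto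
      show "length (map mu [0..<N]) \<le> 2200 * (k * n)" using h(4) by simp
      fix F assume F: "F \<subseteq> {..<m}" "card F \<le> 2"
      show "\<exists>A'. answered w (map mu [0..<N]) F A'"
        by (rule answered_exists[OF h(1,2) p hd h(24,11-23) F])
    qed
  qed
qed

end

section \<open>Real-valued flows\<close>

text \<open>Weak duality: by conservation the value is the net outflow summed over \<open>X\<close>,
  in which inner arcs cancel and each leaving arc counts at most 1.\<close>

lemma flow_value_le_cut:
  fixes H :: "('a, 'b) pre_digraph"
  assumes fin: "finite (arcs H)" "finite X" and X: "X \<subseteq> verts H" "s \<in> X" "t \<notin> X" and g: "st_flow H s t g"
  shows "flow_value H s g \<le> real (card {e \<in> arcs H. tail H e \<in> X \<and> head H e \<notin> X})"
proof -
  have g01: "0 \<le> g e" "g e \<le> 1" if "e \<in> arcs H" for e using g that unfolding st_flow_def by auto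
  have grp: "(\<Sum>v\<in>X. \<Sum>e\<in>{e \<in> arcs H. p e = v}. g e) = (\<Sum>e\<in>{e \<in> arcs H. p e \<in> X}. g e)" for p :: "'b \<Rightarrow> 'a"
  proof -
    have "(\<Sum>v\<in>X. \<Sum>e\<in>{e \<in> {e \<in> arcs H. p e \<in> X}. p e = v}. g e) = (\<Sum>e\<in>{e \<in> arcs H. p e \<in> X}. g e)"
      using fin by (intro sum.group) auto
    moreover have "{e \<in> {e \<in> arcs H. p e \<in> X}. p e = v} = {e \<in> arcs H. p e = v}" if "v \<in> X" for v using that by auto
    ultimately show ?thesis by simp
  qed
  let ?net = "\<lambda>v. (\<Sum>e\<in>out_arcs H v. g e) - (\<Sum>e\<in>in_arcs H v. g e)"
  have "(\<Sum>v\<in>X. ?net v) = ?net s + (\<Sum>v\<in>X - {s}. ?net v)" using fin(2) X(2) by (rule sum.remove)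
  moreover have "(\<Sum>v\<in>X - {s}. ?net v) = 0"
  proof (rule sum.neutral, rule ballI)
    fix v assume "v \<in> X - {s}"
    then have "v \<in> verts H - {s, t}" using X by auto
    then show "?net v = 0" using g unfolding st_flow_def by simp
  qed
  ultimately have "flow_value H s g = (\<Sum>v\<in>X. ?net v)" unfolding flow_value_def by simp
  also have "\<dots> = (\<Sum>e\<in>{e \<in> arcs H. tail H e \<in> X}. g e) - (\<Sum>e\<in>{e \<in> arcs H. head H e \<in> X}. g e)"
    unfolding sum_subtractf out_arcs_def in_arcs_def grp ..
  also have "(\<Sum>e\<in>{e \<in> arcs H. tail H e \<in> X}. g e) =
      (\<Sum>e\<in>{e \<in> arcs H. tail H e \<in> X \<and> head H e \<in> X}. g e) + (\<Sum>e\<in>{e \<in> arcs H. tail H e \<in> X \<and> head H e \<notin> X}. g e)"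
    using fin(1) by (subst sum.union_disjoint[symmetric]) (auto intro!: sum.cong)
  also have "(\<Sum>e\<in>{e \<in> arcs H. tail H e \<in> X \<and> head H e \<in> X}. g e) \<le> (\<Sum>e\<in>{e \<in> arcs H. head H e \<in> X}. g e)"
    using fin(1) g01 by (intro sum_mono2) auto
  also have "(\<Sum>e\<in>{e \<in> arcs H. tail H e \<in> X \<and> head H e \<notin> X}. g e) \<le> (\<Sum>e\<in>{e \<in> arcs H. tail H e \<in> X \<and> head H e \<notin> X}. 1)"
    using g01 by (intro sum_mono) auto
  finally show ?thesis by simp
qed

text \<open>\<open>nu\<close> renumbers the vertices only. Arcs keep their numbers, so queries and
  answers need no translation.\<close>

locale numbered_network = network +
  fixes G :: "(nat, nat) pre_digraph" and s0 t0 :: nat and nu :: "nat \<Rightarrow> nat"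
  assumes G: "fin_digraph G" "arcs G = {..<m}" and nu: "bij_betw nu (verts G) {..<n}"
    and st0: "s0 \<in> verts G" "t0 \<in> verts G" "s = nu s0" "t = nu t0"
    and ends: "ta e = nu (tail G e)" "he e = nu (head G e)"
begin

lemma ends_verts: "e < m \<Longrightarrow> tail G e \<in> verts G \<and> head G e \<in> verts G"
  using G wf_digraph.tail_in_verts[of G e] wf_digraph.head_in_verts[of G e] unfolding fin_digraph_def by auto

lemma nu_eq: "u \<in> verts G \<Longrightarrow> v \<in> verts G \<Longrightarrow> nu u = nu v \<longleftrightarrow> u = v"
  using nu unfolding bij_betw_def inj_on_def by auto

lemma isflow_excess:
  assumes A: "isflow A k" "A \<inter> F = {}" and v: "v \<in> verts G"
  shows "(\<Sum>e\<in>out_arcs (del_arcs G F) v. of_bool (e \<in> A)) - (\<Sum>e\<in>in_arcs (del_arcs G F) v. of_bool (e \<in> A)) =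
    real k * (of_bool (v = s0) - of_bool (v = t0))"
proof -
  have Am: "A \<subseteq> {..<m}" and fA: "finite A" using isflow_subset[OF A(1)] isflow_finite[OF A(1)] by auto
  have fin: "finite (out_arcs (del_arcs G F) v)" "finite (in_arcs (del_arcs G F) v)"
    unfolding out_arcs_def in_arcs_def del_arcs_def using G(2) by auto
  have o: "out_arcs (del_arcs G F) v \<inter> A = A \<inter> {e. ta e = nu v}"
    and i: "in_arcs (del_arcs G F) v \<inter> A = A \<inter> {e. he e = nu v}"
    using Am A(2) G(2) ends_verts nu_eq v unfolding out_arcs_def in_arcs_def del_arcs_def ends by auto
  have "(\<Sum>e\<in>out_arcs (del_arcs G F) v. of_bool (e \<in> A)) - (\<Sum>e\<in>in_arcs (del_arcs G F) v. of_bool (e \<in> A)) = real_of_int (ex A (nu v))"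
    using fin fA by (simp add: o i ex_def sum_subtractf)
  moreover have "ex A (nu v) = int k * (of_bool (v = s0) - of_bool (v = t0))"
    using A(1) st0 nu_eq v unfolding isflow_def by simp
  ultimately show ?thesis by simp
qed

lemma isflow_st_flow:
  assumes A: "isflow A k" "A \<inter> F = {}"
  shows "st_flow (del_arcs G F) s0 t0 (\<lambda>e. of_bool (e \<in> A))" "flow_value (del_arcs G F) s0 (\<lambda>e. of_bool (e \<in> A)) = real k"
proof -
  have neq: "s0 \<noteq> t0" using s_neq_t st0 by auto
  show "st_flow (del_arcs G F) s0 t0 (\<lambda>e. of_bool (e \<in> A))"
    unfolding st_flow_def
  proof (intro conjI ballI)
    fix v assume "v \<in> verts (del_arcs G F) - {s0, t0}"
    then have "v \<in> verts G" "v \<noteq> s0" "v \<noteq> t0" unfolding del_arcs_def by auto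
    then show "(\<Sum>e\<in>in_arcs (del_arcs G F) v. of_bool (e \<in> A)) = (\<Sum>e\<in>out_arcs (del_arcs G F) v. of_bool (e \<in> A) :: real)"
      using isflow_excess[OF A, of v] by simp
  qed auto
  show "flow_value (del_arcs G F) s0 (\<lambda>e. of_bool (e \<in> A)) = real k"
    using isflow_excess[OF A st0(1)] neq unfolding flow_value_def by simp
qed

lemma flow_value_le_mcut:
  assumes X: "st_cut X" and g: "st_flow (del_arcs G F) s0 t0 g"
  shows "flow_value (del_arcs G F) s0 g \<le> real (mcut F X)"
proof -
  define Y where "Y = {v \<in> verts G. nu v \<in> X}"
  have fin: "finite (arcs (del_arcs G F))" "finite Y" using G(2) fin_digraph.finite_verts[OF G(1)] unfolding del_arcs_def Y_def by auto
  have Y: "Y \<subseteq> verts (del_arcs G F)" "s0 \<in> Y" "t0 \<notin> Y" using X st0 unfolding Y_def st_cut_def del_arcs_def by auto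
  have "{e \<in> arcs (del_arcs G F). tail (del_arcs G F) e \<in> Y \<and> head (del_arcs G F) e \<notin> Y} = outs ({..<m} - F) X"
    using ends_verts unfolding outs_def Y_def del_arcs_def ends G(2)[symmetric] by (auto simp: G(2))
  then show ?thesis using flow_value_le_cut[OF fin Y g] unfolding mcut_def by simp
qed

text \<open>The certifying cut also bounds all real-valued flows, so the integral flow is maximum
  among them.\<close>

lemma max_cert_st_max_flow:
  assumes "max_cert F A"
  shows "st_max_flow (del_arcs G F) s0 t0 (\<lambda>e. of_bool (e \<in> A))"
proof -
  obtain k X where kX: "isflow A k" "A \<inter> F = {}" "st_cut X" "mcut F X \<le> k" using assms unfolding max_cert_def by blast
  show ?thesis
    unfolding st_max_flow_def isflow_st_flow(2)[OF kX(1,2)]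
    using isflow_st_flow(1)[OF kX(1,2)] flow_value_le_mcut[OF kX(3), of F] kX(4) by force
qed

end

lemma le_power_word_length:
  fixes N :: nat
  assumes "1 \<le> N"
  shows "N ^ c \<le> 2 ^ (c * nat \<lceil>log 2 (real N)\<rceil>)"
proof -
  have "real N = 2 powr log 2 (real N)" using assms by simp
  also have "\<dots> \<le> 2 powr real (nat \<lceil>log 2 (real N)\<rceil>)" by (intro powr_mono real_nat_ceiling_ge) simp
  also have "\<dots> = real (2 ^ nat \<lceil>log 2 (real N)\<rceil>)" by (simp add: powr_realpow)
  finally have "N \<le> 2 ^ nat \<lceil>log 2 (real N)\<rceil>" by (simp only: of_nat_le_iff)
  then have "N ^ c \<le> (2 ^ nat \<lceil>log 2 (real N)\<rceil>) ^ c" by (rule power_mono) simp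
  then show ?thesis by (simp add: power_mult[symmetric] mult.commute)
qed

theorem theorem2:
  shows "\<exists>(report :: com) (lookup :: com) (c :: nat) (C :: nat).
    \<forall>(G :: (nat, nat) pre_digraph) (s :: nat) (t :: nat) (n :: nat) (w :: nat) (lam :: real).
      fin_digraph G \<longrightarrow> arcs G = {..<card (arcs G)} \<longrightarrow>
      s \<in> verts G \<longrightarrow> t \<in> verts G \<longrightarrow> s \<noteq> t \<longrightarrow>
      n = card (verts G) \<longrightarrow> w = word_length c G \<longrightarrow> lam = max_flow_value G s t \<longrightarrow>
      (\<exists>(f :: nat \<Rightarrow> real) (D :: nat list).
        st_max_flow G s t f \<and> f \<in> arcs G \<rightarrow> {0, 1} \<and>
        set D \<subseteq> {..<2 ^ w} \<and> real (length D) \<le> real C * (lam * real n) \<and>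
        (\<forall>F. F \<subseteq> arcs G \<and> card F \<le> 2 \<longrightarrow>
          (\<exists>f' :: nat \<Rightarrow> real.
            st_max_flow (del_arcs G F) s t f' \<and> f' \<in> arcs (del_arcs G F) \<rightarrow> {0, 1} \<and>
            (\<forall>xs. distinct xs \<and> set xs = F \<longrightarrow>
              (\<exists>k \<tau>. exec w report (start D (length xs # xs)) k \<tau> \<and> k \<le> C * n \<and>
                 set (out \<tau>) = {e \<in> arcs (del_arcs G F). f' e \<noteq> f e})) \<and>
            (\<forall>x. F = {x} \<longrightarrow>
              (\<forall>e \<in> arcs (del_arcs G F).
                \<exists>k \<tau>. exec w lookup (start D [x, e]) k \<tau> \<and> k \<le> C \<and>
                   real (regs \<tau> 0) = f' e)))))"
\<comment> \<open>20 is the exponent that the memory layout asks of the word length; one constant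
  serves for size and time, hence the sum.\<close>
proof (rule exI[of _ report_prog], rule exI[of _ lookup_prog], rule exI[of _ 20], rule exI[of _ "cost + 2200"], intro allI impI)
  fix G :: "(nat, nat) pre_digraph" and s t n w :: nat and lam :: real
  assume G: "fin_digraph G" and arcs: "arcs G = {..<card (arcs G)}" and st: "s \<in> verts G" "t \<in> verts G" "s \<noteq> t"
    and n: "n = card (verts G)" and w: "w = word_length 20 G" and lam: "lam = max_flow_value G s t"
  define m where "m = card (arcs G)"
  have am: "arcs G = {..<m}" using arcs unfolding m_def .
  obtain nu where nu: "bij_betw nu (verts G) {..<n}"
    using ex_bij_betw_finite_nat[OF fin_digraph.finite_verts[OF G]] unfolding n atLeast0LessThan by blast
  have nu_less: "nu v < n" if "v \<in> verts G" for v using nu that unfolding bij_betw_def by auto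
  have wf: "wf_digraph G" using G unfolding fin_digraph_def by blast
  interpret N: numbered_network m n "\<lambda>e. nu (tail G e)" "\<lambda>e. nu (head G e)" "nu s" "nu t" G s t nu
  proof (intro numbered_network.intro network.intro numbered_network_axioms.intro)
    show "nu (tail G y) < n" "nu (head G y) < n" if "y < m" for y
      using that am wf_digraph.tail_in_verts[OF wf, of y] wf_digraph.head_in_verts[OF wf, of y] nu_less by auto
    show "nu s \<noteq> nu t" using nu st unfolding bij_betw_def inj_on_def by blast
  qed (use G am nu st nu_less in auto)
  obtain k A0 X0 where k: "N.isflow A0 k" "N.st_cut X0" "N.mcut {} X0 = k" using N.max_flow_exists by blast
  obtain pl where pl: "\<forall>i<k. N.simple_path (pl i) \<and> set (pl i) \<subseteq> A0" "\<forall>i<k. \<forall>j<k. i \<noteq> j \<longrightarrow> set (pl i) \<inter> set (pl j) = {}"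
    using N.flow_decomposition[OF k(1)] by blast
  interpret P: path_system m n "\<lambda>e. nu (tail G e)" "\<lambda>e. nu (head G e)" "nu s" "nu t" k pl X0
    by unfold_locales (use pl k in auto)
  have d0: "del_arcs G {} = G" unfolding del_arcs_def by simp
  have max: "st_max_flow G s t (\<lambda>e. of_bool (e \<in> P.A))"
    using N.max_cert_st_max_flow[OF P.max_cert_full[OF P.isflow_A, of "{}"]] unfolding d0 by simp
  have fk: "flow_value G s (\<lambda>e. of_bool (e \<in> P.A)) = real k" "st_flow G s t (\<lambda>e. of_bool (e \<in> P.A))"
    using N.isflow_st_flow[OF P.isflow_A, of "{}"] unfolding d0 by auto
  \<comment> \<open>The supremum is attained by the union of the paths.\<close>
  have "lam = real k"
    unfolding lam max_flow_value_def
  proof (rule cSup_eq_maximum)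
    show "real k \<in> flow_value G s ` {f. st_flow G s t f}" using fk by (auto intro: rev_image_eqI)
    show "x \<le> real k" if x: "x \<in> flow_value G s ` {f. st_flow G s t f}" for x
      using x max unfolding st_max_flow_def fk(1) by auto
  qed
  have "1 \<le> n + m" using nu_less[OF st(1)] by simp
  then have wl: "(n + m) ^ 20 \<le> 2 ^ w" using le_power_word_length[of "n + m" 20] unfolding w word_length_def n m_def by simp
  obtain D where D: "set D \<subseteq> {..<2 ^ w}" "length D \<le> 2200 * (k * n)" "\<And>F. F \<subseteq> {..<m} \<Longrightarrow> card F \<le> 2 \<Longrightarrow> \<exists>A'. P.answered w D F A'"
    by (rule P.oracle_exists[OF wl]) blast
  show "\<exists>(f :: nat \<Rightarrow> real) (D :: nat list).
        st_max_flow G s t f \<and> f \<in> arcs G \<rightarrow> {0, 1} \<and>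
        set D \<subseteq> {..<2 ^ w} \<and> real (length D) \<le> real (cost + 2200) * (lam * real n) \<and>
        (\<forall>F. F \<subseteq> arcs G \<and> card F \<le> 2 \<longrightarrow>
          (\<exists>f' :: nat \<Rightarrow> real.
            st_max_flow (del_arcs G F) s t f' \<and> f' \<in> arcs (del_arcs G F) \<rightarrow> {0, 1} \<and>
            (\<forall>xs. distinct xs \<and> set xs = F \<longrightarrow>
              (\<exists>k \<tau>. exec w report_prog (start D (length xs # xs)) k \<tau> \<and> k \<le> (cost + 2200) * n \<and>
                 set (out \<tau>) = {e \<in> arcs (del_arcs G F). f' e \<noteq> f e})) \<and>
            (\<forall>x. F = {x} \<longrightarrow>
              (\<forall>e \<in> arcs (del_arcs G F).
                \<exists>k \<tau>. exec w lookup_prog (start D [x, e]) k \<tau> \<and> k \<le> cost + 2200 \<and>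
                   real (regs \<tau> 0) = f' e))))"
  proof (rule exI[of _ "\<lambda>e. of_bool (e \<in> P.A)"], rule exI[of _ D], intro conjI allI impI)
    show "st_max_flow G s t (\<lambda>e. of_bool (e \<in> P.A))" by (rule max)
    show "(\<lambda>e. of_bool (e \<in> P.A)) \<in> arcs G \<rightarrow> {0, 1 :: real}" by auto
    show "set D \<subseteq> {..<2 ^ w}" by (rule D(1))
    have "length D \<le> (cost + 2200) * (k * n)" using D(2) by (simp add: add_mult_distrib)
    then have "real (length D) \<le> real ((cost + 2200) * (k * n))" by (simp only: of_nat_le_iff)
    then show "real (length D) \<le> real (cost + 2200) * (lam * real n)" unfolding \<open>lam = real k\<close> of_nat_mult .
    fix F assume F: "F \<subseteq> arcs G \<and> card F \<le> 2"
    then obtain A' where A': "P.answered w D F A'" using D(3)[of F] unfolding am by blast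
    have H: "arcs (del_arcs G F) = {..<m} - F" unfolding del_arcs_def am by simp
    have oset: "{e. e < m \<and> e \<notin> F \<and> (e \<in> A') \<noteq> (e \<in> P.A)} = {e \<in> arcs (del_arcs G F). (of_bool (e \<in> A') :: real) \<noteq> of_bool (e \<in> P.A)}"
      unfolding H by (auto simp: of_bool_def)
    show "\<exists>f' :: nat \<Rightarrow> real.
            st_max_flow (del_arcs G F) s t f' \<and> f' \<in> arcs (del_arcs G F) \<rightarrow> {0, 1} \<and>
            (\<forall>xs. distinct xs \<and> set xs = F \<longrightarrow>
              (\<exists>k \<tau>. exec w report_prog (start D (length xs # xs)) k \<tau> \<and> k \<le> (cost + 2200) * n \<and>
                 set (out \<tau>) = {e \<in> arcs (del_arcs G F). f' e \<noteq> of_bool (e \<in> P.A)})) \<and>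
            (\<forall>x. F = {x} \<longrightarrow>
              (\<forall>e \<in> arcs (del_arcs G F).
                \<exists>k \<tau>. exec w lookup_prog (start D [x, e]) k \<tau> \<and> k \<le> cost + 2200 \<and>
                   real (regs \<tau> 0) = f' e))"
    proof (intro exI[of _ "\<lambda>e. of_bool (e \<in> A')"] conjI allI impI ballI)
      show "st_max_flow (del_arcs G F) s t (\<lambda>e. of_bool (e \<in> A'))"
        using A' unfolding P.answered_def by (intro N.max_cert_st_max_flow) blast
      show "(\<lambda>e. of_bool (e \<in> A')) \<in> arcs (del_arcs G F) \<rightarrow> {0, 1 :: real}" by auto
    next
      fix xs assume xs: "distinct xs \<and> set xs = F"
      have "halts w report_prog (start D (length xs # xs)) (cost * n) (\<lambda>\<tau>. set (out \<tau>) = {e. e < m \<and> e \<notin> F \<and> (e \<in> A') \<noteq> (e \<in> P.A)})"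
        using A' xs unfolding P.answered_def by blast
      moreover have "cost * n \<le> (cost + 2200) * n" by (rule mult_le_mono1) simp
      ultimately show "\<exists>k \<tau>. exec w report_prog (start D (length xs # xs)) k \<tau> \<and> k \<le> (cost + 2200) * n \<and>
                 set (out \<tau>) = {e \<in> arcs (del_arcs G F). (of_bool (e \<in> A') :: real) \<noteq> of_bool (e \<in> P.A)}"
        unfolding halts_def oset by (meson le_trans)
    next
      fix x e assume "F = {x}" "e \<in> arcs (del_arcs G F)"
      then have "halts w lookup_prog (start D [x, e]) cost (\<lambda>\<tau>. regs \<tau> 0 = of_bool (e \<in> A'))"
        using A' unfolding P.answered_def H by blast
      then obtain k' \<tau> where "exec w lookup_prog (start D [x, e]) k' \<tau>" "k' \<le> cost" "regs \<tau> 0 = of_bool (e \<in> A')"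
        unfolding halts_def by blast
      then show "\<exists>k \<tau>. exec w lookup_prog (start D [x, e]) k \<tau> \<and> k \<le> cost + 2200 \<and> real (regs \<tau> 0) = of_bool (e \<in> A')"
        by (intro exI[of _ k'] exI[of _ \<tau>]) simp
    qed
  qed
qed

end
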